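(* Let $\sigma,\tau\in\mathbb{R}$, let $i,j\in\frac12\mathbb{Z}$ with $i-j\in\mathbb{Z}$, put $m=\max(|i|,|j|)$, let $l$ satisfy $l-m\in\mathbb{Z}_+$, and let $\lambda\in\mathbb{C}\setminus\{0\}$. With $$d^l_{i,j}(\tau,\sigma)=\frac{C^{l,j}(\sigma)\,C^{l,i}(\tau)}{C^{i,j}(\sigma)\,C^{i,i}(\tau)}\;\frac{q^{i-l}}{(q^{4l};q^{-2})_{l-i}}$$ the following hold. (i) If $m=i$, i.e. $-i\le j\le i$: $$a^l_{i,j}(\tau,\sigma)=d^l_{i,j}(\tau,\sigma)\,a^i_{i,j}(\tau,\sigma)\,p^{(i-j,i+j)}_{l-i}(D.\rho_{\tau,\sigma};q^\tau,q^\sigma\mid q^2),$$ $$\tau_\lambda\big(a^i_{i,j}(\tau,\sigma)\big)=C^{i,j}(\sigma)C^{i,i}(\tau)\lambda^{-2i}(\lambda^2q^{\tau-\sigma};q^2)_{i-j}(-\lambda^2q^{\tau+\sigma};q^2)_{i+j}.$$ (ii) If $m=j$, i.e. $-j\le i\le j$: $$a^l_{i,j}(\tau,\sigma)=d^l_{j,i}(\sigma,\tau)\,a^j_{i,j}(\tau,\sigma)\,p^{(j-i,i+j)}_{l-j}(D.\rho_{\tau,\sigma};q^\sigma,q^\tau\mid q^2),$$ $$\tau_\lambda\big(a^j_{i,j}(\tau,\sigma)\big)=C^{j,i}(\tau)C^{j,j}(\sigma)\lambda^{-2j}(\lambda^2q^{\sigma-\tau};q^2)_{j-i}(-\lambda^2q^{\tau+\sigma};q^2)_{i+j}.$$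 (iii) If $m=-i$, i.e. $i\le j\le -i$: $$a^l_{i,j}(\tau,\sigma)=d^l_{-i,-j}(-\tau,-\sigma)\,a^{-i}_{i,j}(\tau,\sigma)\,p^{(j-i,-i-j)}_{l+i}(D.\rho_{\tau,\sigma};q^{-\tau},q^{-\sigma}\mid q^2),$$ $$\tau_\lambda\big(a^{-i}_{i,j}(\tau,\sigma)\big)=C^{-i,-j}(-\sigma)C^{-i,-i}(-\tau)\lambda^{2i}(\lambda^2q^{-\tau+\sigma};q^2)_{j-i}(-\lambda^2q^{-\tau-\sigma};q^2)_{-i-j}.$$ (iv) If $m=-j$, i.e. $j\le i\le -j$: $$a^l_{i,j}(\tau,\sigma)=d^l_{-j,-i}(-\sigma,-\tau)\,a^{-j}_{i,j}(\tau,\sigma)\,p^{(i-j,-i-j)}_{l+j}(D.\rho_{\tau,\sigma};q^{-\sigma},q^{-\tau}\mid q^2),$$ $$\tau_\lambda\big(a^{-j}_{i,j}(\tau,\sigma)\big)=C^{-j,-i}(-\tau)C^{-j,-j}(-\sigma)\lambda^{2j}(\lambda^2q^{-\sigma+\tau};q^2)_{i-j}(-\lambda^2q^{-\tau-\sigma};q^2)_{-i-j}.$$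
   Context: Fix $0<q<1$; $\mathbb{Z}_+=\{0,1,2,\dots\}$, $\frac12\mathbb{Z}_+=\{0,\frac12,1,\dots\}$. Notation: $(a;p)_k=\prod_{r=0}^{k-1}(1-ap^r)$ for any base $p$, $(a_1,\dots,a_s;p)_k=\prod_r(a_r;p)_k$, $\left[{n\atop k}\right]_{p}=(p^n;p^{-1})_k/(p;p)_k$, and ${}_{r+1}\varphi_r\left({a_1,\dots,a_{r+1}\atop b_1,\dots,b_r};p,z\right)=\sum_{k\ge0}\frac{(a_1,\dots,a_{r+1};p)_k}{(b_1,\dots,b_r,p;p)_k}z^k$; if $p^{-N}$ is a lower parameter and $p^{-n}$, $0\le n\le N$, an upper one, the series is the terminating sum up to $k=n$. Quantum group. $\mathcal{A}=\mathcal{A}_q(SU(2))$ is the complex unital algebra generated by $\alpha,\beta,\gamma,\delta$ with relations $\alpha\beta=q\beta\alpha$, $\alpha\gamma=q\gamma\alpha$, $\beta\delta=q\delta\beta$, $\gamma\delta=q\delta\gamma$, $\beta\gamma=\gamma\beta$, $\alpha\delta-q\beta\gamma=\delta\alpha-q^{-1}\beta\gamma=1$; its comultiplication is $\Delta(\alpha)=\alpha\otimes\alpha+\beta\otimes\gamma$, $\Delta(\beta)=\alpha\otimes\beta+\beta\otimes\delta$, $\Delta(\gamma)=\gamma\otimes\alpha+\delta\otimes\gamma$, $\Delta(\delta)=\gamma\otimes\beta+\delta\otimes\delta$, and its counit is $\varepsilon(\alpha)=\varepsilon(\delta)=1$, $\varepsilon(\beta)=\varepsilon(\gamma)=0$.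 $\mathcal{U}=\mathcal{U}_q(\mathfrak{su}(2))$ is the complex unital algebra generated by $A,B,C,D$ with $AD=DA=1$, $AB=qBA$, $AC=q^{-1}CA$, $BC-CB=(A^2-D^2)/(q-q^{-1})$; $\Delta(A)=A\otimes A$, $\Delta(D)=D\otimes D$, $\Delta(B)=A\otimes B+B\otimes D$, $\Delta(C)=A\otimes C+C\otimes D$; $\varepsilon(A)=\varepsilon(D)=1$, $\varepsilon(B)=\varepsilon(C)=0$. They are in (doubly non-degenerate) duality by the pairing with $\langle XY,\xi\rangle=\langle X\otimes Y,\Delta(\xi)\rangle$, $\langle X,\xi\eta\rangle=\langle\Delta(X),\xi\otimes\eta\rangle$, $\langle 1,\xi\rangle=\varepsilon(\xi)$, $\langle X,1\rangle=\varepsilon(X)$, whose only nonzero values on pairs of generators are $\langle A,\alpha\rangle=\langle D,\delta\rangle=q^{1/2}$, $\langle A,\delta\rangle=\langle D,\alpha\rangle=q^{-1/2}$, $\langle B,\beta\rangle=\langle C,\gamma\rangle=1$. For $X\in\mathcal{U}$, $\xi\in\mathcal{A}$: $X.\xi=(\mathrm{id}\otimes X)\Delta(\xi)$ (pairing in the second factor). Representations. For $l\in\frac12\mathbb{Z}_+$, $t^l$ is the representation of $\mathcal{U}$ on a $(2l+1)$-dimensional space with orthonormal basis $e^l_n$, $n=-l,-l+1,\dots,l$: $t^l(A)e^l_n=q^{-n}e^l_n$, $t^l(D)e^l_n=q^ne^l_n$, $t^l(B)e^l_n=\frac{\sqrt{(q^{-l+n-1}-q^{l-n+1})(q^{-l-n}-q^{l+n})}}{q^{-1}-q}e^l_{n-1}$,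 $t^l(C)e^l_n=\frac{\sqrt{(q^{-l+n}-q^{l-n})(q^{-l-n-1}-q^{l+n+1})}}{q^{-1}-q}e^l_{n+1}$. The elements $t^l_{n,m}\in\mathcal{A}$ are determined by $\langle X,t^l_{n,m}\rangle=\langle t^l(X)e^l_m,e^l_n\rangle$ for all $X\in\mathcal{U}$ (inner products are linear in the first variable). Vectors. For $\sigma\in\mathbb{R}$, $j,n\in\{-l,-l+1,\dots,l\}$, $$C^{l,j}(\sigma)=q^{l+j}\left[{2l\atop l-j}\right]_{q^2}^{1/2}\Big(\frac{1+q^{-4j-2\sigma}}{1+q^{-2\sigma}}\Big)^{1/2}\Big((-q^{2-2\sigma};q^2)_{l-j}(-q^{2+2\sigma};q^2)_{l+j}\Big)^{-1/2},$$ $$v^{l,j}_n(\sigma)=C^{l,j}(\sigma)\,\mathrm{i}^{\,n-l}q^{\sigma(l-n)}q^{\frac12(l-n)(l-n-1)}\Big(\frac{(q^{4l};q^{-2})_{l-n}}{(q^2;q^2)_{l-n}}\Big)^{1/2}{}_3\varphi_2\left({q^{-2(l-n)},q^{-2(l-j)},-q^{-2l-2j-2\sigma}\atop q^{-4l},0};q^2,q^2\right),$$ with $\mathrm{i}=\sqrt{-1}$. The generalised matrix elements are $$a^l_{i,j}(\tau,\sigma)=\sum_{n,m=-l}^l v^{l,j}_m(\sigma)\,\overline{v^{l,i}_n(\tau)}\,t^l_{n,m}\in\mathcal{A}.$$ The element $\rho_{\tau,\sigma}\in\mathcal{A}$ is $$\rho_{\tau,\sigma}=\tfrac12\big(\alpha^2+\delta^2+q\gamma^2+q^{-1}\beta^2+\mathrm{i}(q^{-\sigma}-q^{\sigma})(q\delta\gamma+\beta\alpha)-\mathrm{i}(q^{-\tau}-q^{\tau})(\delta\beta+q\gamma\alpha)+(q^{-\sigma}-q^\sigma)(q^{-\tau}-q^\tau)\beta\gamma\big).$$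 For $\lambda\in\mathbb{C}\setminus\{0\}$, $\tau_\lambda:\mathcal{A}\to\mathbb{C}$ is the algebra homomorphism with $\tau_\lambda(\alpha)=\lambda$, $\tau_\lambda(\delta)=\lambda^{-1}$, $\tau_\lambda(\beta)=\tau_\lambda(\gamma)=0$. Askey-Wilson polynomials: for $x=\frac12(z+z^{-1})$, $p_n(x;a,b,c,d\mid q)=a^{-n}(ab,ac,ad;q)_n\,{}_4\varphi_3\left({q^{-n},abcdq^{n-1},az,a/z\atop ab,ac,ad};q,q\right)$, and $$p_n^{(\mu,\nu)}(x;s,t\mid q)=p_n(x;q^{1/2}t/s,\,q^{1/2+\mu}s/t,\,-q^{1/2}/(st),\,-stq^{1/2+\nu}\mid q);$$ $p_n^{(\mu,\nu)}(x;s,t\mid q^2)$ means that $q$ is replaced by $q^2$ in this definition. *)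

theory Defs
  imports
    Complex_Main
    "HOL-Library.FuncSet"
    "HOL-Library.Poly_Mapping"
    "HOL-Library.Product_Plus"
    "HOL-Computational_Algebra.Polynomial"
    "HOL-Algebra.QuotRing"
    "HOL-Algebra.Module"
begin

section \<open>Complex algebras by generators and relations\<close>

text \<open>
  The deformation parameter is a term-level real number, so the algebras depending on it are
  records of \<^typ>\<open>(complex, 'a) module\<close>, not types. For a monoid written additively
  (\<^class>\<open>monoid_add\<close> does not require commutativity), the type
  \<^typ>\<open>'m::monoid_add \<Rightarrow>\<^sub>0 complex\<close> with the convolution product is
  the complex monoid algebra. For the monoid of words it is the free unital algebra.
\<close>

datatype 'g word = Word "'g list"

instantiation word :: (type) monoid_add
begin

definition zero_word :: "'g word" where
  "zero_word = Word []"

fun plus_word :: "'g word \<Rightarrow> 'g word \<Rightarrow> 'g word" where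
  "plus_word (Word xs) (Word ys) = Word (xs @ ys)"

instance
proof
  fix a b c :: "'g word"
  show "a + b + c = a + (b + c)" by (cases a; cases b; cases c) simp
  show "0 + a = a" by (cases a) (simp add: zero_word_def)
  show "a + 0 = a" by (cases a) (simp add: zero_word_def)
qed

end

type_synonym 'g falg = "'g word \<Rightarrow>\<^sub>0 complex"

definition gen :: "'g \<Rightarrow> 'g falg" where
  "gen g = Poly_Mapping.single (Word [g]) 1"

definition const :: "complex \<Rightarrow> ('m::monoid_add \<Rightarrow>\<^sub>0 complex)" where
  "const c = Poly_Mapping.single 0 c"

definition monoid_alg :: "(complex, 'm::monoid_add \<Rightarrow>\<^sub>0 complex) module" where
  "monoid_alg = \<lparr>carrier = UNIV, mult = (*), one = 1, zero = 0, add = (+),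
                  smult = (\<lambda>c x. const c * x)\<rparr>"

definition cls ::
  "('m::monoid_add \<Rightarrow>\<^sub>0 complex) set \<Rightarrow> ('m \<Rightarrow>\<^sub>0 complex) \<Rightarrow> ('m \<Rightarrow>\<^sub>0 complex) set" where
  "cls R x = (Idl\<^bsub>monoid_alg\<^esub> R) +>\<^bsub>monoid_alg\<^esub> x"

definition quot_alg ::
  "('m::monoid_add \<Rightarrow>\<^sub>0 complex) set \<Rightarrow> (complex, ('m \<Rightarrow>\<^sub>0 complex) set) module" where
  "quot_alg R = (let Q = monoid_alg Quot (Idl\<^bsub>monoid_alg\<^esub> R) in
     \<lparr>carrier = carrier Q, mult = mult Q, one = one Q, zero = zero Q, add = add Q,
      smult = (\<lambda>c X. cls R (const c) \<otimes>\<^bsub>Q\<^esub> X)\<rparr>)"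

definition complex_alg :: "(complex, complex) module" where
  "complex_alg = \<lparr>carrier = UNIV, mult = (*), one = 1, zero = 0, add = (+), smult = (*)\<rparr>"

definition alg_hom :: "(complex, 'a) module \<Rightarrow> (complex, 'b) module \<Rightarrow> ('a \<Rightarrow> 'b) set" where
  "alg_hom A B = {f \<in> ring_hom A B. \<forall>c. \<forall>x\<in>carrier A. f (c \<odot>\<^bsub>A\<^esub> x) = c \<odot>\<^bsub>B\<^esub> f x}"

text \<open>
  The algebra homomorphism out of a presented algebra with prescribed values on the generators.
  Extensionality only fixes the values outside the carrier.
\<close>

definition hom_on_gens ::
  "'g falg set \<Rightarrow> (complex, 'b) module \<Rightarrow> ('g \<Rightarrow> 'b) \<Rightarrow> ('g falg set \<Rightarrow> 'b)" where
  "hom_on_gens R B h = (THE f. f \<in> extensional (carrier (quot_alg R)) \<and>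
     f \<in> alg_hom (quot_alg R) B \<and> (\<forall>g. f (cls R (gen g)) = h g))"

definition poly_eval :: "(complex, 'a) module \<Rightarrow> complex poly \<Rightarrow> 'a \<Rightarrow> 'a" where
  "poly_eval A P x =
     (\<Oplus>\<^bsub>A\<^esub>k\<in>{..Polynomial.degree P}. Polynomial.coeff P k \<odot>\<^bsub>A\<^esub> (x [^]\<^bsub>A\<^esub> k))"


section \<open>Tensor products\<close>

text \<open>
  For monoids \<open>M\<close>, \<open>N\<close> the tensor product of the monoid algebras is the
  monoid algebra of \<open>M \<times> N\<close>, and the tensor product of their quotients by the
  ideals \<open>I\<close>, \<open>J\<close> is the quotient by
  \<open>I \<otimes> N + M \<otimes> J\<close>, the ideal generated by the elements
  \<open>r \<otimes> 1\<close> and \<open>1 \<otimes> s\<close> for \<open>r\<close>, \<open>s\<close>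
  in generating sets of \<open>I\<close>, \<open>J\<close>.
\<close>

definition free_tens ::
  "('m \<Rightarrow>\<^sub>0 complex) \<Rightarrow> ('n \<Rightarrow>\<^sub>0 complex) \<Rightarrow> ('m \<times> 'n \<Rightarrow>\<^sub>0 complex)" where
  "free_tens x y = (\<Sum>u\<in>Poly_Mapping.keys x. \<Sum>v\<in>Poly_Mapping.keys y.
     Poly_Mapping.single (u, v) (Poly_Mapping.lookup x u * Poly_Mapping.lookup y v))"

definition tens_rels ::
  "('m::monoid_add \<Rightarrow>\<^sub>0 complex) set \<Rightarrow> ('n::monoid_add \<Rightarrow>\<^sub>0 complex) set
     \<Rightarrow> ('m \<times> 'n \<Rightarrow>\<^sub>0 complex) set" where
  "tens_rels R S = (\<lambda>r. free_tens r 1) ` R \<union> (\<lambda>s. free_tens 1 s) ` S"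

definition tens_alg ::
  "('m::monoid_add \<Rightarrow>\<^sub>0 complex) set \<Rightarrow> ('n::monoid_add \<Rightarrow>\<^sub>0 complex) set
     \<Rightarrow> (complex, ('m \<times> 'n \<Rightarrow>\<^sub>0 complex) set) module" where
  "tens_alg R S = quot_alg (tens_rels R S)"

text \<open>
  The next three operations follow the pattern of \<^const>\<open>rcoset_mult\<close>: a map on
  cosets is given by a formula on representatives, the results for all representatives coincide
  (for linear \<open>f\<close>, \<open>g\<close>), and the union, respectively
  \<^const>\<open>the_elem\<close>, extracts the common value. They are the pure tensor
  \<open>X \<otimes> Y\<close>, the linear functional \<open>f \<otimes> g\<close> and the partial
  evaluation \<open>id \<otimes> g\<close>.
\<close>

definition tens ::
  "('m::monoid_add \<Rightarrow>\<^sub>0 complex) set \<Rightarrow> ('n::monoid_add \<Rightarrow>\<^sub>0 complex) set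
     \<Rightarrow> ('m \<Rightarrow>\<^sub>0 complex) set \<Rightarrow> ('n \<Rightarrow>\<^sub>0 complex) set \<Rightarrow> ('m \<times> 'n \<Rightarrow>\<^sub>0 complex) set" where
  "tens R S X Y = (\<Union>x\<in>X. \<Union>y\<in>Y. cls (tens_rels R S) (free_tens x y))"

definition tens_functional ::
  "('m::monoid_add \<Rightarrow>\<^sub>0 complex) set \<Rightarrow> ('n::monoid_add \<Rightarrow>\<^sub>0 complex) set
     \<Rightarrow> (('m \<Rightarrow>\<^sub>0 complex) set \<Rightarrow> complex) \<Rightarrow> (('n \<Rightarrow>\<^sub>0 complex) set \<Rightarrow> complex)
     \<Rightarrow> ('m \<times> 'n \<Rightarrow>\<^sub>0 complex) set \<Rightarrow> complex" where
  "tens_functional R S f g T = the_elem ((\<lambda>t. \<Sum>(u, v)\<in>Poly_Mapping.keys t. Poly_Mapping.lookup t (u, v) *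
     f (cls R (Poly_Mapping.single u 1)) * g (cls S (Poly_Mapping.single v 1))) ` T)"

definition id_tens ::
  "('m::monoid_add \<Rightarrow>\<^sub>0 complex) set \<Rightarrow> ('n::monoid_add \<Rightarrow>\<^sub>0 complex) set
     \<Rightarrow> (('n \<Rightarrow>\<^sub>0 complex) set \<Rightarrow> complex)
     \<Rightarrow> ('m \<times> 'n \<Rightarrow>\<^sub>0 complex) set \<Rightarrow> ('m \<Rightarrow>\<^sub>0 complex) set" where
  "id_tens R S g T = (\<Union>t\<in>T. cls R (\<Sum>(u, v)\<in>Poly_Mapping.keys t.
     Poly_Mapping.single u (Poly_Mapping.lookup t (u, v) * g (cls S (Poly_Mapping.single v 1)))))"


section \<open>The quantum SU(2) group and the quantised universal enveloping algebra\<close>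

datatype agen = gen_alpha | gen_beta | gen_gamma | gen_delta
datatype ugen = gen_A | gen_B | gen_C | gen_D

definition Aq_rels :: "real \<Rightarrow> agen falg set" where
  "Aq_rels q = (let a = gen gen_alpha; b = gen gen_beta; c = gen gen_gamma; d = gen gen_delta;
                    k = const (complex_of_real q); k' = const (complex_of_real (inverse q))
     in {a * b - k * b * a, a * c - k * c * a, b * d - k * d * b, c * d - k * d * c,
         b * c - c * b, a * d - k * b * c - 1, d * a - k' * b * c - 1})"

definition Aq :: "real \<Rightarrow> (complex, agen falg set) module" where
  "Aq q = quot_alg (Aq_rels q)"

definition Uq_rels :: "real \<Rightarrow> ugen falg set" where
  "Uq_rels q = (let A = gen gen_A; B = gen gen_B; C = gen gen_C; D = gen gen_D;
                    k = const (complex_of_real q); k' = const (complex_of_real (inverse q));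
                    e = const (complex_of_real (inverse (q - inverse q)))
     in {A * D - 1, D * A - 1, A * B - k * B * A, A * C - k' * C * A,
         B * C - C * B - e * (A ^ 2 - D ^ 2)})"

definition Uq :: "real \<Rightarrow> (complex, ugen falg set) module" where
  "Uq q = quot_alg (Uq_rels q)"

definition a_elem :: "real \<Rightarrow> agen \<Rightarrow> agen falg set" where
  "a_elem q g = cls (Aq_rels q) (gen g)"

definition u_elem :: "real \<Rightarrow> ugen \<Rightarrow> ugen falg set" where
  "u_elem q g = cls (Uq_rels q) (gen g)"

definition Aq_comult :: "real \<Rightarrow> agen falg set \<Rightarrow> (agen word \<times> agen word \<Rightarrow>\<^sub>0 complex) set" where
  "Aq_comult q = (let T = tens_alg (Aq_rels q) (Aq_rels q); t = tens (Aq_rels q) (Aq_rels q);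
       a = a_elem q gen_alpha; b = a_elem q gen_beta; c = a_elem q gen_gamma; d = a_elem q gen_delta
     in hom_on_gens (Aq_rels q) T (\<lambda>g. case g of
          gen_alpha \<Rightarrow> t a a \<oplus>\<^bsub>T\<^esub> t b c
        | gen_beta \<Rightarrow> t a b \<oplus>\<^bsub>T\<^esub> t b d
        | gen_gamma \<Rightarrow> t c a \<oplus>\<^bsub>T\<^esub> t d c
        | gen_delta \<Rightarrow> t c b \<oplus>\<^bsub>T\<^esub> t d d))"

definition Aq_counit :: "real \<Rightarrow> agen falg set \<Rightarrow> complex" where
  "Aq_counit q = hom_on_gens (Aq_rels q) complex_alg
     (\<lambda>g. case g of gen_alpha \<Rightarrow> 1 | gen_beta \<Rightarrow> 0 | gen_gamma \<Rightarrow> 0 | gen_delta \<Rightarrow> 1)"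

definition Uq_comult :: "real \<Rightarrow> ugen falg set \<Rightarrow> (ugen word \<times> ugen word \<Rightarrow>\<^sub>0 complex) set" where
  "Uq_comult q = (let T = tens_alg (Uq_rels q) (Uq_rels q); t = tens (Uq_rels q) (Uq_rels q);
       A = u_elem q gen_A; B = u_elem q gen_B; C = u_elem q gen_C; D = u_elem q gen_D
     in hom_on_gens (Uq_rels q) T (\<lambda>g. case g of
          gen_A \<Rightarrow> t A A
        | gen_B \<Rightarrow> t A B \<oplus>\<^bsub>T\<^esub> t B D
        | gen_C \<Rightarrow> t A C \<oplus>\<^bsub>T\<^esub> t C D
        | gen_D \<Rightarrow> t D D))"

definition Uq_counit :: "real \<Rightarrow> ugen falg set \<Rightarrow> complex" where
  "Uq_counit q = hom_on_gens (Uq_rels q) complex_alg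
     (\<lambda>g. case g of gen_A \<Rightarrow> 1 | gen_B \<Rightarrow> 0 | gen_C \<Rightarrow> 0 | gen_D \<Rightarrow> 1)"

fun gen_pairing :: "real \<Rightarrow> ugen \<Rightarrow> agen \<Rightarrow> complex" where
  "gen_pairing q gen_A gen_alpha = complex_of_real (q powr (1/2))"
| "gen_pairing q gen_D gen_delta = complex_of_real (q powr (1/2))"
| "gen_pairing q gen_A gen_delta = complex_of_real (q powr (-1/2))"
| "gen_pairing q gen_D gen_alpha = complex_of_real (q powr (-1/2))"
| "gen_pairing q gen_B gen_beta = 1"
| "gen_pairing q gen_C gen_gamma = 1"
| "gen_pairing q _ _ = 0"

definition is_duality :: "real \<Rightarrow> (ugen falg set \<Rightarrow> agen falg set \<Rightarrow> complex) \<Rightarrow> bool" where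
  "is_duality q P \<longleftrightarrow>
     (\<forall>X\<in>carrier (Uq q). \<forall>Y\<in>carrier (Uq q). \<forall>\<xi>\<in>carrier (Aq q). \<forall>c.
        P (X \<oplus>\<^bsub>Uq q\<^esub> Y) \<xi> = P X \<xi> + P Y \<xi> \<and> P (c \<odot>\<^bsub>Uq q\<^esub> X) \<xi> = c * P X \<xi> \<and>
        P (X \<otimes>\<^bsub>Uq q\<^esub> Y) \<xi> =
          tens_functional (Aq_rels q) (Aq_rels q) (P X) (P Y) (Aq_comult q \<xi>)) \<and>
     (\<forall>X\<in>carrier (Uq q). \<forall>\<xi>\<in>carrier (Aq q). \<forall>\<eta>\<in>carrier (Aq q). \<forall>c.
        P X (\<xi> \<oplus>\<^bsub>Aq q\<^esub> \<eta>) = P X \<xi> + P X \<eta> \<and> P X (c \<odot>\<^bsub>Aq q\<^esub> \<xi>) = c * P X \<xi> \<and>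
        P X (\<xi> \<otimes>\<^bsub>Aq q\<^esub> \<eta>) =
          tens_functional (Uq_rels q) (Uq_rels q) (\<lambda>Y. P Y \<xi>) (\<lambda>Y. P Y \<eta>) (Uq_comult q X)) \<and>
     (\<forall>\<xi>\<in>carrier (Aq q). P \<one>\<^bsub>Uq q\<^esub> \<xi> = Aq_counit q \<xi>) \<and>
     (\<forall>X\<in>carrier (Uq q). P X \<one>\<^bsub>Aq q\<^esub> = Uq_counit q X) \<and>
     (\<forall>x g. P (u_elem q x) (a_elem q g) = gen_pairing q x g)"

definition pairing :: "real \<Rightarrow> ugen falg set \<Rightarrow> agen falg set \<Rightarrow> complex" where
  "pairing q = (THE P. P \<in> carrier (Uq q) \<rightarrow>\<^sub>E (carrier (Aq q) \<rightarrow>\<^sub>E UNIV) \<and> is_duality q P)"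

definition left_act :: "real \<Rightarrow> ugen falg set \<Rightarrow> agen falg set \<Rightarrow> agen falg set" where
  "left_act q X \<xi> = id_tens (Aq_rels q) (Aq_rels q) (pairing q X) (Aq_comult q \<xi>)"

definition tau_hom :: "real \<Rightarrow> complex \<Rightarrow> agen falg set \<Rightarrow> complex" where
  "tau_hom q lam = hom_on_gens (Aq_rels q) complex_alg
     (\<lambda>g. case g of gen_alpha \<Rightarrow> lam | gen_beta \<Rightarrow> 0 | gen_gamma \<Rightarrow> 0 | gen_delta \<Rightarrow> inverse lam)"

definition rho :: "real \<Rightarrow> real \<Rightarrow> real \<Rightarrow> agen falg set" where
  "rho q \<tau> \<sigma> = (let a = gen gen_alpha; b = gen gen_beta; c = gen gen_gamma; d = gen gen_delta;
       k = const (complex_of_real q); k' = const (complex_of_real (inverse q));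
       s = complex_of_real (q powr (-\<sigma>) - q powr \<sigma>); t = complex_of_real (q powr (-\<tau>) - q powr \<tau>)
     in cls (Aq_rels q) (const (1/2) *
          (a ^ 2 + d ^ 2 + k * c ^ 2 + k' * b ^ 2
           + const (\<i> * s) * (k * d * c + b * a)
           - const (\<i> * t) * (d * b + k * c * a)
           + const (s * t) * b * c)))"


section \<open>Irreducible representations and their matrix elements\<close>

text \<open>
  Spins \<open>l\<close> and weights are half-integers, represented as real numbers. An operator
  \<open>T\<close> on the space with orthonormal basis \<open>e n\<close>, \<open>n \<in> weights l\<close>,
  is represented by its matrix: \<open>M n m\<close> is the inner product
  of \<open>T (e m)\<close> with \<open>e n\<close>.
\<close>

definition weights :: "real \<Rightarrow> real set" where
  "weights l = {- l + real k |k::nat. real k \<le> 2 * l}"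

definition mat_alg :: "real \<Rightarrow> (complex, real \<Rightarrow> real \<Rightarrow> complex) module" where
  "mat_alg l = \<lparr>carrier = {M. \<forall>n m. n \<notin> weights l \<or> m \<notin> weights l \<longrightarrow> M n m = 0},
     mult = (\<lambda>M N n m. \<Sum>k\<in>weights l. M n k * N k m),
     one = (\<lambda>n m. if n \<in> weights l \<and> n = m then 1 else 0),
     zero = (\<lambda>n m. 0),
     add = (\<lambda>M N n m. M n m + N n m),
     smult = (\<lambda>c M n m. c * M n m)\<rparr>"

definition rep :: "real \<Rightarrow> real \<Rightarrow> ugen falg set \<Rightarrow> real \<Rightarrow> real \<Rightarrow> complex" where
  "rep q l = hom_on_gens (Uq_rels q) (mat_alg l) (\<lambda>g n m.
     if n \<in> weights l \<and> m \<in> weights l then complex_of_real (case g of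
         gen_A \<Rightarrow> if n = m then q powr (-m) else 0
       | gen_D \<Rightarrow> if n = m then q powr m else 0
       | gen_B \<Rightarrow> if n = m - 1 then
             sqrt ((q powr (-l+m-1) - q powr (l-m+1)) * (q powr (-l-m) - q powr (l+m)))
               / (inverse q - q) else 0
       | gen_C \<Rightarrow> if n = m + 1 then
             sqrt ((q powr (-l+m) - q powr (l-m)) * (q powr (-l-m-1) - q powr (l+m+1)))
               / (inverse q - q) else 0)
     else 0)"

definition t_elem :: "real \<Rightarrow> real \<Rightarrow> real \<Rightarrow> real \<Rightarrow> agen falg set" where
  "t_elem q l n m = (THE \<xi>. \<xi> \<in> carrier (Aq q) \<and>
     (\<forall>X\<in>carrier (Uq q). pairing q X \<xi> = rep q l X n m))"


section \<open>Basic hypergeometric series\<close>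

definition qpoch :: "'a::comm_ring_1 \<Rightarrow> 'a \<Rightarrow> nat \<Rightarrow> 'a" where
  "qpoch a p k = (\<Prod>r<k. 1 - a * p ^ r)"

definition qbinom :: "nat \<Rightarrow> nat \<Rightarrow> 'a::field \<Rightarrow> 'a" where
  "qbinom n k p = qpoch (p ^ n) (inverse p) k / qpoch p p k"

text \<open>
  If \<open>p\<^sup>-\<^sup>n\<close> is an upper parameter, the numerators of all terms with \<open>k > n\<close> vanish;
  since \<open>0 / 0 = 0\<close>, such terms are zero also when a lower parameter \<open>p\<^sup>-\<^sup>N\<close>
  with \<open>n \<le> N\<close> makes the denominator vanish, so this is the sum up to
  \<open>k = n\<close>, as required.
\<close>

definition qhyp :: "'a::real_normed_field list \<Rightarrow> 'a list \<Rightarrow> 'a \<Rightarrow> 'a \<Rightarrow> 'a" where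
  "qhyp as bs p z =
     suminf (\<lambda>k. (\<Prod>a\<leftarrow>as. qpoch a p k) / ((\<Prod>b\<leftarrow>bs. qpoch b p k) * qpoch p p k) * z ^ k)"

text \<open>
  The series is a polynomial in \<open>x = (z + 1/z) / 2\<close>, since the factors of the numerator
  combine to \<open>(1 - a z p\<^sup>r) (1 - a p\<^sup>r / z) = 1 - 2 a p\<^sup>r x + a\<^sup>2 p\<^sup>2\<^sup>r\<close>; its values at all
  such \<open>x\<close> determine it.
\<close>

definition askey_wilson ::
  "nat \<Rightarrow> complex \<Rightarrow> complex \<Rightarrow> complex \<Rightarrow> complex \<Rightarrow> complex \<Rightarrow> complex poly" where
  "askey_wilson n a b c d p = (THE P. \<forall>z. z \<noteq> 0 \<longrightarrow> poly P ((z + inverse z) / 2) =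
     inverse (a ^ n) * qpoch (a * b) p n * qpoch (a * c) p n * qpoch (a * d) p n *
     qhyp [inverse (p ^ n), a * b * c * d * p powi (int n - 1), a * z, a / z]
          [a * b, a * c, a * d] p p)"

definition askey_wilson2 ::
  "nat \<Rightarrow> real \<Rightarrow> real \<Rightarrow> real \<Rightarrow> real \<Rightarrow> real \<Rightarrow> complex poly" where
  "askey_wilson2 n \<mu> \<nu> s t p = askey_wilson n
     (complex_of_real (p powr (1/2) * t / s))
     (complex_of_real (p powr (1/2 + \<mu>) * s / t))
     (complex_of_real (- (p powr (1/2)) / (s * t)))
     (complex_of_real (- s * t * p powr (1/2 + \<nu>)))
     (complex_of_real p)"


section \<open>Generalised matrix elements\<close>

text \<open>
  Differences such as \<open>l - j\<close> are non-negative integers for the arguments of interest;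
  \<open>nat \<lfloor>l - j\<rfloor>\<close> only converts the type.
\<close>

definition C_coeff :: "real \<Rightarrow> real \<Rightarrow> real \<Rightarrow> real \<Rightarrow> real" where
  "C_coeff q l j \<sigma> = q powr (l + j) * sqrt (qbinom (nat \<lfloor>2 * l\<rfloor>) (nat \<lfloor>l - j\<rfloor>) (q\<^sup>2))
     * sqrt ((1 + q powr (-4*j - 2*\<sigma>)) / (1 + q powr (-2*\<sigma>)))
     * inverse (sqrt (qpoch (- (q powr (2 - 2*\<sigma>))) (q\<^sup>2) (nat \<lfloor>l - j\<rfloor>)
                      * qpoch (- (q powr (2 + 2*\<sigma>))) (q\<^sup>2) (nat \<lfloor>l + j\<rfloor>)))"

definition v_coeff :: "real \<Rightarrow> real \<Rightarrow> real \<Rightarrow> real \<Rightarrow> real \<Rightarrow> complex" where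
  "v_coeff q l j n \<sigma> = \<i> powi \<lfloor>n - l\<rfloor> * complex_of_real (C_coeff q l j \<sigma>
     * q powr (\<sigma> * (l - n)) * q powr (1/2 * (l - n) * (l - n - 1))
     * sqrt (qpoch (q powr (4*l)) (q powr (-2)) (nat \<lfloor>l - n\<rfloor>)
             / qpoch (q\<^sup>2) (q\<^sup>2) (nat \<lfloor>l - n\<rfloor>))
     * qhyp [q powr (-2*(l - n)), q powr (-2*(l - j)), - (q powr (-2*l - 2*j - 2*\<sigma>))]
            [q powr (-4*l), 0] (q\<^sup>2) (q\<^sup>2))"

definition gen_mat_elem :: "real \<Rightarrow> real \<Rightarrow> real \<Rightarrow> real \<Rightarrow> real \<Rightarrow> real \<Rightarrow> agen falg set" where
  "gen_mat_elem q l i j \<tau> \<sigma> = (\<Oplus>\<^bsub>Aq q\<^esub>n\<in>weights l. \<Oplus>\<^bsub>Aq q\<^esub>m\<in>weights l.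
     (v_coeff q l j m \<sigma> * cnj (v_coeff q l i n \<tau>)) \<odot>\<^bsub>Aq q\<^esub> t_elem q l n m)"

definition d_coeff :: "real \<Rightarrow> real \<Rightarrow> real \<Rightarrow> real \<Rightarrow> real \<Rightarrow> real \<Rightarrow> real" where
  "d_coeff q l i j \<tau> \<sigma> =
     C_coeff q l j \<sigma> * C_coeff q l i \<tau> / (C_coeff q i j \<sigma> * C_coeff q i i \<tau>)
     * (q powr (i - l) / qpoch (q powr (4*l)) (q powr (-2)) (nat \<lfloor>l - i\<rfloor>))"

definition poly_at_D_rho :: "real \<Rightarrow> real \<Rightarrow> real \<Rightarrow> complex poly \<Rightarrow> agen falg set" where
  "poly_at_D_rho q \<tau> \<sigma> P =
     poly_eval (Aq q) P (left_act q (u_elem q gen_D) (rho q \<tau> \<sigma>))"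

end

theory Submission
  imports Defs
begin

text \<open>
  Let \<open>X\<^sub>\<sigma>\<close> be the twisted primitive element of the quantised enveloping algebra. The vectors
  \<open>v\<^bsup>l,j\<^esup>(\<sigma>)\<close> are eigenvectors of \<open>t\<^bsup>l\<^esup>(X\<^sub>\<sigma> A)\<close> with an eigenvalue that does not depend on
  \<open>l\<close>, and \<open>D.\<rho>\<^bsub>\<tau>,\<sigma>\<^esub>\<close> is bi-invariant. Hence both sides of each identity are eigenvectors for
  \<open>X\<^sub>\<sigma> A\<close> on the one side and for \<open>X\<^sub>\<tau> A\<close> on the other, with equal eigenvalues. The eigen-equations
  determine such an element from its pairings with the powers of \<open>A\<close>, because the pairing is
  non-degenerate, so it suffices to compare the images under all \<open>\<tau>\<^sub>\<lambda>\<close>. These are bilinear sums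
  of dual \<open>q\<close>-Krawtchouk polynomials, which the \<open>q\<close>-Saalschuetz formula turns into Askey--Wilson
  polynomials. The sums are invariant under exchanging \<open>(i, \<tau>)\<close> with \<open>(j, \<sigma>)\<close> and under
  changing all four signs; this reduces (ii)--(iv) to (i).
\<close>

text \<open>The algebra homomorphisms, the pairing, the elements \<open>t_elem\<close> and the
  polynomials \<open>askey_wilson\<close> are all specified by \<open>THE\<close>, so existence and
  uniqueness have to be proved before anything can be computed. All work is therefore done on
  representatives in the free algebras, and the pairing is constructed as a recursive function
  \<open>pw\<close> on pairs of words. Existence of the matrix elements starts from the power of
  alpha with exponent 2l, whose functional is a diagonal coefficient at an extreme weight; the
  others are translates of it by B and C. The obstacle is to get from the torus to the whole
  algebra. For a functional evaluated at A^k w B and at A^k w C, with w a word in B and C, the right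
  and the left equation give the ratios q and q^(2k-1) up to values at shorter words, so both values
  vanish. Reordering letters uses up copies of A, and so this works only for large k; hence
  non-degeneracy is proved from the assumption that the pairings vanish for all large k, where
  distinct weights can still be separated by power sums.\<close>

lemma pm_induct:
  fixes x :: "'m \<Rightarrow>\<^sub>0 complex"
  assumes s: "\<And>w c. P (Poly_Mapping.single w c)" and a: "\<And>x y. P x \<Longrightarrow> P y \<Longrightarrow> P (x + y)"
  shows "P x"
proof -
  have x: "x = (\<Sum>w\<in>Poly_Mapping.keys x. Poly_Mapping.single w (Poly_Mapping.lookup x w))"
    by (rule poly_mapping_eqI)
      (auto simp: lookup_sum lookup_single when_def not_in_keys_iff_lookup_eq_zero)
  have "P (\<Sum>w\<in>S. Poly_Mapping.single w (f w))" if "finite S" for S and f :: "'m \<Rightarrow> complex"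
    using that
  proof induction
    case empty
    then show ?case using s[of undefined 0] by simp
  qed (auto intro: s a)
  then show ?thesis by (subst x) simp
qed

section \<open>Linear extension of maps given on a monoid\<close>

definition lin :: "('m \<Rightarrow> complex) \<Rightarrow> ('m \<Rightarrow>\<^sub>0 complex) \<Rightarrow> complex" where
  "lin f x = (\<Sum>w\<in>Poly_Mapping.keys x. Poly_Mapping.lookup x w * f w)"

definition lmap ::
  "('m \<Rightarrow> ('n::monoid_add \<Rightarrow>\<^sub>0 complex)) \<Rightarrow> ('m \<Rightarrow>\<^sub>0 complex) \<Rightarrow> ('n \<Rightarrow>\<^sub>0 complex)" where
  "lmap F x = (\<Sum>w\<in>Poly_Mapping.keys x. const (Poly_Mapping.lookup x w) * F w)"

lemma const_0 [simp]: "const 0 = 0" by (simp add: const_def)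
lemma const_1 [simp]: "const 1 = 1" by (simp add: const_def)
lemma const_add: "const (a + b) = const a + const b" by (simp add: const_def single_add)
lemma const_minus: "const (- a) = - const a" by (simp add: const_def single_uminus)
lemma const_mult: "const (a * b) = const a * const b" by (simp add: const_def mult_single)

lemma const_single: "const c * Poly_Mapping.single w d = Poly_Mapping.single w (c * d)"
  by (simp add: const_def mult_single)

text \<open>Scalar multiplication is encoded as left multiplication by \<open>const c\<close>, so
  centrality of these elements has to be available explicitly.\<close>

lemma const_comm: "x * const c = const c * x"
proof (induction x rule: pm_induct)
  case (1 w d)
  then show ?case by (simp add: const_def mult_single mult.commute)
qed (simp add: algebra_simps)

lemma lin_single [simp]: "lin f (Poly_Mapping.single w c) = c * f w"
  by (simp add: lin_def)

lemma lin_superset: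
  assumes "finite S" "Poly_Mapping.keys x \<subseteq> S"
  shows "lin f x = (\<Sum>w\<in>S. Poly_Mapping.lookup x w * f w)"
  unfolding lin_def using assms
  by (intro sum.mono_neutral_left) (auto simp: not_in_keys_iff_lookup_eq_zero)

lemma lin_add: "lin f (x + y) = lin f x + lin f y"
proof -
  let ?S = "Poly_Mapping.keys x \<union> Poly_Mapping.keys y"
  have "lin f z = (\<Sum>w\<in>?S. Poly_Mapping.lookup z w * f w)" if "z \<in> {x, y, x + y}" for z
    using that keys_add[of x y] by (intro lin_superset) auto
  then show ?thesis by (simp add: lookup_add algebra_simps sum.distrib)
qed

lemma lin_0 [simp]: "lin f 0 = 0" by (simp add: lin_def)

lemma lin_minus: "lin f (- x) = - lin f x"
  using lin_add[of f x "- x"] by (simp add: add_eq_0_iff)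

lemma lin_diff: "lin f (x - y) = lin f x - lin f y"
  using lin_add[of f x "- y"] by (simp add: lin_minus)

lemma lin_sum: "lin f (\<Sum>i\<in>S. x i) = (\<Sum>i\<in>S. lin f (x i))"
  by (induction S rule: infinite_finite_induct) (auto simp: lin_add)

lemma lin_const: "lin f (const c * x) = c * lin f x"
proof (induction x rule: pm_induct)
  case (1 w d)
  then show ?case by (simp add: const_single)
qed (simp add: algebra_simps lin_add)

lemma lmap_single: "lmap F (Poly_Mapping.single w c) = const c * F w"
  by (simp add: lmap_def)

lemma lmap_superset:
  assumes "finite S" "Poly_Mapping.keys x \<subseteq> S"
  shows "lmap f x = (\<Sum>w\<in>S. const (Poly_Mapping.lookup x w) * f w)"
  unfolding lmap_def using assms
  by (intro sum.mono_neutral_left) (auto simp: not_in_keys_iff_lookup_eq_zero)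

lemma lmap_add: "lmap f (x + y) = lmap f x + lmap f y"
proof -
  let ?S = "Poly_Mapping.keys x \<union> Poly_Mapping.keys y"
  have "lmap f z = (\<Sum>w\<in>?S. const (Poly_Mapping.lookup z w) * f w)" if "z \<in> {x, y, x + y}" for z
    using that keys_add[of x y] by (intro lmap_superset) auto
  then show ?thesis by (simp add: lookup_add const_add algebra_simps sum.distrib)
qed

lemma lmap_0 [simp]: "lmap f 0 = 0" by (simp add: lmap_def)

lemma lmap_minus: "lmap f (- x) = - lmap f x"
  using lmap_add[of f x "- x"] by (simp add: add_eq_0_iff)

lemma lmap_diff: "lmap f (x - y) = lmap f x - lmap f y"
  using lmap_add[of f x "- y"] by (simp add: lmap_minus)

lemma lmap_const: "lmap f (const c * x) = const c * lmap f x"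
proof (induction x rule: pm_induct)
  case (1 w d)
  then show ?case by (simp add: const_single lmap_single const_mult mult.assoc)
qed (simp add: algebra_simps lmap_add)

lemma lin_lmap: "lin f (lmap F x) = lin (\<lambda>w. lin f (F w)) x"
  by (induction x rule: pm_induct) (auto simp: lmap_single lin_add lmap_add lin_const)

lemma lin_f0 [simp]: "lin (\<lambda>w. 0) x = 0"
  by (simp add: lin_def)

lemma lin_mult:
  assumes "\<And>u v. f (u + v) = f u * f v"
  shows "lin f (x * y) = lin f x * lin f y"
proof (induction x rule: pm_induct)
  case (1 u c)
  show ?case
    by (induction y rule: pm_induct) (auto simp: mult_single lin_add assms algebra_simps)
qed (auto simp: algebra_simps lin_add)

text \<open>Multiplicativity on basis elements passes to linear combinations; coefficients are moved
  past \<open>F u\<close> by centrality of the scalars.\<close>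

lemma lmap_mult:
  assumes "\<And>u v. F (u + v) = F u * F v"
  shows "lmap F (x * y) = lmap F x * lmap F y"
proof (induction x rule: pm_induct)
  case (1 u c)
  show ?case
  proof (induction y rule: pm_induct)
    case (1 v d)
    have "F u * const d = const d * F u" by (rule const_comm)
    then show ?case
      by (simp add: mult_single lmap_single assms const_mult mult.assoc)
        (simp flip: mult.assoc)
  qed (auto simp: lmap_add algebra_simps)
qed (auto simp: algebra_simps lmap_add)

section \<open>Two-sided ideals and quotient algebras, computed on representatives\<close>

text \<open>The generated two-sided ideal, built by adding one term \<open>a * r * b\<close> at a
  time. This gives inductions with a single step, instead of separate closure cases for sums and for
  products on either side.\<close>

inductive_set ideal_span :: "('m::monoid_add \<Rightarrow>\<^sub>0 complex) set \<Rightarrow> ('m \<Rightarrow>\<^sub>0 complex) set" for R where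
  ideal_span_0: "0 \<in> ideal_span R"
| ideal_span_step: "x \<in> ideal_span R \<Longrightarrow> r \<in> R \<Longrightarrow> x + a * r * b \<in> ideal_span R"

lemma ideal_span_add: "y \<in> ideal_span R \<Longrightarrow> x \<in> ideal_span R \<Longrightarrow> x + y \<in> ideal_span R"
  by (induction y rule: ideal_span.induct) (auto intro: ideal_span_step simp flip: add.assoc)

lemma ideal_span_mult: "y \<in> ideal_span R \<Longrightarrow> u * y * v \<in> ideal_span R"
proof (induction y rule: ideal_span.induct)
  case (ideal_span_step x r a b)
  then show ?case
    using ideal_span.ideal_span_step[of "u * x * v" R r "u * a" "b * v"] by (simp add: algebra_simps)
qed (simp add: ideal_span_0)

lemma ideal_span_multl: "y \<in> ideal_span R \<Longrightarrow> u * y \<in> ideal_span R"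
  using ideal_span_mult[of y R u 1] by simp
lemma ideal_span_multr: "y \<in> ideal_span R \<Longrightarrow> y * u \<in> ideal_span R"
  using ideal_span_mult[of y R 1 u] by simp
lemma ideal_span_minus: "y \<in> ideal_span R \<Longrightarrow> - y \<in> ideal_span R"
  using ideal_span_mult[of y R "-1" 1] by simp
lemma ideal_span_diff: "x \<in> ideal_span R \<Longrightarrow> y \<in> ideal_span R \<Longrightarrow> x - y \<in> ideal_span R"
  using ideal_span_add[of "- y" R x] by (simp add: ideal_span_minus)
lemma ideal_span_gen: "r \<in> R \<Longrightarrow> r \<in> ideal_span R"
  using ideal_span_step[OF ideal_span_0, of r R 1 1] by simp
lemma monoid_alg_simps [simp]:
  "carrier monoid_alg = UNIV" "x \<otimes>\<^bsub>monoid_alg\<^esub> y = x * y" "x \<oplus>\<^bsub>monoid_alg\<^esub> y = x + y"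
  "\<one>\<^bsub>monoid_alg\<^esub> = 1" "\<zero>\<^bsub>monoid_alg\<^esub> = 0" "c \<odot>\<^bsub>monoid_alg\<^esub> x = const c * x"
  by (simp_all add: monoid_alg_def)

lemma ring_monoid_alg: "ring (monoid_alg :: (complex, 'm::monoid_add \<Rightarrow>\<^sub>0 complex) module)"
proof (rule ringI)
  show "abelian_group (monoid_alg :: (complex, 'm \<Rightarrow>\<^sub>0 complex) module)"
    by (rule abelian_groupI) (auto simp: algebra_simps intro: exI[of _ "- x" for x])
  show "monoid (monoid_alg :: (complex, 'm \<Rightarrow>\<^sub>0 complex) module)"
    by (rule monoidI) (auto simp: algebra_simps)
qed (auto simp: algebra_simps)

lemma monoid_alg_uminus: "\<ominus>\<^bsub>monoid_alg\<^esub> x = - x"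
proof -
  interpret ring monoid_alg by (rule ring_monoid_alg)
  show ?thesis by (rule minus_equality) auto
qed

lemma ideal_ideal_span: "ideal (ideal_span R) monoid_alg"
proof (rule idealI)
  show "subgroup (ideal_span R) (add_monoid monoid_alg)"
  proof (rule group.subgroupI)
    show "group (add_monoid (monoid_alg :: (complex, 'a \<Rightarrow>\<^sub>0 complex) module))"
      by (rule abelian_group.a_group[OF ring.is_abelian_group[OF ring_monoid_alg]])
    fix a b assume "a \<in> ideal_span R" "b \<in> ideal_span R"
    then show "inv\<^bsub>add_monoid monoid_alg\<^esub> a \<in> ideal_span R" "a \<otimes>\<^bsub>add_monoid monoid_alg\<^esub> b \<in> ideal_span R"
      using monoid_alg_uminus[of a] by (auto simp: a_inv_def ideal_span_minus ideal_span_add)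
  qed (use ideal_span_0 in auto)
qed (auto simp: ring_monoid_alg ideal_span_multl ideal_span_multr)

lemma Idl_ideal_span: "Idl\<^bsub>monoid_alg\<^esub> R = ideal_span R"
proof
  interpret ring "monoid_alg :: (complex, 'a \<Rightarrow>\<^sub>0 complex) module" by (rule ring_monoid_alg)
  show "Idl\<^bsub>monoid_alg\<^esub> R \<subseteq> ideal_span R"
    by (rule genideal_minimal) (auto simp: ideal_ideal_span ideal_span_gen)
  interpret I: ideal "Idl\<^bsub>monoid_alg\<^esub> R" monoid_alg by (rule genideal_ideal) simp
  have "x \<in> Idl\<^bsub>monoid_alg\<^esub> R" if "x \<in> ideal_span R" for x
    using that
  proof induction
    case (ideal_span_step x r a b)
    have "r \<in> Idl\<^bsub>monoid_alg\<^esub> R" using genideal_self[of R] ideal_span_step by auto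
    then have "a * r * b \<in> Idl\<^bsub>monoid_alg\<^esub> R"
      using I.I_l_closed[of r a] I.I_r_closed[of "a * r" b] by simp
    then show ?case using I.a_closed[of x "a * r * b"] ideal_span_step by simp
  qed (use I.zero_closed in simp)
  then show "ideal_span R \<subseteq> Idl\<^bsub>monoid_alg\<^esub> R" by auto
qed

lemma mem_cls: "y \<in> cls R x \<longleftrightarrow> y - x \<in> ideal_span R"
proof -
  have "cls R x = (\<lambda>h. h + x) ` ideal_span R"
    by (auto simp: cls_def Idl_ideal_span a_r_coset_def')
  then show ?thesis by (force simp: image_iff)
qed

lemma cls_eq: "cls R x = cls R y \<longleftrightarrow> x - y \<in> ideal_span R"
proof
  assume "cls R x = cls R y"
  then have "x \<in> cls R y" using mem_cls[of x R x] ideal_span_0 by auto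
  then show "x - y \<in> ideal_span R" by (simp add: mem_cls)
next
  assume *: "x - y \<in> ideal_span R"
  have "z - x \<in> ideal_span R \<longleftrightarrow> z - y \<in> ideal_span R" for z
    using ideal_span_add[OF *, of "z - x"] ideal_span_diff[OF _ *, of "z - y"] by auto
  then show "cls R x = cls R y" by (auto simp: mem_cls)
qed

lemma cls_self: "x \<in> cls R x" by (simp add: mem_cls ideal_span_0)

text \<open>Every operation of the quotient algebra becomes the corresponding operation on
  representatives; the cosets themselves are not opened again except through \<open>cls_eq\<close>
  and \<open>mem_cls\<close>.\<close>

lemma quot_simps:
  "carrier (quot_alg R) = range (cls R)"
  "cls R x \<otimes>\<^bsub>quot_alg R\<^esub> cls R y = cls R (x * y)"
  "cls R x \<oplus>\<^bsub>quot_alg R\<^esub> cls R y = cls R (x + y)"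
  "\<one>\<^bsub>quot_alg R\<^esub> = cls R 1"
  "\<zero>\<^bsub>quot_alg R\<^esub> = cls R 0"
  "c \<odot>\<^bsub>quot_alg R\<^esub> cls R x = cls R (const c * x)"
proof -
  interpret I: ideal "Idl\<^bsub>monoid_alg\<^esub> R" monoid_alg
    using ideal_ideal_span by (simp add: Idl_ideal_span)
  have m: "rcoset_mult monoid_alg (Idl\<^bsub>monoid_alg\<^esub> R) (cls R x) (cls R y) = cls R (x * y)" for x y
    unfolding cls_def using I.rcoset_mult_add[of x y] by simp
  show "cls R x \<otimes>\<^bsub>quot_alg R\<^esub> cls R y = cls R (x * y)"
    "c \<odot>\<^bsub>quot_alg R\<^esub> cls R x = cls R (const c * x)"
    using m by (auto simp: quot_alg_def FactRing_def)
  show "cls R x \<oplus>\<^bsub>quot_alg R\<^esub> cls R y = cls R (x + y)"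
    using I.a_rcos_sum[of x y] by (simp add: quot_alg_def FactRing_def cls_def)
  show "carrier (quot_alg R) = range (cls R)"
    by (auto simp: quot_alg_def FactRing_def A_RCOSETS_def' cls_def)
  show "\<one>\<^bsub>quot_alg R\<^esub> = cls R 1" by (simp add: quot_alg_def FactRing_def cls_def)
  show "\<zero>\<^bsub>quot_alg R\<^esub> = cls R 0"
    by (auto simp: quot_alg_def FactRing_def mem_cls Idl_ideal_span)
qed

lemma ring_quot: "ring (quot_alg R)"
proof (rule ringI)
  show "abelian_group (quot_alg R)"
  proof (rule abelian_groupI)
    fix X assume "X \<in> carrier (quot_alg R)"
    then obtain x where "X = cls R x" by (auto simp: quot_simps)
    then show "\<exists>Y\<in>carrier (quot_alg R). Y \<oplus>\<^bsub>quot_alg R\<^esub> X = \<zero>\<^bsub>quot_alg R\<^esub>"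
      by (intro bexI[of _ "cls R (- x)"]) (auto simp: quot_simps)
  qed (auto simp: quot_simps ac_simps)
  show "monoid (quot_alg R)"
    by (rule monoidI) (auto simp: quot_simps mult.assoc)
qed (auto simp: quot_simps algebra_simps)

lemma finsum_cls: "finite S \<Longrightarrow> (\<Oplus>\<^bsub>quot_alg R\<^esub>i\<in>S. cls R (f i)) = cls R (\<Sum>i\<in>S. f i)"
proof (induction S rule: finite_induct)
  case empty
  interpret ring "quot_alg R" by (rule ring_quot)
  show ?case by (simp add: quot_simps)
next
  case (insert i S)
  interpret ring "quot_alg R" by (rule ring_quot)
  show ?case using insert by (simp add: finsum_insert quot_simps Pi_def)
qed

lemma cls_pow: "cls R x [^]\<^bsub>quot_alg R\<^esub> (n::nat) = cls R (x ^ n)"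
proof -
  interpret ring "quot_alg R" by (rule ring_quot)
  show ?thesis by (induction n) (auto simp: quot_simps power_commutes)
qed

text \<open>Representative in the free algebra of \<open>poly_eval\<close>, see
  \<open>poly_eval_cls\<close>; characters of the monoid evaluate it by
  \<open>lin_poly_lift\<close>.\<close>

definition poly_lift :: "complex poly \<Rightarrow> ('m::monoid_add \<Rightarrow>\<^sub>0 complex) \<Rightarrow> ('m \<Rightarrow>\<^sub>0 complex)" where
  "poly_lift P x = (\<Sum>k\<le>Polynomial.degree P. const (Polynomial.coeff P k) * x ^ k)"

lemma poly_eval_cls: "poly_eval (quot_alg R) P (cls R x) = cls R (poly_lift P x)"
  by (simp add: poly_eval_def poly_lift_def cls_pow quot_simps finsum_cls)

lemma lin_pow:
  assumes "\<And>u v. f (u + v) = f u * f v" "f 0 = 1"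
  shows "lin f (x ^ n) = lin f x ^ n"
proof (induction n)
  case 0
  then show ?case using assms(2) by (simp add: lin_single[of f 0 1, simplified])
qed (simp add: lin_mult[OF assms(1)])

lemma lin_poly_lift:
  assumes "\<And>u v. f (u + v) = f u * f v" "f 0 = 1"
  shows "lin f (poly_lift P x) = poly P (lin f x)"
  by (simp add: poly_lift_def lin_sum lin_const lin_pow[of f, OF assms] poly_altdef)

lemma hom_kills_ideal_span:
  assumes "\<Phi> \<in> ring_hom monoid_alg B" "ring B" "\<And>r. r \<in> R \<Longrightarrow> \<Phi> r = \<zero>\<^bsub>B\<^esub>" "x \<in> ideal_span R"
  shows "\<Phi> x = \<zero>\<^bsub>B\<^esub>"
  using assms(4)
proof induction
  interpret ring_hom_ring monoid_alg B \<Phi>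
    by (rule ring_hom_ringI2) (use assms ring_monoid_alg in auto)
  case ideal_span_0
  show ?case using hom_zero by simp
next
  interpret ring_hom_ring monoid_alg B \<Phi>
    by (rule ring_hom_ringI2) (use assms ring_monoid_alg in auto)
  case (ideal_span_step x r a b)
  then show ?case using hom_add[of x "a * r * b"] hom_mult[of "a * r" b] hom_mult[of a r] assms(3)[of r]
      hom_closed[of a] hom_closed[of b] by simp
qed

text \<open>Resolves the \<open>THE\<close> in \<open>hom_on_gens\<close>: a homomorphism of the
  free algebra that kills the relators descends to the quotient, and a homomorphism out of the
  quotient is determined by its values on generators. It is used for the comultiplications, the
  counits, the torus characters and the representations.\<close>

lemma hom_on_gens_cls:
  assumes B: "ring B" and hom: "\<Phi> \<in> ring_hom monoid_alg B"
    and sm: "\<And>c x. \<Phi> (const c * x) = c \<odot>\<^bsub>B\<^esub> \<Phi> x"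
    and rel: "\<And>r. r \<in> R \<Longrightarrow> \<Phi> r = \<zero>\<^bsub>B\<^esub>" and h: "\<And>g. \<Phi> (gen g) = h g"
  shows "hom_on_gens R B h (cls R x) = \<Phi> x"
proof -
  interpret ring_hom_ring monoid_alg B \<Phi>
    by (rule ring_hom_ringI2) (use assms ring_monoid_alg in auto)
  \<comment> \<open>The choice of representative is harmless because \<open>\<Phi>\<close> vanishes
    on the ideal.\<close>
  define f where "f = restrict (\<lambda>X. \<Phi> (SOME x. x \<in> X)) (carrier (quot_alg R))"
  have f: "f (cls R x) = \<Phi> x" for x
  proof -
    have "(SOME y. y \<in> cls R x) \<in> cls R x" using cls_self by (rule someI)
    then have "(SOME y. y \<in> cls R x) - x \<in> ideal_span R" by (simp add: mem_cls)
    then have "\<Phi> ((SOME y. y \<in> cls R x) - x) = \<zero>\<^bsub>B\<^esub>"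
      using hom_kills_ideal_span[OF hom B rel] by blast
    then have "\<Phi> (SOME y. y \<in> cls R x) = \<Phi> x"
      using hom_add[of "(SOME y. y \<in> cls R x) - x" x] hom_closed[of x] by simp
    then show ?thesis by (simp add: f_def quot_simps)
  qed
  have "hom_on_gens R B h = f"
    unfolding hom_on_gens_def
  proof (rule the_equality, intro conjI allI)
    show "f \<in> extensional (carrier (quot_alg R))" by (simp add: f_def)
    have "f \<in> ring_hom (quot_alg R) B"
    proof (rule ring_hom_memI)
      fix x y assume "x \<in> carrier (quot_alg R)" "y \<in> carrier (quot_alg R)"
      then obtain x' y' where "x = cls R x'" "y = cls R y'" by (auto simp: quot_simps)
      then show "f (x \<otimes>\<^bsub>quot_alg R\<^esub> y) = f x \<otimes>\<^bsub>B\<^esub> f y" "f x \<in> carrier B"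
         "f (x \<oplus>\<^bsub>quot_alg R\<^esub> y) = f x \<oplus>\<^bsub>B\<^esub> f y"
        using hom_mult[of x' y'] hom_add[of x' y'] hom_closed[of x'] by (auto simp: quot_simps f)
    qed (use hom_one in \<open>simp add: quot_simps f\<close>)
    then show "f \<in> alg_hom (quot_alg R) B"
      by (auto simp: alg_hom_def quot_simps f sm)
    show "f (cls R (gen g)) = h g" for g by (simp add: f h)
  next
    fix g assume g: "g \<in> extensional (carrier (quot_alg R)) \<and>
      g \<in> alg_hom (quot_alg R) B \<and> (\<forall>x. g (cls R (gen x)) = h x)"
    then have gr: "g \<in> ring_hom (quot_alg R) B"
      and gs: "g (cls R (const c * x)) = c \<odot>\<^bsub>B\<^esub> g (cls R x)" for c x
      by (auto simp: alg_hom_def quot_simps)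
    have g1: "g (cls R 1) = \<one>\<^bsub>B\<^esub>" using ring_hom_one[OF gr] by (simp add: quot_simps)
    have gm: "g (cls R (x * y)) = g (cls R x) \<otimes>\<^bsub>B\<^esub> g (cls R y)" for x y
      using ring_hom_mult[OF gr, of "cls R x" "cls R y"] by (simp add: quot_simps)
    have ga: "g (cls R (x + y)) = g (cls R x) \<oplus>\<^bsub>B\<^esub> g (cls R y)" for x y
      using ring_hom_add[OF gr, of "cls R x" "cls R y"] by (simp add: quot_simps)
    \<comment> \<open>Uniqueness: a word is a product of generators, so any competitor agrees with
      \<open>\<Phi>\<close> on words and hence on linear combinations.\<close>
    have w: "g (cls R (Poly_Mapping.single (Word w) 1)) = \<Phi> (Poly_Mapping.single (Word w) 1)" for w
    proof (induction w)
      case Nil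
      show ?case using g1 hom_one by (simp flip: zero_word_def)
    next
      case (Cons a w)
      have "Poly_Mapping.single (Word (a # w)) 1 = gen a * Poly_Mapping.single (Word w) (1::complex)"
        by (simp add: gen_def mult_single)
      then show ?case using Cons g h hom_mult[of "gen a"] by (simp add: gm)
    qed
    have "g (cls R x) = \<Phi> x" for x
    proof (induction x rule: pm_induct)
      case (1 w c)
      obtain l where "w = Word l" by (cases w)
      moreover have "Poly_Mapping.single w c = const c * Poly_Mapping.single w 1"
        by (simp add: const_single)
      ultimately show ?case using w[of l] by (metis gs sm)
    next
      case (2 x y)
      then show ?case using hom_add[of x y] by (simp add: ga)
    qed
    then have "g X = f X" if "X \<in> carrier (quot_alg R)" for X
      using that by (auto simp: quot_simps f)
    moreover have "f \<in> extensional (carrier (quot_alg R))" by (simp add: f_def)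
    ultimately show "g = f"
      using g by (intro extensionalityI[of g "carrier (quot_alg R)" f]) auto
  qed
  then show ?thesis by (simp add: f)
qed

section \<open>Tensor products, computed on representatives\<close>

text \<open>As an iterated linear extension, \<open>free_tens\<close> inherits bilinearity from
  \<open>lmap\<close>; the double sum over supports in its definition does not show it.\<close>

lemma free_tens_lmap:
  fixes x :: "'m::monoid_add \<Rightarrow>\<^sub>0 complex" and y :: "'n::monoid_add \<Rightarrow>\<^sub>0 complex"
  shows "free_tens x y = lmap (\<lambda>u. lmap (\<lambda>v. Poly_Mapping.single (u, v) 1) y) x"
  unfolding free_tens_def lmap_def by (simp add: const_single sum_distrib_left)

lemma free_tens_single:
  fixes u :: "'m::monoid_add" and v :: "'n::monoid_add"
  shows "free_tens (Poly_Mapping.single u c) (Poly_Mapping.single v d) = Poly_Mapping.single (u, v) (c * d)"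
  by (simp add: free_tens_lmap lmap_single const_single)

lemma free_tens_add_l:
  fixes x y :: "'m::monoid_add \<Rightarrow>\<^sub>0 complex" and z :: "'n::monoid_add \<Rightarrow>\<^sub>0 complex"
  shows "free_tens (x + y) z = free_tens x z + free_tens y z"
  by (simp add: free_tens_lmap lmap_add)

lemma free_tens_add_r:
  fixes x y :: "'m::monoid_add \<Rightarrow>\<^sub>0 complex" and z :: "'n::monoid_add \<Rightarrow>\<^sub>0 complex"
  shows "free_tens z (x + y) = free_tens z x + free_tens z y"
proof (induction z rule: pm_induct)
  case (1 w c)
  show ?case by (simp add: free_tens_lmap lmap_single lmap_add algebra_simps)
qed (simp add: free_tens_add_l algebra_simps)

lemma free_tens_diff_l:
  fixes x y :: "'m::monoid_add \<Rightarrow>\<^sub>0 complex" and z :: "'n::monoid_add \<Rightarrow>\<^sub>0 complex"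
  shows "free_tens (x - y) z = free_tens x z - free_tens y z"
  using free_tens_add_l[of "x - y" y z] by (simp add: algebra_simps)

lemma free_tens_diff_r:
  fixes x y :: "'m::monoid_add \<Rightarrow>\<^sub>0 complex" and z :: "'n::monoid_add \<Rightarrow>\<^sub>0 complex"
  shows "free_tens z (x - y) = free_tens z x - free_tens z y"
  using free_tens_add_r[of z "x - y" y] by (simp add: algebra_simps)

lemma free_tens_0_l [simp]: "free_tens 0 (y :: 'n::monoid_add \<Rightarrow>\<^sub>0 complex) = (0 :: 'm::monoid_add \<times> 'n \<Rightarrow>\<^sub>0 complex)"
  by (simp add: free_tens_lmap)

lemma free_tens_0_r [simp]: "free_tens (x :: 'm::monoid_add \<Rightarrow>\<^sub>0 complex) 0 = (0 :: 'm \<times> 'n::monoid_add \<Rightarrow>\<^sub>0 complex)"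
  by (simp add: free_tens_lmap lmap_def)

lemma free_tens_const_l: "free_tens (const c * x) y = const c * free_tens x y"
  by (simp add: free_tens_lmap lmap_const)

lemma free_tens_const_r: "free_tens x (const c * y) = const c * free_tens x y"
proof (induction x rule: pm_induct)
  case (1 w d)
  then show ?case
    by (simp add: free_tens_lmap lmap_single lmap_const mult.commute flip: mult.assoc const_mult)
qed (simp add: free_tens_add_l algebra_simps)

lemma free_tens_mult: "free_tens x y * free_tens x' y' = free_tens (x * x') (y * y')"
proof (induction x rule: pm_induct)
  case (1 u c)
  show ?case
  proof (induction y rule: pm_induct)
    case (1 v d)
    show ?case
    proof (induction x' rule: pm_induct)
      case (1 u' c')
      show ?case
        by (induction y' rule: pm_induct)
          (auto simp: free_tens_single mult_single free_tens_add_r algebra_simps)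
    qed (simp add: free_tens_add_l algebra_simps)
  qed (simp add: free_tens_add_r algebra_simps)
qed (simp add: free_tens_add_l algebra_simps)

lemma free_tens_1: "free_tens 1 1 = (1 :: ('m::monoid_add \<times> 'n::monoid_add) \<Rightarrow>\<^sub>0 complex)"
proof -
  have "free_tens (Poly_Mapping.single (0::'m) 1) (Poly_Mapping.single (0::'n) 1) = Poly_Mapping.single 0 1"
    unfolding free_tens_single by (simp add: zero_prod_def)
  then show ?thesis by simp
qed

lemma lin_free_tens:
  fixes f :: "'m::monoid_add \<Rightarrow> complex" and g :: "'n::monoid_add \<Rightarrow> complex"
  shows "lin (\<lambda>(u, v). f u * g v) (free_tens x y) = lin f x * lin g y"
proof (induction x rule: pm_induct)
  case (1 u c)
  show ?case
    by (induction y rule: pm_induct) (auto simp: free_tens_single free_tens_add_r lin_add algebra_simps)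
qed (simp add: free_tens_add_l lin_add algebra_simps)

text \<open>A term \<open>a * r * b\<close> tensored with \<open>y\<close> factors as (a tensor y)(r
  tensor 1)(b tensor 1), with a relator of the tensor product in the middle.\<close>

lemma free_tens_ideal_span_l: "i \<in> ideal_span R \<Longrightarrow> free_tens i y \<in> ideal_span (tens_rels R S)"
proof (induction rule: ideal_span.induct)
  case ideal_span_0
  then show ?case by (simp add: ideal_span.ideal_span_0)
next
  case (ideal_span_step x r a b)
  have "free_tens (a * r * b) y = free_tens a y * free_tens r 1 * free_tens b 1"
    by (simp add: free_tens_mult)
  moreover have "free_tens r 1 \<in> tens_rels R S" using ideal_span_step by (simp add: tens_rels_def)
  ultimately show ?case using ideal_span_step by (simp add: free_tens_add_l ideal_span.ideal_span_step)
qed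

lemma free_tens_ideal_span_r: "i \<in> ideal_span S \<Longrightarrow> free_tens y i \<in> ideal_span (tens_rels R S)"
proof (induction rule: ideal_span.induct)
  case ideal_span_0
  then show ?case by (simp add: ideal_span.ideal_span_0)
next
  case (ideal_span_step x r a b)
  have "free_tens y (a * r * b) = free_tens y a * free_tens 1 r * free_tens 1 b"
    by (simp add: free_tens_mult)
  moreover have "free_tens 1 r \<in> tens_rels R S" using ideal_span_step by (simp add: tens_rels_def)
  ultimately show ?case using ideal_span_step by (simp add: free_tens_add_r ideal_span.ideal_span_step)
qed

text \<open>Changing both representatives alters the pure tensor by an ideal element in the first
  factor plus one in the second, so the union in \<open>tens\<close> is over a constant
  family.\<close>

lemma tens_cls: "tens R S (cls R x) (cls S y) = cls (tens_rels R S) (free_tens x y)"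
proof -
  have *: "cls (tens_rels R S) (free_tens x' y') = cls (tens_rels R S) (free_tens x y)"
    if "x' \<in> cls R x" "y' \<in> cls S y" for x' y'
  proof -
    have "free_tens x' y' - free_tens x y = free_tens (x' - x) y' + free_tens x (y' - y)"
      by (simp add: free_tens_diff_l free_tens_diff_r)
    then show ?thesis using that
      by (simp add: cls_eq mem_cls ideal_span_add free_tens_ideal_span_l free_tens_ideal_span_r)
  qed
  have "tens R S (cls R x) (cls S y) = (\<Union>x'\<in>cls R x. \<Union>y'\<in>cls S y. cls (tens_rels R S) (free_tens x y))"
    unfolding tens_def by (intro SUP_cong refl *)
  also have "\<dots> = cls (tens_rels R S) (free_tens x y)"
    using cls_self[of x R] cls_self[of y S] by (metis UN_constant empty_iff)
  finally show ?thesis .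
qed

lemma additive_ideal_span_0:
  assumes "\<And>x y. L (x + y) = L x + (L y :: 'c::ab_group_add)" "\<And>a r b. r \<in> R \<Longrightarrow> L (a * r * b) = 0"
    and "x \<in> ideal_span R"
  shows "L x = 0"
  using assms(3)
proof induction
  case ideal_span_0
  then show ?case using assms(1)[of 0 0] by simp
qed (simp add: assms)

text \<open>Multiplying a relator by monomials on both sides leaves a pure tensor with an ideal
  element in one factor, and there \<open>f\<close> or \<open>g\<close> gives 0.\<close>

lemma lin_tens_kills:
  assumes f: "\<And>x. x \<in> ideal_span R \<Longrightarrow> lin f x = 0" and g: "\<And>x. x \<in> ideal_span S \<Longrightarrow> lin g x = 0"
    and t: "t \<in> ideal_span (tens_rels R S)"
  shows "lin (\<lambda>(u, v). f u * g v) t = 0"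
proof (rule additive_ideal_span_0[OF _ _ t])
  fix a r b assume r: "r \<in> tens_rels R S"
  show "lin (\<lambda>(u, v). f u * g v) (a * r * b) = 0"
  proof (induction a rule: pm_induct)
    case (1 w c)
    show ?case
    proof (induction b rule: pm_induct)
      case (1 w' c')
      \<comment> \<open>A monomial of the tensor algebra is itself a pure tensor; its coefficient is
        put into the first factor.\<close>
      obtain u v where w: "Poly_Mapping.single w c = free_tens (Poly_Mapping.single u c) (Poly_Mapping.single v 1)"
        by (cases w) (auto simp: free_tens_single)
      obtain u' v' where w': "Poly_Mapping.single w' c' = free_tens (Poly_Mapping.single u' c') (Poly_Mapping.single v' 1)"
        by (cases w') (auto simp: free_tens_single)
      from r consider r1 where "r1 \<in> R" "r = free_tens r1 1" | r2 where "r2 \<in> S" "r = free_tens 1 r2"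
        by (auto simp: tens_rels_def)
      then show ?case
      proof cases
        case 1
        then show ?thesis
          using f[OF ideal_span_mult[OF ideal_span_gen, of r1 R "Poly_Mapping.single u c" "Poly_Mapping.single u' c'"]]
          by (simp add: w w' free_tens_mult lin_free_tens)
      next
        case 2
        then show ?thesis
          using g[OF ideal_span_mult[OF ideal_span_gen, of r2 S "Poly_Mapping.single v 1" "Poly_Mapping.single v' 1"]]
          by (simp add: w w' free_tens_mult lin_free_tens)
      qed
    qed (simp add: lin_add distrib_left distrib_right)
  qed (simp add: lin_add distrib_left distrib_right)
qed (simp add: lin_add)

lemma tens_functional_cls:
  assumes f: "\<And>x. f (cls R x) = lin f' x" and g: "\<And>x. g (cls S x) = lin g' x"
  shows "tens_functional R S f g (cls (tens_rels R S) t) = lin (\<lambda>(u, v). f' u * g' v) t"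
proof -
  \<comment> \<open>\<open>f'\<close> vanishes on the ideal because its values depend on the class
    only; this is what makes the image inside \<open>the_elem\<close> a singleton.\<close>
  have kf: "lin f' x = 0" if "x \<in> ideal_span R" for x
    using that f[of x] f[of 0] by (metis cls_eq diff_zero lin_0)
  have kg: "lin g' x = 0" if "x \<in> ideal_span S" for x
    using that g[of x] g[of 0] by (metis cls_eq diff_zero lin_0)
  have "(\<Sum>(u, v)\<in>Poly_Mapping.keys t'. Poly_Mapping.lookup t' (u, v) *
     f (cls R (Poly_Mapping.single u 1)) * g (cls S (Poly_Mapping.single v 1))) = lin (\<lambda>(u, v). f' u * g' v) t'" for t'
    by (auto simp: lin_def f g mult.assoc case_prod_unfold intro!: sum.cong)
  moreover have "lin (\<lambda>(u, v). f' u * g' v) t' = lin (\<lambda>(u, v). f' u * g' v) t"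
    if "t' \<in> cls (tens_rels R S) t" for t'
  proof -
    have "lin (\<lambda>(u, v). f' u * g' v) (t' - t) = 0"
      by (rule lin_tens_kills[where R = R and S = S]) (use kf kg that in \<open>auto simp: mem_cls\<close>)
    then show ?thesis by (simp add: lin_diff)
  qed
  ultimately have "(\<lambda>t. \<Sum>(u, v)\<in>Poly_Mapping.keys t. Poly_Mapping.lookup t (u, v) *
     f (cls R (Poly_Mapping.single u 1)) * g (cls S (Poly_Mapping.single v 1))) ` cls (tens_rels R S) t
     = (\<lambda>t'. lin (\<lambda>(u, v). f' u * g' v) t) ` cls (tens_rels R S) t"
    by (intro image_cong refl) presburger
  also have "\<dots> = {lin (\<lambda>(u, v). f' u * g' v) t}"
    using cls_self[of t "tens_rels R S"] by blast
  finally have "(\<lambda>t. \<Sum>(u, v)\<in>Poly_Mapping.keys t. Poly_Mapping.lookup t (u, v) *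
     f (cls R (Poly_Mapping.single u 1)) * g (cls S (Poly_Mapping.single v 1))) ` cls (tens_rels R S) t
     = {lin (\<lambda>(u, v). f' u * g' v) t}" .
  then show ?thesis by (simp add: tens_functional_def)
qed

lemma lmap_tens_kills:
  fixes R :: "('m::monoid_add \<Rightarrow>\<^sub>0 complex) set" and S :: "('n::monoid_add \<Rightarrow>\<^sub>0 complex) set"
  assumes g: "\<And>x. x \<in> ideal_span S \<Longrightarrow> lin g x = 0"
    and t: "t \<in> ideal_span (tens_rels R S)"
  shows "lmap (\<lambda>(u, v). const (g v) * Poly_Mapping.single u 1) t \<in> ideal_span R"
proof -
  define L where "L = lmap (\<lambda>(u, v). const (g v) * Poly_Mapping.single (u::'m) 1 :: 'm \<Rightarrow>\<^sub>0 complex)"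
  have L: "L (x + y) = L x + L y" for x y by (simp add: L_def lmap_add)
  have Ls: "L (Poly_Mapping.single (u, v) c) = Poly_Mapping.single u (c * g v)" for u v c
    by (simp add: L_def lmap_single const_single)
  \<comment> \<open>On pure tensors \<open>L\<close> is the identity tensor \<open>g\<close>. A
    relator from \<open>R\<close> therefore stays in the ideal of \<open>R\<close>, and a relator
    from \<open>S\<close> is sent to 0.\<close>
  have ft: "L (free_tens x y) = const (lin g y) * x" for x y
  proof (induction x rule: pm_induct)
    case (1 u c)
    show ?case
      by (induction y rule: pm_induct)
        (auto simp: free_tens_single free_tens_add_r L Ls lin_add single_add
          const_single algebra_simps)
  qed (simp add: free_tens_add_l L algebra_simps)
  have step: "L (a * r * b) \<in> ideal_span R" if r: "r \<in> tens_rels R S" for a r b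
  proof (induction a rule: pm_induct)
    case (1 w c)
    show ?case
    proof (induction b rule: pm_induct)
      case (1 w' c')
      obtain u v where w: "Poly_Mapping.single w c = free_tens (Poly_Mapping.single u c) (Poly_Mapping.single v 1)"
        by (cases w) (auto simp: free_tens_single)
      obtain u' v' where w': "Poly_Mapping.single w' c' = free_tens (Poly_Mapping.single u' c') (Poly_Mapping.single v' 1)"
        by (cases w') (auto simp: free_tens_single)
      from r consider r1 where "r1 \<in> R" "r = free_tens r1 1" | r2 where "r2 \<in> S" "r = free_tens 1 r2"
        by (auto simp: tens_rels_def)
      then show ?case
      proof cases
        case 1
        then show ?thesis
          by (simp add: w w' free_tens_mult ft ideal_span_mult ideal_span_multl ideal_span_gen)
      next
        case 2
        then show ?thesis
          using g[OF ideal_span_mult[OF ideal_span_gen, of r2 S "Poly_Mapping.single v 1" "Poly_Mapping.single v' 1"]]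
          by (simp add: w w' free_tens_mult ft ideal_span_0)
      qed
    qed (simp add: L algebra_simps ideal_span_add)
  qed (simp add: L algebra_simps ideal_span_add)
  have "L t \<in> ideal_span R" using t
    by induction (auto simp: L ideal_span_add ideal_span_0 step, simp add: L_def ideal_span_0)
  then show ?thesis by (simp add: L_def)
qed

lemma id_tens_cls:
  assumes g: "\<And>x. g (cls S x) = lin g' x"
  shows "id_tens R S g (cls (tens_rels R S) t) = cls R (lmap (\<lambda>(u, v). const (g' v) * Poly_Mapping.single u 1) t)"
proof -
  have kg: "lin g' x = 0" if "x \<in> ideal_span S" for x
    using that g[of x] g[of 0] by (metis cls_eq diff_zero lin_0)
  have h1: "(\<Sum>(u, v)\<in>Poly_Mapping.keys t'. Poly_Mapping.single u (Poly_Mapping.lookup t' (u, v) *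
      g (cls S (Poly_Mapping.single v 1)))) = lmap (\<lambda>(u, v). const (g' v) * Poly_Mapping.single u 1) t'" for t'
    by (auto simp: lmap_def g const_single case_prod_unfold intro!: sum.cong)
  have h2: "cls R (lmap (\<lambda>(u, v). const (g' v) * Poly_Mapping.single u 1) t') =
      cls R (lmap (\<lambda>(u, v). const (g' v) * Poly_Mapping.single u 1) t)"
    if "t' \<in> cls (tens_rels R S) t" for t'
  proof -
    have "lmap (\<lambda>(u, v). const (g' v) * Poly_Mapping.single u 1) (t' - t) \<in> ideal_span R"
      by (rule lmap_tens_kills[where S = S]) (use kg that in \<open>auto simp: mem_cls\<close>)
    then show ?thesis by (simp add: cls_eq lmap_diff)
  qed
  have "id_tens R S g (cls (tens_rels R S) t) = (\<Union>t'\<in>cls (tens_rels R S) t.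
      cls R (lmap (\<lambda>(u, v). const (g' v) * Poly_Mapping.single u 1) t))"
    unfolding id_tens_def by (intro SUP_cong refl) (simp only: h1 h2)
  also have "\<dots> = cls R (lmap (\<lambda>(u, v). const (g' v) * Poly_Mapping.single u 1) t)"
    using cls_self[of t "tens_rels R S"] by (metis UN_constant empty_iff)
  finally show ?thesis .
qed

section \<open>Sums over the comultiplication of a word\<close>

text \<open>The Sweedler sum of a word: \<open>f\<close> summed over the two tensor factors of the
  coproduct, where \<open>cm\<close> lists the coproduct of each generator. It avoids explicit
  tensors and needs only a commutative monoid as target.\<close>

fun sw :: "('g \<Rightarrow> ('g \<times> 'g) list) \<Rightarrow> 'g list \<Rightarrow> ('g list \<Rightarrow> 'g list \<Rightarrow> 'b::comm_monoid_add) \<Rightarrow> 'b" where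
  "sw cm [] f = f [] []"
| "sw cm (g # w) f = (\<Sum>(a, b)\<leftarrow>cm g. sw cm w (\<lambda>u v. f (a # u) (b # v)))"

primrec unw :: "'g word \<Rightarrow> 'g list" where "unw (Word w) = w"

lemma unw_add: "unw (u + v) = unw u @ unw v" by (cases u; cases v) simp
lemma unw_0 [simp]: "unw 0 = []" by (simp add: zero_word_def)

lemma sw_add: "sw cm w (\<lambda>u v. f u v + g u v) = sw cm w f + sw cm w g"
  by (induction w arbitrary: f g) (auto simp: sum_list_addf case_prod_unfold)

lemma sw_0 [simp]: "sw cm w (\<lambda>u v. 0) = 0"
  by (induction w) (auto simp: case_prod_unfold)

text \<open>Generators have coproducts in pairs of generators, so both tensor factors of a word keep
  its length. Inductions on the length of words rely on this.\<close>

lemma sw_cong_len: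
  "(\<And>u v. length u = length w \<Longrightarrow> length v = length w \<Longrightarrow> f u v = g u v) \<Longrightarrow> sw cm w f = sw cm w g"
proof (induction w arbitrary: f g)
  case (Cons a w)
  have "sw cm w (\<lambda>u v. f (x # u) (y # v)) = sw cm w (\<lambda>u v. g (x # u) (y # v))" for x y
    by (rule Cons.IH) (simp add: Cons.prems)
  then show ?case by simp
qed simp

lemma sw_additive:
  assumes "h 0 = 0" "\<And>x y. h (x + y) = h x + h y"
  shows "h (sw cm w f) = sw cm w (\<lambda>u v. h (f u v))"
proof (induction w arbitrary: f)
  case (Cons g w)
  have "h (sum_list xs) = sum_list (map h xs)" for xs
    by (induction xs) (auto simp: assms)
  then show ?case by (simp add: Cons case_prod_unfold o_def)
qed simp

lemma sw_mult_l: "sw cm w (\<lambda>u v. c * f u v) = (c :: 'b::semiring_0) * sw cm w f"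
  by (rule sw_additive[where h = "\<lambda>x. c * x", symmetric]) (auto simp: algebra_simps)

lemma sw_mult_r: "sw cm w (\<lambda>u v. f u v * c) = sw cm w f * (c :: 'b::semiring_0)"
  by (rule sw_additive[where h = "\<lambda>x. x * c", symmetric]) (auto simp: algebra_simps)

lemma sw_sum_list: "sw cm w (\<lambda>u v. \<Sum>x\<leftarrow>xs. f x u v) = (\<Sum>x\<leftarrow>xs. sw cm w (f x))"
  by (induction xs) (auto simp: sw_add)

lemma sw_swap: "sw cm w (\<lambda>u v. sw cm' x (\<lambda>a b. f u v a b)) = sw cm' x (\<lambda>a b. sw cm w (\<lambda>u v. f u v a b))"
  by (induction w arbitrary: f) (auto simp: sw_sum_list case_prod_unfold)

lemma sw_append:
  "sw cm (w @ w') f = sw cm w (\<lambda>u v. sw cm w' (\<lambda>u' v'. f (u @ u') (v @ v')))"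
  by (induction w arbitrary: f) auto

text \<open>Coassociativity on generators suffices, since the coproduct of a word is formed letter
  by letter.\<close>

lemma sw_coassoc:
  fixes cm :: "'g \<Rightarrow> ('g \<times> 'g) list"
  assumes "\<And>g (f :: 'g \<Rightarrow> 'g \<Rightarrow> 'g \<Rightarrow> 'b::comm_monoid_add). (\<Sum>(a, b)\<leftarrow>cm g. \<Sum>(c, d)\<leftarrow>cm a. f c d b) = (\<Sum>(a, b)\<leftarrow>cm g. \<Sum>(c, d)\<leftarrow>cm b. f a c d)"
  shows "sw cm w (\<lambda>u v. sw cm u (\<lambda>a b. f a b v)) = sw cm w (\<lambda>u v. sw cm v (\<lambda>b c. (f u b c :: 'b)))"
proof (induction w arbitrary: f)
  case (Cons g w)
  show ?case
    by (simp add: sw_sum_list case_prod_unfold Cons[unfolded case_prod_unfold]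
        assms[of "\<lambda>a b c. sw cm w (\<lambda>u v. sw cm v (\<lambda>b' c'. f (a # u) (b # b') (c # c')))" g, unfolded case_prod_unfold])
qed simp

lemma sw_counit_l:
  fixes cm :: "'g \<Rightarrow> ('g \<times> 'g) list"
  assumes "\<And>g (f :: 'g \<Rightarrow> 'b::semiring_1). (\<Sum>(a, b)\<leftarrow>cm g. e a * f b) = f g"
  shows "sw cm w (\<lambda>u v. prod_list (map e u) * f v) = (f w :: 'b)"
proof (induction w arbitrary: f)
  case (Cons g w)
  then show ?case
    using assms[of "\<lambda>b. f (b # w)" g] by (simp add: mult.assoc sw_mult_l case_prod_unfold)
qed simp

lemma sw_counit_r:
  fixes cm :: "'g \<Rightarrow> ('g \<times> 'g) list"
  assumes "\<And>g (f :: 'g \<Rightarrow> 'b::comm_semiring_1). (\<Sum>(a, b)\<leftarrow>cm g. f a * e b) = f g"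
  shows "sw cm w (\<lambda>u v. f u * prod_list (map e v)) = (f w :: 'b)"
proof (induction w arbitrary: f)
  case (Cons g w)
  have "sw cm w (\<lambda>u v. f (a # u) * (e b * prod_list (map e v))) = f (a # w) * e b" for a b
    using sw_mult_r[of cm w "\<lambda>u v. f (a # u) * prod_list (map e v)" "e b"] Cons[of "\<lambda>u. f (a # u)"]
    by (simp add: ac_simps)
  then show ?case
    using assms[of "\<lambda>b. f (b # w)" g] by (simp add: case_prod_unfold)
qed simp

lemma lin_sw: "lin h (sw cm w f) = sw cm w (\<lambda>u v. lin h (f u v))"
  by (rule sw_additive) (auto simp: lin_add)

text \<open>The comultiplication lifted to the free algebra. It is an algebra homomorphism there,
  and descends to the quotients once it is known to map relators into the tensor ideal
  (\<open>comult_hom\<close>).\<close>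

definition dlt :: "('g \<Rightarrow> ('g \<times> 'g) list) \<Rightarrow> 'g falg \<Rightarrow> ('g word \<times> 'g word \<Rightarrow>\<^sub>0 complex)" where
  "dlt cm = lmap (\<lambda>w. sw cm (unw w) (\<lambda>u v. Poly_Mapping.single (Word u, Word v) 1))"

lemma lin_dlt: "lin h (dlt cm x) = lin (\<lambda>w. sw cm (unw w) (\<lambda>u v. h (Word u, Word v))) x"
  by (simp add: dlt_def lin_lmap lin_sw)

lemma dlt_mult: "dlt cm (x * y) = dlt cm x * dlt cm y"
  unfolding dlt_def
proof (rule lmap_mult)
  fix u v :: "'a word"
  show "sw cm (unw (u + v)) (\<lambda>u v. Poly_Mapping.single (Word u, Word v) (1::complex)) =
    sw cm (unw u) (\<lambda>u v. Poly_Mapping.single (Word u, Word v) 1) *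
    sw cm (unw v) (\<lambda>u v. Poly_Mapping.single (Word u, Word v) 1)"
    by (simp add: unw_add sw_append mult_single flip: sw_mult_l sw_mult_r) (rule sw_swap)
qed

lemma dlt_add: "dlt cm (x + y) = dlt cm x + dlt cm y" by (simp add: dlt_def lmap_add)
lemma dlt_diff: "dlt cm (x - y) = dlt cm x - dlt cm y" by (simp add: dlt_def lmap_diff)
lemma dlt_const: "dlt cm (const c * x) = const c * dlt cm x" by (simp add: dlt_def lmap_const)
lemma dlt_1: "dlt cm 1 = 1"
proof -
  have "dlt cm (Poly_Mapping.single 0 1) = Poly_Mapping.single 0 1"
    unfolding dlt_def lmap_single by (simp add: zero_prod_def zero_word_def)
  then show ?thesis by simp
qed
lemma dlt_gen: "dlt cm (gen g) = (\<Sum>(a, b)\<leftarrow>cm g. free_tens (gen a) (gen b))"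
  by (simp add: dlt_def gen_def lmap_single free_tens_single)

lemma comult_hom:
  assumes "\<And>r. r \<in> R \<Longrightarrow> dlt cm r \<in> ideal_span (tens_rels R R)"
    and "\<And>g. h g = cls (tens_rels R R) (\<Sum>(a, b)\<leftarrow>cm g. free_tens (gen a) (gen b))"
  shows "hom_on_gens R (tens_alg R R) h (cls R x) = cls (tens_rels R R) (dlt cm x)"
  unfolding tens_alg_def
proof (rule hom_on_gens_cls[where \<Phi> = "\<lambda>x. cls (tens_rels R R) (dlt cm x)"])
  show "(\<lambda>x. cls (tens_rels R R) (dlt cm x)) \<in> ring_hom monoid_alg (quot_alg (tens_rels R R))"
    by (rule ring_hom_memI) (auto simp: quot_simps dlt_mult dlt_add dlt_1)
qed (use assms in \<open>auto simp: ring_quot quot_simps dlt_const cls_eq dlt_gen\<close>)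

lemma char_hom:
  assumes "\<And>r. r \<in> R \<Longrightarrow> lin (\<lambda>w. prod_list (map h (unw w))) r = 0"
  shows "hom_on_gens R complex_alg h (cls R x) = lin (\<lambda>w. prod_list (map h (unw w))) x"
proof (rule hom_on_gens_cls)
  show "ring complex_alg"
    by (rule ringI; (rule abelian_groupI monoidI)?)
      (auto simp: complex_alg_def algebra_simps intro: exI[of _ "- x" for x])
  have "lin (\<lambda>w. prod_list (map h (unw w))) 1 = 1"
    using lin_single[of "\<lambda>w. prod_list (map h (unw w))" 0 1] by simp
  then show "lin (\<lambda>w. prod_list (map h (unw w))) \<in> ring_hom monoid_alg complex_alg"
    by (intro ring_hom_memI) (auto simp: complex_alg_def lin_add unw_add intro!: lin_mult)
qed (auto simp: complex_alg_def lin_const assms gen_def)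

text \<open>A form on words that is multiplicative in both arguments vanishes on the whole ideal as
  soon as it does so on relators against words of length at most 1. The hypotheses are symmetric
  under exchanging the two sides, so the lemma serves both algebras.\<close>

lemma pairing_kills:
  fixes P :: "'u list \<Rightarrow> 'a list \<Rightarrow> complex"
  assumes h1: "\<And>xs ys w. P (xs @ ys) w = sw cmA w (\<lambda>u v. P xs u * P ys v)"
    and h2: "\<And>xs w w'. P xs (w @ w') = sw cmU xs (\<lambda>x y. P x w * P y w')"
    and k0: "\<And>r. r \<in> R \<Longrightarrow> lin (\<lambda>w. P [] (unw w)) r = 0"
    and k1: "\<And>r x. r \<in> R \<Longrightarrow> lin (\<lambda>w. P [x] (unw w)) r = 0"
    and k2: "\<And>r. r \<in> R \<Longrightarrow> dlt cmA r \<in> ideal_span (tens_rels R R)"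
    and t: "t \<in> ideal_span R"
  shows "lin (\<lambda>w. P xs (unw w)) t = 0"
proof -
  \<comment> \<open>Pairing \<open>xs\<close> with \<open>a * r * b\<close> splits \<open>xs\<close>
    by its coproduct into three words of the same length as \<open>xs\<close>, the middle one facing
    \<open>r\<close>. Hence relators against words of that one length are enough.\<close>
  have suff: "lin (\<lambda>w. P xs (unw w)) t = 0"
    if z: "\<And>y r. length y = length xs \<Longrightarrow> r \<in> R \<Longrightarrow> lin (\<lambda>w. P y (unw w)) r = 0" and t: "t \<in> ideal_span R" for xs t
  proof (rule additive_ideal_span_0[OF _ _ t])
    fix a r b assume r: "r \<in> R"
    show "lin (\<lambda>w. P xs (unw w)) (a * r * b) = 0"
    proof (induction a rule: pm_induct)
      case (1 wa c)
      show ?case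
      proof (induction b rule: pm_induct)
        case (1 wb d)
        have "lin (\<lambda>w. P xs (unw w)) (Poly_Mapping.single wa c * x * Poly_Mapping.single wb d) =
           c * d * lin (\<lambda>w. P xs (unw wa @ unw w @ unw wb)) x" for x
          by (induction x rule: pm_induct) (auto simp: mult_single unw_add lin_add algebra_simps)
        also have "lin (\<lambda>w. P xs (unw wa @ unw w @ unw wb)) r =
           sw cmU xs (\<lambda>x y. sw cmU y (\<lambda>y z. P x (unw wa) * (lin (\<lambda>w. P y (unw w)) r * P z (unw wb))))"
          (is "lin ?f r = sw cmU xs ?g")
        proof -
          have "?f w = sw cmU xs (\<lambda>x y. sw cmU y (\<lambda>y z. P x (unw wa) * (P y (unw w) * P z (unw wb))))" for w
            by (simp add: h2 flip: sw_mult_l)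
          then have "lin ?f x = sw cmU xs (\<lambda>x' y. sw cmU y (\<lambda>y z. P x' (unw wa) * (lin (\<lambda>w. P y (unw w)) x * P z (unw wb))))" for x
            by (induction x rule: pm_induct) (auto simp: lin_add algebra_simps sw_add simp flip: sw_mult_l)
          then show ?thesis .
        qed
        also have "\<dots> = sw cmU xs (\<lambda>x y. sw cmU y (\<lambda>y z. 0))"
          by (intro sw_cong_len) (use z r in simp)
        finally show ?case by simp
      qed (simp add: lin_add algebra_simps)
    qed (simp add: lin_add algebra_simps)
  qed (simp add: lin_add)
  have one: "lin (\<lambda>w. P [x] (unw w)) t = 0" if "t \<in> ideal_span R" for x t
  proof (rule suff[OF _ that])
    fix y :: "'u list" and r assume "length y = length [x]" "r \<in> R"
    then show "lin (\<lambda>w. P y (unw w)) r = 0" using k1 by (auto simp: length_Suc_conv)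
  qed
  have "\<forall>xs t. length xs = n \<longrightarrow> t \<in> ideal_span R \<longrightarrow> lin (\<lambda>w. P xs (unw w)) t = 0" for n
  proof (induction n)
    case 0
    show ?case
    proof (intro allI impI)
      fix xs :: "'u list" and t assume "length xs = 0" and t: "t \<in> ideal_span R"
      then show "lin (\<lambda>w. P xs (unw w)) t = 0"
        by (intro suff[OF _ t]) (use k0 in auto)
    qed
  next
    case (Suc n)
    have "lin (\<lambda>w. P y (unw w)) r = 0" if y': "length y = Suc n" and r: "r \<in> R" for y r
    proof -
      \<comment> \<open>A longer word is split into its first letter and the rest. The coproduct of
        the relator lies in the tensor ideal, which is killed by the length-1 case in one factor and
        by the induction hypothesis in the other.\<close>
      obtain x ys where y: "y = x # ys" "length ys = n" using y' by (auto simp: length_Suc_conv)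
      define f g where "f = (\<lambda>w. P [x] (unw w))" and "g = (\<lambda>w. P ys (unw w))"
      have "lin (\<lambda>(u, v). f u * g v) (dlt cmA r) = lin (\<lambda>w. P y (unw w)) r"
        using h1[of "[x]" ys] by (simp add: lin_dlt f_def g_def y)
      moreover have "lin (\<lambda>(u, v). f u * g v) (dlt cmA r) = 0"
      proof (rule lin_tens_kills[OF _ _ k2[OF r]])
        show "lin f x = 0" if "x \<in> ideal_span R" for x using one[OF that] by (simp add: f_def)
        show "lin g x = 0" if "x \<in> ideal_span R" for x using Suc[rule_format, OF y(2) that] by (simp add: g_def)
      qed
      ultimately show ?thesis by simp
    qed
    note step = this
    show ?case
    proof (intro allI impI)
      fix xs :: "'u list" and t assume l: "length xs = Suc n" and t: "t \<in> ideal_span R"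
      show "lin (\<lambda>w. P xs (unw w)) t = 0"
        by (rule suff[OF step t]) (simp_all add: l)
    qed
  qed
  then show ?thesis using t by blast
qed

section \<open>The Hopf structures and the pairing on words\<close>

fun cmA :: "agen \<Rightarrow> (agen \<times> agen) list" where
  "cmA gen_alpha = [(gen_alpha, gen_alpha), (gen_beta, gen_gamma)]"
| "cmA gen_beta = [(gen_alpha, gen_beta), (gen_beta, gen_delta)]"
| "cmA gen_gamma = [(gen_gamma, gen_alpha), (gen_delta, gen_gamma)]"
| "cmA gen_delta = [(gen_gamma, gen_beta), (gen_delta, gen_delta)]"

fun cmU :: "ugen \<Rightarrow> (ugen \<times> ugen) list" where
  "cmU gen_A = [(gen_A, gen_A)]"
| "cmU gen_B = [(gen_A, gen_B), (gen_B, gen_D)]"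
| "cmU gen_C = [(gen_A, gen_C), (gen_C, gen_D)]"
| "cmU gen_D = [(gen_D, gen_D)]"

fun epA :: "agen \<Rightarrow> complex" where
  "epA gen_alpha = 1" | "epA gen_beta = 0" | "epA gen_gamma = 0" | "epA gen_delta = 1"

fun epU :: "ugen \<Rightarrow> complex" where
  "epU gen_A = 1" | "epU gen_B = 0" | "epU gen_C = 0" | "epU gen_D = 1"

lemma coassocA: "(\<Sum>(a, b)\<leftarrow>cmA g. \<Sum>(c, d)\<leftarrow>cmA a. f c d b) = (\<Sum>(a, b)\<leftarrow>cmA g. \<Sum>(c, d)\<leftarrow>cmA b. (f a c d :: 'b::comm_monoid_add))"
  by (cases g) (auto simp: ac_simps)

lemma counitA:
  "(\<Sum>(a, b)\<leftarrow>cmA g. epA a * f b) = f g" "(\<Sum>(a, b)\<leftarrow>cmA g. f a * epA b) = f g"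
  by (cases g; simp)+

lemma counitU:
  "(\<Sum>(a, b)\<leftarrow>cmU g. epU a * f b) = f g" "(\<Sum>(a, b)\<leftarrow>cmU g. f a * epU b) = f g"
  by (cases g; simp)+

text \<open>The pairing of one generator of the enveloping algebra with a word of the function
  algebra; \<open>pw\<close> then treats a word in the first argument. Both recursions are the
  duality axioms read as definitions, so on words no other value is possible.\<close>

primrec pg :: "real \<Rightarrow> ugen \<Rightarrow> agen list \<Rightarrow> complex" where
  "pg q x [] = epU x"
| "pg q x (g # w) = (\<Sum>(a, b)\<leftarrow>cmU x. gen_pairing q a g * pg q b w)"

primrec pw :: "real \<Rightarrow> ugen list \<Rightarrow> agen list \<Rightarrow> complex" where
  "pw q [] w = prod_list (map epA w)"
| "pw q (x # xs) w = sw cmA w (\<lambda>u v. pg q x u * pw q xs v)"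

lemma pw_single: "pw q [x] w = pg q x w"
  by (simp add: sw_counit_r[OF counitA(2)])

lemma pw_Nil2: "pw q xs [] = prod_list (map epU xs)"
  by (induction xs) auto

lemma pg_append: "pg q x (u @ v) = (\<Sum>(a, b)\<leftarrow>cmU x. pg q a u * pg q b v)"
proof (induction u arbitrary: x)
  case (Cons g u)
  then show ?case by (cases x) (simp_all add: algebra_simps)
qed (simp add: counitU)

lemma pw_append: "pw q (xs @ ys) w = sw cmA w (\<lambda>u v. pw q xs u * pw q ys v)"
proof (induction xs arbitrary: w)
  case Nil
  show ?case by (simp add: sw_counit_l[OF counitA(1)])
next
  case (Cons x xs)
  show ?case
    using sw_coassoc[OF coassocA, of w "\<lambda>a b c. pg q x a * pw q xs b * pw q ys c"]
    by (simp add: Cons mult.assoc flip: sw_mult_l sw_mult_r)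
qed

text \<open>The asymmetric recursion of \<open>pw\<close> makes multiplicativity in the first
  argument a matter of coassociativity, whereas here the coproducts of both words and of
  \<open>xs\<close> have to be interchanged.\<close>

lemma pw_append2: "pw q xs (w @ w') = sw cmU xs (\<lambda>x y. pw q x w * pw q y w')"
proof (induction xs arbitrary: w w')
  case (Cons x xs)
  have 1: "sw cmU xs (\<lambda>x' y'. sw cmA w (\<lambda>u v. pg q a u * pw q x' v) * sw cmA w' (\<lambda>u' v'. pg q b u' * pw q y' v'))
    = sw cmA w (\<lambda>u v. sw cmA w' (\<lambda>u' v'. (pg q a u * pg q b u') * sw cmU xs (\<lambda>x' y'. pw q x' v * pw q y' v')))" for a b
  proof -
    have "sw cmU xs (\<lambda>x' y'. sw cmA w (\<lambda>u v. pg q a u * pw q x' v) * sw cmA w' (\<lambda>u' v'. pg q b u' * pw q y' v'))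
      = sw cmU xs (\<lambda>x' y'. sw cmA w (\<lambda>u v. sw cmA w' (\<lambda>u' v'. (pg q a u * pg q b u') * (pw q x' v * pw q y' v'))))"
      by (simp add: ac_simps flip: sw_mult_l sw_mult_r)
    also have "\<dots> = sw cmA w (\<lambda>u v. sw cmU xs (\<lambda>x' y'. sw cmA w' (\<lambda>u' v'. (pg q a u * pg q b u') * (pw q x' v * pw q y' v'))))"
      by (rule sw_swap)
    also have "\<dots> = sw cmA w (\<lambda>u v. sw cmA w' (\<lambda>u' v'. sw cmU xs (\<lambda>x' y'. (pg q a u * pg q b u') * (pw q x' v * pw q y' v'))))"
      by (subst sw_swap) (rule refl)
    finally show ?thesis by (simp add: sw_mult_l)
  qed
  have "pw q (x # xs) (w @ w') = (\<Sum>p\<leftarrow>cmU x. sw cmA w (\<lambda>u v. sw cmA w' (\<lambda>u' v'. (pg q (fst p) u * pg q (snd p) u') *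
      sw cmU xs (\<lambda>x' y'. pw q x' v * pw q y' v'))))"
    by (simp add: sw_append pg_append Cons case_prod_unfold flip: sw_sum_list sum_list_mult_const)
  also have "\<dots> = sw cmU (x # xs) (\<lambda>x y. pw q x w * pw q y w')"
    by (simp add: 1 case_prod_unfold)
  finally show ?case .
qed simp

lemma const_const: "const a * (const b * x) = const (a * b) * x"
  by (simp add: const_mult mult.assoc)

lemma gen_mult: "gen a * gen b = Poly_Mapping.single (Word [a, b]) 1"
  by (simp add: gen_def mult_single)

lemma lin_1: "lin f 1 = f 0"
  using lin_single[of f 0 1] by simp

lemma dlt_const0: "dlt cm (const c) = const c"
  using dlt_const[of cm c 1] by (simp add: dlt_1)

lemma free_tens_const0: "free_tens x (const c) = const c * free_tens x 1"
  "free_tens (const c) y = const c * free_tens 1 y"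
  using free_tens_const_r[of x c 1] free_tens_const_l[of c 1 y] by simp_all

lemmas ft_simps = free_tens_const0 free_tens_add_l free_tens_add_r free_tens_diff_l free_tens_diff_r
  free_tens_const_l free_tens_const_r free_tens_1

lemmas ideal_span_intros = ideal_span_add ideal_span_diff ideal_span_multl[of _ _ "const c" for c] free_tens_ideal_span_l free_tens_ideal_span_r

context
  fixes q :: real
  assumes q: "0 < q" "q < 1"
begin

lemma dlt_Aq_rels:
  assumes "r \<in> Aq_rels q"
  shows "dlt cmA r \<in> ideal_span (tens_rels (Aq_rels q) (Aq_rels q))"
proof -
  define k where "k = complex_of_real q"
  have k: "k \<noteq> 0" "k * inverse k = 1" "inverse k * k = 1" using q by (auto simp: k_def)
  define a b c d where "a = gen gen_alpha" "b = gen gen_beta" "c = gen gen_gamma" "d = gen gen_delta"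
  note abcd = this
  have D: "dlt cmA a = free_tens a a + free_tens b c" "dlt cmA b = free_tens a b + free_tens b d"
     "dlt cmA c = free_tens c a + free_tens d c" "dlt cmA d = free_tens c b + free_tens d d"
    by (simp_all add: abcd dlt_gen)
  define r1 r2 r3 r4 r5 r6 r7 where r: "r1 = a * b - const k * (b * a)" "r2 = a * c - const k * (c * a)"
    "r3 = b * d - const k * (d * b)" "r4 = c * d - const k * (d * c)" "r5 = b * c - c * b"
    "r6 = a * d - const k * (b * c) - 1" "r7 = d * a - const (inverse k) * (b * c) - 1"
  have R: "Aq_rels q = {r1, r2, r3, r4, r5, r6, r7}"
    by (simp add: Aq_rels_def Let_def r abcd k_def mult.assoc)
  let ?I = "ideal_span (tens_rels (Aq_rels q) (Aq_rels q))"
  have t: "r1 \<in> ideal_span (Aq_rels q)" "r2 \<in> ideal_span (Aq_rels q)" "r3 \<in> ideal_span (Aq_rels q)" "r4 \<in> ideal_span (Aq_rels q)"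
    "r5 \<in> ideal_span (Aq_rels q)" "r6 \<in> ideal_span (Aq_rels q)" "r7 \<in> ideal_span (Aq_rels q)"
    by (auto simp: R intro: ideal_span_gen)
  note S = dlt_mult dlt_diff dlt_const dlt_const0 dlt_1 D ft_simps free_tens_mult distrib_left distrib_right
    left_diff_distrib right_diff_distrib const_const k mult.assoc
  \<comment> \<open>In each certificate every summand has a relator in one tensor factor. The
    combinations \<open>const k * r7 + r5\<close> and \<open>r6 + const k * r5\<close> are the two
    determinant relators with \<open>c * b\<close> in place of \<open>b * c\<close>.\<close>
  have "dlt cmA r1 = free_tens (a * a) r1 + free_tens (b * b) r4 + free_tens (a * b) r6
     - free_tens (b * a) (const k * r7 + r5) + free_tens r1 1"
    by (simp add: r S)
  moreover have "\<dots> \<in> ?I" by (intro ideal_span_intros t)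
  ultimately have 1: "dlt cmA r1 \<in> ?I" by simp
  have "dlt cmA r2 = free_tens r2 (a * a) + free_tens r3 (c * c) + free_tens (r6 + const k * r5) (a * c)
     - free_tens (const k * r7) (c * a) + free_tens 1 r2"
    by (simp add: r S)
  moreover have "\<dots> \<in> ?I" by (intro ideal_span_intros t)
  ultimately have 2: "dlt cmA r2 \<in> ?I" by simp
  have "dlt cmA r3 = free_tens r2 (b * b) + free_tens r3 (d * d) + free_tens (r6 + const k * r5) (b * d)
     - free_tens (const k * r7) (d * b) + free_tens 1 r3"
    by (simp add: r S)
  moreover have "\<dots> \<in> ?I" by (intro ideal_span_intros t)
  ultimately have 3: "dlt cmA r3 \<in> ?I" by simp
  have "dlt cmA r4 = free_tens (c * c) r1 + free_tens (d * d) r4 + free_tens (c * d) r6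
     - free_tens (d * c) (const k * r7 + r5) + free_tens r4 1"
    by (simp add: r S)
  moreover have "\<dots> \<in> ?I" by (intro ideal_span_intros t)
  ultimately have 4: "dlt cmA r4 \<in> ?I" by simp
  have "dlt cmA r5 = free_tens r2 (b * a) - free_tens (c * a) r1 + free_tens r3 (d * c) - free_tens (d * b) r4
     + free_tens r6 (b * c) + free_tens (b * c) r7 - free_tens (c * b) r6 - free_tens r7 (c * b)
     + free_tens 1 r5 + free_tens r5 1 + const k * free_tens r5 (b * c) + const (inverse k) * free_tens (b * c) r5"
    by (simp add: r S)
  moreover have "\<dots> \<in> ?I" by (intro ideal_span_intros t)
  ultimately have 5: "dlt cmA r5 \<in> ?I" by simp
  have "dlt cmA r6 = free_tens (a * c) r1 + free_tens (b * d) r4 + free_tens (a * d) r6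
     - free_tens (b * c) (const k * r7 + r5) + free_tens r6 1"
    by (simp add: r S)
  moreover have "\<dots> \<in> ?I" by (intro ideal_span_intros t)
  ultimately have 6: "dlt cmA r6 \<in> ?I" by simp
  have "dlt cmA r7 = free_tens r7 (d * a) - const (inverse k) * free_tens r2 (b * a)
     - const (inverse k) * free_tens r3 (d * c) - const (inverse k) * free_tens r6 (b * c) - free_tens r5 (b * c)
     + free_tens 1 r7"
    by (simp add: r S)
  moreover have "\<dots> \<in> ?I" by (intro ideal_span_intros t)
  ultimately have 7: "dlt cmA r7 \<in> ?I" by simp
  show ?thesis using assms 1 2 3 4 5 6 7 unfolding R by blast
qed

lemma dlt_Uq_rels:
  assumes "r \<in> Uq_rels q"
  shows "dlt cmU r \<in> ideal_span (tens_rels (Uq_rels q) (Uq_rels q))"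
proof -
  define k e where "k = complex_of_real q" and "e = complex_of_real (inverse (q - inverse q))"
  have k: "k \<noteq> 0" "k * inverse k = 1" "inverse k * k = 1" "k * (inverse k * x) = x" "inverse k * (k * x) = x" for x
    using q by (auto simp: k_def)
  define a b c d where "a = gen gen_A" "b = gen gen_B" "c = gen gen_C" "d = gen gen_D"
  note abcd = this
  have D: "dlt cmU a = free_tens a a" "dlt cmU b = free_tens a b + free_tens b d"
     "dlt cmU c = free_tens a c + free_tens c d" "dlt cmU d = free_tens d d"
    by (simp_all add: abcd dlt_gen)
  define r1 r2 r3 r4 r5 where r: "r1 = a * d - 1" "r2 = d * a - 1" "r3 = a * b - const k * (b * a)"
    "r4 = a * c - const (inverse k) * (c * a)" "r5 = b * c - c * b - const e * (a * a - d * d)"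
  have R: "Uq_rels q = {r1, r2, r3, r4, r5}"
    by (simp add: Uq_rels_def Let_def r abcd k_def e_def mult.assoc power2_eq_square)
  let ?I = "ideal_span (tens_rels (Uq_rels q) (Uq_rels q))"
  have t: "r1 \<in> ideal_span (Uq_rels q)" "r2 \<in> ideal_span (Uq_rels q)" "r3 \<in> ideal_span (Uq_rels q)" "r4 \<in> ideal_span (Uq_rels q)"
    "r5 \<in> ideal_span (Uq_rels q)"
    by (auto simp: R intro: ideal_span_gen)
  note S = dlt_mult dlt_diff dlt_const dlt_const0 dlt_1 D ft_simps free_tens_mult distrib_left distrib_right
    left_diff_distrib right_diff_distrib const_const k mult.assoc const_comm[of "_ :: ugen falg"]
  \<comment> \<open>The commutation of B and C with D is not among the relators; it follows from
    that with A by multiplying with D on both sides. The coproduct of the commutator relator needs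
    it in its cross terms.\<close>
  define bd cd where "bd = d * r3 * d - r2 * (b * d) + const k * (d * b * r1)"
    and "cd = d * r4 * d - r2 * (c * d) + const (inverse k) * (d * c * r1)"
  have t': "bd \<in> ideal_span (Uq_rels q)" "cd \<in> ideal_span (Uq_rels q)"
    unfolding bd_def cd_def by (intro ideal_span_add ideal_span_diff ideal_span_multl ideal_span_multr t)+
  have dk: "d * (const z * x) = const z * (d * x)" for z x
    using const_comm[of d z] by (metis mult.assoc)
  have bd: "bd = b * d - const k * (d * b)" and cd: "cd = c * d - const (inverse k) * (d * c)"
    by (simp_all add: bd_def cd_def r algebra_simps dk)
  note S = dlt_mult dlt_diff dlt_const dlt_const0 dlt_1 D ft_simps free_tens_mult distrib_left distrib_right
    left_diff_distrib right_diff_distrib const_const k mult.assoc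
  have "dlt cmU r1 = free_tens r1 (a * d) + free_tens 1 r1" by (simp add: r S)
  moreover have "\<dots> \<in> ?I" by (intro ideal_span_intros t)
  ultimately have 1: "dlt cmU r1 \<in> ?I" by simp
  have "dlt cmU r2 = free_tens r2 (d * a) + free_tens 1 r2" by (simp add: r S)
  moreover have "\<dots> \<in> ?I" by (intro ideal_span_intros t)
  ultimately have 2: "dlt cmU r2 \<in> ?I" by simp
  have "dlt cmU r3 = free_tens (a * a) r3 + free_tens (a * b) r1 - const k * free_tens (b * a) r2 + free_tens r3 1"
    by (simp add: r S)
  moreover have "\<dots> \<in> ?I" by (intro ideal_span_intros t)
  ultimately have 3: "dlt cmU r3 \<in> ?I" by simp
  have "dlt cmU r4 = free_tens (a * a) r4 + free_tens (a * c) r1 - const (inverse k) * free_tens (c * a) r2 + free_tens r4 1"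
    by (simp add: r S)
  moreover have "\<dots> \<in> ?I" by (intro ideal_span_intros t)
  ultimately have 4: "dlt cmU r4 \<in> ?I" by simp
  have "dlt cmU r5 = free_tens (a * a) r5 + free_tens r5 (d * d) + free_tens r4 (b * d)
     + const (inverse k) * free_tens (c * a) bd - free_tens r3 (c * d) - const k * free_tens (b * a) cd"
    by (simp add: bd cd r S)
  moreover have "\<dots> \<in> ?I" by (intro ideal_span_intros t t')
  ultimately have 5: "dlt cmU r5 \<in> ?I" by simp
  show ?thesis using assms 1 2 3 4 5 unfolding R by blast
qed

lemma q_half: "complex_of_real (q powr (1/2)) * complex_of_real (q powr (1/2)) = complex_of_real q"
  "complex_of_real (q powr (-1/2)) = inverse (complex_of_real (q powr (1/2)))"
  "complex_of_real (q powr (1/2)) \<noteq> 0"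
  using q by (auto simp: powr_minus simp flip: of_real_mult powr_add)

lemma pw_kills_Aq:
  assumes "t \<in> ideal_span (Aq_rels q)"
  shows "lin (\<lambda>w. pw q xs (unw w)) t = 0"
proof (rule pairing_kills[OF pw_append pw_append2 _ _ dlt_Aq_rels assms])
  fix r x assume r: "r \<in> Aq_rels q"
  \<comment> \<open>With q written as the square of h, all pairings of generators are 0, 1, h or
    1/h, and the remaining checks are identities of Laurent polynomials.\<close>
  define h where "h = complex_of_real (q powr (1/2))"
  have h: "h \<noteq> 0" "complex_of_real (q powr (-1/2)) = inverse h"
    using q_half by (auto simp: h_def)
  have qq: "complex_of_real q = h * h"
    by (simp add: h_def q_half)
  have R: "r \<in> {gen gen_alpha * gen gen_beta - const (h * h) * (gen gen_beta * gen gen_alpha),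
     gen gen_alpha * gen gen_gamma - const (h * h) * (gen gen_gamma * gen gen_alpha),
     gen gen_beta * gen gen_delta - const (h * h) * (gen gen_delta * gen gen_beta),
     gen gen_gamma * gen gen_delta - const (h * h) * (gen gen_delta * gen gen_gamma),
     gen gen_beta * gen gen_gamma - gen gen_gamma * gen gen_beta,
     gen gen_alpha * gen gen_delta - const (h * h) * (gen gen_beta * gen gen_gamma) - 1,
     gen gen_delta * gen gen_alpha - const (inverse h * inverse h) * (gen gen_beta * gen gen_gamma) - 1}"
    using r by (simp add: Aq_rels_def Let_def qq mult.assoc)
  have p1: "gen_pairing q gen_A gen_alpha = h" "gen_pairing q gen_D gen_delta = h"
     "gen_pairing q gen_A gen_delta = inverse h" "gen_pairing q gen_D gen_alpha = inverse h"
    using h by (simp_all add: h_def)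
  note p2 = gen_pairing.simps(1-4)
  show "lin (\<lambda>w. pw q [] (unw w)) r = 0"
    using R by (auto simp: gen_mult lin_diff lin_const lin_1)
  show "lin (\<lambda>w. pw q [x] (unw w)) r = 0"
    using R h(1) unfolding pw_single
    by (cases x) (auto simp: p1 gen_mult lin_diff lin_const lin_1 simp del: p2)
qed

lemma pw_kills_Uq:
  assumes "t \<in> ideal_span (Uq_rels q)"
  shows "lin (\<lambda>x. pw q (unw x) w) t = 0"
proof (rule pairing_kills[OF pw_append2 pw_append _ _ dlt_Uq_rels assms])
  fix r g assume r: "r \<in> Uq_rels q"
  have qq: "complex_of_real q = complex_of_real (q powr (1/2)) * complex_of_real (q powr (1/2))"
    by (simp add: q_half)
  show "lin (\<lambda>x. pw q (unw x) []) r = 0"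
    using r by (auto simp: Uq_rels_def Let_def gen_mult mult.assoc lin_diff lin_const const_single lin_1 power2_eq_square)
  define h where "h = complex_of_real (q powr (1/2))"
  define e where "e = complex_of_real (inverse (q - inverse q))"
  have h: "h \<noteq> 0" "complex_of_real (q powr (-1/2)) = inverse h"
    using q_half by (auto simp: h_def)
  have "q * q < 1" using q by (metis mult_strict_mono mult.right_neutral less_eq_real_def zero_less_one)
  then have "q - inverse q \<noteq> 0" using q by (auto simp: field_simps)
  then have "inverse (q - inverse q) * (q - inverse q) = 1" by simp
  then have "e * (complex_of_real q - inverse (complex_of_real q)) = 1"
    unfolding e_def by (metis of_real_1 of_real_diff of_real_inverse of_real_mult)
  \<comment> \<open>The commutator relator paired with alpha or with delta amounts to exactly
    this.\<close>
  then have e: "e * (h * h) = 1 + e * (inverse h * inverse h)"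
    by (simp add: qq algebra_simps flip: h_def)
  have R: "r \<in> {gen gen_A * gen gen_D - 1, gen gen_D * gen gen_A - 1,
     gen gen_A * gen gen_B - const (h * h) * (gen gen_B * gen gen_A),
     gen gen_A * gen gen_C - const (inverse h * inverse h) * (gen gen_C * gen gen_A),
     gen gen_B * gen gen_C - gen gen_C * gen gen_B - const e * (gen gen_A * gen gen_A - gen gen_D * gen gen_D)}"
    using r by (simp add: Uq_rels_def Let_def e_def qq h_def mult.assoc power2_eq_square)
  have p1: "gen_pairing q gen_A gen_alpha = h" "gen_pairing q gen_D gen_delta = h"
     "gen_pairing q gen_A gen_delta = inverse h" "gen_pairing q gen_D gen_alpha = inverse h"
    using h by (simp_all add: h_def)
  note p2 = gen_pairing.simps(1-4)
  show "lin (\<lambda>x. pw q (unw x) [g]) r = 0"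
    using R h(1) by (cases g) (auto simp: p1 gen_mult lin_diff lin_const const_single lin_1 right_diff_distrib e simp del: p2)
qed

end

section \<open>Existence and uniqueness of the duality pairing\<close>

lemma lin_swap: "lin (\<lambda>u. lin (\<lambda>w. f u w) y) x = lin (\<lambda>w. lin (\<lambda>u. f u w) x) y"
  unfolding lin_def sum_distrib_left by (subst sum.swap) (simp add: ac_simps)

definition col :: "real \<Rightarrow> ugen falg \<Rightarrow> agen list \<Rightarrow> complex" where
  "col q x w = lin (\<lambda>a. pw q (unw a) w) x"

text \<open>An element of the function algebra seen as a functional on words of the enveloping
  algebra. Most later arguments about elements are arguments about such functionals.\<close>

definition row :: "real \<Rightarrow> agen falg \<Rightarrow> ugen list \<Rightarrow> complex" where
  "row q \<xi> a = lin (\<lambda>w. pw q a (unw w)) \<xi>"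

definition bil :: "real \<Rightarrow> ugen falg \<Rightarrow> agen falg \<Rightarrow> complex" where
  "bil q x \<xi> = lin (\<lambda>a. row q \<xi> (unw a)) x"

lemma bil_col: "bil q x \<xi> = lin (\<lambda>w. col q x (unw w)) \<xi>"
  unfolding bil_def row_def col_def by (rule lin_swap)

lemma col_mult: "col q (x * y) w = sw cmA w (\<lambda>u v. col q x u * col q y v)"
  unfolding col_def
proof (induction x rule: pm_induct)
  case (1 u c)
  show ?case
    by (induction y rule: pm_induct)
      (auto simp: mult_single unw_add pw_append lin_add algebra_simps sw_add simp flip: sw_mult_l)
qed (simp add: lin_add algebra_simps sw_add)

lemma row_mult: "row q (\<xi> * \<eta>) a = sw cmU a (\<lambda>u v. row q \<xi> u * row q \<eta> v)"
  unfolding row_def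
proof (induction \<xi> rule: pm_induct)
  case (1 u c)
  show ?case
    by (induction \<eta> rule: pm_induct)
      (auto simp: mult_single unw_add pw_append2 lin_add algebra_simps sw_add simp flip: sw_mult_l)
qed (simp add: lin_add algebra_simps sw_add)

lemma bil_add_r: "bil q x (\<xi> + \<eta>) = bil q x \<xi> + bil q x \<eta>"
  by (simp add: bil_col lin_add)

lemma bil_const_r: "bil q x (const c * \<xi>) = c * bil q x \<xi>"
  by (simp add: bil_col lin_const)

lemma bil_add_l: "bil q (x + y) \<xi> = bil q x \<xi> + bil q y \<xi>"
  by (simp add: bil_def lin_add)

lemma bil_const_l: "bil q (const c * x) \<xi> = c * bil q x \<xi>"
  by (simp add: bil_def lin_const)

lemma bil_diff_l: "bil q (x - y) \<xi> = bil q x \<xi> - bil q y \<xi>"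
  by (simp add: bil_def lin_diff)

lemma bil_diff_r: "bil q x (\<xi> - \<eta>) = bil q x \<xi> - bil q x \<eta>"
  by (simp add: bil_col lin_diff)

lemma bil_mult_l: "bil q (x * y) \<xi> = lin (\<lambda>(u, v). col q x (unw u) * col q y (unw v)) (dlt cmA \<xi>)"
  by (simp add: bil_col lin_dlt col_mult)

lemma bil_mult_r: "bil q x (\<xi> * \<eta>) = lin (\<lambda>(u, v). row q \<xi> (unw u) * row q \<eta> (unw v)) (dlt cmU x)"
  by (simp add: bil_def lin_dlt row_mult)

definition PQ :: "real \<Rightarrow> ugen falg set \<Rightarrow> agen falg set \<Rightarrow> complex" where
  "PQ q = (\<lambda>X\<in>carrier (Uq q). \<lambda>\<Xi>\<in>carrier (Aq q). bil q (SOME x. x \<in> X) (SOME \<xi>. \<xi> \<in> \<Xi>))"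

context
  fixes q :: real
  assumes q: "0 < q" "q < 1"
begin

lemma bil_ideal_span_l: "x \<in> ideal_span (Uq_rels q) \<Longrightarrow> bil q x \<xi> = 0"
  by (simp add: bil_col col_def pw_kills_Uq[OF q])

lemma bil_ideal_span_r: "\<xi> \<in> ideal_span (Aq_rels q) \<Longrightarrow> bil q x \<xi> = 0"
  by (simp add: bil_def row_def pw_kills_Aq[OF q])

lemma PQ_cls: "PQ q (cls (Uq_rels q) x) (cls (Aq_rels q) \<xi>) = bil q x \<xi>"
proof -
  define y \<eta> where "y = (SOME y. y \<in> cls (Uq_rels q) x)" and "\<eta> = (SOME y. y \<in> cls (Aq_rels q) \<xi>)"
  have "y \<in> cls (Uq_rels q) x" "\<eta> \<in> cls (Aq_rels q) \<xi>"
    unfolding y_def \<eta>_def by (metis cls_self someI)+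
  then have "bil q (y - x) \<eta> = 0" "bil q x (\<eta> - \<xi>) = 0"
    by (simp_all add: bil_ideal_span_l bil_ideal_span_r mem_cls)
  then have "bil q y \<eta> = bil q x \<xi>" by (simp add: bil_diff_l bil_diff_r)
  then show ?thesis
    by (simp add: PQ_def Uq_def Aq_def quot_simps y_def \<eta>_def)
qed

lemma Aq_comult_cls:
  "Aq_comult q (cls (Aq_rels q) \<xi>) = cls (tens_rels (Aq_rels q) (Aq_rels q)) (dlt cmA \<xi>)"
  unfolding Aq_comult_def Let_def
  by (rule comult_hom[OF dlt_Aq_rels[OF q]])
    (auto simp: a_elem_def tens_cls tens_alg_def quot_simps split: agen.split)

lemma Uq_comult_cls:
  "Uq_comult q (cls (Uq_rels q) \<xi>) = cls (tens_rels (Uq_rels q) (Uq_rels q)) (dlt cmU \<xi>)"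
  unfolding Uq_comult_def Let_def
  by (rule comult_hom[OF dlt_Uq_rels[OF q]])
    (auto simp: u_elem_def tens_cls tens_alg_def quot_simps split: ugen.split)

lemma Aq_counit_cls: "Aq_counit q (cls (Aq_rels q) \<xi>) = lin (\<lambda>w. prod_list (map epA (unw w))) \<xi>"
proof -
  have e: "(\<lambda>g. case g of gen_alpha \<Rightarrow> 1 | gen_beta \<Rightarrow> 0 | gen_gamma \<Rightarrow> 0 | gen_delta \<Rightarrow> 1) = epA"
    by (auto split: agen.split)
  show ?thesis
    unfolding Aq_counit_def e
    by (rule char_hom) (use pw_kills_Aq[OF q, of _ "[]"] in \<open>auto intro: ideal_span_gen\<close>)
qed

lemma Uq_counit_cls: "Uq_counit q (cls (Uq_rels q) \<xi>) = lin (\<lambda>w. prod_list (map epU (unw w))) \<xi>"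
proof -
  have e: "(\<lambda>g. case g of gen_A \<Rightarrow> 1 | gen_B \<Rightarrow> 0 | gen_C \<Rightarrow> 0 | gen_D \<Rightarrow> 1) = epU"
    by (auto split: ugen.split)
  show ?thesis
    unfolding Uq_counit_def e
    by (rule char_hom) (use pw_kills_Uq[OF q, of _ "[]"] in \<open>auto intro: ideal_span_gen simp: pw_Nil2\<close>)
qed

lemma bil_1_l: "bil q 1 \<xi> = lin (\<lambda>w. prod_list (map epA (unw w))) \<xi>"
  by (simp add: bil_def lin_1 row_def)

lemma bil_1_r: "bil q x 1 = lin (\<lambda>w. prod_list (map epU (unw w))) x"
  by (simp add: bil_col lin_1 col_def pw_Nil2)

lemma bil_gen: "bil q (gen x) (gen g) = gen_pairing q x g"
  by (cases x; cases g) (simp_all add: bil_def gen_def row_def)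

lemma PQ_duality: "is_duality q (PQ q)"
  unfolding is_duality_def
proof (intro conjI ballI allI)
  fix X Y \<xi> and c :: complex
  assume "X \<in> carrier (Uq q)" "Y \<in> carrier (Uq q)" "\<xi> \<in> carrier (Aq q)"
  then obtain x y z where xyz: "X = cls (Uq_rels q) x" "Y = cls (Uq_rels q) y" "\<xi> = cls (Aq_rels q) z"
    by (auto simp: Uq_def Aq_def quot_simps)
  show "PQ q (X \<oplus>\<^bsub>Uq q\<^esub> Y) \<xi> = PQ q X \<xi> + PQ q Y \<xi>" "PQ q (c \<odot>\<^bsub>Uq q\<^esub> X) \<xi> = c * PQ q X \<xi>"
    by (simp_all add: xyz quot_simps Uq_def PQ_cls bil_add_l bil_const_l)
  have "tens_functional (Aq_rels q) (Aq_rels q) (PQ q X) (PQ q Y) (Aq_comult q \<xi>)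
     = lin (\<lambda>(u, v). col q x (unw u) * col q y (unw v)) (dlt cmA z)"
    unfolding xyz Aq_comult_cls by (rule tens_functional_cls) (simp_all add: PQ_cls bil_col)
  then show "PQ q (X \<otimes>\<^bsub>Uq q\<^esub> Y) \<xi> = tens_functional (Aq_rels q) (Aq_rels q) (PQ q X) (PQ q Y) (Aq_comult q \<xi>)"
    by (simp add: xyz quot_simps Uq_def PQ_cls bil_mult_l)
next
  fix X \<xi> \<eta> and c :: complex
  assume "X \<in> carrier (Uq q)" "\<xi> \<in> carrier (Aq q)" "\<eta> \<in> carrier (Aq q)"
  then obtain x y z where xyz: "X = cls (Uq_rels q) x" "\<xi> = cls (Aq_rels q) y" "\<eta> = cls (Aq_rels q) z"
    by (auto simp: Uq_def Aq_def quot_simps)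
  show "PQ q X (\<xi> \<oplus>\<^bsub>Aq q\<^esub> \<eta>) = PQ q X \<xi> + PQ q X \<eta>" "PQ q X (c \<odot>\<^bsub>Aq q\<^esub> \<xi>) = c * PQ q X \<xi>"
    by (simp_all add: xyz quot_simps Aq_def PQ_cls bil_add_r bil_const_r)
  have "tens_functional (Uq_rels q) (Uq_rels q) (\<lambda>Y. PQ q Y \<xi>) (\<lambda>Y. PQ q Y \<eta>) (Uq_comult q X)
     = lin (\<lambda>(u, v). row q y (unw u) * row q z (unw v)) (dlt cmU x)"
    unfolding xyz Uq_comult_cls by (rule tens_functional_cls) (simp_all add: PQ_cls bil_def)
  then show "PQ q X (\<xi> \<otimes>\<^bsub>Aq q\<^esub> \<eta>) = tens_functional (Uq_rels q) (Uq_rels q) (\<lambda>Y. PQ q Y \<xi>) (\<lambda>Y. PQ q Y \<eta>) (Uq_comult q X)"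
    by (simp add: xyz quot_simps Aq_def PQ_cls bil_mult_r)
next
  fix \<xi> assume "\<xi> \<in> carrier (Aq q)"
  then show "PQ q \<one>\<^bsub>Uq q\<^esub> \<xi> = Aq_counit q \<xi>"
    by (auto simp: Uq_def Aq_def quot_simps PQ_cls bil_1_l Aq_counit_cls)
next
  fix X assume "X \<in> carrier (Uq q)"
  then show "PQ q X \<one>\<^bsub>Aq q\<^esub> = Uq_counit q X"
    by (auto simp: Uq_def Aq_def quot_simps PQ_cls bil_1_r Uq_counit_cls)
next
  fix x g
  show "PQ q (u_elem q x) (a_elem q g) = gen_pairing q x g"
    by (simp add: u_elem_def a_elem_def PQ_cls bil_gen)
qed

lemma linear_cls:
  assumes "\<And>x y. f (cls R (x + y)) = f (cls R x) + f (cls R y)" "\<And>c x. f (cls R (const c * x)) = c * f (cls R x)"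
  shows "f (cls R x) = lin (\<lambda>w. f (cls R (Poly_Mapping.single w 1))) x"
proof (induction x rule: pm_induct)
  case (1 w c)
  then show ?case using assms(2)[of c "Poly_Mapping.single w 1"] by (simp add: const_single)
qed (simp add: assms lin_add)

text \<open>Bilinearity reduces to words. The axiom for products in the second argument, starting
  from a generator in the first, forces the recursion of \<open>pg\<close>; the one for products in
  the first argument forces that of \<open>pw\<close>.\<close>

lemma duality_unique:
  assumes P: "is_duality q P"
  shows "P (cls (Uq_rels q) x) (cls (Aq_rels q) \<xi>) = bil q x \<xi>"
proof -
  let ?U = "cls (Uq_rels q)" and ?A = "cls (Aq_rels q)"
  have addl: "P (?U (x + y)) (?A z) = P (?U x) (?A z) + P (?U y) (?A z)"
    and scl: "P (?U (const c * x)) (?A z) = c * P (?U x) (?A z)"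
    and addr: "P (?U x) (?A (z + z')) = P (?U x) (?A z) + P (?U x) (?A z')"
    and scr: "P (?U x) (?A (const c * z)) = c * P (?U x) (?A z)"
    and ml: "P (?U (x * y)) (?A z) = tens_functional (Aq_rels q) (Aq_rels q) (P (?U x)) (P (?U y)) (Aq_comult q (?A z))"
    and mr: "P (?U x) (?A (z * z')) = tens_functional (Uq_rels q) (Uq_rels q) (\<lambda>Y. P Y (?A z)) (\<lambda>Y. P Y (?A z')) (Uq_comult q (?U x))"
    and unl: "P (?U 1) (?A z) = Aq_counit q (?A z)" and unr: "P (?U x) (?A 1) = Uq_counit q (?U x)"
    for x y z z' c
    using P[unfolded is_duality_def Uq_def Aq_def, simplified quot_simps ball_simps ball_UNIV] by blast+
  have gg: "P (?U (gen x)) (?A (gen g)) = gen_pairing q x g" for x g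
    using P by (auto simp: is_duality_def u_elem_def a_elem_def)
  let ?s = "\<lambda>w. Poly_Mapping.single (Word w) (1::complex)"
  have linr: "P (?U x) (?A z) = lin (\<lambda>w. P (?U x) (?A (Poly_Mapping.single w 1))) z" for x z
    by (rule linear_cls) (simp_all add: addr scr)
  have linl: "P (?U x) (?A z) = lin (\<lambda>w. P (?U (Poly_Mapping.single w 1)) (?A z)) x" for x z
    by (rule linear_cls[of "\<lambda>X. P X (?A z)"]) (simp_all add: addl scl)
  have single1: "?s (g # w) = gen g * ?s w" for g :: 'g and w by (simp add: gen_def mult_single)
  have single0: "?s [] = (1 :: 'g falg)" by (simp flip: zero_word_def)
  have 1: "P (?U (gen x)) (?A (?s w)) = pg q x w" for x w
  proof (induction w arbitrary: x)
    case Nil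
    show ?case by (simp add: single0 unr Uq_counit_cls gen_def)
  next
    case (Cons g w)
    have "P (?U (gen x)) (?A (?s (g # w))) = lin (\<lambda>(u, v). P (?U (Poly_Mapping.single u 1)) (?A (gen g)) *
        P (?U (Poly_Mapping.single v 1)) (?A (?s w))) (dlt cmU (gen x))"
      unfolding single1 mr Uq_comult_cls by (rule tens_functional_cls) (rule linl)+
    also have "\<dots> = pg q x (g # w)"
      unfolding lin_dlt using Cons gg by (simp add: gen_def)
    finally show ?case .
  qed
  have 2: "P (?U (?s xs)) (?A (?s w)) = pw q xs w" for xs w
  proof (induction xs arbitrary: w)
    case Nil
    show ?case by (simp add: single0 unl Aq_counit_cls)
  next
    case (Cons x xs)
    have "P (?U (?s (x # xs))) (?A (?s w)) = lin (\<lambda>(u, v). P (?U (gen x)) (?A (Poly_Mapping.single u 1)) *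
        P (?U (?s xs)) (?A (Poly_Mapping.single v 1))) (dlt cmA (?s w))"
      unfolding single1 ml Aq_comult_cls by (rule tens_functional_cls) (rule linr)+
    also have "\<dots> = pw q (x # xs) w"
      unfolding lin_dlt using Cons 1 by simp
    finally show ?case .
  qed
  have "P (?U (Poly_Mapping.single a 1)) (?A (Poly_Mapping.single w 1)) = pw q (unw a) (unw w)" for a w
    using 2[of "unw a" "unw w"] by (cases a; cases w) simp
  then show ?thesis
    unfolding linl[of x] bil_def row_def by (subst linr) (simp only:)
qed

lemma pairing_eq: "pairing q = PQ q"
  unfolding pairing_def
proof (rule the_equality)
  show "PQ q \<in> carrier (Uq q) \<rightarrow>\<^sub>E carrier (Aq q) \<rightarrow>\<^sub>E UNIV \<and> is_duality q (PQ q)"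
    using PQ_duality by (auto simp: PQ_def)
next
  fix P assume P: "P \<in> carrier (Uq q) \<rightarrow>\<^sub>E carrier (Aq q) \<rightarrow>\<^sub>E UNIV \<and> is_duality q P"
  show "P = PQ q"
  proof (rule extensionalityI[of _ "carrier (Uq q)"])
    show "P \<in> extensional (carrier (Uq q))" using P by (auto simp: PiE_def)
    show "PQ q \<in> extensional (carrier (Uq q))" by (simp add: PQ_def)
    fix X assume X: "X \<in> carrier (Uq q)"
    show "P X = PQ q X"
    proof (rule extensionalityI[of _ "carrier (Aq q)"])
      show "P X \<in> extensional (carrier (Aq q))" using P X by (auto simp: PiE_def Pi_def)
      show "PQ q X \<in> extensional (carrier (Aq q))" using X by (simp add: PQ_def)
      fix \<xi> assume "\<xi> \<in> carrier (Aq q)"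
      then show "P X \<xi> = PQ q X \<xi>"
        using X P by (auto simp: Uq_def Aq_def quot_simps PQ_cls duality_unique)
    qed
  qed
qed

lemma pairing_cls: "pairing q (cls (Uq_rels q) x) (cls (Aq_rels q) \<xi>) = bil q x \<xi>"
  by (simp add: pairing_eq PQ_cls)

lemma left_act_cls:
  "left_act q (u_elem q X) (cls (Aq_rels q) \<xi>) =
    cls (Aq_rels q) (lmap (\<lambda>w. sw cmA (unw w) (\<lambda>u v. const (pg q X v) * Poly_Mapping.single (Word u) 1)) \<xi>)"
proof -
  have "left_act q (u_elem q X) (cls (Aq_rels q) \<xi>) =
    cls (Aq_rels q) (lmap (\<lambda>(u, v). const (pg q X (unw v)) * Poly_Mapping.single u 1) (dlt cmA \<xi>))"
    unfolding left_act_def u_elem_def Aq_comult_cls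
    by (rule id_tens_cls) (simp add: pairing_cls bil_col col_def gen_def pw_single del: pw.simps)
  also have "lmap (\<lambda>(u, v). const (pg q X (unw v)) * Poly_Mapping.single u 1) (dlt cmA \<xi>) =
     lmap (\<lambda>w. sw cmA (unw w) (\<lambda>u v. const (pg q X v) * Poly_Mapping.single (Word u) 1)) \<xi>"
    (is "?L \<xi> = ?R \<xi>")
  proof (induction \<xi> rule: pm_induct)
    case (1 w c)
    have "lmap (\<lambda>(u, v). const (pg q X (unw v)) * Poly_Mapping.single u 1)
       (sw cmA (unw w) (\<lambda>u v. Poly_Mapping.single (Word u, Word v) 1)) =
       sw cmA (unw w) (\<lambda>u v. lmap (\<lambda>(u, v). const (pg q X (unw v)) * Poly_Mapping.single u 1) (Poly_Mapping.single (Word u, Word v) 1))"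
      by (rule sw_additive) (simp_all add: lmap_add)
    then show ?case by (simp add: dlt_def lmap_single lmap_const)
  qed (simp add: dlt_add lmap_add)
  finally show ?thesis .
qed

end

section \<open>Separation of weights and the action of generators on words\<close>

text \<open>A sum of geometric sequences that vanishes from some index on has zero coefficient at
  each ratio. Ratios may coincide, so only the grouped coefficients are determined.\<close>

lemma power_sums_zero:
  fixes c \<theta> :: "'i \<Rightarrow> complex"
  assumes S: "finite S" and nz: "\<And>i. i \<in> S \<Longrightarrow> \<theta> i \<noteq> 0"
    and z: "\<And>k. k \<ge> K \<Longrightarrow> (\<Sum>i\<in>S. c i * \<theta> i ^ k) = 0"
  shows "(\<Sum>i\<in>{i\<in>S. \<theta> i = t}. c i) = 0"
proof (cases "\<exists>i\<in>S. \<theta> i = t")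
  case False
  then have "{i\<in>S. \<theta> i = t} = {}" by auto
  then show ?thesis by (simp only: sum.empty)
next
  case True
  then have t0: "t \<noteq> 0" using nz by auto
  have P: "(\<Sum>i\<in>S. c i * \<theta> i ^ K * poly p (\<theta> i)) = 0" for p
  proof -
    have "(\<Sum>i\<in>S. c i * \<theta> i ^ K * poly p (\<theta> i)) =
      (\<Sum>i\<in>S. \<Sum>n\<le>Polynomial.degree p. Polynomial.coeff p n * (c i * \<theta> i ^ (K + n)))"
      by (simp add: poly_altdef sum_distrib_left power_add ac_simps)
    also have "\<dots> = (\<Sum>n\<le>Polynomial.degree p. Polynomial.coeff p n * (\<Sum>i\<in>S. c i * \<theta> i ^ (K + n)))"
      by (subst sum.swap) (simp add: sum_distrib_left)
    finally show ?thesis by (simp add: z)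
  qed
  \<comment> \<open>The polynomial vanishing at all ratios other than \<open>t\<close>; linear
    combinations of the hypotheses evaluate it.\<close>
  define p where "p = (\<Prod>s\<in>\<theta> ` S - {t}. [:- s, 1:])"
  have p: "poly p (\<theta> i) = (if \<theta> i = t then poly p t else 0)" if "i \<in> S" for i
    using that S by (auto simp: p_def poly_prod)
  have pt: "poly p t \<noteq> 0" using S by (auto simp: p_def poly_prod)
  have "0 = (\<Sum>i\<in>S. c i * \<theta> i ^ K * poly p (\<theta> i))" by (simp add: P)
  also have "\<dots> = (\<Sum>i\<in>S. if \<theta> i = t then c i * (t ^ K * poly p t) else 0)"
    by (rule sum.cong) (auto simp: p)
  also have "\<dots> = (\<Sum>i\<in>{i\<in>S. \<theta> i = t}. c i) * (t ^ K * poly p t)"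
    using S by (simp add: sum.inter_filter sum_distrib_right) (intro sum.cong, auto)
  finally show ?thesis using t0 pt by simp
qed

lemma of_real_pow_inj:
  assumes "0 < h" "h < 1" "complex_of_real h ^ m = complex_of_real h ^ n"
  shows "m = n"
proof -
  have "h ^ m = h ^ n" using assms(3) by (metis of_real_eq_iff of_real_power)
  then show ?thesis using assms(1,2)
    by (metis linorder_neqE_nat order_less_irrefl power_strict_decreasing)
qed

text \<open>One generator acting on a functional of words through the coproduct. Peeling letters off
  the first argument of \<open>pw\<close> this way (\<open>pw_Cons\<close>) allows induction for
  arbitrary functionals \<open>F\<close>.\<close>

definition act :: "real \<Rightarrow> ugen \<Rightarrow> agen list \<Rightarrow> (agen list \<Rightarrow> complex) \<Rightarrow> complex" where
  "act q x w F = sw cmA w (\<lambda>u v. pg q x u * F v)"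

lemma act_Nil: "act q x [] F = epU x * F []" by (simp add: act_def)

lemma act_Cons: "act q x (g # w) F =
  (\<Sum>(a, b)\<leftarrow>cmA g. \<Sum>(y, z)\<leftarrow>cmU x. gen_pairing q y a * act q z w (\<lambda>v. F (b # v)))"
  by (simp add: act_def case_prod_unfold mult.assoc flip: sw_mult_l sw_sum_list sum_list_mult_const)

lemma pw_Cons: "pw q (x # xs) w = act q x w (pw q xs)"
  by (simp add: act_def)

text \<open>The generators form a matrix with rows alpha, beta and gamma, delta. The element A,
  placed first, multiplies by a weight depending on the row (\<open>rwt\<close>); placed last, by
  one depending on the column (\<open>cwt\<close>). The inverse row weights \<open>rwt'\<close>
  belong to D.\<close>

fun rwt :: "real \<Rightarrow> agen \<Rightarrow> complex" where
  "rwt q gen_alpha = complex_of_real (q powr (1/2))"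
| "rwt q gen_beta = complex_of_real (q powr (1/2))"
| "rwt q gen_gamma = complex_of_real (q powr (-1/2))"
| "rwt q gen_delta = complex_of_real (q powr (-1/2))"

fun cwt :: "real \<Rightarrow> agen \<Rightarrow> complex" where
  "cwt q gen_alpha = complex_of_real (q powr (1/2))"
| "cwt q gen_gamma = complex_of_real (q powr (1/2))"
| "cwt q gen_beta = complex_of_real (q powr (-1/2))"
| "cwt q gen_delta = complex_of_real (q powr (-1/2))"

abbreviation "rw q w \<equiv> prod_list (map (rwt q) w)"
abbreviation "cw q w \<equiv> prod_list (map (cwt q) w)"

lemma act_A: "act q gen_A w F = rw q w * F w"
proof (induction w arbitrary: F)
  case (Cons g w)
  then show ?case by (cases g) (simp_all add: act_Cons)
qed (simp add: act_Nil)

fun rwt' :: "real \<Rightarrow> agen \<Rightarrow> complex" where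
  "rwt' q gen_alpha = complex_of_real (q powr (-1/2))"
| "rwt' q gen_beta = complex_of_real (q powr (-1/2))"
| "rwt' q gen_gamma = complex_of_real (q powr (1/2))"
| "rwt' q gen_delta = complex_of_real (q powr (1/2))"

abbreviation "rw' q w \<equiv> prod_list (map (rwt' q) w)"

lemma act_D: "act q gen_D w F = rw' q w * F w"
proof (induction w arbitrary: F)
  case (Cons g w)
  then show ?case by (cases g) (simp_all add: act_Cons)
qed (simp add: act_Nil)

text \<open>B is a twisted derivation: it replaces one letter by the letter below it in the matrix
  of generators, with A-weights for the letters before and D-weights for those after. Likewise C
  replaces a letter by the one above it.\<close>

lemma act_B: "act q gen_B (g # w) F = rwt q g * act q gen_B w (\<lambda>v. F (g # v)) +
   (case g of gen_alpha \<Rightarrow> rw' q w * F (gen_gamma # w) | gen_beta \<Rightarrow> rw' q w * F (gen_delta # w) | _ \<Rightarrow> 0)"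
  by (cases g) (simp_all add: act_Cons act_D)

lemma act_C: "act q gen_C (g # w) F = rwt q g * act q gen_C w (\<lambda>v. F (g # v)) +
   (case g of gen_gamma \<Rightarrow> rw' q w * F (gen_alpha # w) | gen_delta \<Rightarrow> rw' q w * F (gen_beta # w) | _ \<Rightarrow> 0)"
  by (cases g) (simp_all add: act_Cons act_D)

lemma pw_snoc_A: "pw q (xs @ [gen_A]) w = cw q w * pw q xs w"
proof -
  have "sw cmA w (\<lambda>u v. F u * pg q gen_A v) = cw q w * F w" for F
  proof (induction w arbitrary: F)
    case (Cons g w)
    have "sw cmA w (\<lambda>u v. F (a # u) * (c * pg q gen_A v)) = c * (cw q w * F (a # w))" for a c
      using Cons[of "\<lambda>u. F (a # u)"] sw_mult_l[of cmA w c "\<lambda>u v. F (a # u) * pg q gen_A v"]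
      by (simp add: ac_simps)
    then show ?case by (cases g) simp_all
  qed simp
  then show ?thesis by (simp add: pw_append pw_single del: pw.simps)
qed

text \<open>Pairings of words in the generators are non-negative reals, so nothing cancels: one
  strictly positive contribution already shows that a pairing is nonzero.\<close>

definition nn :: "complex \<Rightarrow> bool" where "nn z \<longleftrightarrow> Im z = 0 \<and> 0 \<le> Re z"
definition pos :: "complex \<Rightarrow> bool" where "pos z \<longleftrightarrow> Im z = 0 \<and> 0 < Re z"

lemma nn_pos [intro]:
  "nn x \<Longrightarrow> nn y \<Longrightarrow> nn (x + y)" "nn x \<Longrightarrow> nn y \<Longrightarrow> nn (x * y)" "pos x \<Longrightarrow> nn x"
  "pos x \<Longrightarrow> nn y \<Longrightarrow> pos (x + y)" "nn x \<Longrightarrow> pos y \<Longrightarrow> pos (x + y)" "pos x \<Longrightarrow> pos y \<Longrightarrow> pos (x * y)"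
  by (auto simp: nn_def pos_def)

lemma nn_0 [simp]: "nn 0" "pos 1" "\<not> pos 0" by (auto simp: nn_def pos_def)

section \<open>Functionals on the words of the enveloping algebra\<close>

text \<open>Functionals on words that factor through the enveloping algebra, phrased as rewriting
  rules at an arbitrary position of a word. Matrix coefficients of representations and the
  functionals \<open>row\<close> are both of this kind.\<close>

definition uq_functional :: "real \<Rightarrow> (ugen list \<Rightarrow> complex) \<Rightarrow> bool" where
  "uq_functional q F \<longleftrightarrow> (\<forall>u v. F (u @ gen_A # gen_D # v) = F (u @ v) \<and> F (u @ gen_D # gen_A # v) = F (u @ v) \<and>
     F (u @ gen_A # gen_B # v) = complex_of_real q * F (u @ gen_B # gen_A # v) \<and>
     F (u @ gen_A # gen_C # v) = inverse (complex_of_real q) * F (u @ gen_C # gen_A # v) \<and>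
     F (u @ gen_B # gen_C # v) = F (u @ gen_C # gen_B # v) +
       complex_of_real (inverse (q - inverse q)) * (F (u @ gen_A # gen_A # v) - F (u @ gen_D # gen_D # v)))"

lemma UfunI:
  assumes "\<And>t. t \<in> ideal_span (Uq_rels q) \<Longrightarrow> lin (\<lambda>x. F (unw x)) t = 0"
  shows "uq_functional q F"
proof -
  define e where "e = complex_of_real (inverse (q - inverse q))"
  have U: "Uq_rels q = {gen gen_A * gen gen_D - 1, gen gen_D * gen gen_A - 1,
     gen gen_A * gen gen_B - const (complex_of_real q) * (gen gen_B * gen gen_A),
     gen gen_A * gen gen_C - const (inverse (complex_of_real q)) * (gen gen_C * gen gen_A),
     gen gen_B * gen gen_C - gen gen_C * gen gen_B - const e * (gen gen_A * gen gen_A - gen gen_D * gen gen_D)}"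
    by (simp add: Uq_rels_def Let_def mult.assoc power2_eq_square e_def)
  have *: "lin (\<lambda>x. F (unw x)) (Poly_Mapping.single (Word u) 1 * r * Poly_Mapping.single (Word v) 1) = 0"
    if "r \<in> Uq_rels q" for r u v
    using that by (intro assms ideal_span_mult ideal_span_gen)
  have L: "lin (\<lambda>x. F (unw x)) (Poly_Mapping.single (Word u) 1 * r * Poly_Mapping.single (Word v) 1) =
      lin (\<lambda>x. F (u @ unw x @ v)) r" for u v r
    by (induction r rule: pm_induct) (auto simp: mult_single unw_add algebra_simps lin_add)
  have **: "lin (\<lambda>x. F (u @ unw x @ v)) r = 0" if "r \<in> Uq_rels q" for r u v
    using *[OF that] L by simp
  note l = lin_diff lin_const gen_mult lin_1
  show ?thesis unfolding uq_functional_def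
  proof (intro allI conjI)
    fix u v
    show "F (u @ gen_A # gen_D # v) = F (u @ v)"
      using **[of "gen gen_A * gen gen_D - 1" u v] by (simp add: U l)
    show "F (u @ gen_D # gen_A # v) = F (u @ v)"
      using **[of "gen gen_D * gen gen_A - 1" u v] by (simp add: U l)
    show "F (u @ gen_A # gen_B # v) = complex_of_real q * F (u @ gen_B # gen_A # v)"
      using **[of "gen gen_A * gen gen_B - const (complex_of_real q) * (gen gen_B * gen gen_A)" u v] by (simp add: U l)
    show "F (u @ gen_A # gen_C # v) = inverse (complex_of_real q) * F (u @ gen_C # gen_A # v)"
      using **[of "gen gen_A * gen gen_C - const (inverse (complex_of_real q)) * (gen gen_C * gen gen_A)" u v] by (simp add: U l)
    show "F (u @ gen_B # gen_C # v) = F (u @ gen_C # gen_B # v) +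
       complex_of_real (inverse (q - inverse q)) * (F (u @ gen_A # gen_A # v) - F (u @ gen_D # gen_D # v))"
    proof -
      have "gen gen_B * gen gen_C - gen gen_C * gen gen_B - const e * (gen gen_A * gen gen_A - gen gen_D * gen gen_D) \<in> Uq_rels q"
        by (simp add: U)
      from **[OF this, of u v] show ?thesis by (simp add: l) (simp add: e_def algebra_simps)
    qed
  qed
qed

abbreviation "BC \<equiv> {gen_B, gen_C}"

definition qs :: "real \<Rightarrow> ugen list \<Rightarrow> complex" where
  "qs q xs = prod_list (map (\<lambda>x. if x = gen_B then complex_of_real q else if x = gen_C then inverse (complex_of_real q) else 1) xs)"

lemma uq_functional_A:
  assumes "uq_functional q F" "set xs \<subseteq> BC"
  shows "F (u @ gen_A # xs @ v) = qs q xs * F (u @ xs @ gen_A # v)"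
  using assms(2)
proof (induction xs arbitrary: u)
  case (Cons x xs)
  from Cons.IH[of "u @ [x]"] Cons.prems
  have "F (u @ x # gen_A # xs @ v) = qs q xs * F (u @ x # xs @ gen_A # v)" by simp
  moreover have "x = gen_B \<or> x = gen_C" using Cons.prems by auto
  ultimately show ?case using assms(1) by (auto simp: uq_functional_def qs_def)
qed (simp add: qs_def)

section \<open>Non-degeneracy\<close>

lemma pw_Bs:
  "pw q (replicate b gen_B) w \<noteq> 0 \<Longrightarrow> count_list w gen_gamma = 0 \<and> count_list w gen_beta = b"
proof (induction b arbitrary: w)
  case 0
  then have "prod_list (map epA w) \<noteq> 0" by simp
  then show ?case
  proof (induction w)
    case (Cons g w)
    then show ?case by (cases g) auto
  qed simp
next
  case (Suc b)
  \<comment> \<open>One B either creates a gamma from an alpha or uses up a beta. The induction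
    hypothesis allows no gamma in \<open>v\<close>, so only the second can have happened.\<close>
  have "\<exists>v. F v \<noteq> 0 \<and> (count_list v gen_gamma = count_list w gen_gamma + 1 \<or>
     count_list v gen_gamma = count_list w gen_gamma \<and> count_list w gen_beta = count_list v gen_beta + 1)"
    if "act q gen_B w F \<noteq> 0" for w F
    using that
  proof (induction w arbitrary: F)
    case (Cons g w)
    show ?case
    proof (cases "act q gen_B w (\<lambda>v. F (g # v)) = 0")
      case True
      with Cons.prems show ?thesis
        by (cases g) (auto simp: act_B intro: exI[of _ "gen_gamma # w"] exI[of _ "gen_delta # w"])
    next
      case False
      from Cons.IH[OF this] obtain v where "F (g # v) \<noteq> 0" "count_list v gen_gamma = count_list w gen_gamma + 1 \<or>
        count_list v gen_gamma = count_list w gen_gamma \<and> count_list w gen_beta = count_list v gen_beta + 1" by blast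
      then show ?thesis by (intro exI[of _ "g # v"]) auto
    qed
  qed (simp add: act_Nil)
  moreover have "act q gen_B w (pw q (replicate b gen_B)) \<noteq> 0" using Suc.prems by (simp add: pw_Cons del: pw.simps)
  ultimately show ?case using Suc.IH by fastforce
qed

lemma pw_Cs:
  "pw q (replicate b gen_C) w \<noteq> 0 \<Longrightarrow> count_list w gen_beta = 0 \<and> count_list w gen_gamma = b"
proof (induction b arbitrary: w)
  case 0
  then have "prod_list (map epA w) \<noteq> 0" by simp
  then show ?case
  proof (induction w)
    case (Cons g w)
    then show ?case by (cases g) auto
  qed simp
next
  case (Suc b)
  have "\<exists>v. F v \<noteq> 0 \<and> (count_list v gen_beta = count_list w gen_beta + 1 \<or>
     count_list v gen_beta = count_list w gen_beta \<and> count_list w gen_gamma = count_list v gen_gamma + 1)"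
    if "act q gen_C w F \<noteq> 0" for w F
    using that
  proof (induction w arbitrary: F)
    case (Cons g w)
    show ?case
    proof (cases "act q gen_C w (\<lambda>v. F (g # v)) = 0")
      case True
      with Cons.prems show ?thesis
        by (cases g) (auto simp: act_C intro: exI[of _ "gen_alpha # w"] exI[of _ "gen_beta # w"])
    next
      case False
      from Cons.IH[OF this] obtain v where "F (g # v) \<noteq> 0" "count_list v gen_beta = count_list w gen_beta + 1 \<or>
        count_list v gen_beta = count_list w gen_beta \<and> count_list w gen_gamma = count_list v gen_gamma + 1" by blast
      then show ?thesis by (intro exI[of _ "g # v"]) auto
    qed
  qed (simp add: act_Nil)
  moreover have "act q gen_C w (pw q (replicate b gen_C)) \<noteq> 0" using Suc.prems by (simp add: pw_Cons del: pw.simps)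
  ultimately show ?case using Suc.IH by fastforce
qed

text \<open>Without delta in the word, C can only turn a gamma into an alpha, so the C's use up the
  gammas and the B's then use up the betas. For words without alpha the order of B and C is reversed
  in \<open>pw_BsCs\<close>.\<close>

lemma pw_CsBs:
  "pw q (replicate c gen_C @ replicate b gen_B) w \<noteq> 0 \<Longrightarrow> gen_delta \<notin> set w \<Longrightarrow>
    count_list w gen_gamma = c \<and> count_list w gen_beta = b"
proof (induction c arbitrary: w)
  case 0
  then show ?case using pw_Bs by simp
next
  case (Suc c)
  have "\<exists>v. F v \<noteq> 0 \<and> gen_delta \<notin> set v \<and> count_list w gen_gamma = count_list v gen_gamma + 1 \<and>
     count_list w gen_beta = count_list v gen_beta"
    if "act q gen_C w F \<noteq> 0" "gen_delta \<notin> set w" for w F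
    using that
  proof (induction w arbitrary: F)
    case (Cons g w)
    show ?case
    proof (cases "act q gen_C w (\<lambda>v. F (g # v)) = 0")
      case True
      with Cons.prems show ?thesis
        by (cases g) (auto simp: act_C intro: exI[of _ "gen_alpha # w"])
    next
      case False
      from Cons.IH[OF this] Cons.prems obtain v where "F (g # v) \<noteq> 0" "gen_delta \<notin> set v" "count_list w gen_gamma = count_list v gen_gamma + 1"
        "count_list w gen_beta = count_list v gen_beta" by auto
      then show ?thesis using Cons.prems by (intro exI[of _ "g # v"]) auto
    qed
  qed (simp add: act_Nil)
  moreover have "act q gen_C w (pw q (replicate c gen_C @ replicate b gen_B)) \<noteq> 0"
    using Suc.prems by (simp add: pw_Cons del: pw.simps)
  ultimately show ?case using Suc.IH Suc.prems(2) by fastforce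
qed

lemma pw_BsCs:
  "pw q (replicate b gen_B @ replicate c gen_C) w \<noteq> 0 \<Longrightarrow> gen_alpha \<notin> set w \<Longrightarrow>
    count_list w gen_gamma = c \<and> count_list w gen_beta = b"
proof (induction b arbitrary: w)
  case 0
  then show ?case using pw_Cs by simp
next
  case (Suc b)
  have "\<exists>v. F v \<noteq> 0 \<and> gen_alpha \<notin> set v \<and> count_list w gen_beta = count_list v gen_beta + 1 \<and>
     count_list w gen_gamma = count_list v gen_gamma"
    if "act q gen_B w F \<noteq> 0" "gen_alpha \<notin> set w" for w F
    using that
  proof (induction w arbitrary: F)
    case (Cons g w)
    show ?case
    proof (cases "act q gen_B w (\<lambda>v. F (g # v)) = 0")
      case True
      with Cons.prems show ?thesis
        by (cases g) (auto simp: act_B intro: exI[of _ "gen_delta # w"])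
    next
      case False
      from Cons.IH[OF this] Cons.prems obtain v where "F (g # v) \<noteq> 0" "gen_alpha \<notin> set v" "count_list w gen_beta = count_list v gen_beta + 1"
        "count_list w gen_gamma = count_list v gen_gamma" by auto
      then show ?thesis using Cons.prems by (intro exI[of _ "g # v"]) auto
    qed
  qed (simp add: act_Nil)
  moreover have "act q gen_B w (pw q (replicate b gen_B @ replicate c gen_C)) \<noteq> 0"
    using Suc.prems by (simp add: pw_Cons del: pw.simps)
  ultimately show ?case using Suc.IH Suc.prems(2) by fastforce
qed

context
  fixes q :: real
  assumes q: "0 < q" "q < 1"
begin

lemma pos_wt: "pos (rwt q g)" "pos (rwt' q g)" "pos (rw q w)" "pos (rw' q w)"
proof -
  show 1: "pos (rwt q g)" "pos (rwt' q g)" for g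
    using q by (cases g; simp add: pos_def)+
  show "pos (rw q w)" "pos (rw' q w)" by (induction w) (auto simp: 1)
qed

lemma nn_act: "(\<And>v. nn (F v)) \<Longrightarrow> nn (act q x w F)"
proof -
  have "(\<And>v. nn (F v)) \<Longrightarrow> nn (act q gen_B w F)" for F
  proof (induction w arbitrary: F)
    case (Cons g w)
    then have "nn (act q gen_B w (\<lambda>v. F (g # v)))" by simp
    moreover have "nn (case g of gen_alpha \<Rightarrow> rw' q w * F (gen_gamma # w) | gen_beta \<Rightarrow> rw' q w * F (gen_delta # w) | _ \<Rightarrow> 0)"
      using Cons.prems by (cases g) (auto intro: nn_pos(2) nn_pos(3) pos_wt)
    ultimately show ?case
      unfolding act_B by (intro nn_pos(1) nn_pos(2)[OF nn_pos(3)[OF pos_wt(1)]])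
  qed (simp add: act_Nil)
  moreover have "(\<And>v. nn (F v)) \<Longrightarrow> nn (act q gen_C w F)" for F
  proof (induction w arbitrary: F)
    case (Cons g w)
    then have "nn (act q gen_C w (\<lambda>v. F (g # v)))" by simp
    moreover have "nn (case g of gen_gamma \<Rightarrow> rw' q w * F (gen_alpha # w) | gen_delta \<Rightarrow> rw' q w * F (gen_beta # w) | _ \<Rightarrow> 0)"
      using Cons.prems by (cases g) (auto intro: nn_pos(2) nn_pos(3) pos_wt)
    ultimately show ?case
      unfolding act_C by (intro nn_pos(1) nn_pos(2)[OF nn_pos(3)[OF pos_wt(1)]])
  qed (simp add: act_Nil)
  moreover assume "\<And>v. nn (F v)"
  ultimately show ?thesis by (cases x) (auto simp: act_A act_D intro: nn_pos(2) nn_pos(3) pos_wt)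
qed

lemma nn_pw: "nn (pw q xs w)"
proof (induction xs arbitrary: w)
  case Nil
  show ?case
  proof (induction w)
    case (Cons g w)
    then show ?case by (cases g) auto
  qed auto
qed (simp add: pw_Cons nn_act del: pw.simps)

text \<open>The term in which B replaces a beta by a delta is positive, and all other terms are
  non-negative. The number of gammas and the presence of alpha are kept under control because the
  later steps need both.\<close>

lemma act_B_pos:
  assumes "\<And>v. nn (F v)" "count_list w gen_beta = Suc b"
    "\<And>v. count_list v gen_beta = b \<Longrightarrow> count_list v gen_gamma = count_list w gen_gamma \<Longrightarrow>
       gen_alpha \<in> set v \<longleftrightarrow> gen_alpha \<in> set w \<Longrightarrow> pos (F v)"
  shows "pos (act q gen_B w F)"
  using assms
proof (induction w arbitrary: F b)
  case (Cons g w)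
  have n: "nn (act q gen_B w (\<lambda>v. F (g # v)))" by (rule nn_act) (rule Cons.prems)
  show ?case
  proof (cases "g = gen_beta")
    case True
    have "pos (F (gen_delta # w))" by (rule Cons.prems(3)) (use Cons.prems(2) True in auto)
    then show ?thesis using nn_pos(5)[OF nn_pos(2)[OF nn_pos(3)[OF pos_wt(1)] n] nn_pos(6)[OF pos_wt(4)]]
      by (simp add: act_B True del: rwt.simps rwt'.simps)
  next
    case False
    have "pos (act q gen_B w (\<lambda>v. F (g # v)))"
      by (rule Cons.IH[where b = b]) (use Cons.prems False in auto)
    moreover have "nn (case g of gen_alpha \<Rightarrow> rw' q w * F (gen_gamma # w) | gen_beta \<Rightarrow> rw' q w * F (gen_delta # w) | _ \<Rightarrow> 0)"
      using Cons.prems(1) by (cases g) (auto intro: nn_pos(2) nn_pos(3) pos_wt)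
    ultimately show ?thesis
      unfolding act_B by (intro nn_pos(4) nn_pos(6)[OF pos_wt(1)])
  qed
qed simp

lemma act_C_pos:
  assumes "\<And>v. nn (F v)" "count_list w gen_gamma = Suc b"
    "\<And>v. count_list v gen_gamma = b \<Longrightarrow> count_list v gen_beta = count_list w gen_beta \<Longrightarrow>
       gen_delta \<in> set v \<longleftrightarrow> gen_delta \<in> set w \<Longrightarrow> pos (F v)"
  shows "pos (act q gen_C w F)"
  using assms
proof (induction w arbitrary: F b)
  case (Cons g w)
  have n: "nn (act q gen_C w (\<lambda>v. F (g # v)))" by (rule nn_act) (rule Cons.prems)
  show ?case
  proof (cases "g = gen_gamma")
    case True
    have "pos (F (gen_alpha # w))" by (rule Cons.prems(3)) (use Cons.prems(2) True in auto)
    then show ?thesis using nn_pos(5)[OF nn_pos(2)[OF nn_pos(3)[OF pos_wt(1)] n] nn_pos(6)[OF pos_wt(4)]]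
      by (simp add: act_C True del: rwt.simps rwt'.simps)
  next
    case False
    have "pos (act q gen_C w (\<lambda>v. F (g # v)))"
      by (rule Cons.IH[where b = b]) (use Cons.prems False in auto)
    moreover have "nn (case g of gen_gamma \<Rightarrow> rw' q w * F (gen_alpha # w) | gen_delta \<Rightarrow> rw' q w * F (gen_beta # w) | _ \<Rightarrow> 0)"
      using Cons.prems(1) by (cases g) (auto intro: nn_pos(2) nn_pos(3) pos_wt)
    ultimately show ?thesis
      unfolding act_C by (intro nn_pos(4) nn_pos(6)[OF pos_wt(1)])
  qed
qed simp

lemma pos_eps: "count_list w gen_gamma = 0 \<Longrightarrow> count_list w gen_beta = 0 \<Longrightarrow> pos (prod_list (map epA w))"
proof (induction w)
  case (Cons g w)
  then show ?case by (cases g) auto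
qed simp

lemma pw_Bs_pos: "count_list w gen_gamma = 0 \<Longrightarrow> count_list w gen_beta = b \<Longrightarrow> pos (pw q (replicate b gen_B) w)"
proof (induction b arbitrary: w)
  case (Suc b)
  show ?case unfolding replicate_Suc pw_Cons
    by (rule act_B_pos[where b = b]) (use Suc nn_pw in auto)
qed (simp add: pos_eps)

lemma pw_Cs_pos: "count_list w gen_beta = 0 \<Longrightarrow> count_list w gen_gamma = b \<Longrightarrow> pos (pw q (replicate b gen_C) w)"
proof (induction b arbitrary: w)
  case (Suc b)
  show ?case unfolding replicate_Suc pw_Cons
    by (rule act_C_pos[where b = b]) (use Suc nn_pw in auto)
qed (simp add: pos_eps)

lemma pw_CsBs_pos: "count_list w gen_gamma = c \<Longrightarrow> count_list w gen_beta = b \<Longrightarrow>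
   pos (pw q (replicate c gen_C @ replicate b gen_B) w)"
proof (induction c arbitrary: w)
  case (Suc c)
  show ?case unfolding replicate_Suc append_Cons pw_Cons
    by (rule act_C_pos[where b = c]) (use Suc nn_pw in auto)
qed (simp add: pw_Bs_pos)

lemma pw_BsCs_pos: "count_list w gen_gamma = c \<Longrightarrow> count_list w gen_beta = b \<Longrightarrow>
   pos (pw q (replicate b gen_B @ replicate c gen_C) w)"
proof (induction b arbitrary: w)
  case (Suc b)
  show ?case unfolding replicate_Suc append_Cons pw_Cons
    by (rule act_B_pos[where b = b]) (use Suc nn_pw in auto)
qed (simp add: pw_Cs_pos)

lemma uq_functional_pw: "uq_functional q (\<lambda>a. pw q a w)"
  by (rule UfunI) (rule pw_kills_Uq[OF q])

lemma uq_functional_row: "uq_functional q (row q \<xi>)"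
proof (rule UfunI)
  fix t assume "t \<in> ideal_span (Uq_rels q)"
  then show "lin (\<lambda>x. row q \<xi> (unw x)) t = 0"
    using bil_ideal_span_l[OF q, of t \<xi>] by (simp add: bil_def)
qed

text \<open>Moving A from the front to the back of \<open>xs\<close> costs \<open>qs q xs\<close>,
  while on the word \<open>w\<close> it is read off as row weight in front and as column weight at
  the back.\<close>

lemma pw_balance:
  assumes "pw q xs w \<noteq> 0" "set xs \<subseteq> BC"
  shows "rw q w = qs q xs * cw q w"
proof -
  have "rw q w * pw q xs w = pw q (gen_A # xs) w" by (simp only: pw_Cons act_A)
  also have "\<dots> = qs q xs * pw q (xs @ [gen_A]) w"
    using uq_functional_A[OF uq_functional_pw assms(2), of "[]" "[]"] by simp
  finally show ?thesis using assms(1) by (simp add: pw_snoc_A)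
qed

lemma pw_As: "pw q (replicate k gen_A @ xs) w = rw q w ^ k * pw q xs w"
  by (induction k) (simp_all add: pw_Cons act_A del: pw.simps)

end

section \<open>Ordered monomials span the function algebra\<close>

text \<open>The words of a Poincare-Birkhoff-Witt basis. Only spanning is proved here; independence
  is contained in the separation argument of \<open>nondegenerate\<close>.\<close>

definition Mon :: "agen list set" where
  "Mon = {replicate i gen_gamma @ replicate j gen_beta @ replicate n x | i j n x. x = gen_alpha \<or> x = gen_delta}"

lemma single_append: "Poly_Mapping.single (Word (u @ v)) (1::complex) = Poly_Mapping.single (Word u) 1 * Poly_Mapping.single (Word v) 1"
  by (simp add: mult_single)

lemma single_replicate: "Poly_Mapping.single (Word (replicate n g)) (1::complex) = gen g ^ n"
proof (induction n)
  case 0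
  show ?case by (simp flip: zero_word_def)
next
  case (Suc n)
  then show ?case using single_append[of "[g]" "replicate n g"] by (simp add: gen_def)
qed

lemma mult_const_left: "x * (const c * y) = const c * (x * y)"
  using const_comm[of x c] by (metis mult.assoc)

definition eqv :: "('m::monoid_add \<Rightarrow>\<^sub>0 complex) set \<Rightarrow> _ \<Rightarrow> _ \<Rightarrow> bool" where
  "eqv R x y \<longleftrightarrow> x - y \<in> ideal_span R"

lemma eqv_refl [simp]: "eqv R x x" by (simp add: eqv_def ideal_span_0)
lemma eqv_sym: "eqv R x y \<Longrightarrow> eqv R y x" using ideal_span_minus[of "x - y" R] by (simp add: eqv_def)
lemma eqv_trans [trans]: "eqv R x y \<Longrightarrow> eqv R y z \<Longrightarrow> eqv R x z"
  using ideal_span_add[of "x - y" R "y - z"] by (simp add: eqv_def)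
lemma eqv_mult_l: "eqv R x y \<Longrightarrow> eqv R (z * x) (z * y)"
  using ideal_span_multl[of "x - y" R z] by (simp add: eqv_def algebra_simps)
lemma eqv_mult_r: "eqv R x y \<Longrightarrow> eqv R (x * z) (y * z)"
  using ideal_span_multr[of "x - y" R z] by (simp add: eqv_def algebra_simps)
lemma eqv_add: "eqv R x y \<Longrightarrow> eqv R x' y' \<Longrightarrow> eqv R (x + x') (y + y')"
  using ideal_span_add[of "x - y" R "x' - y'"] by (simp add: eqv_def algebra_simps)

lemma eqv_pow_comm:
  assumes "eqv R (x * y) (const \<kappa> * (y * x))"
  shows "eqv R (x ^ n * y) (const (\<kappa> ^ n) * (y * x ^ n))"
proof (induction n)
  case (Suc n)
  have "eqv R (x ^ Suc n * y) (x ^ n * (const \<kappa> * (y * x)))"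
    using eqv_mult_l[OF assms, of "x ^ n"] by (simp add: mult.assoc power_commutes flip: power_Suc2)
      (simp add: power_commutes flip: mult.assoc)
  also have "x ^ n * (const \<kappa> * (y * x)) = const \<kappa> * (x ^ n * y) * x"
    by (simp add: mult_const_left mult.assoc)
  also have "eqv R \<dots> (const \<kappa> * (const (\<kappa> ^ n) * (y * x ^ n)) * x)"
    by (intro eqv_mult_r eqv_mult_l Suc)
  also have "const \<kappa> * (const (\<kappa> ^ n) * (y * x ^ n)) * x = const (\<kappa> ^ Suc n) * (y * x ^ Suc n)"
    by (simp add: const_const mult.assoc power_commutes)
  finally show ?case .
qed simp

definition mon_span :: "real \<Rightarrow> agen falg set" where
  "mon_span q = {\<xi>. \<exists>\<eta>. Poly_Mapping.keys \<eta> \<subseteq> Word ` Mon \<and> eqv (Aq_rels q) \<xi> \<eta>}"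

lemma mon_span_eqv: "eqv (Aq_rels q) x y \<Longrightarrow> y \<in> mon_span q \<Longrightarrow> x \<in> mon_span q"
  by (auto simp: mon_span_def intro: eqv_trans)

lemma mon_span_add: "x \<in> mon_span q \<Longrightarrow> y \<in> mon_span q \<Longrightarrow> x + y \<in> mon_span q"
proof -
  assume "x \<in> mon_span q" "y \<in> mon_span q"
  then obtain x' y' where "Poly_Mapping.keys x' \<subseteq> Word ` Mon" "Poly_Mapping.keys y' \<subseteq> Word ` Mon"
    "eqv (Aq_rels q) x x'" "eqv (Aq_rels q) y y'" by (auto simp: mon_span_def)
  then show ?thesis unfolding mon_span_def using keys_add[of x' y']
    by (intro CollectI exI[of _ "x' + y'"]) (auto intro: eqv_add)
qed

lemma mon_span_const: "x \<in> mon_span q \<Longrightarrow> const c * x \<in> mon_span q"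
proof -
  assume "x \<in> mon_span q"
  then obtain x' where x': "Poly_Mapping.keys x' \<subseteq> Word ` Mon" "eqv (Aq_rels q) x x'" by (auto simp: mon_span_def)
  have "Poly_Mapping.keys (const c * x') \<subseteq> Poly_Mapping.keys x'"
    using keys_mult[of "const c" x'] by (auto simp: const_def split: if_splits)
  then show ?thesis unfolding mon_span_def using x'
    by (intro CollectI exI[of _ "const c * x'"]) (auto intro: eqv_mult_l)
qed

lemma mon_span_0: "0 \<in> mon_span q" unfolding mon_span_def by (intro CollectI exI[of _ 0]) auto

lemma mon_span_sum: "(\<And>i. i \<in> S \<Longrightarrow> x i \<in> mon_span q) \<Longrightarrow> (\<Sum>i\<in>S. x i) \<in> mon_span q"
  by (induction S rule: infinite_finite_induct) (auto intro: mon_span_add mon_span_0)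

lemma mon_span_mon:
  "gen gen_gamma ^ i * (gen gen_beta ^ j * gen gen_alpha ^ n) \<in> mon_span q"
  "gen gen_gamma ^ i * (gen gen_beta ^ j * gen gen_delta ^ n) \<in> mon_span q"
proof -
  have "Poly_Mapping.single (Word (replicate i gen_gamma @ replicate j gen_beta @ replicate n x)) 1 \<in> mon_span q"
    if x: "x = gen_alpha \<or> x = gen_delta" for x
  proof -
    have "replicate i gen_gamma @ replicate j gen_beta @ replicate n x \<in> Mon"
      unfolding Mon_def using x by blast
    then show ?thesis
    unfolding mon_span_def
    by (intro CollectI exI[of _ "Poly_Mapping.single (Word (replicate i gen_gamma @ replicate j gen_beta @ replicate n x)) 1"]) auto
  qed
  then show "gen gen_gamma ^ i * (gen gen_beta ^ j * gen gen_alpha ^ n) \<in> mon_span q"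
    "gen gen_gamma ^ i * (gen gen_beta ^ j * gen gen_delta ^ n) \<in> mon_span q"
    unfolding single_append single_replicate by blast+
qed

text \<open>Right multiplication by a generator stays in the span: beta and gamma move left at the
  cost of a scalar, and a product of alpha and delta is replaced by 1 plus a multiple of beta
  gamma.\<close>

lemma mon_span_mult_gen:
  assumes q: "0 < q" and x: "x \<in> mon_span q"
  shows "x * gen g \<in> mon_span q"
proof -
  define k where "k = complex_of_real q"
  have k: "k \<noteq> 0" using q by (simp add: k_def)
  define a b c d where "a = gen gen_alpha" "b = gen gen_beta" "c = gen gen_gamma" "d = gen gen_delta"
  note abcd = this
  let ?e = "eqv (Aq_rels q)"
  have R: "a * b - const k * (b * a) \<in> Aq_rels q" "a * c - const k * (c * a) \<in> Aq_rels q"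
    "b * d - const k * (d * b) \<in> Aq_rels q" "c * d - const k * (d * c) \<in> Aq_rels q" "b * c - c * b \<in> Aq_rels q"
    "a * d - const k * (b * c) - 1 \<in> Aq_rels q" "d * a - const (inverse k) * (b * c) - 1 \<in> Aq_rels q"
    by (simp_all add: Aq_rels_def Let_def abcd k_def mult.assoc)
  have ab: "?e (a * b) (const k * (b * a))" and ac: "?e (a * c) (const k * (c * a))"
    and bd: "?e (b * d) (const k * (d * b))" and cd: "?e (c * d) (const k * (d * c))"
    and bc: "?e (b * c) (const 1 * (c * b))"
    and ad: "?e (a * d) (1 + const k * (b * c))" and da: "?e (d * a) (1 + const (inverse k) * (b * c))"
    using R[THEN ideal_span_gen] by (simp_all add: eqv_def algebra_simps)
  have db: "?e (d * b) (const (inverse k) * (b * d))" and dc: "?e (d * c) (const (inverse k) * (c * d))"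
    using eqv_mult_l[OF eqv_sym[OF bd], of "const (inverse k)"] eqv_mult_l[OF eqv_sym[OF cd], of "const (inverse k)"] k
    by (simp_all add: const_const)
  \<comment> \<open>Here \<open>y\<close> is alpha or delta, with commutation factor
    \<open>\<kappa>\<close>, so both families of monomials are treated at once.\<close>
  have gen1: "c ^ i * (b ^ j * y ^ n) * b \<in> mon_span q" "c ^ i * (b ^ j * y ^ n) * c \<in> mon_span q"
     "?e (c ^ i * (b ^ j * y ^ n) * b) (const (\<kappa> ^ n) * (c ^ i * (b ^ Suc j * y ^ n)))"
    if yb: "?e (y * b) (const \<kappa> * (b * y))" and yc: "?e (y * c) (const \<kappa> * (c * y))"
     and S: "\<And>i j n. c ^ i * (b ^ j * y ^ n) \<in> mon_span q" for i j n y \<kappa>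
  proof -
    have "?e (c ^ i * b ^ j * (y ^ n * b)) (c ^ i * b ^ j * (const (\<kappa> ^ n) * (b * y ^ n)))"
      by (intro eqv_mult_l eqv_pow_comm yb)
    also have "c ^ i * b ^ j * (const (\<kappa> ^ n) * (b * y ^ n)) = const (\<kappa> ^ n) * (c ^ i * (b ^ Suc j * y ^ n))"
      by (simp add: mult_const_left mult.assoc power_commutes) (simp add: power_commutes flip: mult.assoc)
    finally show 1: "?e (c ^ i * (b ^ j * y ^ n) * b) (const (\<kappa> ^ n) * (c ^ i * (b ^ Suc j * y ^ n)))"
      by (simp add: mult.assoc)
    show "c ^ i * (b ^ j * y ^ n) * b \<in> mon_span q"
      by (rule mon_span_eqv[OF 1]) (intro mon_span_const S)
    have "?e (c ^ i * b ^ j * (y ^ n * c)) (c ^ i * b ^ j * (const (\<kappa> ^ n) * (c * y ^ n)))"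
      by (intro eqv_mult_l eqv_pow_comm yc)
    also have "c ^ i * b ^ j * (const (\<kappa> ^ n) * (c * y ^ n)) = const (\<kappa> ^ n) * (c ^ i * (b ^ j * c) * y ^ n)"
      by (simp add: mult_const_left mult.assoc)
    also have "?e \<dots> (const (\<kappa> ^ n) * (c ^ i * (const (1 ^ j) * (c * b ^ j)) * y ^ n))"
      by (intro eqv_mult_l eqv_mult_r eqv_pow_comm bc)
    also have "const (\<kappa> ^ n) * (c ^ i * (const (1 ^ j) * (c * b ^ j)) * y ^ n) = const (\<kappa> ^ n) * (c ^ Suc i * (b ^ j * y ^ n))"
      by (simp add: mult.assoc) (simp add: power_commutes flip: mult.assoc)
    finally have 2: "?e (c ^ i * (b ^ j * y ^ n) * c) (const (\<kappa> ^ n) * (c ^ Suc i * (b ^ j * y ^ n)))"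
      by (simp add: mult.assoc)
    show "c ^ i * (b ^ j * y ^ n) * c \<in> mon_span q"
      by (rule mon_span_eqv[OF 2]) (intro mon_span_const S)
  qed
  \<comment> \<open>Here \<open>y\<close> and \<open>z\<close> are alpha and delta in either order;
    the determinant relation lowers the exponent of \<open>y\<close> by one.\<close>
  have gen2: "c ^ i * (b ^ j * y ^ Suc n) * z \<in> mon_span q"
    if yb: "?e (y * b) (const \<kappa> * (b * y))" and yc: "?e (y * c) (const \<kappa> * (c * y))"
     and yz: "?e (y * z) (1 + const k' * (b * c))"
     and S: "\<And>i j n. c ^ i * (b ^ j * y ^ n) \<in> mon_span q" for i j n y \<kappa> z k'
  proof -
    have "?e (c ^ i * (b ^ j * y ^ n) * (y * z)) (c ^ i * (b ^ j * y ^ n) * (1 + const k' * (b * c)))"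
      by (intro eqv_mult_l yz)
    also have "c ^ i * (b ^ j * y ^ n) * (1 + const k' * (b * c)) = c ^ i * (b ^ j * y ^ n) + const k' * (c ^ i * (b ^ j * y ^ n) * b * c)"
      by (simp add: distrib_left mult_const_left mult.assoc)
    finally have 1: "?e (c ^ i * (b ^ j * y ^ Suc n) * z) (c ^ i * (b ^ j * y ^ n) + const k' * (c ^ i * (b ^ j * y ^ n) * b * c))"
      by (simp add: mult.assoc power_commutes) (simp add: power_commutes flip: mult.assoc)
    have "?e (c ^ i * (b ^ j * y ^ n) * b * c) (const (\<kappa> ^ n) * (c ^ i * (b ^ Suc j * y ^ n)) * c)"
      using gen1(3)[OF yb yc S] by (intro eqv_mult_r)
    moreover have "const (\<kappa> ^ n) * (c ^ i * (b ^ Suc j * y ^ n)) * c \<in> mon_span q"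
      using mon_span_const[OF gen1(2)[OF yb yc S, of i "Suc j" n]] by (simp add: mult.assoc)
    ultimately have "c ^ i * (b ^ j * y ^ n) * b * c \<in> mon_span q" by (rule mon_span_eqv)
    then show ?thesis by (intro mon_span_eqv[OF 1] mon_span_add mon_span_const S)
  qed
  note SA = mon_span_mon(1)[of _ _ _ q, folded abcd] and SD = mon_span_mon(2)[of _ _ _ q, folded abcd]
  have A: "c ^ i * (b ^ j * a ^ n) * gen g \<in> mon_span q" for i j n
  proof (cases g)
    case gen_alpha
    have "c ^ i * (b ^ j * a ^ n) * a = c ^ i * (b ^ j * a ^ Suc n)" by (simp add: mult.assoc power_commutes)
    then show ?thesis using SA[of i j "Suc n"] gen_alpha by (simp only: abcd)
  next
    case gen_delta
    show ?thesis
    proof (cases n)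
      case 0
      have "c ^ i * (b ^ j * a ^ n) * d = c ^ i * (b ^ j * d ^ 1)" by (simp add: 0 mult.assoc)
      then show ?thesis using SD[of i j 1] gen_delta by (simp only: abcd)
    next
      case (Suc n')
      then show ?thesis using gen2[OF ab ac ad SA] gen_delta abcd by simp
    qed
  qed (use gen1(1,2)[OF ab ac SA, of i j n] abcd in auto)
  have D: "c ^ i * (b ^ j * d ^ n) * gen g \<in> mon_span q" for i j n
  proof (cases g)
    case gen_delta
    have "c ^ i * (b ^ j * d ^ n) * d = c ^ i * (b ^ j * d ^ Suc n)" by (simp add: mult.assoc power_commutes)
    then show ?thesis using SD[of i j "Suc n"] gen_delta by (simp only: abcd)
  next
    case gen_alpha
    show ?thesis
    proof (cases n)
      case 0
      have "c ^ i * (b ^ j * d ^ n) * a = c ^ i * (b ^ j * a ^ 1)" by (simp add: 0 mult.assoc)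
      then show ?thesis using SA[of i j 1] gen_alpha by (simp only: abcd)
    next
      case (Suc n')
      then show ?thesis using gen2[OF db dc da SD] gen_alpha abcd by simp
    qed
  qed (use gen1(1,2)[OF db dc SD, of i j n] abcd in auto)
  obtain \<eta> where \<eta>: "Poly_Mapping.keys \<eta> \<subseteq> Word ` Mon" "?e x \<eta>" using x by (auto simp: mon_span_def)
  have m: "Poly_Mapping.single w 1 * gen g \<in> mon_span q" if "w \<in> Word ` Mon" for w
  proof -
    from that obtain i j n y where w: "w = Word (replicate i gen_gamma @ replicate j gen_beta @ replicate n y)"
      and y: "y = gen_alpha \<or> y = gen_delta" by (auto simp: Mon_def)
    have "Poly_Mapping.single w 1 = c ^ i * (b ^ j * gen y ^ n)"
      unfolding w single_append single_replicate abcd ..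
    then show ?thesis using A D y abcd by auto
  qed
  have "\<eta> = (\<Sum>w\<in>Poly_Mapping.keys \<eta>. Poly_Mapping.single w (Poly_Mapping.lookup \<eta> w))"
    by (rule poly_mapping_eqI)
      (auto simp: lookup_sum lookup_single when_def not_in_keys_iff_lookup_eq_zero)
  then have "\<eta> * gen g = (\<Sum>w\<in>Poly_Mapping.keys \<eta>. Poly_Mapping.single w (Poly_Mapping.lookup \<eta> w)) * gen g" by simp
  also have "\<dots> = (\<Sum>w\<in>Poly_Mapping.keys \<eta>. const (Poly_Mapping.lookup \<eta> w) * (Poly_Mapping.single w 1 * gen g))"
    by (simp add: sum_distrib_right const_single flip: mult.assoc)
  also have "\<dots> \<in> mon_span q" using \<eta>(1) m by (intro mon_span_sum mon_span_const) auto
  finally show ?thesis using eqv_mult_r[OF \<eta>(2)] mon_span_eqv by blast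
qed

lemma mon_span_UNIV: assumes "0 < q" shows "\<xi> \<in> mon_span q"
proof (induction \<xi> rule: pm_induct)
  case (1 w c)
  have "Poly_Mapping.single (Word xs) 1 \<in> mon_span q" for xs
  proof (induction xs rule: rev_induct)
    case Nil
    show ?case using mon_span_mon(1)[of 0 0 0 q] by (simp flip: zero_word_def)
  next
    case (snoc g xs)
    then show ?case using mon_span_mult_gen[OF assms snoc, of g] by (simp add: gen_def mult_single)
  qed
  then have "const c * Poly_Mapping.single (Word (unw w)) 1 \<in> mon_span q" by (rule mon_span_const)
  then show ?case by (cases w) (simp add: const_single)
qed (rule mon_span_add)

lemma qs_BsCs: "q \<noteq> 0 \<Longrightarrow> qs q (replicate c gen_C @ replicate b gen_B) = complex_of_real q ^ b * inverse (complex_of_real q) ^ c"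
  "q \<noteq> 0 \<Longrightarrow> qs q (replicate b gen_B @ replicate c gen_C) = complex_of_real q ^ b * inverse (complex_of_real q) ^ c"
  by (simp_all add: qs_def prod_list_replicate)

lemma count_list_replicate: "count_list (replicate n x) y = (if x = y then n else 0)"
  by (induction n) auto

text \<open>This and the next four eliminate the row weight, the column weight and the factor
  \<open>qs\<close> between monomial equations. Stated for arbitrary numbers, they keep the unfolded
  weights out of the calculation.\<close>

lemma weight_identity_1:
  "r = s * c \<Longrightarrow> s * u = v \<Longrightarrow> r * u = v * (c :: complex)"
  by auto

lemma weight_identity_2:
  assumes "r * (x * y) = z" "c * (z * y) = x" "r * u = v * (c :: complex)"
  shows "z * u * z = v * x * x"
proof -
  have "z * u * z = (r * (x * y)) * u * z" using assms(1) by simp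
  also have "\<dots> = (r * u) * x * (z * y)" by (simp only: ac_simps)
  also have "\<dots> = v * x * (c * (z * y))" unfolding assms(3) by (simp only: ac_simps)
  finally show ?thesis unfolding assms(2) .
qed

lemma weight_identity_3:
  assumes "r * (x * y) = z" "r * u = v * (w :: complex)"
  shows "z * u = v * w * (x * y)"
proof -
  have "z * u = (r * u) * (x * y)" unfolding assms(1)[symmetric] by (simp only: ac_simps)
  then show ?thesis unfolding assms(2) .
qed

lemma weight_identity_4:
  assumes "r * x = z * y" "c * z = x * y" "r * u = v * (c :: complex)"
  shows "z * y * u * z = v * (x * y) * x"
proof -
  have "z * y * u * z = (r * u) * x * z" unfolding assms(1)[symmetric] by (simp only: ac_simps)
  also have "\<dots> = v * (c * z) * x" unfolding assms(3) by (simp only: ac_simps)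
  finally show ?thesis unfolding assms(2) .
qed

lemma weight_identity_5:
  assumes "r * x = z * y" "r * (u * n) = (v :: complex)"
  shows "z * y * (u * n) = v * x"
  unfolding assms(1)[symmetric] assms(2)[symmetric] by (simp only: ac_simps)

text \<open>Paired with A^k followed by \<open>xs\<close>, a combination of ordered monomials
  becomes a sum of k-th powers of row weights. Power sums separate the weights, and a suitable
  \<open>xs\<close> then singles out one monomial. Only large k is assumed because that is what
  \<open>torus_vanish\<close> provides.\<close>

theorem nondegenerate:
  assumes q: "0 < q" "q < 1"
    and z: "\<And>xs. set xs \<subseteq> BC \<Longrightarrow> \<exists>K. \<forall>k\<ge>K. row q \<xi> (replicate k gen_A @ xs) = 0"
  shows "\<xi> \<in> ideal_span (Aq_rels q)"
proof -
  define h where "h = q powr (1/2)"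
  have h: "0 < h" "h < 1" using q powr_less_mono'[of q 0 "1/2"] by (auto simp: h_def)
  have h_const: "complex_of_real q = of_real h * of_real h" and h': "complex_of_real (q powr - (1/2)) = inverse (of_real h)"
    using q_half[OF q] q by (simp_all add: h_def powr_minus)
  have hz: "complex_of_real h \<noteq> 0" using h by simp
  obtain \<eta> where \<eta>: "Poly_Mapping.keys \<eta> \<subseteq> Word ` Mon" "eqv (Aq_rels q) \<xi> \<eta>"
    using mon_span_UNIV[OF q(1), of \<xi>] by (auto simp: mon_span_def)
  have row: "row q \<xi> xs = row q \<eta> xs" for xs
    using pw_kills_Aq[OF q, of "\<xi> - \<eta>" xs] \<eta>(2) by (simp add: row_def eqv_def lin_diff)
  \<comment> \<open>The test word for the monomial with i gammas, j betas and a power of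
    \<open>x\<close>; its order follows \<open>pw_CsBs\<close> for alpha and \<open>pw_BsCs\<close>
    for delta.\<close>
  define xsf where "xsf i j x = (if x = gen_alpha then replicate i gen_C @ replicate j gen_B
     else replicate j gen_B @ replicate i gen_C)" for i j :: nat and x
  let ?mon = "\<lambda>i j n x. replicate i gen_gamma @ replicate j gen_beta @ replicate n x"
  have xsf: "set (xsf i j x) \<subseteq> BC" for i j x by (auto simp: xsf_def)
  have cnt: "count_list (?mon i j n x) gen_gamma = i" "count_list (?mon i j n x) gen_beta = j"
    "y \<in> {gen_alpha, gen_delta} \<Longrightarrow> y \<noteq> x \<Longrightarrow> y \<notin> set (?mon i j n x)"
    if "x = gen_alpha \<or> x = gen_delta" for i j n x y using that by (auto simp: count_list_replicate)
  have rwA: "rw q (?mon i j n gen_alpha) * of_real h ^ i = of_real h ^ j * of_real h ^ n" for i j n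
    using hz by (simp add: h' power_inverse field_simps flip: h_def)
  have rwD: "rw q (?mon i j n gen_delta) * (of_real h ^ i * of_real h ^ n) = of_real h ^ j" for i j n
    using hz by (simp add: h' power_inverse field_simps flip: h_def)
  have cwA: "cw q (?mon i j n gen_alpha) * of_real h ^ j = of_real h ^ i * of_real h ^ n" for i j n
    using hz by (simp add: h' power_inverse field_simps flip: h_def)
  have cwD: "cw q (?mon i j n gen_delta) * (of_real h ^ j * of_real h ^ n) = of_real h ^ i" for i j n
    using hz by (simp add: h' power_inverse field_simps flip: h_def)
  have qsx: "qs q (xsf i j x) * of_real h ^ (2 * i) = of_real h ^ (2 * j)" for i j x
    using q hz by (auto simp: xsf_def qs_BsCs h_const power_inverse power_mult_distrib field_simps) (simp_all add: power_mult power2_eq_square ac_simps)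
  have inj: "of_real h ^ m = complex_of_real h ^ n \<Longrightarrow> m = n" for m n
    by (rule of_real_pow_inj[OF h])
  \<comment> \<open>Among ordered monomials of equal row weight, only \<open>m\<close> can pair
    nontrivially with its test word. For a competitor of the same kind the letters are counted; for
    one of the other kind the weights are contradictory.\<close>
  have uniq: "w = m" if m: "m = ?mon i j n x" "x = gen_alpha \<or> x = gen_delta" and w: "w \<in> Mon"
    and eq: "rw q w = rw q m" and nz: "pw q (xsf i j x) w \<noteq> 0" for w m i j n x
  proof -
    from w obtain i' j' n' x' where w': "w = ?mon i' j' n' x'" "x' = gen_alpha \<or> x' = gen_delta"
      by (auto simp: Mon_def)
    have bal: "rw q w = qs q (xsf i j x) * cw q w" by (rule pw_balance[OF q nz xsf])
    show ?thesis
    proof (cases "x' = x \<or> n' = 0")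
      case True
      have nx: "(if x = gen_alpha then gen_delta else gen_alpha) \<notin> set w"
        using True w'(2) m(2) unfolding w'(1) by auto
      have ij: "i' = i \<and> j' = j"
        using nx nz pw_CsBs[of q i j w] pw_BsCs[of q j i w] cnt(1,2)[OF w'(2), of i' j' n'] m(2)
        by (auto simp: xsf_def w'(1) simp del: count_list_append split: if_splits)
      have "n' = n"
      proof (cases "x = gen_alpha")
        case xa: True
        have "rw q w * of_real h ^ i = of_real h ^ j * of_real h ^ n'"
          using True rwA[of i j n'] xa ij w' by (auto simp: rwA)
        moreover have "rw q m * of_real h ^ i = of_real h ^ j * of_real h ^ n" using rwA[of i j n] xa m by simp
        ultimately have "complex_of_real h ^ n' = of_real h ^ n" using eq hz by simp
        then show ?thesis by (rule inj)
      next
        case False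
        then have xd: "x = gen_delta" using m by simp
        have "rw q w * (of_real h ^ i * of_real h ^ n') = of_real h ^ j"
          using True rwD[of i j n'] xd ij w' by (auto simp: rwD)
        moreover have "rw q m * (of_real h ^ i * of_real h ^ n) = of_real h ^ j" using rwD[of i j n] xd m by simp
        ultimately have "(rw q w * of_real h ^ i) * of_real h ^ n' = (rw q w * of_real h ^ i) * of_real h ^ n"
          using eq by (simp add: mult.assoc)
        moreover have "rw q w \<noteq> 0" using pos_wt(3)[OF q, of w] by auto
        ultimately have "complex_of_real h ^ n' = of_real h ^ n"
          using hz by (metis mult_left_cancel mult_eq_0_iff power_not_zero)
        then show ?thesis by (rule inj)
      qed
      then show ?thesis using ij True w' m by auto
    next
      case False
      have rz: "rw q w \<noteq> 0" using pos_wt(3)[OF q, of w] by auto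
      show ?thesis
      proof (cases "x = gen_alpha")
        case xa: True
        then have xd: "x' = gen_delta" using False w' by auto
        have e1: "rw q w * (of_real h ^ i' * of_real h ^ n') = of_real h ^ j'" using rwD xd w' by simp
        have e2: "cw q w * (of_real h ^ j' * of_real h ^ n') = of_real h ^ i'" using cwD xd w' by simp
        have e3: "rw q w * of_real h ^ i = of_real h ^ j * of_real h ^ n" using eq rwA[of i j n] xa m by simp
        have e4: "rw q w * of_real h ^ (2 * i) = of_real h ^ (2 * j) * cw q w"
          using bal qsx[of i j x] by (rule weight_identity_1)
        have "of_real h ^ j' * of_real h ^ (2 * i) * (of_real h ^ j') = of_real h ^ (2 * j) * of_real h ^ i' * complex_of_real h ^ i'"
          using e1 e2 e4 by (rule weight_identity_2)
        then have "complex_of_real h ^ (j' + 2 * i + j') = of_real h ^ (2 * j + i' + i')" by (simp only: power_add)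
        \<comment> \<open>This says i + j' = i' + j. Equality of the row weights then leaves n + n'
          = 0, although n' is positive.\<close>
        then have f1: "j' + 2 * i + j' = 2 * j + i' + i'" by (rule inj)
        have "of_real h ^ j' * of_real h ^ i = of_real h ^ j * of_real h ^ n * (of_real h ^ i' * complex_of_real h ^ n')"
          using e1 e3 by (rule weight_identity_3)
        then have "complex_of_real h ^ (j' + i) = of_real h ^ (j + n + (i' + n'))" by (simp only: power_add)
        then have "j' + i = j + n + (i' + n')" by (rule inj)
        then show ?thesis using f1 False by simp
      next
        case xna: False
        then have xd: "x = gen_delta" "x' = gen_alpha" using False w' m by auto
        have e1: "rw q w * of_real h ^ i' = of_real h ^ j' * of_real h ^ n'" using rwA xd w' by simp
        have e2: "cw q w * of_real h ^ j' = of_real h ^ i' * of_real h ^ n'" using cwA xd w' by simp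
        have e3: "rw q w * (of_real h ^ i * of_real h ^ n) = of_real h ^ j" using eq rwD[of i j n] xd m by simp
        have e4: "rw q w * of_real h ^ (2 * i) = of_real h ^ (2 * j) * cw q w"
          using bal qsx[of i j x] by (rule weight_identity_1)
        have "of_real h ^ j' * of_real h ^ n' * of_real h ^ (2 * i) * (of_real h ^ j') = of_real h ^ (2 * j) * (of_real h ^ i' * of_real h ^ n') * complex_of_real h ^ i'"
          using e1 e2 e4 by (rule weight_identity_4)
        then have "complex_of_real h ^ (j' + n' + 2 * i + j') = of_real h ^ (2 * j + (i' + n') + i')" by (simp only: power_add)
        then have f1: "j' + n' + 2 * i + j' = 2 * j + (i' + n') + i'" by (rule inj)
        have "of_real h ^ j' * of_real h ^ n' * (of_real h ^ i * of_real h ^ n) = of_real h ^ j * complex_of_real h ^ i'"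
          using e1 e3 by (rule weight_identity_5)
        then have "complex_of_real h ^ (j' + n' + (i + n)) = of_real h ^ (j + i')" by (simp only: power_add)
        then have "j' + n' + (i + n) = j + i'" by (rule inj)
        then show ?thesis using f1 False by simp
      qed
    qed
  qed
  have "Poly_Mapping.lookup \<eta> w0 = 0" if w0: "w0 \<in> Poly_Mapping.keys \<eta>" for w0
  proof -
    from w0 \<eta>(1) obtain i j n x where m: "w0 = Word (?mon i j n x)" "x = gen_alpha \<or> x = gen_delta"
      by (auto simp: Mon_def)
    define xs where "xs = xsf i j x"
    obtain K where K: "\<And>k. k \<ge> K \<Longrightarrow> row q \<xi> (replicate k gen_A @ xs) = 0"
      using z[OF xsf[of i j x]] by (auto simp: xs_def)
    \<comment> \<open>The copies of A contribute the k-th power of the row weight, so the pairing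
      has the shape required by \<open>power_sums_zero\<close>.\<close>
    have "(\<Sum>w\<in>Poly_Mapping.keys \<eta>. (Poly_Mapping.lookup \<eta> w * pw q xs (unw w)) * rw q (unw w) ^ k) = 0" if "k \<ge> K" for k
      using K[OF that, unfolded row] by (simp add: row_def lin_def pw_As[OF q] ac_simps)
    moreover have rz: "rw q w \<noteq> 0" for w using pos_wt(3)[OF q, of w] by (metis nn_0(3))
    ultimately have S0: "(\<Sum>w\<in>{w\<in>Poly_Mapping.keys \<eta>. rw q (unw w) = rw q (unw w0)}. Poly_Mapping.lookup \<eta> w * pw q xs (unw w)) = 0"
      by (intro power_sums_zero[where K = K]) (use rz in auto)
    have "(\<Sum>w\<in>{w\<in>Poly_Mapping.keys \<eta>. rw q (unw w) = rw q (unw w0)}. Poly_Mapping.lookup \<eta> w * pw q xs (unw w))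
      = (\<Sum>w\<in>{w0}. Poly_Mapping.lookup \<eta> w * pw q xs (unw w))"
    proof (rule sum.mono_neutral_right)
      show "\<forall>w\<in>{w \<in> Poly_Mapping.keys \<eta>. rw q (unw w) = rw q (unw w0)} - {w0}. Poly_Mapping.lookup \<eta> w * pw q xs (unw w) = 0"
      proof
        fix w assume w: "w \<in> {w \<in> Poly_Mapping.keys \<eta>. rw q (unw w) = rw q (unw w0)} - {w0}"
        then have "unw w \<in> Mon" "w = Word (unw w)" using \<eta>(1) by auto
        have "pw q xs (unw w) = 0"
        proof (rule ccontr)
          assume "pw q xs (unw w) \<noteq> 0"
          then have "unw w = unw w0"
            using uniq[of "unw w0" i j n x "unw w"] w m \<open>unw w \<in> Mon\<close> unfolding xs_def by simp
          then have "w = w0" by (cases w; cases w0) simp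
          then show False using w by simp
        qed
        then show "Poly_Mapping.lookup \<eta> w * pw q xs (unw w) = 0" by simp
      qed
    qed (use w0 in auto)
    moreover have "pos (pw q xs (unw w0))"
      using pw_CsBs_pos[OF q cnt(1,2)[OF m(2), of i j n]] pw_BsCs_pos[OF q cnt(1,2)[OF m(2), of i j n]] m
      by (auto simp: xs_def xsf_def)
    ultimately show ?thesis using S0 by auto
  qed
  then have "\<eta> = 0" by (metis in_keys_iff keys_eq_empty ex_in_conv poly_mapping_eqI lookup_zero)
  then show ?thesis using \<eta>(2) by (simp add: eqv_def)
qed

section \<open>Functionals determined by their values on the torus\<close>

lemma qs_append: "qs q (u @ v) = qs q u * qs q v" by (simp add: qs_def)

lemma qs_nonzero: "q \<noteq> 0 \<Longrightarrow> qs q u \<noteq> 0" by (induction u) (auto simp: qs_def)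

lemma qs_simps [simp]: "qs q [] = 1" "qs q (gen_B # u) = complex_of_real q * qs q u"
  "qs q (gen_C # u) = inverse (complex_of_real q) * qs q u"
  by (simp_all add: qs_def)

lemma uq_functional_As:
  assumes "uq_functional q F" "set xs \<subseteq> BC"
  shows "F (u @ replicate k gen_A @ xs @ v) = qs q xs ^ k * F (u @ xs @ replicate k gen_A @ v)"
proof (induction k arbitrary: u)
  case (Suc k)
  have "F (u @ replicate (Suc k) gen_A @ xs @ v) = F ((u @ [gen_A]) @ replicate k gen_A @ xs @ v)" by simp
  also have "\<dots> = qs q xs ^ k * F ((u @ [gen_A]) @ xs @ replicate k gen_A @ v)" by (rule Suc)
  also have "\<dots> = qs q xs ^ Suc k * F (u @ xs @ gen_A # replicate k gen_A @ v)"
    using uq_functional_A[OF assms, of u "replicate k gen_A @ v"] by simp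
  finally show ?case by simp
qed simp

text \<open>Induction on the length of \<open>w\<close>: the last letter is B or C, and the right
  and the left equation each relate these two possibilities, modulo shorter words. The bound on
  \<open>k\<close> leaves enough copies of A to cancel the D's arising from the commutator of B and
  C.\<close>

lemma torus_vanish:
  assumes q: "0 < q" "q < 1" and U: "uq_functional q F"
    and x1: "x1 \<noteq> 0" and x2: "x2 = - x1 / complex_of_real q"
    and right: "\<And>u. x1 * F (u @ [gen_B, gen_A]) + x2 * F (u @ [gen_C, gen_A]) - s * (F (u @ [gen_A, gen_A]) - F u) = \<mu> * F u"
    and left: "\<And>v. x1 * F (gen_B # gen_A # v) + x2 * F (gen_C # gen_A # v) - t * (F (gen_A # gen_A # v) - F v) = \<nu> * F v"
    and torus: "\<And>k. F (replicate k gen_A) = 0"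
  shows "set w \<subseteq> BC \<Longrightarrow> k \<ge> 2 * length w + 2 \<Longrightarrow> F (replicate k gen_A @ w) = 0"
proof (induction "length w" arbitrary: w k rule: less_induct)
  case less
  define Q where "Q = complex_of_real q"
  have Q: "Q \<noteq> 0" using q by (simp add: Q_def)
  have qsn: "qs q u \<noteq> 0" for u using q by (simp add: qs_nonzero)
  note UA = uq_functional_A[OF U]
  define A where "A k = replicate k gen_A" for k
  have AS: "A (Suc k) = A k @ [gen_A]" for k by (simp add: A_def replicate_append_same)
  have AC: "A (Suc k) = gen_A # A k" for k by (simp add: A_def)
  show ?case
  proof (cases w rule: rev_cases)
    case Nil
    then show ?thesis using torus by simp
  next
    case (snoc w' x)
    define n where "n = length w'"
    have w': "set w' \<subseteq> BC" and k: "k \<ge> 2 * n + 4" using less.prems snoc by (auto simp: n_def)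
    have IH: "F (A m @ y) = 0" if "set y \<subseteq> BC" "length y \<le> n" "m \<ge> 2 * length y + 2" for m y
      using less.hyps[of y m] that snoc by (simp add: A_def n_def)
    have mA: "F (A m @ u @ gen_A # v) = F (A (Suc m) @ u @ v) / qs q u" if "set u \<subseteq> BC" for m u v
      using UA[OF that, of "A m" v] qsn[of u] by (simp add: AS)
    have mD: "F (A (Suc m) @ u @ gen_D # v) = qs q u * F (A m @ u @ v)" if "set u \<subseteq> BC" for m u v
    proof -
      have "F (A (Suc m) @ u @ gen_D # v) = qs q u * F (A m @ u @ gen_A # gen_D # v)"
        using UA[OF that, of "A m" "gen_D # v"] by (simp add: AS)
      also have "F (A m @ u @ gen_A # gen_D # v) = F (A m @ u @ v)"
        using U[unfolded uq_functional_def, rule_format, of "A m @ u" v] by simp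
      finally show ?thesis .
    qed
    \<comment> \<open>The commutator of B and C contributes words with two letters fewer; after
      moving A's and D's to the front these vanish by induction. Two D's cancel two copies of
      A.\<close>
    have sBC: "F (A k @ u @ gen_B # gen_C # v) = F (A k @ u @ gen_C # gen_B # v)"
      if uv: "set u \<subseteq> BC" "set v \<subseteq> BC" "length u + length v + 1 = n" for u v
    proof -
      have "k = Suc (Suc (k - 2))" "k - 2 \<ge> 2 * n + 2" using k by auto
      then obtain k' where k': "k = Suc (Suc k')" "k' \<ge> 2 * n + 2" by blast
      have "F (A k @ u @ gen_A # gen_A # v) = 0"
        using mA[OF uv(1), of k "gen_A # v"] mA[OF uv(1), of "Suc k" v] IH[of "u @ v" "Suc (Suc k)"] uv k by simp
      moreover have "F (A k @ u @ gen_D # gen_D # v) = 0"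
        using mD[OF uv(1), of "Suc k'" "gen_D # v"] mD[OF uv(1), of k' v] IH[of "u @ v" k'] uv k' by simp
      ultimately show ?thesis
        using U[unfolded uq_functional_def, rule_format, of "A k @ u" v] by simp
    qed
    have swap: "F (A k @ u @ y # z # v) = F (A k @ u @ z # y # v)"
      if "set u \<subseteq> BC" "set v \<subseteq> BC" "length u + length v + 1 = n" "y \<in> BC" "z \<in> BC" for u v y z
      using that sBC[of u v] by auto
    \<comment> \<open>Behind \<open>A k\<close> the letters B and C commute under \<open>F\<close>,
      so the last letter may be carried to the front, where the left equation can reach it.\<close>
    have rot: "F (A k @ u @ v @ [y]) = F (A k @ u @ y # v)"
      if "set u \<subseteq> BC" "set v \<subseteq> BC" "length u + length v = n" "y \<in> BC" for u v y
      using that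
    proof (induction v arbitrary: u)
      case (Cons z v)
      from Cons.IH[of "u @ [z]"] Cons.prems have "F (A k @ u @ (z # v) @ [y]) = F (A k @ u @ z # y # v)" by simp
      also have "\<dots> = F (A k @ u @ y # z # v)" by (rule swap) (use Cons.prems in auto)
      finally show ?case .
    qed simp
    obtain k' where k': "k = Suc k'" "k' \<ge> 2 * n + 3" using k by (cases k) auto
    have z0: "F (A k' @ w') = 0" "F (A (Suc (Suc k')) @ w') = 0"
      using IH[OF w', of k'] IH[OF w', of "Suc (Suc k')"] k' by (auto simp: n_def)
    define FB FC where "FB = F (A k @ w' @ [gen_B])" and "FC = F (A k @ w' @ [gen_C])"
    have "x1 * F (A k' @ w' @ [gen_B, gen_A]) + x2 * F (A k' @ w' @ [gen_C, gen_A]) = 0"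
      using right[of "A k' @ w'"] z0 mA[OF w', of k' "[gen_A]"] mA[OF w', of "Suc k'" "[]"] by simp
    moreover have "F (A k' @ w' @ [gen_B, gen_A]) = FB / (qs q w' * Q)"
      using mA[of "w' @ [gen_B]" k' "[]"] w' by (simp add: FB_def k' qs_append Q_def)
    moreover have "F (A k' @ w' @ [gen_C, gen_A]) = FC / (qs q w' * inverse Q)"
      using mA[of "w' @ [gen_C]" k' "[]"] w' by (simp add: FC_def k' qs_append Q_def)
    ultimately have "x1 * (FB / (qs q w' * Q)) + - x1 / Q * (FC / (qs q w' * inverse Q)) = 0"
      by (simp add: x2 Q_def)
    \<comment> \<open>The first ratio, from the equation on the right. In it, the A after the last
      letter is moved left, with factors q for B and 1/q for C.\<close>
    then have BC: "FB = Q * FC" using x1 Q qsn[of w'] by (simp add: field_simps)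
    have zl: "F (gen_A # gen_A # A k' @ w') = 0" using z0(2) by (simp add: AC)
    have "x1 * F (gen_B # gen_A # A k' @ w') + x2 * F (gen_C # gen_A # A k' @ w') = 0"
      using left[of "A k' @ w'"] z0(1) zl by simp
    moreover have "F (A k @ gen_B # w') = Q ^ k * F (gen_B # A k @ w')"
      using uq_functional_As[OF U, of "[gen_B]" "[]" k w'] by (simp add: A_def Q_def)
    then have "FB = Q ^ k * F (gen_B # gen_A # A k' @ w')"
      using rot[of "[]" w' gen_B] w' by (simp add: FB_def n_def k' AC)
    moreover have "F (A k @ gen_C # w') = inverse Q ^ k * F (gen_C # A k @ w')"
      using uq_functional_As[OF U, of "[gen_C]" "[]" k w'] by (simp add: A_def Q_def)
    then have "FC = inverse Q ^ k * F (gen_C # gen_A # A k' @ w')"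
      using rot[of "[]" w' gen_C] w' by (simp add: FC_def n_def k' AC)
    ultimately have "x1 * FB / Q ^ k + - x1 / Q * FC * Q ^ k = 0"
      using Q by (simp add: x2 Q_def[symmetric] power_inverse field_simps)
    \<comment> \<open>The second ratio: on the left the letter stands before all copies of A, and
      passing it through them gives the k-th powers. Together with the first ratio this leaves a
      factor that is nonzero for k > 1.\<close>
    then have "FB * Q = FC * Q ^ k * Q ^ k" using x1 Q by (simp add: field_simps)
    then have "FC * (Q * Q) = FC * (Q ^ k * Q ^ k)" by (simp only: BC ac_simps)
    moreover have "Q * Q \<noteq> Q ^ k * Q ^ k"
    proof
      assume "Q * Q = Q ^ k * Q ^ k"
      then have "Q ^ 2 = Q ^ (2 * k)" by (simp add: power2_eq_square mult_2 power_add)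
      then have "2 = 2 * k" unfolding Q_def by (rule of_real_pow_inj[OF q])
      then show False using k by simp
    qed
    ultimately have "FC = 0" by simp
    then have "FB = 0" using BC by simp
    then show ?thesis using \<open>FC = 0\<close> less.prems snoc by (auto simp: FB_def FC_def A_def)
  qed
qed

definition cntBC :: "ugen list \<Rightarrow> nat" where "cntBC w = length (filter (\<lambda>x. x \<in> BC) w)"

text \<open>Triangular decomposition: every word is rewritten with C's on the left and B's on the
  right, where they annihilate, and what remains are powers of A and D, fixed by the value at the
  empty word. The induction is on the number of letters B and C.\<close>

lemma highest_weight_zero:
  assumes q: "q \<noteq> 0" and U: "uq_functional q F"
    and B: "\<And>u. F (u @ [gen_B]) = 0" and C: "\<And>u. F (gen_C # u) = 0"
    and A: "\<And>u. F (u @ [gen_A]) = \<kappa> * F u" and k: "\<kappa> \<noteq> 0" and N: "F [] = 0"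
  shows "F w = 0"
proof (induction "cntBC w" arbitrary: w rule: less_induct)
  case less
  note R = U[unfolded uq_functional_def, rule_format]
  have 1: "F (u @ gen_C # v) = 0" if "cntBC (u @ gen_C # v) = cntBC w" for u v
    using that
  proof (induction u arbitrary: v rule: rev_induct)
    case Nil
    show ?case using C by simp
  next
    case (snoc x u)
    show ?case
    proof (cases x)
      case gen_A
      then show ?thesis using snoc.IH[of "gen_A # v"] snoc.prems R[of u v] by (simp add: cntBC_def)
    next
      case gen_D
      \<comment> \<open>AD = 1 is inserted behind C, which turns DC into q CD with the relation for
        A and C alone.\<close>
      have "F (u @ gen_D # gen_C # v) = F (u @ gen_D # gen_C # gen_A # gen_D # v)"
        using R[of "u @ [gen_D, gen_C]" v] by simp
      also have "\<dots> = complex_of_real q * F (u @ gen_D # gen_A # gen_C # gen_D # v)"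
        using R[of "u @ [gen_D]" "gen_D # v"] q by (simp add: field_simps)
      also have "\<dots> = complex_of_real q * F (u @ gen_C # gen_D # v)"
        using R[of u "gen_C # gen_D # v"] by simp
      finally show ?thesis using snoc.IH[of "gen_D # v"] snoc.prems gen_D by (simp add: cntBC_def)
    next
      case gen_B
      have "F (u @ gen_A # gen_A # v) = 0" "F (u @ gen_D # gen_D # v) = 0"
        using snoc.prems gen_B by (auto intro!: less simp: cntBC_def)
      then show ?thesis using R[of u v] snoc.IH[of "gen_B # v"] snoc.prems gen_B by (simp add: cntBC_def)
    next
      case gen_C
      then show ?thesis using snoc.IH[of "gen_C # v"] snoc.prems by simp
    qed
  qed
  \<comment> \<open>Without C the word is stripped from the right: B annihilates, A and D give
    scalars.\<close>
  have 2: "gen_C \<notin> set v \<Longrightarrow> F v = 0" for v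
  proof (induction v rule: rev_induct)
    case (snoc x v)
    have "F v = 0" using snoc by simp
    moreover have "F (v @ [gen_D]) = F v / \<kappa>"
      using A[of "v @ [gen_D]"] R[of v "[]"] k by simp
    ultimately show ?case using A[of v] B[of v] snoc by (cases x) auto
  qed (simp add: N)
  show ?case
  proof (cases "gen_C \<in> set w")
    case True
    then obtain u v where "w = u @ gen_C # v" by (meson split_list)
    then show ?thesis using 1[of u v] by simp
  qed (rule 2)
qed

section \<open>Irreducible representations on words\<close>

text \<open>The entry of B from weight m to m - 1. The entry of C from m - 1 to m is the same
  number, so one function describes both operators.\<close>

definition b_entry :: "real \<Rightarrow> real \<Rightarrow> real \<Rightarrow> complex" where
  "b_entry q l m = complex_of_real (sqrt ((q powr (-l+m-1) - q powr (l-m+1)) * (q powr (-l-m) - q powr (l+m)))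
               / (inverse q - q))"

definition gen_matrix :: "real \<Rightarrow> real \<Rightarrow> ugen \<Rightarrow> real \<Rightarrow> real \<Rightarrow> complex" where
  "gen_matrix q l g n m = (if n \<in> weights l \<and> m \<in> weights l then (case g of
         gen_A \<Rightarrow> if n = m then complex_of_real (q powr (-m)) else 0
       | gen_D \<Rightarrow> if n = m then complex_of_real (q powr m) else 0
       | gen_B \<Rightarrow> if n = m - 1 then b_entry q l m else 0
       | gen_C \<Rightarrow> if n = m + 1 then b_entry q l (m + 1) else 0) else 0)"

lemma rep_gen_matrix: "rep q l = hom_on_gens (Uq_rels q) (mat_alg l) (gen_matrix q l)"
proof -
  have "(\<lambda>g n m.
     if n \<in> weights l \<and> m \<in> weights l then complex_of_real (case g of
         gen_A \<Rightarrow> if n = m then q powr (-m) else 0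
       | gen_D \<Rightarrow> if n = m then q powr m else 0
       | gen_B \<Rightarrow> if n = m - 1 then
             sqrt ((q powr (-l+m-1) - q powr (l-m+1)) * (q powr (-l-m) - q powr (l+m)))
               / (inverse q - q) else 0
       | gen_C \<Rightarrow> if n = m + 1 then
             sqrt ((q powr (-l+m) - q powr (l-m)) * (q powr (-l-m-1) - q powr (l+m+1)))
               / (inverse q - q) else 0)
     else 0) = gen_matrix q l"
    by (intro ext) (auto simp: gen_matrix_def b_entry_def algebra_simps split: ugen.split)
  then show ?thesis by (simp only: rep_def)
qed

primrec word_matrix :: "real \<Rightarrow> real \<Rightarrow> ugen list \<Rightarrow> real \<Rightarrow> real \<Rightarrow> complex" where
  "word_matrix q l [] = (\<lambda>n m. if n \<in> weights l \<and> n = m then 1 else 0)"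
| "word_matrix q l (g # w) = (\<lambda>n m. \<Sum>k\<in>weights l. gen_matrix q l g n k * word_matrix q l w k m)"

context
  fixes q l :: real and N :: nat
  assumes q: "0 < q" "q < 1" and N: "2 * l = real N"
begin

lemma weights_eq: "weights l = (\<lambda>k. - l + real k) ` {..N}"
  using N by (auto simp: weights_def)

lemma finite_weights [simp]: "finite (weights l)" by (simp add: weights_eq)

lemma sum_weights: "(\<Sum>n\<in>weights l. f n) = (\<Sum>k\<le>N. f (- l + real k))"
  unfolding weights_eq by (subst sum.reindex) (auto simp: inj_on_def)

lemma weight_bounds: "n \<in> weights l \<Longrightarrow> - l \<le> n \<and> n \<le> l"
  using N by (auto simp: weights_eq)

lemma weight_succ: "n \<in> weights l \<Longrightarrow> n + 1 \<in> weights l \<or> n = l"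
proof -
  assume "n \<in> weights l"
  then obtain k where k: "k \<le> N" "n = - l + real k" by (auto simp: weights_eq)
  show ?thesis
  proof (cases "k = N")
    case True
    then show ?thesis using k N by simp
  next
    case False
    then have "n + 1 = - l + real (Suc k)" "Suc k \<le> N" using k by auto
    then show ?thesis unfolding weights_eq by blast
  qed
qed

lemma weight_pred: "n \<in> weights l \<Longrightarrow> n - 1 \<in> weights l \<or> n = - l"
proof -
  assume "n \<in> weights l"
  then obtain k where k: "k \<le> N" "n = - l + real k" by (auto simp: weights_eq)
  show ?thesis
  proof (cases k)
    case 0
    then show ?thesis using k by simp
  next
    case (Suc k')
    then have "n - 1 = - l + real k'" "k' \<le> N" using k by auto
    then show ?thesis unfolding weights_eq by blast
  qed
qed

lemma ends_in_weights: "- l \<in> weights l" "l \<in> weights l"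
  using N unfolding weights_eq by (auto simp: image_iff intro: bexI[of _ 0] bexI[of _ N])

text \<open>The entries vanish just outside the range of weights. Recurrences may therefore mention
  n + 1 and n - 1 without distinguishing the boundary.\<close>

lemma b_entry_ends [simp]: "b_entry q l (- l) = 0" "b_entry q l (l + 1) = 0" "b_entry q l (1 + l) = 0"
  using q by (simp_all add: b_entry_def)

lemma sum_weights_shift:
  "(\<Sum>m\<in>weights l. b_entry q l m * X (m - 1) * Y m) = (\<Sum>m\<in>weights l. b_entry q l (m + 1) * X m * (Y (m + 1) :: complex))"
proof -
  define g where "g k = b_entry q l (- l + real k) * X (- l + real k - 1) * Y (- l + real k)" for k :: nat
  have "g 0 = 0" by (simp add: g_def)
  have "- l + real (Suc N) = l + 1" using N by simp
  then have "g (Suc N) = 0" unfolding g_def by (metis b_entry_ends(2) mult_zero_left)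
  have "(\<Sum>m\<in>weights l. b_entry q l m * X (m - 1) * Y m) = (\<Sum>k\<le>N. g k)"
    by (simp add: sum_weights g_def)
  also have "\<dots> = (\<Sum>k\<le>Suc N. g k)" using \<open>g (Suc N) = 0\<close> by simp
  also have "\<dots> = (\<Sum>k\<le>N. g (Suc k))" unfolding sum.atMost_Suc_shift using \<open>g 0 = 0\<close> by simp
  also have "\<dots> = (\<Sum>m\<in>weights l. b_entry q l (m + 1) * X m * Y (m + 1))"
    by (simp add: sum_weights g_def algebra_simps)
  finally show ?thesis .
qed

lemma word_matrix_off: "n \<notin> weights l \<or> m \<notin> weights l \<Longrightarrow> word_matrix q l w n m = 0"
  by (induction w arbitrary: n) (auto simp: gen_matrix_def)

lemma word_matrix_A: "n \<in> weights l \<Longrightarrow> word_matrix q l (gen_A # w) n m = complex_of_real (q powr (-n)) * word_matrix q l w n m"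
  by (simp add: gen_matrix_def if_distrib[of "\<lambda>x. x * _"] cong: if_cong)

lemma word_matrix_D: "n \<in> weights l \<Longrightarrow> word_matrix q l (gen_D # w) n m = complex_of_real (q powr n) * word_matrix q l w n m"
  by (simp add: gen_matrix_def if_distrib[of "\<lambda>x. x * _"] cong: if_cong)

lemma word_matrix_B: "n \<in> weights l \<Longrightarrow> word_matrix q l (gen_B # w) n m = b_entry q l (n + 1) * word_matrix q l w (n + 1) m"
proof -
  assume n: "n \<in> weights l"
  have "word_matrix q l (gen_B # w) n m = (\<Sum>k\<in>weights l. if k = n + 1 then b_entry q l (n + 1) * word_matrix q l w (n + 1) m else 0)"
    unfolding word_matrix.simps by (rule sum.cong) (use n in \<open>auto simp: gen_matrix_def\<close>)
  also have "\<dots> = b_entry q l (n + 1) * word_matrix q l w (n + 1) m"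
    using word_matrix_off[of "n + 1" m w] by auto
  finally show ?thesis .
qed

lemma word_matrix_C: "n \<in> weights l \<Longrightarrow> word_matrix q l (gen_C # w) n m = b_entry q l n * word_matrix q l w (n - 1) m"
proof -
  assume n: "n \<in> weights l"
  have "word_matrix q l (gen_C # w) n m = (\<Sum>k\<in>weights l. if k = n - 1 then b_entry q l n * word_matrix q l w (n - 1) m else 0)"
    unfolding word_matrix.simps by (rule sum.cong) (use n in \<open>auto simp: gen_matrix_def\<close>)
  also have "\<dots> = b_entry q l n * word_matrix q l w (n - 1) m"
    using word_matrix_off[of "n - 1" m w] by auto
  finally show ?thesis .
qed

lemma word_matrix_append: "word_matrix q l (u @ v) n m = (\<Sum>k\<in>weights l. word_matrix q l u n k * word_matrix q l v k m)"
proof (induction u arbitrary: n)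
  case Nil
  have "(\<Sum>k\<in>weights l. word_matrix q l [] n k * word_matrix q l v k m) = (\<Sum>k\<in>weights l. if k = n then word_matrix q l v n m else 0)"
    by (intro sum.cong) auto
  then show ?case using word_matrix_off[of n m v] by auto
next
  case (Cons g u)
  have "word_matrix q l ((g # u) @ v) n m = (\<Sum>k\<in>weights l. \<Sum>k'\<in>weights l. gen_matrix q l g n k * (word_matrix q l u k k' * word_matrix q l v k' m))"
    by (simp add: Cons sum_distrib_left)
  also have "\<dots> = (\<Sum>k'\<in>weights l. \<Sum>k\<in>weights l. gen_matrix q l g n k * (word_matrix q l u k k' * word_matrix q l v k' m))"
    by (rule sum.swap)
  finally show ?case by (simp add: sum_distrib_right mult.assoc)
qed

text \<open>The radicand is non-negative for -l <= m <= l + 1; the value m = l + 1 is included since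
  it occurs when C acts at the top weight.\<close>

lemma b_entry_sq: "m \<in> weights l \<or> m - 1 \<in> weights l \<Longrightarrow> b_entry q l m * b_entry q l m =
   complex_of_real ((q powr (-l+m-1) - q powr (l-m+1)) * (q powr (-l-m) - q powr (l+m)) / (inverse q - q)\<^sup>2)"
proof -
  assume "m \<in> weights l \<or> m - 1 \<in> weights l"
  then have "-l \<le> m" "m \<le> l + 1" using weight_bounds by force+
  then have "q powr (-l+m-1) \<ge> q powr (l-m+1)" "q powr (-l-m) \<ge> q powr (l+m)"
    using q by (auto intro!: powr_mono')
  then have "(q powr (-l+m-1) - q powr (l-m+1)) * (q powr (-l-m) - q powr (l+m)) \<ge> 0" by simp
  then show ?thesis unfolding b_entry_def of_real_mult[symmetric] times_divide_times_eq
    by (simp add: power2_eq_square)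
qed

lemma word_matrix_BC_rel:
  assumes n: "n \<in> weights l"
  shows "word_matrix q l (gen_B # gen_C # v) n m = word_matrix q l (gen_C # gen_B # v) n m +
       complex_of_real (inverse (q - inverse q)) * (word_matrix q l (gen_A # gen_A # v) n m - word_matrix q l (gen_D # gen_D # v) n m)"
proof -
  have f1: "word_matrix q l (gen_B # gen_C # v) n m = b_entry q l (n + 1) * b_entry q l (n + 1) * word_matrix q l v n m"
    using weight_succ[OF n] by (auto simp: word_matrix_B[OF n] word_matrix_C simp del: word_matrix.simps)
  have f2: "word_matrix q l (gen_C # gen_B # v) n m = b_entry q l n * b_entry q l n * word_matrix q l v n m"
    using weight_pred[OF n] by (auto simp: word_matrix_C[OF n] word_matrix_B simp del: word_matrix.simps)
  have f3: "b_entry q l (n + 1) * b_entry q l (n + 1) = b_entry q l n * b_entry q l n +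
     complex_of_real (inverse (q - inverse q)) * (complex_of_real (q powr (-n)) * complex_of_real (q powr (-n)) - complex_of_real (q powr n) * complex_of_real (q powr n))"
  proof -
    \<comment> \<open>In terms of q^l and q^n the relation is an identity of rational
      functions.\<close>
    define x y where "x = q powr l" and "y = q powr n"
    have xy: "x > 0" "y > 0" using q by (auto simp: x_def y_def)
    have p: "q powr (-l+n) = y / x" "q powr (l-n) = x / y" "q powr (-l-n) = 1 / (x * y)" "q powr (l+n) = x * y"
      "q powr (-l+n-1) = y / (x * q)" "q powr (l-n+1) = x * q / y" "q powr (-l-n-1) = 1 / (x * y * q)" "q powr (l+n+1) = x * y * q"
      "q powr (-n) = 1 / y" "q powr n = y" "q powr (-l-(n+1)) = 1 / (x * y * q)" "q powr (l+(n+1)) = x * y * q"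
      "q powr (-l+(n+1)-1) = y / x" "q powr (l-(n+1)+1) = x / y"
      using q by (simp_all add: x_def y_def powr_add powr_diff powr_minus field_simps)
    have "q * q < 1" using q by (metis mult_strict_mono mult.right_neutral less_eq_real_def zero_less_one)
    then have qq: "q * q - 1 \<noteq> 0" "1 - q * q \<noteq> 0" by auto
    have i: "inverse q - q = (1 - q * q) / q" "inverse (q - inverse q) = - q / (1 - q * q)"
      using q qq by (simp_all add: field_simps)
    have "(y / x - x / y) * (1 / (x * y * q) - x * y * q) / (inverse q - q)\<^sup>2 =
       (y / (x * q) - x * q / y) * (1 / (x * y) - x * y) / (inverse q - q)\<^sup>2 + inverse (q - inverse q) * ((1 / y) * (1 / y) - y * y)"
      unfolding i using xy q qq by (simp add: divide_simps power2_eq_square) (simp add: algebra_simps)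
    then have "(q powr (-l+(n+1)-1) - q powr (l-(n+1)+1)) * (q powr (-l-(n+1)) - q powr (l+(n+1))) / (inverse q - q)\<^sup>2
      = (q powr (-l+n-1) - q powr (l-n+1)) * (q powr (-l-n) - q powr (l+n)) / (inverse q - q)\<^sup>2 +
        inverse (q - inverse q) * (q powr (-n) * q powr (-n) - q powr n * q powr n)"
      unfolding p .
    then have "complex_of_real ((q powr (-l+(n+1)-1) - q powr (l-(n+1)+1)) * (q powr (-l-(n+1)) - q powr (l+(n+1))) / (inverse q - q)\<^sup>2)
      = complex_of_real ((q powr (-l+n-1) - q powr (l-n+1)) * (q powr (-l-n) - q powr (l+n)) / (inverse q - q)\<^sup>2 +
        inverse (q - inverse q) * (q powr (-n) * q powr (-n) - q powr n * q powr n))" by (rule arg_cong)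
    moreover have "b_entry q l (n + 1) * b_entry q l (n + 1) = complex_of_real ((q powr (-l+(n+1)-1) - q powr (l-(n+1)+1)) * (q powr (-l-(n+1)) - q powr (l+(n+1))) / (inverse q - q)\<^sup>2)"
      by (rule b_entry_sq) (use n in simp)
    moreover have "b_entry q l n * b_entry q l n = complex_of_real ((q powr (-l+n-1) - q powr (l-n+1)) * (q powr (-l-n) - q powr (l+n)) / (inverse q - q)\<^sup>2)"
      by (rule b_entry_sq) (use n in simp)
    ultimately show ?thesis by (simp only: of_real_add of_real_mult of_real_diff)
  qed
  show ?thesis unfolding f1 f2 f3 by (simp add: word_matrix_A[OF n] word_matrix_D[OF n] algebra_simps del: word_matrix.simps)
qed

lemma uq_functional_word_matrix: "uq_functional q (\<lambda>w. word_matrix q l w n m)"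
proof -
  have c: "word_matrix q l (u @ x) n m = c * word_matrix q l (u @ y) n m"
    if "\<And>k. k \<in> weights l \<Longrightarrow> word_matrix q l x k m = c * word_matrix q l y k m" for u x y c
    unfolding word_matrix_append sum_distrib_left by (rule sum.cong) (auto simp: that)
  have pm: "complex_of_real (q powr k) * complex_of_real (q powr k') = complex_of_real (q powr (k + k'))" for k k'
    by (simp add: powr_add)
  have pq: "complex_of_real q = complex_of_real (q powr 1)" "inverse (complex_of_real q) = complex_of_real (q powr (-1))"
    using q by (simp_all add: powr_minus)
  have p0: "complex_of_real (q powr x) = complex_of_real q * complex_of_real (q powr (x - 1))"
    "complex_of_real (q powr x) = inverse (complex_of_real q) * complex_of_real (q powr (x + 1))" for x
    subgoal unfolding pq(1) pm by simp
    subgoal unfolding pq(2) pm by simp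
    done
  have p1: "complex_of_real (q powr x) * (z * y) = complex_of_real q * (z * (complex_of_real (q powr (x - 1)) * y))"
    "complex_of_real (q powr x) * (z * y) = inverse (complex_of_real q) * (z * (complex_of_real (q powr (x + 1)) * y))" for x y z
    by (subst p0(1), simp) (subst p0(2), simp)
  have 1: "word_matrix q l (u @ gen_A # gen_D # v) n m = 1 * word_matrix q l (u @ v) n m"
     "word_matrix q l (u @ gen_D # gen_A # v) n m = 1 * word_matrix q l (u @ v) n m" for u v
    by (rule c; use q in \<open>simp add: word_matrix_A word_matrix_D del: word_matrix.simps flip: mult.assoc\<close>; simp add: pm)+
  have 2: "word_matrix q l (u @ gen_A # gen_B # v) n m = complex_of_real q * word_matrix q l (u @ gen_B # gen_A # v) n m" for u v
  proof (rule c)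
    fix k assume k: "k \<in> weights l"
    show "word_matrix q l (gen_A # gen_B # v) k m = complex_of_real q * word_matrix q l (gen_B # gen_A # v) k m"
      using weight_succ[OF k] p1(1)[of "-k" "b_entry q l (k + 1)" "word_matrix q l v (k + 1) m"]
      by (auto simp: word_matrix_A word_matrix_B k simp del: word_matrix.simps)
  qed
  have 3: "word_matrix q l (u @ gen_A # gen_C # v) n m = inverse (complex_of_real q) * word_matrix q l (u @ gen_C # gen_A # v) n m" for u v
  proof (rule c)
    fix k assume k: "k \<in> weights l"
    show "word_matrix q l (gen_A # gen_C # v) k m = inverse (complex_of_real q) * word_matrix q l (gen_C # gen_A # v) k m"
      using weight_pred[OF k] p1(2)[of "-k" "b_entry q l k" "word_matrix q l v (k - 1) m"]
      by (auto simp: word_matrix_A word_matrix_C k algebra_simps simp del: word_matrix.simps)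
  qed
  have 4: "word_matrix q l (u @ gen_B # gen_C # v) n m = word_matrix q l (u @ gen_C # gen_B # v) n m +
       complex_of_real (inverse (q - inverse q)) * (word_matrix q l (u @ gen_A # gen_A # v) n m - word_matrix q l (u @ gen_D # gen_D # v) n m)" for u v
  proof -
    have "word_matrix q l (u @ gen_B # gen_C # v) n m = (\<Sum>k\<in>weights l. word_matrix q l u n k * (word_matrix q l (gen_C # gen_B # v) k m +
       complex_of_real (inverse (q - inverse q)) * (word_matrix q l (gen_A # gen_A # v) k m - word_matrix q l (gen_D # gen_D # v) k m)))"
      unfolding word_matrix_append by (rule sum.cong[OF refl]) (simp only: word_matrix_BC_rel)
    then show ?thesis
      by (simp add: word_matrix_append distrib_left right_diff_distrib sum.distrib sum_subtractf sum_distrib_left mult.left_commute del: word_matrix.simps)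
  qed
  show ?thesis unfolding uq_functional_def using 1 2 3 4 by simp
qed

end

section \<open>Matrix coefficients as elements of the function algebra\<close>

lemma ring_mat_alg:
  assumes "finite (weights l)"
  shows "ring (mat_alg l)"
proof (rule ringI)
  show "abelian_group (mat_alg l)"
  proof (rule abelian_groupI)
    fix M assume "M \<in> carrier (mat_alg l)"
    then show "\<exists>M'\<in>carrier (mat_alg l). M' \<oplus>\<^bsub>mat_alg l\<^esub> M = \<zero>\<^bsub>mat_alg l\<^esub>"
      by (intro bexI[of _ "\<lambda>n m. - M n m"]) (auto simp: mat_alg_def)
  qed (auto simp: mat_alg_def fun_eq_iff)
  show "monoid (mat_alg l)"
  proof (rule monoidI)
    fix x y z assume "x \<in> carrier (mat_alg l)" "y \<in> carrier (mat_alg l)" "z \<in> carrier (mat_alg l)"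
    have "(\<Sum>k\<in>weights l. (\<Sum>k'\<in>weights l. x n k' * y k' k) * z k m) = (\<Sum>k\<in>weights l. x n k * (\<Sum>k'\<in>weights l. y k k' * z k' m))" for n m
      unfolding sum_distrib_left sum_distrib_right by (subst sum.swap) (simp add: mult.assoc)
    then show "x \<otimes>\<^bsub>mat_alg l\<^esub> y \<otimes>\<^bsub>mat_alg l\<^esub> z = x \<otimes>\<^bsub>mat_alg l\<^esub> (y \<otimes>\<^bsub>mat_alg l\<^esub> z)"
      by (simp add: mat_alg_def)
  next
    fix x assume x: "x \<in> carrier (mat_alg l)"
    have "(\<Sum>k\<in>weights l. (if n \<in> weights l \<and> n = k then 1 else 0) * x k m) = (\<Sum>k\<in>weights l. if k = n then x n m else 0)"
      "(\<Sum>k\<in>weights l. x n k * (if k \<in> weights l \<and> k = m then 1 else 0)) = (\<Sum>k\<in>weights l. if k = m then x n m else 0)" for n m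
      by (auto intro!: sum.cong)
    then show "\<one>\<^bsub>mat_alg l\<^esub> \<otimes>\<^bsub>mat_alg l\<^esub> x = x" "x \<otimes>\<^bsub>mat_alg l\<^esub> \<one>\<^bsub>mat_alg l\<^esub> = x"
      using x assms by (auto simp: mat_alg_def fun_eq_iff)
  qed (auto simp: mat_alg_def)
qed (auto simp: mat_alg_def fun_eq_iff algebra_simps sum.distrib)

lemma uq_functional_rels: "uq_functional q F \<Longrightarrow> r \<in> Uq_rels q \<Longrightarrow> lin (\<lambda>w. F (unw w)) r = 0"
proof -
  assume "uq_functional q F" and r: "r \<in> Uq_rels q"
  then have F: "F [gen_A, gen_D] = F []" "F [gen_D, gen_A] = F []"
    "F [gen_A, gen_B] = complex_of_real q * F [gen_B, gen_A]"
    "F [gen_A, gen_C] = inverse (complex_of_real q) * F [gen_C, gen_A]"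
    "F [gen_B, gen_C] = F [gen_C, gen_B] + complex_of_real (inverse (q - inverse q)) * (F [gen_A, gen_A] - F [gen_D, gen_D])"
    unfolding uq_functional_def by (metis append_Nil)+
  define e where "e = complex_of_real (inverse (q - inverse q))"
  have U: "r \<in> {gen gen_A * gen gen_D - 1, gen gen_D * gen gen_A - 1,
     gen gen_A * gen gen_B - const (complex_of_real q) * (gen gen_B * gen gen_A),
     gen gen_A * gen gen_C - const (inverse (complex_of_real q)) * (gen gen_C * gen gen_A),
     gen gen_B * gen gen_C - gen gen_C * gen gen_B - const e * (gen gen_A * gen gen_A - gen gen_D * gen gen_D)}"
    using r by (simp add: Uq_rels_def Let_def mult.assoc power2_eq_square e_def)
  show ?thesis using U F unfolding e_def[symmetric]
    by (auto simp: lin_diff lin_const gen_mult lin_1)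
qed

lemma uq_functional_diff: "uq_functional q F \<Longrightarrow> uq_functional q G \<Longrightarrow> uq_functional q (\<lambda>w. F w - G w)"
proof -
  assume F: "uq_functional q F" and G: "uq_functional q G"
  note R = F[unfolded uq_functional_def, rule_format] G[unfolded uq_functional_def, rule_format]
  show ?thesis unfolding uq_functional_def
  proof (intro allI conjI)
    fix u v
    show "F (u @ gen_B # gen_C # v) - G (u @ gen_B # gen_C # v) = F (u @ gen_C # gen_B # v) - G (u @ gen_C # gen_B # v) +
       complex_of_real (inverse (q - inverse q)) * (F (u @ gen_A # gen_A # v) - G (u @ gen_A # gen_A # v) -
        (F (u @ gen_D # gen_D # v) - G (u @ gen_D # gen_D # v)))"
      using R(1)[of u v] R(2)[of u v] by (simp add: right_diff_distrib)
  qed (use R in \<open>simp_all add: right_diff_distrib\<close>)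
qed

context
  fixes q l :: real and N :: nat
  assumes q: "0 < q" "q < 1" and N: "2 * l = real N"
begin

lemmas fw = finite_weights[OF q N]

lemma word_matrix_snoc: "word_matrix q l (u @ [g]) n m = (\<Sum>k\<in>weights l. word_matrix q l u n k * gen_matrix q l g k m)"
proof -
  have "word_matrix q l [g] k m = gen_matrix q l g k m" if "k \<in> weights l" for k
  proof -
    have "word_matrix q l [g] k m = (\<Sum>k'\<in>weights l. if k' = m then gen_matrix q l g k m else 0)"
      unfolding word_matrix.simps by (rule sum.cong) auto
    also have "\<dots> = gen_matrix q l g k m" by (auto simp: gen_matrix_def fw)
    finally show ?thesis .
  qed
  then show ?thesis
    unfolding word_matrix_append[OF q N] by (intro sum.cong) (auto simp del: word_matrix.simps)
qed

lemma word_matrix_snoc_A: "m \<in> weights l \<Longrightarrow> word_matrix q l (u @ [gen_A]) n m = complex_of_real (q powr (-m)) * word_matrix q l u n m"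
proof -
  assume "m \<in> weights l"
  then have "word_matrix q l (u @ [gen_A]) n m = (\<Sum>k\<in>weights l. if k = m then complex_of_real (q powr (-m)) * word_matrix q l u n m else 0)"
    unfolding word_matrix_snoc by (intro sum.cong) (auto simp: gen_matrix_def)
  then show ?thesis using \<open>m \<in> weights l\<close> fw by simp
qed

lemma word_matrix_snoc_B: "m \<in> weights l \<Longrightarrow> word_matrix q l (u @ [gen_B]) n m = b_entry q l m * word_matrix q l u n (m - 1)"
proof -
  assume "m \<in> weights l"
  then have "word_matrix q l (u @ [gen_B]) n m = (\<Sum>k\<in>weights l. if k = m - 1 then b_entry q l m * word_matrix q l u n (m - 1) else 0)"
    unfolding word_matrix_snoc by (intro sum.cong) (auto simp: gen_matrix_def)
  then show ?thesis using word_matrix_off[OF q N, of n "m - 1" u] fw by auto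
qed

lemma word_matrix_snoc_C: "m \<in> weights l \<Longrightarrow> word_matrix q l (u @ [gen_C]) n m = b_entry q l (m + 1) * word_matrix q l u n (m + 1)"
proof -
  assume "m \<in> weights l"
  then have "word_matrix q l (u @ [gen_C]) n m = (\<Sum>k\<in>weights l. if k = m + 1 then b_entry q l (m + 1) * word_matrix q l u n (m + 1) else 0)"
    unfolding word_matrix_snoc by (intro sum.cong) (auto simp: gen_matrix_def)
  then show ?thesis using word_matrix_off[OF q N, of n "m + 1" u] fw by auto
qed

lemma rep_cls: "rep q l (cls (Uq_rels q) x) n m = lin (\<lambda>w. word_matrix q l (unw w) n m) x"
proof -
  let ?\<Phi> = "\<lambda>x n m. lin (\<lambda>w. word_matrix q l (unw w) n m) x"
  have "hom_on_gens (Uq_rels q) (mat_alg l) (gen_matrix q l) (cls (Uq_rels q) x) = ?\<Phi> x"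
  proof (rule hom_on_gens_cls)
    show "ring (mat_alg l)" by (rule ring_mat_alg[OF fw])
    have mm: "lin (\<lambda>w. word_matrix q l (unw w) n m) (x * y) =
      (\<Sum>k\<in>weights l. lin (\<lambda>w. word_matrix q l (unw w) n k) x * lin (\<lambda>w. word_matrix q l (unw w) k m) y)" for x y n m
    proof (induction x rule: pm_induct)
      case (1 u c)
      show ?case
      proof (induction y rule: pm_induct)
        case (1 v d)
        show ?case by (simp add: mult_single unw_add word_matrix_append[OF q N] sum_distrib_left ac_simps)
      qed (simp add: lin_add algebra_simps sum.distrib)
    qed (simp add: lin_add algebra_simps sum.distrib)
    show "?\<Phi> \<in> ring_hom monoid_alg (mat_alg l)"
    proof (rule ring_hom_memI)
      have "lin (\<lambda>w. word_matrix q l (unw w) n m) x = 0" if "n \<notin> weights l \<or> m \<notin> weights l" for n m x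
        using word_matrix_off[OF q N that] by simp
      then show "?\<Phi> x \<in> carrier (mat_alg l)" for x by (auto simp: mat_alg_def)
    qed (auto simp: mat_alg_def mm lin_add lin_1)
    fix r assume "r \<in> Uq_rels q"
    then have "?\<Phi> r n m = 0" for n m by (rule uq_functional_rels[OF uq_functional_word_matrix[OF q N]])
    then show "?\<Phi> r = \<zero>\<^bsub>mat_alg l\<^esub>" by (auto simp: mat_alg_def)
  next
    fix g
    have "word_matrix q l [g] n m = gen_matrix q l g n m" for n m
      using word_matrix_snoc[of "[]" g n m] fw
      by (cases "n \<in> weights l") (auto simp: gen_matrix_def if_distrib[of "\<lambda>x. x * _"] cong: if_cong)
    then show "?\<Phi> (gen g) = gen_matrix q l g" by (simp add: gen_def del: word_matrix.simps)
  qed (auto simp: mat_alg_def lin_const)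
  then show ?thesis by (simp add: rep_gen_matrix)
qed

text \<open>Both functionals are annihilated by B on the right and by C on the left, have the same
  A-weight and the same value at the empty word. The difference therefore vanishes by
  \<open>highest_weight_zero\<close>.\<close>

lemma pw_alpha: "pw q w (replicate N gen_alpha) = word_matrix q l w (- l) (- l)"
proof -
  let ?F = "\<lambda>w. pw q w (replicate N gen_alpha) - word_matrix q l w (- l) (- l)"
  note W = ends_in_weights[OF q N]
  have h: "complex_of_real (q powr (1/2)) ^ N = complex_of_real (q powr l)"
  proof -
    have l: "1/2 * real N = l" using N by simp
    have "(q powr (1/2)) ^ N = (q powr (1/2)) powr real N" using q by (intro powr_realpow[symmetric]) simp
    also have "\<dots> = q powr l" by (simp only: powr_powr l)
    finally show ?thesis by (metis of_real_power)
  qed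
  have "?F w = 0"
  proof (rule highest_weight_zero[of q ?F "complex_of_real (q powr l)"])
    show "q \<noteq> 0" using q by simp
    show "uq_functional q ?F" by (intro uq_functional_diff uq_functional_pw uq_functional_word_matrix[OF q N] q)
    fix u
    have "sw cmA w (\<lambda>u v. F u * pg q gen_B v) = 0" if "set w \<subseteq> {gen_alpha, gen_gamma}" for w F
      using that
    proof (induction w arbitrary: F)
      case (Cons g w)
      have "sw cmA w (\<lambda>u v. F (a # u) * (c * pg q gen_B v)) = 0" for a c
        using Cons sw_mult_l[of cmA w c "\<lambda>u v. F (a # u) * pg q gen_B v"] by (simp add: ac_simps)
      then show ?case using Cons.prems by auto
    qed simp
    then have "pw q (u @ [gen_B]) (replicate N gen_alpha) = 0"
      by (simp add: pw_append pw_single set_replicate_conv_if del: pw.simps)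
    moreover have "word_matrix q l (u @ [gen_B]) (- l) (- l) = 0"
      using W b_entry_ends(1)[OF q N] by (simp add: word_matrix_snoc_B)
    ultimately show "?F (u @ [gen_B]) = 0" by simp
    have "act q gen_C (replicate n gen_alpha) F = 0" for F n
      by (induction n arbitrary: F) (simp_all add: act_C act_Nil)
    then have "pw q (gen_C # u) (replicate N gen_alpha) = 0" by (simp add: pw_Cons del: pw.simps)
    moreover have "word_matrix q l (gen_C # u) (- l) (- l) = 0"
      using W b_entry_ends(1)[OF q N] by (simp add: word_matrix_C[OF q N] del: word_matrix.simps)
    ultimately show "?F (gen_C # u) = 0" by simp
    show "?F (u @ [gen_A]) = complex_of_real (q powr l) * ?F u"
      using W by (simp add: pw_snoc_A word_matrix_snoc_A h algebra_simps)
  qed (use W q in auto)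
  then show ?thesis by simp
qed

lemma b_entry_nonzero: "- l < m \<Longrightarrow> m \<le> l \<Longrightarrow> b_entry q l m \<noteq> 0"
proof -
  assume m: "- l < m" "m \<le> l"
  have "q powr (-l+m-1) > q powr (l-m+1)" "q powr (-l-m) > q powr (l+m)"
    using q m by (auto intro!: powr_less_mono')
  moreover have "inverse q - q \<noteq> 0"
    using q by (metis eq_iff_diff_eq_0 less_irrefl one_less_inverse order.strict_trans)
  ultimately show ?thesis unfolding b_entry_def of_real_eq_0_iff by simp
qed

lemma word_matrix_Bs:
  "n \<in> weights l \<Longrightarrow> n + real k \<in> weights l \<Longrightarrow>
    word_matrix q l (replicate k gen_B @ x) n m = (\<Prod>r<k. b_entry q l (n + real r + 1)) * word_matrix q l x (n + real k) m"
proof (induction k arbitrary: n)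
  case (Suc k)
  have "n \<noteq> l" using Suc.prems weight_bounds[OF q N, of "n + real (Suc k)"] by auto
  then have n1: "n + 1 \<in> weights l" using weight_succ[OF q N Suc.prems(1)] by simp
  have "word_matrix q l (replicate (Suc k) gen_B @ x) n m = b_entry q l (n + 1) * word_matrix q l (replicate k gen_B @ x) (n + 1) m"
    using Suc.prems by (simp add: word_matrix_B[OF q N] del: word_matrix.simps)
  also have "word_matrix q l (replicate k gen_B @ x) (n + 1) m = (\<Prod>r<k. b_entry q l (n + 1 + real r + 1)) * word_matrix q l x (n + 1 + real k) m"
    by (rule Suc.IH[OF n1]) (use Suc.prems in \<open>simp add: algebra_simps\<close>)
  finally show ?case
    unfolding prod.lessThan_Suc_shift by (simp add: algebra_simps del: prod.lessThan_Suc)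
qed simp

lemma word_matrix_Cs:
  "m \<in> weights l \<Longrightarrow> m + real k \<in> weights l \<Longrightarrow>
    word_matrix q l (x @ replicate k gen_C) n m = (\<Prod>r<k. b_entry q l (m + real r + 1)) * word_matrix q l x n (m + real k)"
proof (induction k arbitrary: m)
  case (Suc k)
  have "m \<noteq> l" using Suc.prems weight_bounds[OF q N, of "m + real (Suc k)"] by auto
  then have n1: "m + 1 \<in> weights l" using weight_succ[OF q N Suc.prems(1)] by simp
  have "word_matrix q l (x @ replicate (Suc k) gen_C) n m = word_matrix q l ((x @ replicate k gen_C) @ [gen_C]) n m"
    by (simp add: replicate_append_same)
  also have "\<dots> = b_entry q l (m + 1) * word_matrix q l (x @ replicate k gen_C) n (m + 1)"
    by (rule word_matrix_snoc_C) (rule Suc.prems)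
  also have "word_matrix q l (x @ replicate k gen_C) n (m + 1) = (\<Prod>r<k. b_entry q l (m + 1 + real r + 1)) * word_matrix q l x n (m + 1 + real k)"
    by (rule Suc.IH[OF n1]) (use Suc.prems in \<open>simp add: algebra_simps\<close>)
  finally show ?case
    unfolding prod.lessThan_Suc_shift by (simp add: algebra_simps del: prod.lessThan_Suc)
qed simp

text \<open>The coefficient at weights n, m is reached from the extreme one by putting k letters B
  in front and k' letters C behind; the resulting factor \<open>c\<close> is a product of nonzero
  entries.\<close>

lemma matrix_element_exists:
  assumes n: "n \<in> weights l" and m: "m \<in> weights l"
  shows "\<exists>T. \<forall>a. row q T a = word_matrix q l a n m"
proof -
  obtain k k' where k: "k \<le> N" "n = - l + real k" "k' \<le> N" "m = - l + real k'"
    using n m by (auto simp: weights_eq[OF q N])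
  define c where "c = (\<Prod>r<k. b_entry q l (- l + real r + 1)) * (\<Prod>r<k'. b_entry q l (- l + real r + 1))"
  have "b_entry q l (- l + real r + 1) \<noteq> 0" if "r < N" for r
    by (rule b_entry_nonzero) (use that N in auto)
  then have c: "c \<noteq> 0" using k by (auto simp: c_def)
  \<comment> \<open>The power of alpha is split by the iterated coproduct into three factors; the
    outer two are paired with the B's and the C's, and the middle one is kept.\<close>
  define T where "T = const (1 / c) * sw cmA (replicate N gen_alpha) (\<lambda>w1 w. sw cmA w (\<lambda>w2 w3.
     const (pw q (replicate k gen_B) w1 * pw q (replicate k' gen_C) w3) * Poly_Mapping.single (Word w2) 1))"
  have "row q T a = word_matrix q l a n m" for a
  proof -
    have "row q T a = 1 / c * sw cmA (replicate N gen_alpha) (\<lambda>w1 w. sw cmA w (\<lambda>w2 w3.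
       pw q (replicate k gen_B) w1 * pw q (replicate k' gen_C) w3 * pw q a w2))"
      by (simp add: row_def T_def lin_const lin_sw)
    also have "\<dots> = 1 / c * pw q (replicate k gen_B @ a @ replicate k' gen_C) (replicate N gen_alpha)"
      by (simp add: pw_append ac_simps flip: sw_mult_l)
    also have "pw q (replicate k gen_B @ a @ replicate k' gen_C) (replicate N gen_alpha) = c * word_matrix q l a n m"
    proof -
      have "- l + real k \<in> weights l" "- l + real k' \<in> weights l" using n m k by auto
      then show ?thesis
        using ends_in_weights[OF q N] k by (simp add: pw_alpha word_matrix_Bs word_matrix_Cs c_def)
    qed
    finally show ?thesis using c by simp
  qed
  then show ?thesis by blast
qed

definition t_lift :: "real \<Rightarrow> real \<Rightarrow> agen falg" where
  "t_lift n m = (SOME T. \<forall>a. row q T a = word_matrix q l a n m)"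

lemma row_t_lift: "n \<in> weights l \<Longrightarrow> m \<in> weights l \<Longrightarrow> row q (t_lift n m) a = word_matrix q l a n m"
  using someI_ex[OF matrix_element_exists] unfolding t_lift_def by blast

text \<open>Resolves the \<open>THE\<close> of \<open>t_elem\<close>: existence is
  \<open>row_t_lift\<close>, uniqueness is non-degeneracy of the pairing.\<close>

lemma t_elem_eq:
  assumes n: "n \<in> weights l" and m: "m \<in> weights l"
  shows "t_elem q l n m = cls (Aq_rels q) (t_lift n m)"
  unfolding t_elem_def
proof (rule the_equality)
  have "pairing q (cls (Uq_rels q) x) (cls (Aq_rels q) (t_lift n m)) = rep q l (cls (Uq_rels q) x) n m" for x
    by (simp add: pairing_cls[OF q] bil_def row_t_lift[OF n m] rep_cls)
  then show "cls (Aq_rels q) (t_lift n m) \<in> carrier (Aq q) \<and>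
    (\<forall>X\<in>carrier (Uq q). pairing q X (cls (Aq_rels q) (t_lift n m)) = rep q l X n m)"
    by (auto simp: Aq_def Uq_def quot_simps)
next
  fix \<xi> assume "\<xi> \<in> carrier (Aq q) \<and> (\<forall>X\<in>carrier (Uq q). pairing q X \<xi> = rep q l X n m)"
  then obtain y where y: "\<xi> = cls (Aq_rels q) y"
    and p: "\<And>x. pairing q (cls (Uq_rels q) x) (cls (Aq_rels q) y) = rep q l (cls (Uq_rels q) x) n m"
    by (auto simp: Aq_def Uq_def quot_simps)
  have "row q y a = word_matrix q l a n m" for a
    using p[of "Poly_Mapping.single (Word a) 1"] by (simp add: pairing_cls[OF q] bil_def rep_cls)
  then have "row q (y - t_lift n m) a = 0" for a
    using row_t_lift[OF n m, of a] by (simp add: row_def lin_diff)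
  then have "y - t_lift n m \<in> ideal_span (Aq_rels q)" by (intro nondegenerate[OF q]) auto
  then show "\<xi> = cls (Aq_rels q) (t_lift n m)" by (simp add: y cls_eq)
qed

definition elem_lift :: "(real \<Rightarrow> complex) \<Rightarrow> (real \<Rightarrow> complex) \<Rightarrow> agen falg" where
  "elem_lift v w = (\<Sum>n\<in>weights l. \<Sum>m\<in>weights l. const (v m * cnj (w n)) * t_lift n m)"

lemma row_const: "row q (const c * x) a = c * row q x a" by (simp add: row_def lin_const)
lemma row_sum: "row q (\<Sum>i\<in>S. f i) a = (\<Sum>i\<in>S. row q (f i) a)" by (simp add: row_def lin_sum)

lemma row_elem_lift: "row q (elem_lift v w) a = (\<Sum>n\<in>weights l. \<Sum>m\<in>weights l. v m * cnj (w n) * word_matrix q l a n m)"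
  unfolding elem_lift_def row_sum row_const by (intro sum.cong refl) (simp add: row_t_lift)

lemma gen_mat_elem_eq: "gen_mat_elem q l i j \<tau> \<sigma> =
  cls (Aq_rels q) (elem_lift (\<lambda>m. v_coeff q l j m \<sigma>) (\<lambda>n. v_coeff q l i n \<tau>))"
proof -
  interpret ring "quot_alg (Aq_rels q)" by (rule ring_quot)
  have 1: "(\<Oplus>\<^bsub>quot_alg (Aq_rels q)\<^esub>m\<in>weights l. c m n \<odot>\<^bsub>quot_alg (Aq_rels q)\<^esub> t_elem q l n m) =
     (\<Oplus>\<^bsub>quot_alg (Aq_rels q)\<^esub>m\<in>weights l. cls (Aq_rels q) (const (c m n) * t_lift n m))" if "n \<in> weights l" for c n
    by (rule finsum_cong') (auto simp: that t_elem_eq quot_simps)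
  have "(\<Oplus>\<^bsub>quot_alg (Aq_rels q)\<^esub>n\<in>weights l. \<Oplus>\<^bsub>quot_alg (Aq_rels q)\<^esub>m\<in>weights l. c m n \<odot>\<^bsub>quot_alg (Aq_rels q)\<^esub> t_elem q l n m) =
    (\<Oplus>\<^bsub>quot_alg (Aq_rels q)\<^esub>n\<in>weights l. cls (Aq_rels q) (\<Sum>m\<in>weights l. const (c m n) * t_lift n m))" for c
    by (rule finsum_cong') (auto simp: 1 finsum_cls[OF fw] quot_simps)
  then show ?thesis
    unfolding gen_mat_elem_def Aq_def elem_lift_def by (simp add: finsum_cls[OF fw])
qed

end

section \<open>Restriction to the torus\<close>

definition tw :: "complex \<Rightarrow> agen list \<Rightarrow> complex" where
  "tw lam w = prod_list (map (\<lambda>g. case g of gen_alpha \<Rightarrow> lam | gen_beta \<Rightarrow> 0 | gen_gamma \<Rightarrow> 0 | gen_delta \<Rightarrow> inverse lam) w)"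

definition tau :: "complex \<Rightarrow> agen falg \<Rightarrow> complex" where
  "tau lam \<xi> = lin (\<lambda>w. tw lam (unw w)) \<xi>"

lemma tau_hom_cls:
  assumes "0 < q" "lam \<noteq> 0"
  shows "tau_hom q lam (cls (Aq_rels q) \<xi>) = tau lam \<xi>"
  unfolding tau_hom_def tau_def tw_def
proof (rule char_hom)
  fix r assume "r \<in> Aq_rels q"
  then show "lin (\<lambda>w. prod_list (map (\<lambda>g. case g of gen_alpha \<Rightarrow> lam | gen_beta \<Rightarrow> 0 | gen_gamma \<Rightarrow> 0 | gen_delta \<Rightarrow> inverse lam) (unw w))) r = 0"
    using assms by (auto simp: Aq_rels_def Let_def gen_mult mult.assoc lin_diff lin_const lin_1)
qed

lemma tau_mult: "tau lam (x * y) = tau lam x * tau lam y"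
  unfolding tau_def by (rule lin_mult) (simp add: unw_add tw_def)

lemma tau_const: "tau lam (const c * x) = c * tau lam x" by (simp add: tau_def lin_const)
lemma tau_sum: "tau lam (\<Sum>i\<in>S. f i) = (\<Sum>i\<in>S. tau lam (f i))" by (simp add: tau_def lin_sum)
lemma tau_diff: "tau lam (x - y) = tau lam x - tau lam y" by (simp add: tau_def lin_diff)

lemma tau_poly_lift: "tau lam (poly_lift P x) = poly P (tau lam x)"
  unfolding tau_def by (rule lin_poly_lift) (simp_all add: unw_add tw_def)

text \<open>Powers of A are characters of the function algebra: at the k-th power of q^(1/2) the
  torus character agrees with A^k.\<close>

lemma tau_row:
  assumes q: "0 < q" "q < 1"
  shows "tau (complex_of_real (q powr (1/2)) ^ k) \<xi> = row q \<xi> (replicate k gen_A)"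
proof -
  have "tw (complex_of_real (q powr (1/2)) ^ k) w = rw q w ^ k * prod_list (map epA w)" for w
  proof (induction w)
    case (Cons g w)
    then show ?case
      using q by (cases g) (simp_all add: tw_def power_mult_distrib power_inverse powr_minus)
  qed (simp add: tw_def)
  moreover have "pw q (replicate k gen_A) w = rw q w ^ k * prod_list (map epA w)" for w
    using pw_As[OF q, of k "[]" w] by simp
  ultimately show ?thesis by (simp add: tau_def row_def)
qed

lemma tau_poly: "\<exists>P M. \<forall>lam. lam \<noteq> 0 \<longrightarrow> tau lam \<xi> * lam ^ M = poly P lam"
proof (induction \<xi> rule: pm_induct)
  case (1 w c)
  have "\<exists>P M. \<forall>lam. lam \<noteq> 0 \<longrightarrow> tw lam xs * lam ^ M = poly P lam" for xs
  proof (induction xs)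
    case Nil
    show ?case by (intro exI[of _ 1] exI[of _ 0]) (simp add: tw_def)
  next
    case (Cons g xs)
    then obtain P M where P: "\<And>lam. lam \<noteq> 0 \<Longrightarrow> tw lam xs * lam ^ M = poly P lam" by blast
    show ?case
    proof (cases g)
      case gen_alpha
      then show ?thesis using P by (intro exI[of _ "[:0, 1:] * P"] exI[of _ M]) (simp add: tw_def)
    next
      case gen_delta
      then show ?thesis using P by (intro exI[of _ P] exI[of _ "Suc M"]) (simp add: tw_def field_simps)
    qed (intro exI[of _ 0] exI[of _ 0], simp add: tw_def)+
  qed
  then obtain P M where "\<And>lam. lam \<noteq> 0 \<Longrightarrow> tw lam (unw w) * lam ^ M = poly P lam" by blast
  then show ?case by (intro exI[of _ "Polynomial.smult c P"] exI[of _ M]) (simp add: tau_def)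
next
  case (2 x y)
  then obtain P M P' M' where "\<And>lam. lam \<noteq> 0 \<Longrightarrow> tau lam x * lam ^ M = poly P lam"
    "\<And>lam. lam \<noteq> 0 \<Longrightarrow> tau lam y * lam ^ M' = poly P' lam" by blast
  then show ?case
    by (intro exI[of _ "Polynomial.monom 1 M' * P + Polynomial.monom 1 M * P'"] exI[of _ "M + M'"])
      (auto simp: tau_def lin_add poly_monom power_add algebra_simps)
qed

text \<open>By \<open>tau_poly\<close> the torus restriction is a Laurent polynomial in the
  parameter, so its values at the infinitely many distinct powers of q^(1/2) determine it.\<close>

lemma tau_determined:
  assumes q: "0 < q" "q < 1"
    and *: "\<And>k. row q \<xi> (replicate k gen_A) = c * (complex_of_real (q powr (1/2)) ^ k) powi e"
    and lam: "lam \<noteq> 0"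
  shows "tau lam \<xi> = c * lam powi e"
proof -
  define h where "h = q powr (1/2)"
  have h: "0 < h" "h < 1" using q powr_less_mono'[of q 0 "1/2"] by (auto simp: h_def)
  obtain P M where P: "\<And>lam. lam \<noteq> 0 \<Longrightarrow> tau lam \<xi> * lam ^ M = poly P lam" using tau_poly by blast
  \<comment> \<open>Clears a negative exponent, so that both sides can be compared as
    polynomials.\<close>
  define K where "K = nat (- e)"
  have pe: "z ^ K * z powi e = z ^ nat (int K + e)" if "z \<noteq> 0" for z :: complex
    using that by (simp add: K_def power_int_def nonzero_eq_divide_eq power_inverse)
  define R where "R = Polynomial.monom 1 K * P - Polynomial.monom c (M + nat (int K + e))"
  have R: "poly R z = z ^ K * z ^ M * (tau z \<xi> - c * z powi e)" if "z \<noteq> 0" for z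
  proof -
    have "z ^ K * z ^ M * (tau z \<xi> - c * z powi e) = z ^ K * (tau z \<xi> * z ^ M) - c * z ^ M * (z ^ K * z powi e)"
      by (simp add: algebra_simps)
    then show ?thesis using P[OF that] pe[OF that] by (simp add: R_def poly_monom power_add)
  qed
  have "poly R (complex_of_real h ^ k) = 0" for k
    using R[of "complex_of_real h ^ k"] h *[of k] tau_row[OF q, of k \<xi>] by (simp add: h_def)
  then have "range (\<lambda>k. complex_of_real h ^ k) \<subseteq> {z. poly R z = 0}" by auto
  moreover have "inj (\<lambda>k. complex_of_real h ^ k)"
    by (rule injI) (rule of_real_pow_inj[OF h])
  ultimately have "infinite {z. poly R z = 0}"
    using range_inj_infinite infinite_super by blast
  then have "R = 0" using poly_roots_finite by blast
  then show ?thesis using R[OF lam] lam by simp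
qed

context
  fixes q l :: real and N :: nat
  assumes q: "0 < q" "q < 1" and N: "2 * l = real N"
begin

lemma word_matrix_As: "n \<in> weights l \<Longrightarrow> word_matrix q l (replicate k gen_A) n m = (if n = m then complex_of_real (q powr (-n)) ^ k else 0)"
  by (induction k) (auto simp: word_matrix_A[OF q N] simp del: word_matrix.simps(2))

lemma tau_t_lift:
  assumes n: "n \<in> weights l" and m: "m \<in> weights l" and lam: "lam \<noteq> 0"
  shows "tau lam (t_lift q l n m) = (if n = m then lam powi \<lfloor>- 2 * n\<rfloor> else 0)"
proof -
  obtain k where k: "n = - l + real k" using n by (auto simp: weights_eq[OF q N])
  have e: "- 2 * n = of_int (int N - 2 * int k)" using N k by simp
  have i: "real_of_int \<lfloor>- 2 * n\<rfloor> = - 2 * n" unfolding e by (simp only: floor_of_int)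
  have e: "complex_of_real (q powr (-n)) ^ a = (complex_of_real (q powr (1/2)) ^ a) powi \<lfloor>- 2 * n\<rfloor>" for a
  proof -
    have "q powr (- n) = (q powr (1/2)) powi \<lfloor>- 2 * n\<rfloor>"
    proof -
      have "(q powr (1/2)) powi \<lfloor>- 2 * n\<rfloor> = (q powr (1/2)) powr real_of_int \<lfloor>- 2 * n\<rfloor>"
        using q by (intro powr_real_of_int'[symmetric]) auto
      also have "\<dots> = q powr (1/2 * (- 2 * n))" unfolding i powr_powr ..
      finally show ?thesis by simp
    qed
    moreover have "((q powr (1/2)) powi \<lfloor>- 2 * n\<rfloor>) ^ a = ((q powr (1/2)) ^ a) powi \<lfloor>- 2 * n\<rfloor>"
      unfolding power_int_power power_int_power' by (rule arg_cong[OF mult.commute])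
    ultimately have "(q powr (- n)) ^ a = ((q powr (1/2)) ^ a) powi \<lfloor>- 2 * n\<rfloor>"
      by (simp only:)
    then show ?thesis by (metis of_real_power of_real_power_int)
  qed
  have "row q (t_lift q l n m) (replicate k gen_A) = (if n = m then 1 else 0) * (complex_of_real (q powr (1/2)) ^ k) powi \<lfloor>- 2 * n\<rfloor>" for k
    unfolding row_t_lift[OF q N n m] word_matrix_As[OF n] e by simp
  then have "tau lam (t_lift q l n m) = (if n = m then 1 else 0) * lam powi \<lfloor>- 2 * n\<rfloor>"
    by (intro tau_determined[OF q _ lam])
  then show ?thesis by simp
qed

lemma tau_elem_lift:
  assumes "lam \<noteq> 0"
  shows "tau lam (elem_lift q l v w) = (\<Sum>n\<in>weights l. v n * cnj (w n) * lam powi \<lfloor>- 2 * n\<rfloor>)"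
proof -
  have "tau lam (elem_lift q l v w) = (\<Sum>n\<in>weights l. \<Sum>m\<in>weights l. if m = n then v n * cnj (w n) * lam powi \<lfloor>- 2 * n\<rfloor> else 0)"
    unfolding elem_lift_def[OF q N] tau_sum tau_const by (intro sum.cong refl) (simp add: tau_t_lift[OF _ _ assms])
  then show ?thesis by (simp add: finite_weights[OF q N])
qed

end

section \<open>Twisted primitive elements\<close>

text \<open>
  For \<open>s = (q\<^bsup>-\<sigma>\<^esup> - q\<^bsup>\<sigma>\<^esup>) / (q\<^bsup>-1\<^esup> - q)\<close> let
  \<open>X\<^sub>\<sigma> = i q\<^bsup>1/2\<^esup> B - i q\<^bsup>-1/2\<^esup> C - s (A - D)\<close> be the twisted primitive element.
  The two predicates say that \<open>\<xi>\<close> is an eigenvector of \<open>X\<^sub>\<sigma> A\<close>, acting from the left,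
  respectively from the right.\<close>

definition xB :: "real \<Rightarrow> complex" where "xB q = \<i> * complex_of_real (q powr (1/2))"
definition xC :: "real \<Rightarrow> complex" where "xC q = - xB q / complex_of_real q"

definition right_eigen :: "real \<Rightarrow> complex \<Rightarrow> complex \<Rightarrow> agen falg \<Rightarrow> bool" where
  "right_eigen q s \<mu> \<xi> \<longleftrightarrow> (\<forall>u. xB q * row q \<xi> (u @ [gen_B, gen_A]) + xC q * row q \<xi> (u @ [gen_C, gen_A]) -
     s * (row q \<xi> (u @ [gen_A, gen_A]) - row q \<xi> u) = \<mu> * row q \<xi> u)"

definition left_eigen :: "real \<Rightarrow> complex \<Rightarrow> complex \<Rightarrow> agen falg \<Rightarrow> bool" where
  "left_eigen q s \<mu> \<xi> \<longleftrightarrow> (\<forall>v. xB q * row q \<xi> (gen_B # gen_A # v) + xC q * row q \<xi> (gen_C # gen_A # v) -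
     s * (row q \<xi> (gen_A # gen_A # v) - row q \<xi> v) = \<mu> * row q \<xi> v)"

lemma right_eigen_const: "right_eigen q s \<mu> \<xi> \<Longrightarrow> right_eigen q s \<mu> (const c * \<xi>)"
proof -
  assume "right_eigen q s \<mu> \<xi>"
  then have *: "c * (xB q * row q \<xi> (u @ [gen_B, gen_A]) + xC q * row q \<xi> (u @ [gen_C, gen_A]) -
     s * (row q \<xi> (u @ [gen_A, gen_A]) - row q \<xi> u)) = c * (\<mu> * row q \<xi> u)" for u
    unfolding right_eigen_def by metis
  have r: "row q (const c * \<xi>) a = c * row q \<xi> a" for a by (simp add: row_def lin_const)
  show ?thesis unfolding right_eigen_def r using * by (simp add: algebra_simps)
qed

lemma left_eigen_const: "left_eigen q s \<mu> \<xi> \<Longrightarrow> left_eigen q s \<mu> (const c * \<xi>)"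
proof -
  assume "left_eigen q s \<mu> \<xi>"
  then have *: "c * (xB q * row q \<xi> (gen_B # gen_A # u) + xC q * row q \<xi> (gen_C # gen_A # u) -
     s * (row q \<xi> (gen_A # gen_A # u) - row q \<xi> u)) = c * (\<mu> * row q \<xi> u)" for u
    unfolding left_eigen_def by metis
  have r: "row q (const c * \<xi>) a = c * row q \<xi> a" for a by (simp add: row_def lin_const)
  show ?thesis unfolding left_eigen_def r using * by (simp add: algebra_simps)
qed

lemma right_eigen_0: "right_eigen q s \<mu> 0" and left_eigen_0: "left_eigen q s \<mu> 0"
  by (simp_all add: right_eigen_def left_eigen_def row_def)

lemma right_eigen_add: "right_eigen q s \<mu> \<xi> \<Longrightarrow> right_eigen q s \<mu> \<eta> \<Longrightarrow> right_eigen q s \<mu> (\<xi> + \<eta>)"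
proof -
  assume a: "right_eigen q s \<mu> \<xi>" "right_eigen q s \<mu> \<eta>"
  have r: "row q (\<xi> + \<eta>) a = row q \<xi> a + row q \<eta> a" for a by (simp add: row_def lin_add)
  show ?thesis unfolding right_eigen_def r
  proof
    fix u
    show "xB q * (row q \<xi> (u @ [gen_B, gen_A]) + row q \<eta> (u @ [gen_B, gen_A])) +
         xC q * (row q \<xi> (u @ [gen_C, gen_A]) + row q \<eta> (u @ [gen_C, gen_A])) -
         s * (row q \<xi> (u @ [gen_A, gen_A]) + row q \<eta> (u @ [gen_A, gen_A]) - (row q \<xi> u + row q \<eta> u)) =
         \<mu> * (row q \<xi> u + row q \<eta> u)"
      using arg_cong2[where f="(+)", OF a(1)[unfolded right_eigen_def, rule_format, of u] a(2)[unfolded right_eigen_def, rule_format, of u]] by (simp add: algebra_simps)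
  qed
qed

lemma left_eigen_add: "left_eigen q s \<mu> \<xi> \<Longrightarrow> left_eigen q s \<mu> \<eta> \<Longrightarrow> left_eigen q s \<mu> (\<xi> + \<eta>)"
proof -
  assume a: "left_eigen q s \<mu> \<xi>" "left_eigen q s \<mu> \<eta>"
  have r: "row q (\<xi> + \<eta>) a = row q \<xi> a + row q \<eta> a" for a by (simp add: row_def lin_add)
  show ?thesis unfolding left_eigen_def r
  proof
    fix u
    show "xB q * (row q \<xi> (gen_B # gen_A # u) + row q \<eta> (gen_B # gen_A # u)) +
         xC q * (row q \<xi> (gen_C # gen_A # u) + row q \<eta> (gen_C # gen_A # u)) -
         s * (row q \<xi> (gen_A # gen_A # u) + row q \<eta> (gen_A # gen_A # u) - (row q \<xi> u + row q \<eta> u)) =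
         \<mu> * (row q \<xi> u + row q \<eta> u)"
      using arg_cong2[where f="(+)", OF a(1)[unfolded left_eigen_def, rule_format, of u] a(2)[unfolded left_eigen_def, rule_format, of u]] by (simp add: algebra_simps)
  qed
qed

lemma right_eigen_sum: "(\<And>i. i \<in> S \<Longrightarrow> right_eigen q s \<mu> (f i)) \<Longrightarrow> right_eigen q s \<mu> (\<Sum>i\<in>S. f i)"
  by (induction S rule: infinite_finite_induct) (auto intro: right_eigen_0 right_eigen_add)

lemma left_eigen_sum: "(\<And>i. i \<in> S \<Longrightarrow> left_eigen q s \<mu> (f i)) \<Longrightarrow> left_eigen q s \<mu> (\<Sum>i\<in>S. f i)"
  by (induction S rule: infinite_finite_induct) (auto intro: left_eigen_0 left_eigen_add)

lemma right_eigen_diff: "right_eigen q s \<mu> \<xi> \<Longrightarrow> right_eigen q s \<mu> \<eta> \<Longrightarrow> right_eigen q s \<mu> (\<xi> - \<eta>)"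
  using right_eigen_add[of q s \<mu> \<xi> "const (-1) * \<eta>"] right_eigen_const[of q s \<mu> \<eta> "-1"] by (simp add: const_minus)

lemma left_eigen_diff: "left_eigen q s \<mu> \<xi> \<Longrightarrow> left_eigen q s \<mu> \<eta> \<Longrightarrow> left_eigen q s \<mu> (\<xi> - \<eta>)"
  using left_eigen_add[of q s \<mu> \<xi> "const (-1) * \<eta>"] left_eigen_const[of q s \<mu> \<eta> "-1"] by (simp add: const_minus)

context
  fixes q :: real
  assumes q: "0 < q" "q < 1"
begin

text \<open>
  With \<open>Z = X\<^sub>\<sigma>A\<close> one has \<open>\<Delta>(Z) = A\<^sup>2 \<otimes> Z + Z \<otimes> 1\<close>.
\<close>

lemma right_eigen_mult:
  assumes "right_eigen q s \<mu> \<xi>" "right_eigen q s 0 \<eta>"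
  shows "right_eigen q s \<mu> (\<xi> * \<eta>)"
  unfolding right_eigen_def row_mult
proof
  fix u
  let ?X = "row q \<xi>" and ?Y = "row q \<eta>"
  have D: "?Y (v @ [gen_D, gen_A]) = ?Y v" for v
    using uq_functional_row[OF q, of \<eta>, unfolded uq_functional_def, rule_format, of v "[]"] by simp
  have "xB q * sw cmU (u @ [gen_B, gen_A]) (\<lambda>a b. ?X a * ?Y b) + xC q * sw cmU (u @ [gen_C, gen_A]) (\<lambda>a b. ?X a * ?Y b) -
     s * (sw cmU (u @ [gen_A, gen_A]) (\<lambda>a b. ?X a * ?Y b) - sw cmU u (\<lambda>a b. ?X a * ?Y b)) =
     sw cmU u (\<lambda>a b. xB q * (?X (a @ [gen_A, gen_A]) * ?Y (b @ [gen_B, gen_A]) + ?X (a @ [gen_B, gen_A]) * ?Y b) +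
        xC q * (?X (a @ [gen_A, gen_A]) * ?Y (b @ [gen_C, gen_A]) + ?X (a @ [gen_C, gen_A]) * ?Y b) +
        (- s) * (?X (a @ [gen_A, gen_A]) * ?Y (b @ [gen_A, gen_A])) + s * (?X a * ?Y b))"
    unfolding sw_add sw_mult_l sw_append by (simp add: D sw_add algebra_simps)
  also have "\<dots> = sw cmU u (\<lambda>a b. \<mu> * (?X a * ?Y b))"
  proof (rule arg_cong[of _ _ "sw cmU u"], intro ext)
    fix a b
    have "xB q * ?X (a @ [gen_B, gen_A]) + xC q * ?X (a @ [gen_C, gen_A]) = s * (?X (a @ [gen_A, gen_A]) - ?X a) + \<mu> * ?X a"
      using assms(1)[unfolded right_eigen_def, rule_format, of a] by (simp add: algebra_simps)
    moreover have "xB q * ?Y (b @ [gen_B, gen_A]) + xC q * ?Y (b @ [gen_C, gen_A]) = s * (?Y (b @ [gen_A, gen_A]) - ?Y b)"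
      using assms(2)[unfolded right_eigen_def, rule_format, of b] by (simp add: algebra_simps)
    moreover have "xB q * (?X (a @ [gen_A, gen_A]) * ?Y (b @ [gen_B, gen_A]) + ?X (a @ [gen_B, gen_A]) * ?Y b) +
        xC q * (?X (a @ [gen_A, gen_A]) * ?Y (b @ [gen_C, gen_A]) + ?X (a @ [gen_C, gen_A]) * ?Y b) +
        (- s) * (?X (a @ [gen_A, gen_A]) * ?Y (b @ [gen_A, gen_A])) + s * (?X a * ?Y b) =
        ?X (a @ [gen_A, gen_A]) * (xB q * ?Y (b @ [gen_B, gen_A]) + xC q * ?Y (b @ [gen_C, gen_A])) +
        (xB q * ?X (a @ [gen_B, gen_A]) + xC q * ?X (a @ [gen_C, gen_A])) * ?Y b +
        (- s) * (?X (a @ [gen_A, gen_A]) * ?Y (b @ [gen_A, gen_A])) + s * (?X a * ?Y b)"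
      by (simp add: algebra_simps)
    ultimately show "xB q * (?X (a @ [gen_A, gen_A]) * ?Y (b @ [gen_B, gen_A]) + ?X (a @ [gen_B, gen_A]) * ?Y b) +
        xC q * (?X (a @ [gen_A, gen_A]) * ?Y (b @ [gen_C, gen_A]) + ?X (a @ [gen_C, gen_A]) * ?Y b) +
        (- s) * (?X (a @ [gen_A, gen_A]) * ?Y (b @ [gen_A, gen_A])) + s * (?X a * ?Y b) = \<mu> * (?X a * ?Y b)"
      by (simp only:) (simp add: algebra_simps)
  qed
  finally show "xB q * sw cmU (u @ [gen_B, gen_A]) (\<lambda>a b. ?X a * ?Y b) + xC q * sw cmU (u @ [gen_C, gen_A]) (\<lambda>a b. ?X a * ?Y b) -
     s * (sw cmU (u @ [gen_A, gen_A]) (\<lambda>a b. ?X a * ?Y b) - sw cmU u (\<lambda>a b. ?X a * ?Y b)) = \<mu> * sw cmU u (\<lambda>a b. ?X a * ?Y b)"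
    by (simp add: sw_mult_l)
qed

lemma left_eigen_mult:
  assumes "left_eigen q s \<mu> \<xi>" "left_eigen q s 0 \<eta>"
  shows "left_eigen q s \<mu> (\<xi> * \<eta>)"
  unfolding left_eigen_def row_mult
proof
  fix u
  let ?X = "row q \<xi>" and ?Y = "row q \<eta>"
  have D: "?Y (gen_D # gen_A # v) = ?Y v" for v
    using uq_functional_row[OF q, of \<eta>, unfolded uq_functional_def, rule_format, of "[]" v] by simp
  have "xB q * sw cmU (gen_B # gen_A # u) (\<lambda>a b. ?X a * ?Y b) + xC q * sw cmU (gen_C # gen_A # u) (\<lambda>a b. ?X a * ?Y b) -
     s * (sw cmU (gen_A # gen_A # u) (\<lambda>a b. ?X a * ?Y b) - sw cmU u (\<lambda>a b. ?X a * ?Y b)) =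
     sw cmU u (\<lambda>a b. xB q * (?X (gen_A # gen_A # a) * ?Y (gen_B # gen_A # b) + ?X (gen_B # gen_A # a) * ?Y b) +
        xC q * (?X (gen_A # gen_A # a) * ?Y (gen_C # gen_A # b) + ?X (gen_C # gen_A # a) * ?Y b) +
        (- s) * (?X (gen_A # gen_A # a) * ?Y (gen_A # gen_A # b)) + s * (?X a * ?Y b))"
    unfolding sw_add sw_mult_l by (simp add: D sw_add algebra_simps)
  also have "\<dots> = sw cmU u (\<lambda>a b. \<mu> * (?X a * ?Y b))"
  proof (rule arg_cong[of _ _ "sw cmU u"], intro ext)
    fix a b
    have "xB q * ?X (gen_B # gen_A # a) + xC q * ?X (gen_C # gen_A # a) = s * (?X (gen_A # gen_A # a) - ?X a) + \<mu> * ?X a"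
      using assms(1)[unfolded left_eigen_def, rule_format, of a] by (simp add: algebra_simps)
    moreover have "xB q * ?Y (gen_B # gen_A # b) + xC q * ?Y (gen_C # gen_A # b) = s * (?Y (gen_A # gen_A # b) - ?Y b)"
      using assms(2)[unfolded left_eigen_def, rule_format, of b] by (simp add: algebra_simps)
    moreover have "xB q * (?X (gen_A # gen_A # a) * ?Y (gen_B # gen_A # b) + ?X (gen_B # gen_A # a) * ?Y b) +
        xC q * (?X (gen_A # gen_A # a) * ?Y (gen_C # gen_A # b) + ?X (gen_C # gen_A # a) * ?Y b) +
        (- s) * (?X (gen_A # gen_A # a) * ?Y (gen_A # gen_A # b)) + s * (?X a * ?Y b) =
        ?X (gen_A # gen_A # a) * (xB q * ?Y (gen_B # gen_A # b) + xC q * ?Y (gen_C # gen_A # b)) +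
        (xB q * ?X (gen_B # gen_A # a) + xC q * ?X (gen_C # gen_A # a)) * ?Y b +
        (- s) * (?X (gen_A # gen_A # a) * ?Y (gen_A # gen_A # b)) + s * (?X a * ?Y b)"
      by (simp add: algebra_simps)
    ultimately show "xB q * (?X (gen_A # gen_A # a) * ?Y (gen_B # gen_A # b) + ?X (gen_B # gen_A # a) * ?Y b) +
        xC q * (?X (gen_A # gen_A # a) * ?Y (gen_C # gen_A # b) + ?X (gen_C # gen_A # a) * ?Y b) +
        (- s) * (?X (gen_A # gen_A # a) * ?Y (gen_A # gen_A # b)) + s * (?X a * ?Y b) = \<mu> * (?X a * ?Y b)"
      by (simp only:) (simp add: algebra_simps)
  qed
  finally show "xB q * sw cmU (gen_B # gen_A # u) (\<lambda>a b. ?X a * ?Y b) + xC q * sw cmU (gen_C # gen_A # u) (\<lambda>a b. ?X a * ?Y b) -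
     s * (sw cmU (gen_A # gen_A # u) (\<lambda>a b. ?X a * ?Y b) - sw cmU u (\<lambda>a b. ?X a * ?Y b)) = \<mu> * sw cmU u (\<lambda>a b. ?X a * ?Y b)"
    by (simp add: sw_mult_l)
qed

lemma right_eigen_poly_lift: "right_eigen q s \<mu> \<xi> \<Longrightarrow> right_eigen q s 0 \<eta> \<Longrightarrow> right_eigen q s \<mu> (\<xi> * poly_lift P \<eta>)"
proof -
  assume a: "right_eigen q s \<mu> \<xi>" "right_eigen q s 0 \<eta>"
  have "right_eigen q s \<mu> (\<xi> * \<eta> ^ k)" for k
  proof (induction k)
    case (Suc k)
    then show ?case using right_eigen_mult[OF _ a(2), of \<mu> "\<xi> * \<eta> ^ k"] by (simp add: mult.assoc power_commutes)
  qed (use a in simp)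
  then show ?thesis unfolding poly_lift_def sum_distrib_left mult_const_left by (intro right_eigen_sum right_eigen_const)
qed

lemma left_eigen_poly_lift: "left_eigen q s \<mu> \<xi> \<Longrightarrow> left_eigen q s 0 \<eta> \<Longrightarrow> left_eigen q s \<mu> (\<xi> * poly_lift P \<eta>)"
proof -
  assume a: "left_eigen q s \<mu> \<xi>" "left_eigen q s 0 \<eta>"
  have "left_eigen q s \<mu> (\<xi> * \<eta> ^ k)" for k
  proof (induction k)
    case (Suc k)
    then show ?case using left_eigen_mult[OF _ a(2), of \<mu> "\<xi> * \<eta> ^ k"] by (simp add: mult.assoc power_commutes)
  qed (use a in simp)
  then show ?thesis unfolding poly_lift_def sum_distrib_left mult_const_left by (intro left_eigen_sum left_eigen_const)
qed

text \<open>Vanishing on the torus spreads to all words A^k w with large k by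
  \<open>torus_vanish\<close>, which is precisely the hypothesis of \<open>nondegenerate\<close>.
  The eigenvalues on the two sides are arbitrary.\<close>

lemma spherical_zero:
  assumes "right_eigen q s \<mu> \<xi>" "left_eigen q t \<nu> \<xi>" "\<And>lam. lam \<noteq> 0 \<Longrightarrow> tau lam \<xi> = 0"
  shows "\<xi> \<in> ideal_span (Aq_rels q)"
proof (rule nondegenerate[OF q])
  fix xs assume "set xs \<subseteq> BC"
  then have "row q \<xi> (replicate k gen_A @ xs) = 0" if "k \<ge> 2 * length xs + 2" for k
    using that
  proof (intro torus_vanish[OF q uq_functional_row[OF q], where ?x1.0 = "xB q" and ?x2.0 = "xC q" and s = s and \<mu> = \<mu> and t = t and \<nu> = \<nu>])
    show "xB q \<noteq> 0" using q by (simp add: xB_def)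
    show "row q \<xi> (replicate k gen_A) = 0" for k
      using assms(3)[of "complex_of_real (q powr (1/2)) ^ k"] tau_row[OF q, of k \<xi>] q by simp
  qed (use assms in \<open>auto simp: xC_def right_eigen_def left_eigen_def\<close>)
  then show "\<exists>K. \<forall>k\<ge>K. row q \<xi> (replicate k gen_A @ xs) = 0" by blast
qed

section \<open>The element D.rho: invariance and torus values\<close>

definition rhoF :: "real \<Rightarrow> real \<Rightarrow> agen falg" where
  "rhoF \<tau> \<sigma> = (let a = gen gen_alpha; b = gen gen_beta; c = gen gen_gamma; d = gen gen_delta;
       k = const (complex_of_real q); k' = const (complex_of_real (inverse q));
       s = complex_of_real (q powr (-\<sigma>) - q powr \<sigma>); t = complex_of_real (q powr (-\<tau>) - q powr \<tau>)
     in const (1/2) *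
          (a ^ 2 + d ^ 2 + k * c ^ 2 + k' * b ^ 2
           + const (\<i> * s) * (k * d * c + b * a)
           - const (\<i> * t) * (d * b + k * c * a)
           + const (s * t) * b * c))"

definition eta :: "real \<Rightarrow> real \<Rightarrow> agen falg" where
  "eta \<tau> \<sigma> = lmap (\<lambda>w. sw cmA (unw w) (\<lambda>u v. const (pg q gen_D v) * Poly_Mapping.single (Word u) 1)) (rhoF \<tau> \<sigma>)"

lemma poly_at_D_rho_eq: "poly_at_D_rho q \<tau> \<sigma> P = cls (Aq_rels q) (poly_lift P (eta \<tau> \<sigma>))"
proof -
  have "rho q \<tau> \<sigma> = cls (Aq_rels q) (rhoF \<tau> \<sigma>)" by (simp add: rho_def rhoF_def Let_def)
  then show ?thesis
    by (simp add: poly_at_D_rho_def left_act_cls[OF q] poly_eval_cls Aq_def eta_def)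
qed

text \<open>Acting by D from the left appends D to the word in the pairing. Since AD = 1, invariance
  of D.rho under \<open>X A\<close> on the right is annihilation of rho by \<open>X\<close>.\<close>

lemma row_eta: "row q (eta \<tau> \<sigma>) a = row q (rhoF \<tau> \<sigma>) (a @ [gen_D])"
  by (simp add: row_def eta_def lin_lmap lin_sw lin_const pw_append pw_single ac_simps del: pw.simps)

lemma lin_rhoF: "lin f (rhoF \<tau> \<sigma>) = (let F = (\<lambda>x y. f (Word [x, y]));
    k = complex_of_real q; s = complex_of_real (q powr (-\<sigma>) - q powr \<sigma>); t = complex_of_real (q powr (-\<tau>) - q powr \<tau>) in
    1/2 * (F gen_alpha gen_alpha + F gen_delta gen_delta + k * F gen_gamma gen_gamma + inverse k * F gen_beta gen_beta
     + \<i> * s * (k * F gen_delta gen_gamma + F gen_beta gen_alpha) - \<i> * t * (F gen_delta gen_beta + k * F gen_gamma gen_alpha)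
     + s * t * F gen_beta gen_gamma))"
  by (simp add: rhoF_def Let_def lin_const lin_add lin_diff gen_mult mult.assoc power2_eq_square)

text \<open>Only the squares of alpha and delta survive on the torus. The action of D scales them by
  1/q and q, which is why the Askey-Wilson variable is z = lam^2 / q.\<close>

lemma tau_eta:
  assumes "lam \<noteq> 0"
  shows "tau lam (eta \<tau> \<sigma>) = (lam\<^sup>2 / q + inverse (lam\<^sup>2 / q)) / 2"
proof -
  have h: "complex_of_real (q powr (1/2)) \<noteq> 0" "complex_of_real (q powr (1/2)) * complex_of_real (q powr (1/2)) = complex_of_real q"
    using q_half[OF q] q by simp_all
  have "tau lam (eta \<tau> \<sigma>) = lin (\<lambda>w. sw cmA (unw w) (\<lambda>u v. pg q gen_D v * tw lam u)) (rhoF \<tau> \<sigma>)"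
    by (simp add: tau_def eta_def lin_lmap lin_sw lin_const)
  also have "\<dots> = 1/2 * (lam * lam * (inverse (complex_of_real (q powr (1/2))) * inverse (complex_of_real (q powr (1/2))))
      + inverse lam * inverse lam * (complex_of_real (q powr (1/2)) * complex_of_real (q powr (1/2))))"
    unfolding lin_rhoF Let_def using q by (simp add: tw_def powr_minus)
  also have "inverse (complex_of_real (q powr (1/2))) * inverse (complex_of_real (q powr (1/2))) = inverse (complex_of_real q)"
    using h(2) by (metis inverse_mult_distrib)
  finally show ?thesis unfolding h(2) using assms q by (simp add: power2_eq_square field_simps)
qed

text \<open>Acting from the right on beta gamma produces alpha gamma and beta delta, whereas the
  other terms of rho produce them in the opposite order.\<close>

lemma pw_relations:
  "pw q y [gen_alpha, gen_gamma] = complex_of_real q * pw q y [gen_gamma, gen_alpha]"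
  "pw q y [gen_beta, gen_delta] = complex_of_real q * pw q y [gen_delta, gen_beta]"
proof -
  have "gen gen_alpha * gen gen_gamma - const (complex_of_real q) * (gen gen_gamma * gen gen_alpha) \<in> ideal_span (Aq_rels q)"
    "gen gen_beta * gen gen_delta - const (complex_of_real q) * (gen gen_delta * gen gen_beta) \<in> ideal_span (Aq_rels q)"
    by (auto intro!: ideal_span_gen simp: Aq_rels_def Let_def mult.assoc)
  from this[THEN pw_kills_Aq[OF q, of _ y]]
  show "pw q y [gen_alpha, gen_gamma] = complex_of_real q * pw q y [gen_gamma, gen_alpha]"
    "pw q y [gen_beta, gen_delta] = complex_of_real q * pw q y [gen_delta, gen_beta]"
    by (simp_all add: lin_diff lin_const gen_mult del: pw.simps)
qed

lemma eta_equations: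
  "right_eigen q (complex_of_real ((q powr (-\<sigma>) - q powr \<sigma>) / (inverse q - q))) 0 (eta \<tau> \<sigma>)"
  "left_eigen q (complex_of_real ((q powr (-\<tau>) - q powr \<tau>) / (inverse q - q))) 0 (eta \<tau> \<sigma>)"
proof -
  define h where "h = complex_of_real (q powr (1/2))"
  have h: "h \<noteq> 0" using q by (simp add: h_def)
  have k: "complex_of_real q = h * h" using q_half(1)[OF q] by (simp add: h_def)
  have kz: "complex_of_real q \<noteq> 0" using q by simp
  have h4: "h * h * h * h \<noteq> 1"
  proof
    assume "h * h * h * h = 1"
    then have "complex_of_real (q * q) = 1" by (simp add: k mult.assoc)
    then have "q * q = 1" using of_real_eq_1_iff by blast
    moreover have "q * q < 1" using q by (metis mult_strict_mono mult.right_neutral less_eq_real_def zero_less_one)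
    ultimately show False by simp
  qed
  have gp: "gen_pairing q gen_A gen_alpha = h" "gen_pairing q gen_D gen_delta = h"
     "gen_pairing q gen_A gen_delta = inverse h" "gen_pairing q gen_D gen_alpha = inverse h"
    using q by (simp_all add: h_def powr_minus)
  note gps = gen_pairing.simps(1-4)
  define S T where "S = complex_of_real ((q powr (-\<sigma>) - q powr \<sigma>) / (inverse q - q))" and "T = complex_of_real ((q powr (-\<tau>) - q powr \<tau>) / (inverse q - q))"
  have iq: "inverse q - q \<noteq> 0"
    using q by (metis eq_iff_diff_eq_0 less_irrefl one_less_inverse order.strict_trans)
  have ST: "complex_of_real (q powr (-\<sigma>) - q powr \<sigma>) = S * (inverse (h * h) - h * h)"
    "complex_of_real (q powr (-\<tau>) - q powr \<tau>) = T * (inverse (h * h) - h * h)"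
    unfolding S_def T_def k[symmetric] of_real_inverse[symmetric] of_real_diff[symmetric] of_real_mult[symmetric] using iq by simp_all
  have XB: "xB q = \<i> * h" "xC q = - \<i> * inverse h"
    using h by (simp_all add: xB_def xC_def k h_def[symmetric] field_simps)
  note R = uq_functional_row[OF q, of "rhoF \<tau> \<sigma>", unfolded uq_functional_def, rule_format]
  note expand = lin_rhoF Let_def row_def
  have 1: "xB q * row q (rhoF \<tau> \<sigma>) (y @ [gen_B]) + xC q * row q (rhoF \<tau> \<sigma>) (y @ [gen_C]) -
     S * (row q (rhoF \<tau> \<sigma>) (y @ [gen_A]) - row q (rhoF \<tau> \<sigma>) (y @ [gen_D])) = 0" for y
  proof -
    have pr: "pw q y [gen_alpha, gen_gamma] = h * h * pw q y [gen_gamma, gen_alpha]"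
      "pw q y [gen_beta, gen_delta] = h * h * pw q y [gen_delta, gen_beta]"
      using pw_relations k by simp_all
    show ?thesis
      unfolding row_def lin_rhoF Let_def ST k XB pw_append pw_single
      by (simp add: gp pr del: gps pw.simps) (use h in \<open>simp add: field_simps\<close>)
  qed
  show "right_eigen q S 0 (eta \<tau> \<sigma>)"
    unfolding right_eigen_def
  proof
    fix u
    show "xB q * row q (eta \<tau> \<sigma>) (u @ [gen_B, gen_A]) + xC q * row q (eta \<tau> \<sigma>) (u @ [gen_C, gen_A]) -
        S * (row q (eta \<tau> \<sigma>) (u @ [gen_A, gen_A]) - row q (eta \<tau> \<sigma>) u) = 0 * row q (eta \<tau> \<sigma>) u"
      using 1[of u] R[of "u @ [gen_B]" "[]"] R[of "u @ [gen_C]" "[]"] R[of "u @ [gen_A]" "[]"] by (simp add: row_eta)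
  qed
  \<comment> \<open>On the left, rho is already annihilated by the twisted primitive element for the
    other parameter; the tail of the word, including the D from \<open>row_eta\<close>, does not
    interfere.\<close>
  have 2: "xB q * row q (rhoF \<tau> \<sigma>) (gen_B # y) + xC q * row q (rhoF \<tau> \<sigma>) (gen_C # y) -
     T * (row q (rhoF \<tau> \<sigma>) (gen_A # y) - row q (rhoF \<tau> \<sigma>) (gen_D # y)) = 0" for y
    unfolding row_def lin_rhoF Let_def ST k XB pw_Cons act_def
    by (simp add: gp del: gps) (use h in \<open>simp add: field_simps\<close>)
  show "left_eigen q T 0 (eta \<tau> \<sigma>)"
    unfolding left_eigen_def
  proof
    fix v
    show "xB q * row q (eta \<tau> \<sigma>) (gen_B # gen_A # v) + xC q * row q (eta \<tau> \<sigma>) (gen_C # gen_A # v) -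
        T * (row q (eta \<tau> \<sigma>) (gen_A # gen_A # v) - row q (eta \<tau> \<sigma>) v) = 0 * row q (eta \<tau> \<sigma>) v"
      using 2[of "gen_A # v @ [gen_D]"] R[of "[]" "v @ [gen_D]"] by (simp add: row_eta)
  qed
qed

end

section \<open>From eigenvectors in a representation to eigen-equations in the algebra\<close>

text \<open>The eigenvector equation for the matrix of \<open>X A\<close>, written in coordinates.
  Values of \<open>v\<close> outside the weights carry the coefficient 0 by
  \<open>b_entry_ends\<close>.\<close>

definition eigenvec :: "real \<Rightarrow> real \<Rightarrow> real \<Rightarrow> real \<Rightarrow> (real \<Rightarrow> complex) \<Rightarrow> bool" where
  "eigenvec q l s \<mu> v \<longleftrightarrow> (\<forall>n\<in>weights l. xB q * b_entry q l (n + 1) * complex_of_real (q powr (-n-1)) * v (n + 1)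
     + xC q * b_entry q l n * complex_of_real (q powr (1-n)) * v (n - 1)
     - complex_of_real s * (complex_of_real (q powr (-n)) * complex_of_real (q powr (-n)) - 1) * v n = complex_of_real \<mu> * v n)"

context
  fixes q l :: real and N :: nat
  assumes q: "0 < q" "q < 1" and N: "2 * l = real N"
begin

lemma right_eigen_elem_lift:
  assumes v: "eigenvec q l s \<mu> v"
  shows "right_eigen q (complex_of_real s) (complex_of_real \<mu>) (elem_lift q l v w)"
  unfolding right_eigen_def row_elem_lift[OF q N]
proof
  fix u
  let ?W = "weights l"
  have "xB q * (\<Sum>m\<in>?W. v m * c * word_matrix q l (u @ [gen_B, gen_A]) n m) + xC q * (\<Sum>m\<in>?W. v m * c * word_matrix q l (u @ [gen_C, gen_A]) n m)
     - complex_of_real s * ((\<Sum>m\<in>?W. v m * c * word_matrix q l (u @ [gen_A, gen_A]) n m) - (\<Sum>m\<in>?W. v m * c * word_matrix q l u n m)) =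
     complex_of_real \<mu> * (\<Sum>m\<in>?W. v m * c * word_matrix q l u n m)" for n c
  proof -
    have A: "word_matrix q l (u @ [g, gen_A]) n m = complex_of_real (q powr (-m)) * word_matrix q l (u @ [g]) n m" if "m \<in> ?W" for g m
      using word_matrix_snoc_A[OF q N that, of "u @ [g]"] by simp
    have "(\<Sum>m\<in>?W. v m * c * word_matrix q l (u @ [gen_B, gen_A]) n m) =
       (\<Sum>m\<in>?W. b_entry q l m * word_matrix q l u n (m - 1) * (complex_of_real (q powr (-m)) * v m * c))"
      by (rule sum.cong) (simp_all add: A word_matrix_snoc_B[OF q N])
    also have "\<dots> = (\<Sum>m\<in>?W. b_entry q l (m + 1) * word_matrix q l u n m * (complex_of_real (q powr (-(m+1))) * v (m + 1) * c))"
      using sum_weights_shift[OF q N, of "word_matrix q l u n" "\<lambda>m. complex_of_real (q powr (-m)) * v m * c"] by simp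
    finally have B: "(\<Sum>m\<in>?W. v m * c * word_matrix q l (u @ [gen_B, gen_A]) n m) = \<dots>" .
    have "(\<Sum>m\<in>?W. v m * c * word_matrix q l (u @ [gen_C, gen_A]) n m) =
       (\<Sum>m\<in>?W. b_entry q l (m + 1) * (complex_of_real (q powr (-m)) * v m * c) * word_matrix q l u n (m + 1))"
      by (rule sum.cong) (simp_all add: A word_matrix_snoc_C[OF q N])
    also have "\<dots> = (\<Sum>m\<in>?W. b_entry q l m * (complex_of_real (q powr (-(m-1))) * v (m - 1) * c) * word_matrix q l u n m)"
      using sum_weights_shift[OF q N, of "\<lambda>m. complex_of_real (q powr (-m)) * v m * c" "word_matrix q l u n"] by simp
    finally have C: "(\<Sum>m\<in>?W. v m * c * word_matrix q l (u @ [gen_C, gen_A]) n m) = \<dots>" .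
    have AA: "(\<Sum>m\<in>?W. v m * c * word_matrix q l (u @ [gen_A, gen_A]) n m) =
       (\<Sum>m\<in>?W. complex_of_real (q powr (-m)) * complex_of_real (q powr (-m)) * v m * c * word_matrix q l u n m)"
      by (rule sum.cong) (simp_all add: A word_matrix_snoc_A[OF q N])
    have "(\<Sum>m\<in>?W. (xB q * b_entry q l (m + 1) * complex_of_real (q powr (-m-1)) * v (m + 1)
     + xC q * b_entry q l m * complex_of_real (q powr (1-m)) * v (m - 1)
     - complex_of_real s * (complex_of_real (q powr (-m)) * complex_of_real (q powr (-m)) - 1) * v m) * (c * word_matrix q l u n m)) =
      (\<Sum>m\<in>?W. (complex_of_real \<mu> * v m) * (c * word_matrix q l u n m))"
      using v unfolding eigenvec_def by (intro sum.cong) auto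
    then show ?thesis unfolding B C AA
      by (simp add: sum_distrib_left sum_subtractf sum.distrib algebra_simps)
  qed
  then have "(\<Sum>n\<in>?W. xB q * (\<Sum>m\<in>?W. v m * cnj (w n) * word_matrix q l (u @ [gen_B, gen_A]) n m) + xC q * (\<Sum>m\<in>?W. v m * cnj (w n) * word_matrix q l (u @ [gen_C, gen_A]) n m)
     - complex_of_real s * ((\<Sum>m\<in>?W. v m * cnj (w n) * word_matrix q l (u @ [gen_A, gen_A]) n m) - (\<Sum>m\<in>?W. v m * cnj (w n) * word_matrix q l u n m))) =
     (\<Sum>n\<in>?W. complex_of_real \<mu> * (\<Sum>m\<in>?W. v m * cnj (w n) * word_matrix q l u n m))"
    by (intro sum.cong) auto
  then show "xB q * (\<Sum>n\<in>?W. \<Sum>m\<in>?W. v m * cnj (w n) * word_matrix q l (u @ [gen_B, gen_A]) n m) + xC q * (\<Sum>n\<in>?W. \<Sum>m\<in>?W. v m * cnj (w n) * word_matrix q l (u @ [gen_C, gen_A]) n m)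
     - complex_of_real s * ((\<Sum>n\<in>?W. \<Sum>m\<in>?W. v m * cnj (w n) * word_matrix q l (u @ [gen_A, gen_A]) n m) - (\<Sum>n\<in>?W. \<Sum>m\<in>?W. v m * cnj (w n) * word_matrix q l u n m)) =
     complex_of_real \<mu> * (\<Sum>n\<in>?W. \<Sum>m\<in>?W. v m * cnj (w n) * word_matrix q l u n m)"
    unfolding sum.distrib sum_subtractf sum_distrib_left[symmetric] by (simp only: right_diff_distrib)
qed

lemma left_eigen_elem_lift:
  assumes w: "eigenvec q l s \<mu> w"
  shows "left_eigen q (complex_of_real s) (complex_of_real \<mu>) (elem_lift q l v w)"
  unfolding left_eigen_def row_elem_lift[OF q N]
proof
  fix u
  let ?W = "weights l"
  have cB: "cnj (b_entry q l n) = b_entry q l n" for n by (simp add: b_entry_def)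
  \<comment> \<open>This expresses that the matrix of \<open>X A\<close> is Hermitian. With a real
    eigenvalue, the conjugate of a right eigenvector is a left eigenvector.\<close>
  have cx: "cnj (xB q) * complex_of_real (q powr (-n-1)) = xC q * complex_of_real (q powr (-n))"
    "cnj (xC q) * complex_of_real (q powr (1-n)) = xB q * complex_of_real (q powr (-n))" for n
    using q by (simp_all add: xB_def xC_def powr_diff powr_minus field_simps)
  have sw: "(\<Sum>n\<in>?W. \<Sum>m\<in>?W. v m * cnj (w n) * word_matrix q l a n m) = (\<Sum>m\<in>?W. v m * (\<Sum>n\<in>?W. cnj (w n) * word_matrix q l a n m))" for a
    by (subst sum.swap) (simp add: sum_distrib_left mult.assoc)
  have "xB q * (\<Sum>n\<in>?W. cnj (w n) * word_matrix q l (gen_B # gen_A # u) n m) + xC q * (\<Sum>n\<in>?W. cnj (w n) * word_matrix q l (gen_C # gen_A # u) n m)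
     - complex_of_real s * ((\<Sum>n\<in>?W. cnj (w n) * word_matrix q l (gen_A # gen_A # u) n m) - (\<Sum>n\<in>?W. cnj (w n) * word_matrix q l u n m)) =
     complex_of_real \<mu> * (\<Sum>n\<in>?W. cnj (w n) * word_matrix q l u n m)" for m
  proof -
    have A: "word_matrix q l (gen_A # u) n m = complex_of_real (q powr (-n)) * word_matrix q l u n m" for n
      using word_matrix_A[OF q N, of n u m] word_matrix_off[OF q N, of n m] by (cases "n \<in> ?W") (simp_all del: word_matrix.simps)
    have "(\<Sum>n\<in>?W. cnj (w n) * word_matrix q l (gen_B # gen_A # u) n m) =
       (\<Sum>n\<in>?W. b_entry q l (n + 1) * cnj (w n) * (complex_of_real (q powr (-(n+1))) * word_matrix q l u (n + 1) m))"
      by (rule sum.cong) (simp_all add: A word_matrix_B[OF q N] del: word_matrix.simps)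
    also have "\<dots> = (\<Sum>n\<in>?W. b_entry q l n * cnj (w (n - 1)) * (complex_of_real (q powr (-n)) * word_matrix q l u n m))"
      using sum_weights_shift[OF q N, of "\<lambda>n. cnj (w n)" "\<lambda>n. complex_of_real (q powr (-n)) * word_matrix q l u n m"] by simp
    finally have B: "(\<Sum>n\<in>?W. cnj (w n) * word_matrix q l (gen_B # gen_A # u) n m) = \<dots>" .
    have "(\<Sum>n\<in>?W. cnj (w n) * word_matrix q l (gen_C # gen_A # u) n m) =
       (\<Sum>n\<in>?W. b_entry q l n * (complex_of_real (q powr (-(n-1))) * word_matrix q l u (n - 1) m) * cnj (w n))"
      by (rule sum.cong) (simp_all add: A word_matrix_C[OF q N] del: word_matrix.simps)
    also have "\<dots> = (\<Sum>n\<in>?W. b_entry q l (n + 1) * (complex_of_real (q powr (-n)) * word_matrix q l u n m) * cnj (w (n + 1)))"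
      using sum_weights_shift[OF q N, of "\<lambda>n. complex_of_real (q powr (-n)) * word_matrix q l u n m" "\<lambda>n. cnj (w n)"] by simp
    finally have C: "(\<Sum>n\<in>?W. cnj (w n) * word_matrix q l (gen_C # gen_A # u) n m) = \<dots>" .
    have AA: "(\<Sum>n\<in>?W. cnj (w n) * word_matrix q l (gen_A # gen_A # u) n m) =
       (\<Sum>n\<in>?W. complex_of_real (q powr (-n)) * complex_of_real (q powr (-n)) * cnj (w n) * word_matrix q l u n m)"
      by (rule sum.cong) (simp_all add: A word_matrix_A[OF q N] del: word_matrix.simps)
    have e: "xB q * b_entry q l n * complex_of_real (q powr (-n)) * cnj (w (n - 1)) + xC q * b_entry q l (n + 1) * complex_of_real (q powr (-n)) * cnj (w (n + 1))
      - complex_of_real s * (complex_of_real (q powr (-n)) * complex_of_real (q powr (-n)) - 1) * cnj (w n) = complex_of_real \<mu> * cnj (w n)" if "n \<in> ?W" for n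
    proof -
      have "cnj (xB q * b_entry q l (n + 1) * complex_of_real (q powr (-n-1)) * w (n + 1)
     + xC q * b_entry q l n * complex_of_real (q powr (1-n)) * w (n - 1)
     - complex_of_real s * (complex_of_real (q powr (-n)) * complex_of_real (q powr (-n)) - 1) * w n) = cnj (complex_of_real \<mu> * w n)"
        using w that by (simp only: eigenvec_def)
      then have "(cnj (xB q) * complex_of_real (q powr (-n-1))) * b_entry q l (n + 1) * cnj (w (n + 1))
     + (cnj (xC q) * complex_of_real (q powr (1-n))) * b_entry q l n * cnj (w (n - 1))
     - complex_of_real s * (complex_of_real (q powr (-n)) * complex_of_real (q powr (-n)) - 1) * cnj (w n) = complex_of_real \<mu> * cnj (w n)"
        by (simp add: cB algebra_simps)
      then show ?thesis unfolding cx by (simp add: algebra_simps)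
    qed
    have "(\<Sum>n\<in>?W. (xB q * b_entry q l n * complex_of_real (q powr (-n)) * cnj (w (n - 1)) + xC q * b_entry q l (n + 1) * complex_of_real (q powr (-n)) * cnj (w (n + 1))
      - complex_of_real s * (complex_of_real (q powr (-n)) * complex_of_real (q powr (-n)) - 1) * cnj (w n)) * word_matrix q l u n m) =
      (\<Sum>n\<in>?W. complex_of_real \<mu> * cnj (w n) * word_matrix q l u n m)"
      by (intro sum.cong refl) (simp only: e)
    then show ?thesis unfolding B C AA
      by (simp add: sum_distrib_left sum_subtractf sum.distrib algebra_simps)
  qed
  then have "(\<Sum>m\<in>?W. v m * (xB q * (\<Sum>n\<in>?W. cnj (w n) * word_matrix q l (gen_B # gen_A # u) n m) + xC q * (\<Sum>n\<in>?W. cnj (w n) * word_matrix q l (gen_C # gen_A # u) n m)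
     - complex_of_real s * ((\<Sum>n\<in>?W. cnj (w n) * word_matrix q l (gen_A # gen_A # u) n m) - (\<Sum>n\<in>?W. cnj (w n) * word_matrix q l u n m)))) =
     (\<Sum>m\<in>?W. v m * (complex_of_real \<mu> * (\<Sum>n\<in>?W. cnj (w n) * word_matrix q l u n m)))"
    by (intro sum.cong) auto
  moreover have "(\<Sum>m\<in>?W. v m * (c1 * f1 m + c2 * f2 m - c3 * (f3 m - f4 m))) =
     c1 * (\<Sum>m\<in>?W. v m * f1 m) + c2 * (\<Sum>m\<in>?W. v m * f2 m) - c3 * ((\<Sum>m\<in>?W. v m * f3 m) - (\<Sum>m\<in>?W. v m * f4 m))"
    "(\<Sum>m\<in>?W. v m * (c1 * f1 m)) = c1 * (\<Sum>m\<in>?W. v m * f1 m)" for c1 c2 c3 and f1 f2 f3 f4 :: "real \<Rightarrow> complex"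
    by (simp_all add: sum_distrib_left sum_subtractf sum.distrib algebra_simps)
  ultimately show "xB q * (\<Sum>n\<in>?W. \<Sum>m\<in>?W. v m * cnj (w n) * word_matrix q l (gen_B # gen_A # u) n m) + xC q * (\<Sum>n\<in>?W. \<Sum>m\<in>?W. v m * cnj (w n) * word_matrix q l (gen_C # gen_A # u) n m)
     - complex_of_real s * ((\<Sum>n\<in>?W. \<Sum>m\<in>?W. v m * cnj (w n) * word_matrix q l (gen_A # gen_A # u) n m) - (\<Sum>n\<in>?W. \<Sum>m\<in>?W. v m * cnj (w n) * word_matrix q l u n m)) =
     complex_of_real \<mu> * (\<Sum>n\<in>?W. \<Sum>m\<in>?W. v m * cnj (w n) * word_matrix q l u n m)"
    unfolding sw by (simp only:)
qed

end

section \<open>Basic hypergeometric sums\<close>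

lemma qpoch_0 [simp]: "qpoch a p 0 = 1" by (simp add: qpoch_def)
lemma qpoch_Suc: "qpoch a p (Suc k) = qpoch a p k * (1 - a * p ^ k)" by (simp add: qpoch_def)
lemma qpoch_zero [simp]: "qpoch 0 p k = 1" by (simp add: qpoch_def)

lemma qpoch_add: "qpoch a p (m + n) = qpoch a p m * qpoch (a * p ^ m) p n"
  by (induction n) (simp_all add: qpoch_Suc power_add ac_simps)

lemma qpoch_Suc_shift: "qpoch a p (Suc k) = (1 - a) * qpoch (a * p) p k"
  using qpoch_add[of a p 1 k] by (simp add: qpoch_Suc)

text \<open>The top-degree part of \<open>qpoch\<close>, that is (-x)^n p^(n(n-1)/2). As a product
  it needs no half-integer exponent and splits like \<open>qpoch\<close>.\<close>

definition tri :: "'a::comm_ring_1 \<Rightarrow> 'a \<Rightarrow> nat \<Rightarrow> 'a" where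
  "tri p x n = (\<Prod>r<n. - (x * p ^ r))"

lemma tri_0 [simp]: "tri p x 0 = 1" by (simp add: tri_def)
lemma tri_Suc: "tri p x (Suc n) = tri p x n * - (x * p ^ n)" by (simp add: tri_def)
lemma tri_scale: "tri p (c * x) n = c ^ n * tri p x n"
  by (induction n) (simp_all add: tri_Suc ac_simps)
lemma tri_add: "tri p x (m + n) = tri p x m * tri p (x * p ^ m) n"
  by (induction n) (simp_all add: tri_Suc power_add ac_simps)
lemma tri_nonzero: "x \<noteq> 0 \<Longrightarrow> p \<noteq> 0 \<Longrightarrow> tri p x n \<noteq> (0 :: 'a::field)"
  by (simp add: tri_def)

text \<open>The Gaussian binomial by its Pascal recursion, hence a polynomial in p over any
  commutative ring. No denominators have to be discussed until \<open>gauss_binom_mult\<close> links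
  it to \<open>qpoch\<close>.\<close>

fun gauss_binom :: "'a::comm_ring_1 \<Rightarrow> nat \<Rightarrow> nat \<Rightarrow> 'a" where
  "gauss_binom p n 0 = 1"
| "gauss_binom p 0 (Suc j) = 0"
| "gauss_binom p (Suc n) (Suc j) = gauss_binom p n (Suc j) + p ^ (n - j) * gauss_binom p n j"

lemma gauss_binom_zero: "n < j \<Longrightarrow> gauss_binom p n j = 0"
  by (induction p n j rule: gauss_binom.induct) auto

lemma gauss_binom_self [simp]: "gauss_binom p n n = 1"
  by (induction n) (auto simp: gauss_binom_zero)

lemma gauss_binom_step: "gauss_binom p n j * (1 - p ^ (n - j)) = gauss_binom p n (Suc j) * (1 - p ^ Suc j)"
proof (induction n arbitrary: j)
  case (Suc n)
  show ?case
  proof (cases j)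
    case 0
    have "gauss_binom p n (Suc 0) * (1 - p) = 1 - p ^ n" using Suc[of 0] by simp
    then have f: "gauss_binom p (Suc n) (Suc 0) * (1 - p) = (1 - p ^ n) + p ^ n * (1 - p)" by (simp add: distrib_right)
    have e: "(1 - p ^ n) + p ^ n * (1 - p) = 1 - p ^ Suc n" by (simp add: algebra_simps)
    show ?thesis unfolding 0 power_Suc0_right f e gauss_binom.simps(1) by simp
  next
    case (Suc j')
    show ?thesis
    proof (cases "j \<le> n")
      case True
      have 1: "gauss_binom p n (Suc j) * (1 - p ^ Suc j) = gauss_binom p n j * (1 - p ^ (n - j))" using Suc.IH[of j] by simp
      have 2: "gauss_binom p n j' * (1 - p ^ (n - j')) = gauss_binom p n j * (1 - p ^ j)" using Suc.IH[of j'] Suc by simp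
      have n: "n - j' = Suc n - j" "p ^ (n - j) * p ^ Suc j = p ^ Suc n" "p ^ (Suc n - j) * p ^ j = p ^ Suc n"
      proof -
        have "n - j + Suc j = Suc n" "Suc n - j + j = Suc n" using True by auto
        then show "p ^ (n - j) * p ^ Suc j = p ^ Suc n" "p ^ (Suc n - j) * p ^ j = p ^ Suc n"
          by (simp_all only: power_add[symmetric])
      qed (use Suc in simp)
      have "gauss_binom p (Suc n) j * (1 - p ^ (Suc n - j)) = (gauss_binom p n j + p ^ (Suc n - j) * gauss_binom p n j') * (1 - p ^ (Suc n - j))"
        using Suc n(1) by simp
      also have "\<dots> = gauss_binom p n j * (1 - p ^ (Suc n - j)) + p ^ (Suc n - j) * (gauss_binom p n j' * (1 - p ^ (n - j')))"
        unfolding n(1) by (simp add: algebra_simps)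
      also have "\<dots> = gauss_binom p n j * (1 - p ^ (Suc n - j) * p ^ j)"
        unfolding 2 by (simp add: algebra_simps)
      also have "\<dots> = gauss_binom p n j * (1 - p ^ (n - j) * p ^ Suc j)" by (simp only: n)
      also have "\<dots> = gauss_binom p n j * (1 - p ^ (n - j)) + p ^ (n - j) * gauss_binom p n j * (1 - p ^ Suc j)"
        by (simp add: algebra_simps)
      also have "\<dots> = gauss_binom p (Suc n) (Suc j) * (1 - p ^ Suc j)"
        unfolding 1[symmetric] by (simp add: algebra_simps)
      finally show ?thesis .
    next
      case False
      then show ?thesis by (cases "j = Suc n") (auto simp: gauss_binom_zero)
    qed
  qed
qed simp

lemma gauss_binom_mult: "k \<le> n \<Longrightarrow> gauss_binom p n k * qpoch p p k = (\<Prod>r<k. 1 - p ^ (n - r))"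
proof (induction k)
  case (Suc k)
  have "gauss_binom p n (Suc k) * qpoch p p (Suc k) = (gauss_binom p n (Suc k) * (1 - p ^ Suc k)) * qpoch p p k"
    by (simp add: qpoch_Suc algebra_simps)
  also have "\<dots> = (gauss_binom p n k * qpoch p p k) * (1 - p ^ (n - k))"
    unfolding gauss_binom_step[symmetric] by (simp add: algebra_simps)
  finally show ?case using Suc by simp
qed simp

text \<open>The terminating balanced sum with its denominators multiplied out, which makes it an
  identity over commutative rings. Special cases such as A = 0 or E = 0 then need no limits.\<close>

theorem q_saalschuetz:
  fixes A B E p :: "'a::comm_ring_1"
  shows "(\<Sum>j\<le>k. gauss_binom p k j * qpoch A p j * qpoch B p j * qpoch (A * B * E * p ^ j) p (k - j) * qpoch E p (k - j) * E ^ j)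
    = qpoch (A * E) p k * qpoch (B * E) p k"
proof (induction k)
  case (Suc k)
  define C where "C = A * B * E"
  define t where "t k j = gauss_binom p k j * qpoch A p j * qpoch B p j * qpoch (C * p ^ j) p (k - j) * qpoch E p (k - j) * E ^ j" for k j
  \<comment> \<open>The ratio of consecutive right-hand sides; the left-hand side is to satisfy the
    same first-order recurrence in k.\<close>
  define c where "c = (1 - A * E * p ^ k) * (1 - B * E * p ^ k)"
  \<comment> \<open>The certificate: \<open>t (Suc k) j - c * t k j\<close> is the difference of
    consecutive values of \<open>G\<close>, so the sum telescopes.\<close>
  define G where "G j = - (p ^ (k - j) * gauss_binom p k j * qpoch A p (Suc j) * qpoch B p (Suc j) *
      qpoch (C * p ^ j) p (k - j) * qpoch E p (k - j) * E ^ Suc j)" for j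
  have C1: "qpoch (C * p ^ j) p (Suc m) = (1 - C * p ^ j) * qpoch (C * p ^ Suc j) p m" for j m
    using qpoch_Suc_shift[of "C * p ^ j" p m] by (simp add: ac_simps)
  have step: "(\<Sum>j\<le>m. t (Suc k) j - c * t k j) = G m" if "m \<le> k" for m
    using that
  proof (induction m)
    case 0
    show ?case by (simp add: t_def G_def c_def qpoch_Suc C_def) (simp add: algebra_simps)
  next
    case (Suc m)
    define j where "j = Suc m"
    define M where "M = k - j"
    have kj: "k = j + M" "Suc k - j = Suc M" "k - m = Suc M" using Suc.prems by (auto simp: j_def M_def)
    define a b x e where "a = qpoch A p j" and "b = qpoch B p j" and "x = qpoch (C * p ^ j) p M" and "e = qpoch E p M"
    have gS: "gauss_binom p (Suc k) j = gauss_binom p k j + p ^ Suc M * gauss_binom p k m"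
      using kj by (simp add: j_def)
    have g: "gauss_binom p k m * (1 - p ^ Suc M) = gauss_binom p k j * (1 - p ^ j)"
      using gauss_binom_step[of p k m] kj by (simp add: j_def)
    have pk: "p ^ k = p ^ j * p ^ M" using kj(1) by (simp add: power_add)
    have pj: "p ^ j = p * p ^ m" by (simp add: j_def)
    have x': "qpoch (C * p ^ m) p (Suc M) = (1 - C * p ^ m) * x" using C1[of m M] by (simp add: x_def j_def)
    have x'': "qpoch (C * p ^ j) p (Suc M) = x * (1 - C * p ^ k)" by (simp add: qpoch_Suc x_def pk ac_simps)
    have "G m + (t (Suc k) j - c * t k j) - G j = a * b * E ^ j * x * e *
       (- (p ^ Suc M * gauss_binom p k m * (1 - C * p ^ m) * (1 - E * p ^ M))
        + (gauss_binom p k j + p ^ Suc M * gauss_binom p k m) * (1 - C * p ^ k) * (1 - E * p ^ M) - c * gauss_binom p k j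
        + p ^ M * gauss_binom p k j * (1 - A * p ^ j) * (1 - B * p ^ j) * E)"
    proof -
      have g1: "G m = - (p ^ Suc M * gauss_binom p k m * a * b * ((1 - C * p ^ m) * x) * (e * (1 - E * p ^ M)) * E ^ j)"
        unfolding G_def kj(3) x' by (simp add: a_def b_def j_def e_def qpoch_Suc[of E])
      have g2: "t (Suc k) j = (gauss_binom p k j + p ^ Suc M * gauss_binom p k m) * a * b * (x * (1 - C * p ^ k)) * (e * (1 - E * p ^ M)) * E ^ j"
        unfolding t_def kj(2) x'' gS by (simp add: a_def b_def e_def qpoch_Suc[of E])
      have g3: "t k j = gauss_binom p k j * a * b * x * e * E ^ j"
        by (simp add: t_def a_def b_def x_def e_def M_def)
      have g4: "G j = - (p ^ M * gauss_binom p k j * (a * (1 - A * p ^ j)) * (b * (1 - B * p ^ j)) * x * e * (E * E ^ j))"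
        by (simp add: G_def a_def b_def x_def e_def M_def qpoch_Suc)
      show ?thesis unfolding g1 g2 g3 g4 by (simp add: algebra_simps)
    qed
    also have "- (p ^ Suc M * gauss_binom p k m * (1 - C * p ^ m) * (1 - E * p ^ M))
        + (gauss_binom p k j + p ^ Suc M * gauss_binom p k m) * (1 - C * p ^ k) * (1 - E * p ^ M) - c * gauss_binom p k j
        + p ^ M * gauss_binom p k j * (1 - A * p ^ j) * (1 - B * p ^ j) * E =
        C * p ^ k * (1 - E * p ^ M) * (gauss_binom p k m * (1 - p ^ Suc M) - gauss_binom p k j * (1 - p ^ j))"
      unfolding c_def pk pj C_def power_Suc by (simp add: algebra_simps)
    also have "\<dots> = 0" unfolding g by simp
    finally have "G m + (t (Suc k) j - c * t k j) = G j" by simp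
    then show ?case using Suc by (simp add: j_def)
  qed
  have "(\<Sum>j\<le>Suc k. t (Suc k) j) = (\<Sum>j\<le>k. t (Suc k) j - c * t k j) + c * (\<Sum>j\<le>k. t k j) + t (Suc k) (Suc k)"
    by (simp add: sum_subtractf sum_distrib_left)
  also have "t (Suc k) (Suc k) = - G k" by (simp add: t_def G_def gauss_binom_zero)
  also have "(\<Sum>j\<le>k. t (Suc k) j - c * t k j) = G k" by (rule step) simp
  also have "(\<Sum>j\<le>k. t k j) = qpoch (A * E) p k * qpoch (B * E) p k" using Suc by (simp add: t_def C_def)
  finally show ?case by (simp add: t_def C_def c_def qpoch_Suc ac_simps)
qed simp

lemma q_binomial: "(\<Sum>j\<le>n. gauss_binom p n j * tri p u j) = qpoch u p n"
proof (induction n)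
  case (Suc n)
  have *: "gauss_binom p n j * tri p u (Suc j) * p ^ (n - j) = - u * p ^ n * (gauss_binom p n j * tri p u j)" if "j \<le> n" for j
  proof -
    have "p ^ n = p ^ j * p ^ (n - j)" using that by (simp flip: power_add)
    then show ?thesis by (simp add: tri_Suc ac_simps)
  qed
  have "(\<Sum>j\<le>Suc n. gauss_binom p (Suc n) j * tri p u j) = 1 + (\<Sum>j\<le>n. gauss_binom p n (Suc j) * tri p u (Suc j)) +
     (\<Sum>j\<le>n. gauss_binom p n j * tri p u (Suc j) * p ^ (n - j))"
    unfolding sum.atMost_Suc_shift by (simp add: algebra_simps sum.distrib)
  also have "1 + (\<Sum>j\<le>n. gauss_binom p n (Suc j) * tri p u (Suc j)) = (\<Sum>j\<le>Suc n. gauss_binom p n j * tri p u j)"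
    unfolding sum.atMost_Suc_shift by simp
  also have "\<dots> = qpoch u p n" using Suc by (simp add: gauss_binom_zero)
  also have "(\<Sum>j\<le>n. gauss_binom p n j * tri p u (Suc j) * p ^ (n - j)) = - u * p ^ n * qpoch u p n"
    unfolding Suc[symmetric] sum_distrib_left by (rule sum.cong) (auto simp: *)
  finally show ?case by (simp add: qpoch_Suc algebra_simps)
qed simp

section \<open>Reversed products and double sums over a field\<close>

context
  fixes p :: "'a::field"
  assumes p0: "p \<noteq> 0"
begin

text \<open>The factors are taken in reverse order, and from each a multiple of
  \<open>x * p ^ r\<close> is extracted; these multiples form \<open>tri\<close>.\<close>

lemma qpoch_reverse:
  assumes "x \<noteq> 0"
  shows "qpoch (p / (p ^ M * x)) p M * tri p x M = qpoch x p M"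
proof -
  have "qpoch (p / (p ^ M * x)) p M = (\<Prod>r<M. 1 - p / (p ^ M * x) * p ^ (M - Suc r))"
    unfolding qpoch_def by (rule prod.nat_diff_reindex[symmetric])
  also have "\<dots> = (\<Prod>r<M. 1 - 1 / (x * p ^ r))"
  proof (rule prod.cong[OF refl])
    fix r assume "r \<in> {..<M}"
    then have "p ^ M = p * p ^ (M - Suc r) * p ^ r" by (simp flip: power_add power_Suc)
    then show "1 - p / (p ^ M * x) * p ^ (M - Suc r) = 1 - 1 / (x * p ^ r)" using p0 by simp
  qed
  finally show ?thesis
    using assms p0 unfolding tri_def qpoch_def
    by (simp add: prod.distrib[symmetric]) (intro prod.cong refl, simp add: field_simps)
qed

lemma qpoch_reverse':
  assumes "x \<noteq> 0" "k \<le> M"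
  shows "qpoch (p / (p ^ M * x)) p k * tri p (x * p ^ (M - k)) k = qpoch (x * p ^ (M - k)) p k"
proof -
  have "p ^ M = p ^ k * p ^ (M - k)" using assms(2) by (simp flip: power_add)
  then have e: "p ^ M * x = p ^ k * (x * p ^ (M - k))" by (simp only: ac_simps)
  show ?thesis unfolding e by (rule qpoch_reverse) (use assms p0 in simp)
qed

lemma q_saalschuetz_reversed:
  assumes V: "V \<noteq> 0" and X: "X \<noteq> 0"
  shows "(\<Sum>s\<le>M. gauss_binom p M s * tri p (p / p ^ M) s * qpoch X p s * qpoch E p s *
      qpoch (X * E * (p / (p ^ M * V)) * p ^ s) p (M - s) * qpoch (V * p ^ s) p (M - s))
    = X ^ M * qpoch (V / X) p M * qpoch (E * (p / (p ^ M * V))) p M"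
proof -
  \<comment> \<open>Reversing the factors with \<open>V\<close> turns them into those with
    \<open>Y\<close>, and the sum takes the shape of \<open>q_saalschuetz\<close>.\<close>
  define Y where "Y = p / (p ^ M * V)"
  have "(\<Sum>s\<le>M. gauss_binom p M s * tri p (p / p ^ M) s * qpoch X p s * qpoch E p s *
      qpoch (X * E * Y * p ^ s) p (M - s) * qpoch (V * p ^ s) p (M - s))
    = (\<Sum>s\<le>M. tri p V M * (gauss_binom p M s * qpoch X p s * qpoch E p s * qpoch (X * E * Y * p ^ s) p (M - s) * qpoch Y p (M - s) * Y ^ s))"
  proof (rule sum.cong[OF refl])
    fix s assume s: "s \<in> {..M}"
    have "qpoch (V * p ^ s) p (M - s) = qpoch Y p (M - s) * tri p (V * p ^ s) (M - s)"
      using qpoch_reverse'[OF V, of "M - s" M] s by (simp add: Y_def)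
    moreover have "tri p (p / p ^ M) s = Y ^ s * tri p V s"
      using tri_scale[of p Y V s] V by (simp add: Y_def)
    moreover have "tri p V M = tri p V s * tri p (V * p ^ s) (M - s)"
      using tri_add[of p V s "M - s"] s by simp
    ultimately show "gauss_binom p M s * tri p (p / p ^ M) s * qpoch X p s * qpoch E p s *
      qpoch (X * E * Y * p ^ s) p (M - s) * qpoch (V * p ^ s) p (M - s) =
      tri p V M * (gauss_binom p M s * qpoch X p s * qpoch E p s * qpoch (X * E * Y * p ^ s) p (M - s) * qpoch Y p (M - s) * Y ^ s)"
      by (simp add: ac_simps)
  qed
  also have "\<dots> = tri p V M * (qpoch (X * Y) p M * qpoch (E * Y) p M)"
    unfolding sum_distrib_left[symmetric] by (simp add: q_saalschuetz)
  also have "tri p V M = X ^ M * tri p (V / X) M" using tri_scale[of p X "V / X" M] X by simp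
  also have "qpoch (X * Y) p M * tri p (V / X) M = qpoch (V / X) p M"
    using qpoch_reverse[of "V / X" M] V X by (simp add: Y_def ac_simps)
  then have "X ^ M * tri p (V / X) M * (qpoch (X * Y) p M * qpoch (E * Y) p M) = X ^ M * qpoch (V / X) p M * qpoch (E * Y) p M"
    unfolding \<open>qpoch (X * Y) p M * tri p (V / X) M = qpoch (V / X) p M\<close>[symmetric]
    by (simp only: ac_simps)
  finally show ?thesis by (simp add: Y_def)
qed

text \<open>Rewrites the numerator of a terminating series by a Gaussian binomial, so that the sums
  below can use the division-free identities.\<close>

lemma qpoch_minus: "k \<le> n \<Longrightarrow> qpoch (inverse (p ^ n)) p k * p ^ k = gauss_binom p n k * tri p (p / p ^ n) k * qpoch p p k"
proof -
  assume k: "k \<le> n"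
  have "qpoch (inverse (p ^ n)) p k * p ^ k = (\<Prod>r<k. (1 - inverse (p ^ n) * p ^ r) * p)"
    by (simp add: qpoch_def prod.distrib)
  also have "\<dots> = (\<Prod>r<k. (1 - p ^ (n - r)) * - (p / p ^ n * p ^ r))"
  proof (rule prod.cong[OF refl])
    fix r assume "r \<in> {..<k}"
    then have "p ^ n = p ^ (n - r) * p ^ r" using k by (simp flip: power_add)
    then show "(1 - inverse (p ^ n) * p ^ r) * p = (1 - p ^ (n - r)) * - (p / p ^ n * p ^ r)"
      using p0 by (simp add: field_simps)
  qed
  also have "\<dots> = (gauss_binom p n k * qpoch p p k) * tri p (p / p ^ n) k"
    by (simp only: gauss_binom_mult[OF k] prod.distrib tri_def)
  finally show ?thesis by (simp add: ac_simps)
qed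

lemma prod_lessThan_add: "(\<Prod>r<m + n. f r) = (\<Prod>r<m. f r) * (\<Prod>r<n. f (m + r :: nat) :: 'b::comm_monoid_mult)"
  by (induction n) (simp_all add: ac_simps)

text \<open>Both sides are the same q-trinomial coefficient; this decouples the two indices after
  exchanging a double sum.\<close>

lemma gauss_binom_trinomial:
  assumes nz: "\<And>k. k > 0 \<Longrightarrow> p ^ k \<noteq> 1" and "j + s \<le> n"
  shows "gauss_binom p n (j + s) * gauss_binom p (j + s) j = gauss_binom p n j * gauss_binom p (n - j) s"
proof -
  have qn: "qpoch p p k \<noteq> 0" for k
  proof (induction k)
    case (Suc k)
    then show ?case using nz[of "Suc k"] by (simp add: qpoch_Suc)
  qed simp
  have P: "(\<Prod>r<j + s. 1 - p ^ (n - r)) = (\<Prod>r<j. 1 - p ^ (n - r)) * (\<Prod>r<s. 1 - p ^ (n - j - r))"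
    unfolding prod_lessThan_add by simp
  have Q: "(\<Prod>r<j. 1 - p ^ (j + s - r)) * qpoch p p s = qpoch p p (j + s)"
  proof -
    have "qpoch p p k = (\<Prod>r<k. 1 - p ^ (k - r))" for k
      using gauss_binom_mult[of k k p] by simp
    moreover have "(\<Prod>r<j + s. 1 - p ^ (j + s - r)) = (\<Prod>r<j. 1 - p ^ (j + s - r)) * (\<Prod>r<s. 1 - p ^ (s - r))"
      unfolding prod_lessThan_add by simp
    ultimately show ?thesis by simp
  qed
  have "gauss_binom p n (j + s) * qpoch p p (j + s) * (gauss_binom p (j + s) j * qpoch p p j) * qpoch p p s =
    (gauss_binom p n j * qpoch p p j) * (gauss_binom p (n - j) s * qpoch p p s) * qpoch p p (j + s)"
  proof -
    have e: "gauss_binom p n (j + s) * qpoch p p (j + s) = (\<Prod>r<j. 1 - p ^ (n - r)) * (\<Prod>r<s. 1 - p ^ (n - j - r))"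
      "gauss_binom p (j + s) j * qpoch p p j = (\<Prod>r<j. 1 - p ^ (j + s - r))"
      "gauss_binom p n j * qpoch p p j = (\<Prod>r<j. 1 - p ^ (n - r))"
      "gauss_binom p (n - j) s * qpoch p p s = (\<Prod>r<s. 1 - p ^ (n - j - r))"
      using assms(2) gauss_binom_mult[of "j + s" n p] gauss_binom_mult[of j "j + s" p] gauss_binom_mult[of j n p] gauss_binom_mult[of s "n - j" p] P by auto
    show ?thesis unfolding e unfolding Q[symmetric] by (simp only: ac_simps)
  qed
  then show ?thesis using qn[of j] qn[of s] qn[of "j + s"] by (simp add: ac_simps)
qed

end

lemma sum_triangle:
  fixes F :: "nat \<Rightarrow> nat \<Rightarrow> 'b::comm_monoid_add"
  shows "(\<Sum>m\<le>n. \<Sum>j\<le>m. F m j) = (\<Sum>j\<le>n. \<Sum>s\<le>n - j. F (j + s) j)"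
proof (induction n)
  case (Suc n)
  have "(\<Sum>j\<le>n. \<Sum>s\<le>Suc n - j. F (j + s) j) = (\<Sum>j\<le>n. (\<Sum>s\<le>n - j. F (j + s) j) + F (Suc n) j)"
  proof (rule sum.cong[OF refl])
    fix j assume "j \<in> {..n}"
    then have "Suc n - j = Suc (n - j)" "j + Suc (n - j) = Suc n" by auto
    then show "(\<Sum>s\<le>Suc n - j. F (j + s) j) = (\<Sum>s\<le>n - j. F (j + s) j) + F (Suc n) j"
      by (simp only: sum.atMost_Suc)
  qed
  then show ?case using Suc by (simp add: sum.distrib add.assoc)
qed simp

context
  fixes p :: "'a::field"
  assumes p0: "p \<noteq> 0" and p1: "\<And>k. k > 0 \<Longrightarrow> p ^ k \<noteq> 1"
begin

lemma qpoch_pp_nonzero: "qpoch p p k \<noteq> 0"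
proof (induction k)
  case (Suc k)
  then show ?case using p1[of "Suc k"] by (simp add: qpoch_Suc)
qed simp

lemma qpoch_ratio: "k \<le> n \<Longrightarrow> qpoch x p k \<noteq> 0 \<Longrightarrow> qpoch x p n / qpoch x p k = qpoch (x * p ^ k) p (n - k)"
  using qpoch_add[of x p k "n - k"] by simp

lemma qpoch_le_nonzero: "k \<le> n \<Longrightarrow> qpoch x p n \<noteq> 0 \<Longrightarrow> qpoch x p k \<noteq> 0"
  using qpoch_add[of x p k "n - k"] by auto

lemma qpoch_minus_zero: "k < m \<Longrightarrow> qpoch (inverse (p ^ k)) p m = 0"
  unfolding qpoch_def using p0 by (intro prod_zero) (auto intro!: bexI[of _ k])

lemma qpoch_minus_nonzero: "k \<le> n \<Longrightarrow> qpoch (inverse (p ^ n)) p k \<noteq> 0"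
proof -
  assume k: "k \<le> n"
  have "1 - inverse (p ^ n) * p ^ r \<noteq> 0" if "r < k" for r
  proof -
    have "p ^ n = p ^ (n - r) * p ^ r" using that k by (simp flip: power_add)
    then have "1 - inverse (p ^ n) * p ^ r = 1 - inverse (p ^ (n - r))" using p0 by simp
    then show ?thesis using p1[of "n - r"] that k by (metis right_minus_eq inverse_eq_1_iff zero_less_diff order.strict_trans2)
  qed
  then show ?thesis by (simp add: qpoch_def)
qed

text \<open>The Askey-Wilson polynomial as a single sum without denominators in the parameters. The
  bilinear sums of dual q-Krawtchouk polynomials come out in this form.\<close>

definition aw_sum :: "nat \<Rightarrow> 'a \<Rightarrow> 'a \<Rightarrow> 'a \<Rightarrow> 'a \<Rightarrow> 'a \<Rightarrow> 'a" where
  "aw_sum n a b c d z = (\<Sum>j\<le>n. gauss_binom p n j * qpoch (b * d * p ^ (n - j)) p j * qpoch (a * c * p ^ j) p (n - j) *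
     qpoch (b * z) p (n - j) * qpoch (d * z) p (n - j) * qpoch (a / z) p j * qpoch (c / z) p j * (z ^ j / z ^ (n - j)))"

text \<open>Sears' transformation: expand two factors by the Saalschuetz sum, exchange the summations and sum again.\<close>

lemma askey_wilson_sum:
  assumes nz: "a \<noteq> 0" "b \<noteq> 0" "c \<noteq> 0" "d \<noteq> 0" "z \<noteq> 0"
    and den: "qpoch (a * b) p n \<noteq> 0" "qpoch (a * c) p n \<noteq> 0" "qpoch (a * d) p n \<noteq> 0"
  shows "inverse (a ^ n) * qpoch (a * b) p n * qpoch (a * c) p n * qpoch (a * d) p n *
     (\<Sum>k\<le>n. qpoch (inverse (p ^ n)) p k * qpoch (a * b * c * d * p ^ n / p) p k * qpoch (a * z) p k * qpoch (a / z) p k /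
        (qpoch (a * b) p k * qpoch (a * c) p k * qpoch (a * d) p k * qpoch p p k) * p ^ k) = aw_sum n a b c d z"
proof -
  \<comment> \<open>Chosen such that \<open>q_saalschuetz\<close> with \<open>c / z\<close>,
    \<open>B\<close>, \<open>E\<close> yields the two factors with abcd p^(n-1) and az, while its
    own third parameter becomes ac.\<close>
  define B E where "B = p / (p ^ n * (b * d))" and "E = a * b * d * z * p ^ n / p"
  have BE: "c / z * E = a * b * c * d * p ^ n / p" "B * E = a * z" "c / z * B * E = a * c"
    using nz p0 by (simp_all add: B_def E_def field_simps)
  define F where "F k j = gauss_binom p n k * tri p (p / p ^ n) k * qpoch (a * b * p ^ k) p (n - k) * qpoch (a * d * p ^ k) p (n - k) *
     qpoch (a * c * p ^ k) p (n - k) * qpoch (a / z) p k *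
     (gauss_binom p k j * qpoch (c / z) p j * qpoch B p j * qpoch (a * c * p ^ j) p (k - j) * qpoch E p (k - j) * E ^ j)" for k j
  have "qpoch (a * b) p n * qpoch (a * c) p n * qpoch (a * d) p n *
     (\<Sum>k\<le>n. qpoch (inverse (p ^ n)) p k * qpoch (a * b * c * d * p ^ n / p) p k * qpoch (a * z) p k * qpoch (a / z) p k /
        (qpoch (a * b) p k * qpoch (a * c) p k * qpoch (a * d) p k * qpoch p p k) * p ^ k) = (\<Sum>k\<le>n. \<Sum>j\<le>k. F k j)"
    unfolding sum_distrib_left
  proof (rule sum.cong[OF refl])
    fix k assume "k \<in> {..n}"
    then have k: "k \<le> n" by simp
    have d: "qpoch (a * b) p k \<noteq> 0" "qpoch (a * c) p k \<noteq> 0" "qpoch (a * d) p k \<noteq> 0"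
      using den qpoch_le_nonzero[OF k] by auto
    have s: "(\<Sum>j\<le>k. gauss_binom p k j * qpoch (c / z) p j * qpoch B p j * qpoch (a * c * p ^ j) p (k - j) * qpoch E p (k - j) * E ^ j)
      = qpoch (a * b * c * d * p ^ n / p) p k * qpoch (a * z) p k"
      using q_saalschuetz[of p k "c / z" B E] by (simp only: BE)
    have "qpoch (a * b) p n * qpoch (a * c) p n * qpoch (a * d) p n *
      (qpoch (inverse (p ^ n)) p k * qpoch (a * b * c * d * p ^ n / p) p k * qpoch (a * z) p k * qpoch (a / z) p k /
        (qpoch (a * b) p k * qpoch (a * c) p k * qpoch (a * d) p k * qpoch p p k) * p ^ k) =
      (qpoch (inverse (p ^ n)) p k * p ^ k / qpoch p p k) * (qpoch (a * b) p n / qpoch (a * b) p k) * (qpoch (a * d) p n / qpoch (a * d) p k) *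
      (qpoch (a * c) p n / qpoch (a * c) p k) * qpoch (a / z) p k * (qpoch (a * b * c * d * p ^ n / p) p k * qpoch (a * z) p k)"
      by (simp add: divide_inverse ac_simps)
    also have "qpoch (inverse (p ^ n)) p k * p ^ k / qpoch p p k = gauss_binom p n k * tri p (p / p ^ n) k"
      using qpoch_minus[OF p0 k] qpoch_pp_nonzero by simp
    also have "qpoch (a * b) p n / qpoch (a * b) p k = qpoch (a * b * p ^ k) p (n - k)" by (rule qpoch_ratio[OF k d(1)])
    also have "qpoch (a * d) p n / qpoch (a * d) p k = qpoch (a * d * p ^ k) p (n - k)" by (rule qpoch_ratio[OF k d(3)])
    also have "qpoch (a * c) p n / qpoch (a * c) p k = qpoch (a * c * p ^ k) p (n - k)" by (rule qpoch_ratio[OF k d(2)])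
    also have "gauss_binom p n k * tri p (p / p ^ n) k * qpoch (a * b * p ^ k) p (n - k) * qpoch (a * d * p ^ k) p (n - k) *
       qpoch (a * c * p ^ k) p (n - k) * qpoch (a / z) p k * (qpoch (a * b * c * d * p ^ n / p) p k * qpoch (a * z) p k) = (\<Sum>j\<le>k. F k j)"
      unfolding s[symmetric] F_def by (rule sum_distrib_left)
    finally show "qpoch (a * b) p n * qpoch (a * c) p n * qpoch (a * d) p n *
      (qpoch (inverse (p ^ n)) p k * qpoch (a * b * c * d * p ^ n / p) p k * qpoch (a * z) p k * qpoch (a / z) p k /
        (qpoch (a * b) p k * qpoch (a * c) p k * qpoch (a * d) p k * qpoch p p k) * p ^ k) = (\<Sum>j\<le>k. F k j)" .
  qed
  also have "\<dots> = (\<Sum>j\<le>n. \<Sum>s\<le>n - j. F (j + s) j)" by (rule sum_triangle)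
  also have "\<dots> = (\<Sum>j\<le>n. a ^ n * (gauss_binom p n j * qpoch (b * d * p ^ (n - j)) p j * qpoch (a * c * p ^ j) p (n - j) *
     qpoch (b * z) p (n - j) * qpoch (d * z) p (n - j) * qpoch (a / z) p j * qpoch (c / z) p j * (z ^ j / z ^ (n - j))))"
  proof (rule sum.cong[OF refl])
    fix j assume "j \<in> {..n}"
    then have j: "j \<le> n" by simp
    define M where "M = n - j"
    have n: "n = j + M" using j by (simp add: M_def)
    \<comment> \<open>With these, the inner sum over \<open>s\<close> is the one evaluated by
      \<open>q_saalschuetz_reversed\<close>.\<close>
    define X V where "X = a * p ^ j / z" and "V = a * d * p ^ j"
    have XV: "X \<noteq> 0" "V \<noteq> 0" "V / X = d * z" "E * (p / (p ^ M * V)) = b * z" "X * E * (p / (p ^ M * V)) = a * b * p ^ j"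
      using nz p0 by (simp_all add: X_def V_def E_def n power_add field_simps)
    define H where "H = gauss_binom p n j * tri p (p / p ^ n) j * qpoch (a / z) p j * qpoch (c / z) p j * qpoch B p j * E ^ j * qpoch (a * c * p ^ j) p M"
    have "F (j + s) j = H * (gauss_binom p M s * tri p (p / p ^ M) s * qpoch X p s * qpoch E p s *
       qpoch (X * E * (p / (p ^ M * V)) * p ^ s) p (M - s) * qpoch (V * p ^ s) p (M - s))" if s: "s \<le> M" for s
    proof -
      have g: "gauss_binom p n (j + s) * gauss_binom p (j + s) j = gauss_binom p n j * gauss_binom p M s"
        using gauss_binom_trinomial[OF p0 p1, of j s n] s by (simp add: n)
      have t: "tri p (p / p ^ n) (j + s) = tri p (p / p ^ n) j * tri p (p / p ^ M) s"
      proof -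
        have "p / p ^ n * p ^ j = p / p ^ M" using p0 by (simp add: n power_add)
        then show ?thesis using tri_add[of p "p / p ^ n" j s] by simp
      qed
      have q1: "qpoch (a / z) p (j + s) = qpoch (a / z) p j * qpoch X p s"
        using qpoch_add[of "a / z" p j s] by (simp add: X_def)
      have ms: "n - (j + s) = M - s" by (simp add: n)
      have q2: "qpoch (a * c * p ^ j) p s * qpoch (a * c * p ^ (j + s)) p (M - s) = qpoch (a * c * p ^ j) p M"
        using qpoch_add[of "a * c * p ^ j" p s "M - s"] s by (simp add: power_add mult.assoc)
      have q3: "qpoch (a * b * p ^ (j + s)) p (M - s) = qpoch (X * E * (p / (p ^ M * V)) * p ^ s) p (M - s)"
        "qpoch (a * d * p ^ (j + s)) p (M - s) = qpoch (V * p ^ s) p (M - s)"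
        unfolding XV(5) by (simp_all add: V_def power_add mult.assoc)
      have "F (j + s) j = (gauss_binom p n (j + s) * gauss_binom p (j + s) j) * tri p (p / p ^ n) (j + s) *
         qpoch (a * b * p ^ (j + s)) p (M - s) * qpoch (a * d * p ^ (j + s)) p (M - s) *
         (qpoch (a * c * p ^ j) p s * qpoch (a * c * p ^ (j + s)) p (M - s)) * qpoch (a / z) p (j + s) *
         (qpoch (c / z) p j * qpoch B p j * qpoch E p s * E ^ j)"
        unfolding F_def ms by (simp add: ac_simps)
      then show ?thesis unfolding g t q1 q2 q3 H_def by (simp add: ac_simps)
    qed
    then have "(\<Sum>s\<le>n - j. F (j + s) j) = H * (\<Sum>s\<le>M. gauss_binom p M s * tri p (p / p ^ M) s * qpoch X p s * qpoch E p s *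
       qpoch (X * E * (p / (p ^ M * V)) * p ^ s) p (M - s) * qpoch (V * p ^ s) p (M - s))"
      unfolding M_def[symmetric] sum_distrib_left by (intro sum.cong) auto
    also have "\<dots> = H * (X ^ M * qpoch (d * z) p M * qpoch (b * z) p M)"
      unfolding q_saalschuetz_reversed[OF p0 XV(2,1)] XV(3,4) ..
    also have "\<dots> = a ^ n * (gauss_binom p n j * qpoch (b * d * p ^ M) p j * qpoch (a * c * p ^ j) p M *
     qpoch (b * z) p M * qpoch (d * z) p M * qpoch (a / z) p j * qpoch (c / z) p j * (z ^ j / z ^ M))"
    proof -
      have f1: "qpoch B p j * tri p (b * d * p ^ M) j = qpoch (b * d * p ^ M) p j"
        using qpoch_reverse'[OF p0, of "b * d" j n] nz j by (simp add: B_def M_def)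
      have f2: "tri p (b * d * p ^ M) j = (b * d * p ^ M) ^ j * tri p 1 j"
        "tri p (p / p ^ n) j = (p / p ^ n) ^ j * tri p 1 j"
        using tri_scale[of p "b * d * p ^ M" 1 j] tri_scale[of p "p / p ^ n" 1 j] by simp_all
      have f3: "(p / p ^ n) ^ j * E ^ j * X ^ M = a ^ n * ((b * d * p ^ M) ^ j * (z ^ j / z ^ M))"
      proof -
        have "(p / p ^ n) ^ j * E ^ j = (a * b * d * z) ^ j"
          unfolding power_mult_distrib[symmetric] E_def using p0 by (simp add: mult.assoc)
        moreover have "(p ^ j) ^ M = (p ^ M) ^ j" by (metis power_mult mult.commute)
        ultimately show ?thesis using nz by (simp add: X_def n power_add power_mult_distrib power_divide ac_simps)
      qed
      define rest where "rest = gauss_binom p n j * qpoch (a / z) p j * qpoch (c / z) p j * qpoch (a * c * p ^ j) p M * qpoch (d * z) p M * qpoch (b * z) p M"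
      have "H * (X ^ M * qpoch (d * z) p M * qpoch (b * z) p M) = ((p / p ^ n) ^ j * E ^ j * X ^ M) * (qpoch B p j * tri p 1 j) * rest"
        unfolding H_def f2(2) rest_def by (simp only: ac_simps)
      also have "\<dots> = a ^ n * (qpoch B p j * ((b * d * p ^ M) ^ j * tri p 1 j)) * (z ^ j / z ^ M) * rest"
        unfolding f3 by (simp only: ac_simps)
      also have "\<dots> = a ^ n * qpoch (b * d * p ^ M) p j * (z ^ j / z ^ M) * rest"
        unfolding f2(1)[symmetric] f1 ..
      finally show ?thesis unfolding rest_def by (simp only: ac_simps)
    qed
    finally show "(\<Sum>s\<le>n - j. F (j + s) j) = a ^ n * (gauss_binom p n j * qpoch (b * d * p ^ (n - j)) p j * qpoch (a * c * p ^ j) p (n - j) *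
     qpoch (b * z) p (n - j) * qpoch (d * z) p (n - j) * qpoch (a / z) p j * qpoch (c / z) p j * (z ^ j / z ^ (n - j)))"
      by (simp add: M_def)
  qed
  also have "\<dots> = a ^ n * aw_sum n a b c d z" by (simp add: aw_sum_def sum_distrib_left)
  finally show ?thesis using nz(1) by (simp add: mult.assoc)
qed

text \<open>Dual \<open>q\<close>-Krawtchouk polynomials: the series \<open>\<^sub>3\<phi>\<^sub>2\<close> in the vectors \<open>v\<close>, with \<open>N = 2 l\<close>, \<open>x = l - j\<close>,
  \<open>k = l - n\<close>, base \<open>p = q\<^sup>2\<close> and \<open>\<theta> = - q\<^bsup>-2\<sigma>\<^esup>\<close>.\<close>

definition dual_krawtchouk :: "'a \<Rightarrow> nat \<Rightarrow> nat \<Rightarrow> nat \<Rightarrow> 'a" where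
  "dual_krawtchouk \<theta> N x k = (\<Sum>m\<le>x. qpoch (inverse (p ^ k)) p m * qpoch (inverse (p ^ x)) p m * qpoch (\<theta> * p ^ x / p ^ N) p m /
     (qpoch (inverse (p ^ N)) p m * qpoch p p m) * p ^ m)"

lemma tri_inverse: "tri p (p / p ^ m) m * tri p 1 m = 1"
proof -
  have "tri p (p / p ^ m) m = (\<Prod>r<m. - (p / p ^ m * p ^ (m - Suc r)))"
    unfolding tri_def by (rule prod.nat_diff_reindex[symmetric])
  also have "\<dots> = (\<Prod>r<m. - (1 / p ^ r))"
  proof (rule prod.cong[OF refl])
    fix r assume "r \<in> {..<m}"
    then have "p ^ m = p * p ^ (m - Suc r) * p ^ r" by (simp flip: power_add power_Suc)
    then show "- (p / p ^ m * p ^ (m - Suc r)) = - (1 / p ^ r)" using p0 by simp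
  qed
  finally show ?thesis using p0 by (simp add: tri_def prod.distrib[symmetric])
qed

lemma tri_1: "tri p x n = x ^ n * tri p 1 n"
  using tri_scale[of p x 1 n] by simp

text \<open>For each term of the series the sum over k is a shifted q-binomial sum; the remaining
  sum over m is a Saalschuetz sum with one parameter 0. The product form is the source of the
  recurrence, the reflection and the bilinear formula.\<close>

lemma dual_krawtchouk_generating:
  assumes x: "x \<le> N"
  shows "(\<Sum>k\<le>N. gauss_binom p N k * tri p b k * dual_krawtchouk \<theta> N x k) = qpoch b p (N - x) * qpoch (b * \<theta>) p x"
proof -
  define B Y where "B = \<theta> * p ^ x / p ^ N" and "Y = b * p ^ (N - x)"
  define c where "c m = gauss_binom p x m * tri p (p / p ^ x) m * qpoch B p m / qpoch (inverse (p ^ N)) p m" for m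
  \<comment> \<open>Terms with k < m vanish; after the shift k = m + s the q-binomial theorem
    applies.\<close>
  have inner: "(\<Sum>k\<le>N. gauss_binom p N k * tri p b k * qpoch (inverse (p ^ k)) p m) / qpoch (inverse (p ^ N)) p m =
     (p ^ N / p ^ m) ^ m * tri p b m * qpoch b p (N - m)" if m: "m \<le> N" for m
  proof -
    have "(\<Sum>k\<le>N. gauss_binom p N k * tri p b k * qpoch (inverse (p ^ k)) p m) =
      (\<Sum>k\<in>{m..N}. gauss_binom p N k * tri p b k * qpoch (inverse (p ^ k)) p m)"
      by (rule sum.mono_neutral_right) (auto simp: qpoch_minus_zero)
    also have "\<dots> = (\<Sum>s\<le>N - m. gauss_binom p N (m + s) * tri p b (m + s) * qpoch (inverse (p ^ (m + s))) p m)"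
      by (rule sum.reindex_bij_witness[of _ "\<lambda>s. m + s" "\<lambda>k. k - m"]) (use m in auto)
    also have "\<dots> = (\<Sum>s\<le>N - m. (gauss_binom p N m * tri p b m * tri p (p / p ^ m) m * qpoch p p m / p ^ m) * (gauss_binom p (N - m) s * tri p b s))"
    proof (rule sum.cong[OF refl])
      fix s assume "s \<in> {..N - m}"
      then have s: "m + s \<le> N" using m by auto
      have e1: "qpoch (inverse (p ^ (m + s))) p m = gauss_binom p (m + s) m * tri p (p / p ^ (m + s)) m * qpoch p p m / p ^ m"
        using qpoch_minus[OF p0, of m "m + s"] p0 by (simp add: field_simps)
      have e2: "tri p (p / p ^ (m + s)) m = tri p (p / p ^ m) m / p ^ (m * s)"
        by (subst (1 2) tri_1) (simp add: power_add power_divide power_mult_distrib power_mult[symmetric] mult.commute)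
      have e3: "tri p b (m + s) = tri p b m * (p ^ (m * s) * tri p b s)"
        unfolding tri_add by (subst (2 3) tri_1) (simp add: power_mult_distrib power_mult)
      have e4: "gauss_binom p N (m + s) * gauss_binom p (m + s) m = gauss_binom p N m * gauss_binom p (N - m) s"
        by (rule gauss_binom_trinomial[OF p0 p1 s])
      have "gauss_binom p N (m + s) * tri p b (m + s) * qpoch (inverse (p ^ (m + s))) p m =
        (gauss_binom p N (m + s) * gauss_binom p (m + s) m) * (tri p b m * (p ^ (m * s) * tri p b s)) * (tri p (p / p ^ m) m / p ^ (m * s)) * (qpoch p p m / p ^ m)"
        unfolding e1 e2 e3 by (simp add: ac_simps)
      then show "gauss_binom p N (m + s) * tri p b (m + s) * qpoch (inverse (p ^ (m + s))) p m =
        (gauss_binom p N m * tri p b m * tri p (p / p ^ m) m * qpoch p p m / p ^ m) * (gauss_binom p (N - m) s * tri p b s)"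
        unfolding e4 using p0 by (simp add: ac_simps)
    qed
    also have "\<dots> = (gauss_binom p N m * tri p b m * tri p (p / p ^ m) m * qpoch p p m / p ^ m) * qpoch b p (N - m)"
      unfolding sum_distrib_left[symmetric] q_binomial ..
    finally have 1: "(\<Sum>k\<le>N. gauss_binom p N k * tri p b k * qpoch (inverse (p ^ k)) p m) = \<dots>" .
    have 2: "qpoch (inverse (p ^ N)) p m = gauss_binom p N m * tri p (p / p ^ N) m * qpoch p p m / p ^ m"
      using qpoch_minus[OF p0 m] p0 by (simp add: field_simps)
    have 3: "tri p (p / p ^ m) m = (p ^ N / p ^ m) ^ m * tri p (p / p ^ N) m"
      by (subst (1 2) tri_1) (simp add: p0 power_divide power_mult_distrib)
    have "qpoch (inverse (p ^ N)) p m \<noteq> 0" by (rule qpoch_minus_nonzero[OF m])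
    then show ?thesis unfolding 1 3 unfolding 2 by (simp add: p0)
  qed
  have "(\<Sum>k\<le>N. gauss_binom p N k * tri p b k * dual_krawtchouk \<theta> N x k) =
     (\<Sum>k\<le>N. \<Sum>m\<le>x. c m * (gauss_binom p N k * tri p b k * qpoch (inverse (p ^ k)) p m))"
  proof (rule sum.cong[OF refl])
    fix k
    have "qpoch (inverse (p ^ k)) p m * qpoch (inverse (p ^ x)) p m * qpoch (\<theta> * p ^ x / p ^ N) p m /
     (qpoch (inverse (p ^ N)) p m * qpoch p p m) * p ^ m = c m * qpoch (inverse (p ^ k)) p m" if "m \<le> x" for m
      using qpoch_minus[OF p0 that] qpoch_pp_nonzero[of m] qpoch_minus_nonzero[of m N] that x
      by (simp add: c_def B_def field_simps)
    then show "gauss_binom p N k * tri p b k * dual_krawtchouk \<theta> N x k = (\<Sum>m\<le>x. c m * (gauss_binom p N k * tri p b k * qpoch (inverse (p ^ k)) p m))"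
      unfolding dual_krawtchouk_def sum_distrib_left by (intro sum.cong refl) (simp add: ac_simps)
  qed
  also have "\<dots> = (\<Sum>m\<le>x. c m * (\<Sum>k\<le>N. gauss_binom p N k * tri p b k * qpoch (inverse (p ^ k)) p m))"
    by (subst sum.swap) (simp add: sum_distrib_left)
  also have "\<dots> = (\<Sum>m\<le>x. qpoch b p (N - x) * (gauss_binom p x m * qpoch 0 p m * qpoch B p m * qpoch (0 * B * Y * p ^ m) p (x - m) * qpoch Y p (x - m) * Y ^ m))"
  proof (rule sum.cong[OF refl])
    fix m assume "m \<in> {..x}"
    then have m: "m \<le> x" "m \<le> N" using x by auto
    have "c m * (\<Sum>k\<le>N. gauss_binom p N k * tri p b k * qpoch (inverse (p ^ k)) p m) =
      gauss_binom p x m * qpoch B p m * (tri p (p / p ^ x) m * (p ^ N / p ^ m) ^ m * tri p b m) * qpoch b p (N - m)"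
    proof -
      have *: "c m * S = gauss_binom p x m * tri p (p / p ^ x) m * qpoch B p m * (S / qpoch (inverse (p ^ N)) p m)" for S
        by (simp add: c_def)
      show ?thesis unfolding *[of "\<Sum>k\<le>N. gauss_binom p N k * tri p b k * qpoch (inverse (p ^ k)) p m"] inner[OF m(2)]
        by (simp only: ac_simps)
    qed
    also have "tri p (p / p ^ x) m * (p ^ N / p ^ m) ^ m * tri p b m = Y ^ m"
    proof -
      have px: "p ^ N = p ^ x * p ^ (N - x)" using x by (simp flip: power_add)
      have "tri p (p / p ^ x) m = (p ^ m / p ^ x) ^ m * tri p (p / p ^ m) m"
        by (subst (1 2) tri_1) (simp add: p0 power_divide power_mult_distrib)
      then have "tri p (p / p ^ x) m * (p ^ N / p ^ m) ^ m * tri p b m =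
         ((p ^ m / p ^ x) * (p ^ N / p ^ m) * b) ^ m * (tri p (p / p ^ m) m * tri p 1 m)"
        unfolding power_mult_distrib by (subst (2) tri_1) (simp add: ac_simps)
      also have "(p ^ m / p ^ x) * (p ^ N / p ^ m) * b = Y" using p0 by (simp add: Y_def px)
      finally show ?thesis by (simp add: tri_inverse)
    qed
    also have "qpoch b p (N - m) = qpoch b p (N - x) * qpoch Y p (x - m)"
      using qpoch_add[of b p "N - x" "x - m"] m x by (simp add: Y_def)
    finally show "c m * (\<Sum>k\<le>N. gauss_binom p N k * tri p b k * qpoch (inverse (p ^ k)) p m) =
      qpoch b p (N - x) * (gauss_binom p x m * qpoch 0 p m * qpoch B p m * qpoch (0 * B * Y * p ^ m) p (x - m) * qpoch Y p (x - m) * Y ^ m)"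
      by (simp add: ac_simps)
  qed
  also have "\<dots> = qpoch b p (N - x) * qpoch (B * Y) p x"
    unfolding sum_distrib_left[symmetric] q_saalschuetz by simp
  also have "B * Y = b * \<theta>"
  proof -
    have "p ^ N = p ^ x * p ^ (N - x)" using x by (simp flip: power_add)
    then show ?thesis using p0 by (simp add: B_def Y_def)
  qed
  finally show ?thesis .
qed

text \<open>Coefficients of the polynomial in the variable p^(-k), evaluated in closed form, see
  \<open>dual_krawtchouk_expansion\<close>.\<close>

definition dual_krawtchouk_coeff :: "'a \<Rightarrow> nat \<Rightarrow> nat \<Rightarrow> nat \<Rightarrow> 'a" where
  "dual_krawtchouk_coeff \<theta> N y j = tri p 1 j * gauss_binom p y j * tri p (p / p ^ y) j * qpoch (\<theta> * p ^ y / p ^ N) p j / qpoch (inverse (p ^ N)) p y *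
     ((\<theta> * p ^ y / p ^ N * p ^ j) ^ (y - j) * qpoch (inverse (p ^ N) / (\<theta> * p ^ y / p ^ N)) p (y - j))"

lemma dual_krawtchouk_expansion:
  assumes y: "y \<le> N" and th: "\<theta> \<noteq> 0"
  shows "dual_krawtchouk \<theta> N y k = (\<Sum>j\<le>y. dual_krawtchouk_coeff \<theta> N y j * inverse (p ^ k) ^ j)"
proof -
  define D P where "D = \<theta> * p ^ y / p ^ N" and "P = inverse (p ^ N)"
  have D: "D \<noteq> 0" "P \<noteq> 0" using th p0 by (auto simp: D_def P_def)
  have Pn: "qpoch P p m \<noteq> 0" if "m \<le> y" for m
    unfolding P_def by (rule qpoch_minus_nonzero) (use that y in simp)
  define F where "F m j = gauss_binom p y m * tri p (p / p ^ y) m * qpoch D p m / qpoch P p m * (gauss_binom p m j * (inverse (p ^ k) ^ j * tri p 1 j))" for m j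
  have "dual_krawtchouk \<theta> N y k = (\<Sum>m\<le>y. \<Sum>j\<le>m. F m j)"
    unfolding dual_krawtchouk_def
  proof (rule sum.cong[OF refl])
    fix m assume "m \<in> {..y}"
    then have m: "m \<le> y" by simp
    have "(\<Sum>j\<le>m. gauss_binom p m j * (inverse (p ^ k) ^ j * tri p 1 j)) = qpoch (inverse (p ^ k)) p m"
      unfolding tri_1[symmetric] by (rule q_binomial)
    then have "(\<Sum>j\<le>m. F m j) = gauss_binom p y m * tri p (p / p ^ y) m * qpoch D p m / qpoch P p m * qpoch (inverse (p ^ k)) p m"
      unfolding F_def by (simp only: sum_distrib_left[symmetric])
    then show "qpoch (inverse (p ^ k)) p m * qpoch (inverse (p ^ y)) p m * qpoch (\<theta> * p ^ y / p ^ N) p m /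
        (qpoch (inverse (p ^ N)) p m * qpoch p p m) * p ^ m = (\<Sum>j\<le>m. F m j)"
    proof -
      have "qpoch (inverse (p ^ k)) p m * qpoch (inverse (p ^ y)) p m * qpoch D p m / (qpoch P p m * qpoch p p m) * p ^ m =
        (qpoch (inverse (p ^ y)) p m * p ^ m) * qpoch (inverse (p ^ k)) p m * qpoch D p m / (qpoch P p m * qpoch p p m)"
        by (simp add: ac_simps)
      also have "\<dots> = gauss_binom p y m * tri p (p / p ^ y) m * qpoch D p m / qpoch P p m * qpoch (inverse (p ^ k)) p m"
        unfolding qpoch_minus[OF p0 m] using qpoch_pp_nonzero[of m] by simp
      finally show ?thesis using \<open>(\<Sum>j\<le>m. F m j) = _\<close> by (simp only: D_def[symmetric] P_def[symmetric])
    qed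
  qed
  also have "\<dots> = (\<Sum>j\<le>y. \<Sum>s\<le>y - j. F (j + s) j)" by (rule sum_triangle)
  also have "\<dots> = (\<Sum>j\<le>y. dual_krawtchouk_coeff \<theta> N y j * inverse (p ^ k) ^ j)"
  proof (rule sum.cong[OF refl])
    fix j assume "j \<in> {..y}"
    then have j: "j \<le> y" by simp
    define M where "M = y - j"
    have n: "y = j + M" using j by (simp add: M_def)
    \<comment> \<open>The case E = 0 of the reversed summation: the powers of p^(-k) come from the
      q-binomial theorem, and this sum collects the coefficient of each power.\<close>
    define X V where "X = D * p ^ j" and "V = P * p ^ j"
    have XV: "X \<noteq> 0" "V \<noteq> 0" "V / X = P / D" using D p0 by (auto simp: X_def V_def)
    define H where "H = gauss_binom p y j * tri p (p / p ^ y) j * qpoch D p j / qpoch P p y * (inverse (p ^ k) ^ j * tri p 1 j)"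
    have "F (j + s) j = H * (gauss_binom p M s * tri p (p / p ^ M) s * qpoch X p s * qpoch 0 p s *
       qpoch (X * 0 * (p / (p ^ M * V)) * p ^ s) p (M - s) * qpoch (V * p ^ s) p (M - s))" if s: "s \<le> M" for s
    proof -
      have g: "gauss_binom p y (j + s) * gauss_binom p (j + s) j = gauss_binom p y j * gauss_binom p M s"
        using gauss_binom_trinomial[OF p0 p1, of j s y] s by (simp add: n)
      have t: "tri p (p / p ^ y) (j + s) = tri p (p / p ^ y) j * tri p (p / p ^ M) s"
      proof -
        have "p / p ^ y * p ^ j = p / p ^ M" using p0 by (simp add: n power_add)
        then show ?thesis using tri_add[of p "p / p ^ y" j s] by simp
      qed
      have q1: "qpoch D p (j + s) = qpoch D p j * qpoch X p s"
        using qpoch_add[of D p j s] by (simp add: X_def)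
      have q2: "qpoch P p y = qpoch P p (j + s) * qpoch (V * p ^ s) p (M - s)"
        using qpoch_add[of P p "j + s" "M - s"] s by (simp add: V_def n power_add mult.assoc)
      have nz: "qpoch P p y \<noteq> 0" "qpoch P p (j + s) \<noteq> 0" using Pn[of y] Pn[of "j + s"] s by (auto simp: n)
      then have q3: "1 / qpoch P p (j + s) = qpoch (V * p ^ s) p (M - s) / qpoch P p y"
        using q2 by (simp add: field_simps)
      have "F (j + s) j = (gauss_binom p y (j + s) * gauss_binom p (j + s) j) * tri p (p / p ^ y) (j + s) * qpoch D p (j + s) * (1 / qpoch P p (j + s)) *
        (inverse (p ^ k) ^ j * tri p 1 j)"
        unfolding F_def by (simp add: ac_simps)
      then show ?thesis unfolding g t q1 q3 H_def by (simp add: ac_simps)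
    qed
    then have "(\<Sum>s\<le>y - j. F (j + s) j) = H * (\<Sum>s\<le>M. gauss_binom p M s * tri p (p / p ^ M) s * qpoch X p s * qpoch 0 p s *
       qpoch (X * 0 * (p / (p ^ M * V)) * p ^ s) p (M - s) * qpoch (V * p ^ s) p (M - s))"
      unfolding M_def[symmetric] sum_distrib_left by (intro sum.cong) auto
    also have "\<dots> = H * (X ^ M * qpoch (P / D) p M)"
      unfolding q_saalschuetz_reversed[OF p0 XV(2,1)] XV(3) by simp
    also have "\<dots> = dual_krawtchouk_coeff \<theta> N y j * inverse (p ^ k) ^ j"
      unfolding dual_krawtchouk_coeff_def D_def[symmetric] P_def[symmetric] M_def[symmetric] H_def X_def by (simp add: ac_simps)
    finally show "(\<Sum>s\<le>y - j. F (j + s) j) = dual_krawtchouk_coeff \<theta> N y j * inverse (p ^ k) ^ j" .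
  qed
  finally show ?thesis .
qed

text \<open>One polynomial is expanded in powers of p^(-k); each power only rescales
  \<open>b\<close> in the generating function of the other one. The condition on \<open>z\<close> is
  what makes the products split into the four Askey-Wilson parameters.\<close>

lemma dual_krawtchouk_bilinear:
  assumes xy: "y \<le> x" "x + y \<le> N" and nz: "\<theta> \<noteq> 0" "\<theta>' \<noteq> 0" "b \<noteq> 0" "z \<noteq> 0" and z: "z * z * p = \<theta>' * (b * \<theta>) * b"
  shows "(\<Sum>k\<le>N. gauss_binom p N k * tri p b k * dual_krawtchouk \<theta> N x k * dual_krawtchouk \<theta>' N y k) =
    qpoch (b * \<theta>) p (x - y) * qpoch b p (N - x - y) * (z ^ y / (\<Prod>r<y. 1 - p ^ (N - r))) *
    aw_sum y (p * z / (b * \<theta>)) (b * \<theta> * p ^ (x - y) / z) (p * z / b) (b * p ^ (N - x - y) / z) z"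
proof -
  define A where "A = b * \<theta>"
  have A: "A \<noteq> 0" using nz by (simp add: A_def)
  define W where "W = (\<Prod>r<y. 1 - p ^ (N - r))"
  have W: "W \<noteq> 0"
  proof -
    have "1 - p ^ (N - r) \<noteq> 0" if "r < y" for r
      using p1[of "N - r"] that xy by (metis right_minus_eq add_leD2 order.strict_trans2 zero_less_diff)
    then show ?thesis by (simp add: W_def)
  qed
  have "(\<Sum>k\<le>N. gauss_binom p N k * tri p b k * dual_krawtchouk \<theta> N x k * dual_krawtchouk \<theta>' N y k) =
    (\<Sum>k\<le>N. \<Sum>j\<le>y. dual_krawtchouk_coeff \<theta>' N y j * (gauss_binom p N k * tri p (b / p ^ j) k * dual_krawtchouk \<theta> N x k))"
  proof (rule sum.cong[OF refl])
    fix k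
    have "tri p (b / p ^ j) k = inverse (p ^ k) ^ j * tri p b k" for j
      by (subst (1 2) tri_1) (simp add: power_divide power_inverse divide_inverse power_mult_distrib power_mult[symmetric] mult.commute)
    then show "gauss_binom p N k * tri p b k * dual_krawtchouk \<theta> N x k * dual_krawtchouk \<theta>' N y k =
      (\<Sum>j\<le>y. dual_krawtchouk_coeff \<theta>' N y j * (gauss_binom p N k * tri p (b / p ^ j) k * dual_krawtchouk \<theta> N x k))"
      using xy nz by (simp add: dual_krawtchouk_expansion[of y N \<theta>' k] sum_distrib_left ac_simps)
  qed
  also have "\<dots> = (\<Sum>j\<le>y. dual_krawtchouk_coeff \<theta>' N y j * (\<Sum>k\<le>N. gauss_binom p N k * tri p (b / p ^ j) k * dual_krawtchouk \<theta> N x k))"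
    by (subst sum.swap) (simp add: sum_distrib_left)
  also have "\<dots> = (\<Sum>j\<le>y. dual_krawtchouk_coeff \<theta>' N y j * (qpoch (b / p ^ j) p (N - x) * qpoch (A / p ^ j) p x))"
    using xy by (simp add: dual_krawtchouk_generating A_def)
  also have "\<dots> = (\<Sum>j\<le>y. qpoch A p (x - y) * qpoch b p (N - x - y) * (z ^ y / W) *
     (gauss_binom p y j * qpoch (A * p ^ (x - y) / z * (b * p ^ (N - x - y) / z) * p ^ (y - j)) p j * qpoch (p * z / A * (p * z / b) * p ^ j) p (y - j) *
     qpoch (A * p ^ (x - y) / z * z) p (y - j) * qpoch (b * p ^ (N - x - y) / z * z) p (y - j) * qpoch (p * z / A / z) p j * qpoch (p * z / b / z) p j * (z ^ j / z ^ (y - j))))"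
  proof (rule sum.cong[OF refl])
    fix j assume "j \<in> {..y}"
    then have j: "j \<le> y" by simp
    define M where "M = y - j"
    have n: "y = j + M" using j by (simp add: M_def)
    define D P where "D = \<theta>' * p ^ y / p ^ N" and "P = inverse (p ^ N)"
    have D: "D \<noteq> 0" using nz p0 by (simp add: D_def)
    have split: "qpoch (e / p ^ j) p (j + m + M) = qpoch (e / p ^ j) p j * qpoch e p m * qpoch (e * p ^ m) p M" for e m
      unfolding qpoch_add using p0 by (simp add: power_add)
    have s1: "qpoch (b / p ^ j) p (N - x) = qpoch (b / p ^ j) p j * qpoch b p (N - x - y) * qpoch (b * p ^ (N - x - y)) p M"
      using split[of b "N - x - y"] xy by (simp add: n)
    have s2: "qpoch (A / p ^ j) p x = qpoch (A / p ^ j) p j * qpoch A p (x - y) * qpoch (A * p ^ (x - y)) p M"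
      using split[of A "x - y"] xy by (simp add: n)
    have r1: "qpoch (e / p ^ j) p j = qpoch (p / e) p j * tri p (e / p ^ j) j" if "e \<noteq> 0" for e
      using qpoch_reverse[OF p0, of "e / p ^ j" j] that p0 by simp
    have pN: "p ^ N = p ^ (N - x - y) * p ^ (x - y) * p ^ y * p ^ y"
      using xy by (simp flip: power_add)
    have bd: "A * p ^ (x - y) / z * (b * p ^ (N - x - y) / z) * p ^ M = p / (p ^ j * D)"
    proof -
      have "A * b = z * z * p / \<theta>'" using z nz by (simp add: A_def field_simps)
      then have "A * p ^ (x - y) / z * (b * p ^ (N - x - y) / z) * p ^ M = p / \<theta>' * p ^ (x - y) * p ^ (N - x - y) * p ^ M"
        using nz by (simp add: field_simps)
      also have "\<dots> = p / (p ^ j * D)" using p0 nz unfolding D_def pN by (simp add: n power_add field_simps)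
      finally show ?thesis .
    qed
    have ac: "p * z / A * (p * z / b) * p ^ j = \<theta>' * p ^ Suc j"
    proof -
      have "z * z * p = \<theta>' * A * b" using z by (simp add: A_def)
      then have "p * z / A * (p * z / b) = \<theta>' * p" using A nz by (simp add: field_simps)
      then show ?thesis by simp
    qed
    have r2: "qpoch D p j = qpoch (p / (p ^ j * D)) p j * tri p D j"
      using qpoch_reverse[OF p0 D, of j] by simp
    have r3: "qpoch (P / D) p M * tri p (\<theta>' * p ^ Suc j) M = qpoch (\<theta>' * p ^ Suc j) p M"
    proof -
      have "P / D = p / (p ^ M * (\<theta>' * p ^ Suc j))" using p0 nz by (simp add: P_def D_def n power_add field_simps)
      then show ?thesis using qpoch_reverse[OF p0, of "\<theta>' * p ^ Suc j" M] nz p0 by simp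
    qed
    have r4: "qpoch P p y = tri p P y * W"
    proof -
      have "qpoch P p y * p ^ y = gauss_binom p N y * tri p (p / p ^ N) y * qpoch p p y"
        unfolding P_def by (rule qpoch_minus[OF p0]) (use xy in simp)
      also have "\<dots> = tri p (p / p ^ N) y * W" using gauss_binom_mult[of y N p] xy by (simp add: W_def ac_simps)
      also have "tri p (p / p ^ N) y = p ^ y * tri p P y" using tri_scale[of p p P y] by (simp add: P_def divide_inverse)
      finally show ?thesis using p0 by simp
    qed
    have Pz: "tri p P y \<noteq> 0" using p0 by (simp add: tri_nonzero P_def)
    \<comment> \<open>All powers of p and of the parameters are collected here; the genuine shifted
      factorials have been matched already by \<open>r1\<close> to \<open>r4\<close>.\<close>
    have key: "tri p 1 j * tri p (p / p ^ y) j * tri p D j * (D * p ^ j) ^ M * tri p (A / p ^ j) j * tri p (b / p ^ j) j =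
       (z * z) ^ j * tri p (\<theta>' * p ^ Suc j) M * tri p P y"
    proof -
      have sq: "tri p 1 n * tri p 1 n * p ^ n = (p ^ n) ^ n" for n
        by (induction n) (simp_all add: tri_Suc power_mult_distrib ac_simps power_commutes)
      have XX: "(p ^ M) ^ j = (p ^ j) ^ M" by (metis power_mult mult.commute)
      have zz: "(z * z) ^ j * p ^ j = \<theta>' ^ j * (A ^ j * b ^ j)"
        using arg_cong[OF z, of "\<lambda>t. t ^ j"] by (simp add: power_mult_distrib A_def ac_simps)
      have t1: "tri p (p / p ^ y) j = p ^ j / ((p ^ j) ^ j * (p ^ j) ^ M) * tri p 1 j"
        by (subst tri_1) (simp add: power_divide n power_add power_mult_distrib XX)
      have t2: "tri p D j = \<theta>' ^ j * (p ^ j) ^ j * (p ^ j) ^ M / (p ^ N) ^ j * tri p 1 j"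
        by (subst tri_1) (simp add: D_def power_divide n power_add power_mult_distrib XX)
      have t3: "(D * p ^ j) ^ M = \<theta>' ^ M * (p ^ j) ^ M * (p ^ j) ^ M * (p ^ M) ^ M / (p ^ N) ^ M"
        by (simp add: D_def power_divide n power_add power_mult_distrib)
      have t4: "tri p (A / p ^ j) j * tri p (b / p ^ j) j = A ^ j * b ^ j / ((p ^ j) ^ j * (p ^ j) ^ j) * (tri p 1 j * tri p 1 j)"
        by (subst (1 2) tri_1) (simp add: power_divide)
      have t5: "tri p (\<theta>' * p ^ Suc j) M = \<theta>' ^ M * p ^ M * (p ^ j) ^ M * tri p 1 M"
        by (subst tri_1) (simp add: power_mult_distrib)
      have t6: "tri p P y = 1 / ((p ^ N) ^ j * (p ^ N) ^ M) * (tri p 1 j * ((p ^ j) ^ M * tri p 1 M))"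
      proof -
        have "tri p 1 y = tri p 1 j * ((p ^ j) ^ M * tri p 1 M)"
          unfolding n tri_add using tri_1[of "1 * p ^ j" M] by simp
        then show ?thesis by (subst tri_1) (simp add: P_def n power_add power_inverse field_simps)
      qed
      define tj tM where "tj = tri p 1 j" and "tM = tri p 1 M"
      have e: "tj * tj * p ^ j = (p ^ j) ^ j" "tM * tM * p ^ M = (p ^ M) ^ M" using sq by (simp_all add: tj_def tM_def)
      \<comment> \<open>Every factor is a monomial in these quantities, so that the simplifier never
        has to combine exponents.\<close>
      define u v w x1 x2 g h where "u = p ^ j" and "v = (p ^ j) ^ M" and "w = p ^ M" and "x1 = (p ^ N) ^ j" and "x2 = (p ^ N) ^ M"
        and "g = \<theta>' ^ j" and "h = \<theta>' ^ M"
      note defs = this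
      have nzs: "u \<noteq> 0" "v \<noteq> 0" "w \<noteq> 0" "x1 \<noteq> 0" "x2 \<noteq> 0" "tj \<noteq> 0" "tM \<noteq> 0"
        using p0 by (simp_all add: defs tj_def tM_def tri_nonzero)
      have "tri p 1 j * tri p (p / p ^ y) j * tri p D j * (D * p ^ j) ^ M * (tri p (A / p ^ j) j * tri p (b / p ^ j) j) =
        tj * (u / (tj * tj * u * v) * tj) * (g * (tj * tj * u) * v / x1 * tj) * (h * v * v * (tM * tM * w) / x2) *
        (A ^ j * b ^ j / ((tj * tj * u) * (tj * tj * u)) * (tj * tj))"
        unfolding t1 t2 t3 t4 unfolding e(1)[symmetric] e(2)[symmetric] defs tj_def[symmetric] tM_def[symmetric] ..
      also have "\<dots> = tj * (g * (A ^ j * b ^ j)) * h * v * v * (tM * tM * w) / (u * x1 * x2)"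
        using nzs by (simp add: field_simps)
      also have "g * (A ^ j * b ^ j) = (z * z) ^ j * u" unfolding defs by (rule zz[symmetric])
      also have "tj * ((z * z) ^ j * u) * h * v * v * (tM * tM * w) / (u * x1 * x2) =
        (z * z) ^ j * (h * w * v * tM) * (1 / (x1 * x2) * (tj * (v * tM)))"
        using nzs by (simp add: field_simps)
      also have "\<dots> = (z * z) ^ j * tri p (\<theta>' * p ^ Suc j) M * tri p P y"
        unfolding t5 t6 defs tj_def tM_def ..
      finally show ?thesis by (simp add: ac_simps)
    qed
    define R where "R = gauss_binom p y j * qpoch (p / (p ^ j * D)) p j * qpoch (p / A) p j * qpoch (p / b) p j * qpoch A p (x - y) * qpoch b p (N - x - y)
       * qpoch (b * p ^ (N - x - y)) p M * qpoch (A * p ^ (x - y)) p M"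
    have "dual_krawtchouk_coeff \<theta>' N y j * (qpoch (b / p ^ j) p (N - x) * qpoch (A / p ^ j) p x) =
       R * qpoch (P / D) p M * (tri p 1 j * tri p (p / p ^ y) j * tri p D j * (D * p ^ j) ^ M * tri p (A / p ^ j) j * tri p (b / p ^ j) j) / (tri p P y * W)"
      unfolding dual_krawtchouk_coeff_def D_def[symmetric] P_def[symmetric] M_def[symmetric] s1 s2 r1[OF A] r1[OF nz(3)] r2 r4 R_def
      by (simp add: ac_simps)
    also have "\<dots> = R * (qpoch (P / D) p M * tri p (\<theta>' * p ^ Suc j) M) * (z * z) ^ j / W"
      unfolding key using Pz by (simp add: field_simps)
    also have "\<dots> = R * qpoch (\<theta>' * p ^ Suc j) p M * (z ^ y * (z ^ j / z ^ M)) / W"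
    proof -
      have "(z * z) ^ j = z ^ y * (z ^ j / z ^ M)" using nz by (simp add: n power_add power_mult_distrib)
      then show ?thesis unfolding r3 by simp
    qed
    finally show "dual_krawtchouk_coeff \<theta>' N y j * (qpoch (b / p ^ j) p (N - x) * qpoch (A / p ^ j) p x) =
      qpoch A p (x - y) * qpoch b p (N - x - y) * (z ^ y / W) *
     (gauss_binom p y j * qpoch (A * p ^ (x - y) / z * (b * p ^ (N - x - y) / z) * p ^ (y - j)) p j * qpoch (p * z / A * (p * z / b) * p ^ j) p (y - j) *
     qpoch (A * p ^ (x - y) / z * z) p (y - j) * qpoch (b * p ^ (N - x - y) / z * z) p (y - j) * qpoch (p * z / A / z) p j * qpoch (p * z / b / z) p j * (z ^ j / z ^ (y - j)))"
      unfolding M_def[symmetric] bd ac R_def using nz by (simp add: ac_simps)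
  qed
  also have "\<dots> = qpoch A p (x - y) * qpoch b p (N - x - y) * (z ^ y / W) *
    aw_sum y (p * z / A) (A * p ^ (x - y) / z) (p * z / b) (b * p ^ (N - x - y) / z) z"
    unfolding aw_sum_def sum_distrib_left ..
  finally show ?thesis by (simp add: A_def W_def)
qed

end

section \<open>Values of Askey--Wilson polynomials\<close>

lemma qpoch_pair_poly:
  fixes a p :: complex
  shows "\<exists>P. \<forall>z. z \<noteq> 0 \<longrightarrow> poly P ((z + inverse z) / 2) = qpoch (a * z) p k * qpoch (a / z) p k"
proof (induction k)
  case 0
  show ?case by (rule exI[of _ 1]) simp
next
  case (Suc k)
  then obtain P where P: "\<And>z. z \<noteq> 0 \<Longrightarrow> poly P ((z + inverse z) / 2) = qpoch (a * z) p k * qpoch (a / z) p k" by blast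
  have "poly (P * [:1 + (a * p ^ k)\<^sup>2, - 2 * a * p ^ k:]) ((z + inverse z) / 2) = qpoch (a * z) p (Suc k) * qpoch (a / z) p (Suc k)"
    if "z \<noteq> 0" for z
    using that by (simp add: P qpoch_Suc) (simp add: field_simps power2_eq_square)
  then show ?case by blast
qed

lemma joukowski_surj: "\<exists>z. z \<noteq> 0 \<and> (z + inverse z) / 2 = (x :: complex)"
proof -
  define z where "z = x + csqrt (x\<^sup>2 - 1)"
  have "z * (x - csqrt (x\<^sup>2 - 1)) = x\<^sup>2 - (csqrt (x\<^sup>2 - 1))\<^sup>2" by (simp add: z_def power2_eq_square algebra_simps)
  then have e: "z * (x - csqrt (x\<^sup>2 - 1)) = 1" by simp
  then have "z \<noteq> 0" by auto
  moreover have "inverse z = x - csqrt (x\<^sup>2 - 1)" using e by (rule inverse_unique)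
  ultimately show ?thesis by (auto simp: z_def)
qed

lemma of_real_pow_neq_1:
  assumes "0 < p" "p < 1" "k > 0"
  shows "complex_of_real p ^ k \<noteq> 1" "p ^ k \<noteq> 1"
proof -
  show "p ^ k \<noteq> 1" using power_Suc_less_one[of p "k - 1"] assms by auto
  then show "complex_of_real p ^ k \<noteq> 1" by (metis of_real_eq_1_iff of_real_power)
qed

text \<open>Resolves the \<open>THE\<close> of \<open>askey_wilson\<close>: the series is a
  polynomial in (z + 1/z)/2, and since this expression takes every complex value, the polynomial is
  unique.\<close>

lemma askey_wilson_value:
  assumes p: "0 < p" "p < 1" and nz: "a \<noteq> 0" "b \<noteq> 0" "c \<noteq> 0" "d \<noteq> 0" "z \<noteq> 0"
    and den: "qpoch (a * b) (complex_of_real p) n \<noteq> 0" "qpoch (a * c) (complex_of_real p) n \<noteq> 0"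
      "qpoch (a * d) (complex_of_real p) n \<noteq> 0"
  shows "poly (askey_wilson n a b c d (complex_of_real p)) ((z + inverse z) / 2) = aw_sum (complex_of_real p) n a b c d z"
proof -
  define P where "P = complex_of_real p"
  have P0: "P \<noteq> 0" and P1: "\<And>k. k > 0 \<Longrightarrow> P ^ k \<noteq> 1" using p by (auto simp: P_def of_real_pow_neq_1)
  define K where "K = inverse (a ^ n) * qpoch (a * b) P n * qpoch (a * c) P n * qpoch (a * d) P n"
  define c' where "c' k = K * (qpoch (inverse (P ^ n)) P k * qpoch (a * b * c * d * P ^ n / P) P k /
        (qpoch (a * b) P k * qpoch (a * c) P k * qpoch (a * d) P k * qpoch P P k) * P ^ k)" for k
  have pw: "P powi (int n - 1) = P ^ n / P" using P0 by (simp add: power_int_diff)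
  have hy: "K * qhyp [inverse (P ^ n), a * b * c * d * P powi (int n - 1), a * z, a / z] [a * b, a * c, a * d] P P =
     (\<Sum>k\<le>n. c' k * (qpoch (a * z) P k * qpoch (a / z) P k))" for z
  proof -
    have "qhyp [inverse (P ^ n), a * b * c * d * P powi (int n - 1), a * z, a / z] [a * b, a * c, a * d] P P =
      (\<Sum>k\<le>n. (\<Prod>a\<leftarrow>[inverse (P ^ n), a * b * c * d * P powi (int n - 1), a * z, a / z]. qpoch a P k) /
         ((\<Prod>b\<leftarrow>[a * b, a * c, a * d]. qpoch b P k) * qpoch P P k) * P ^ k)"
      unfolding qhyp_def by (rule suminf_finite) (auto simp: qpoch_minus_zero[OF P0 P1])
    then show ?thesis unfolding c'_def pw by (simp add: sum_distrib_left ac_simps)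
  qed
  obtain Q where Q: "\<And>k z. z \<noteq> 0 \<Longrightarrow> poly (Q k) ((z + inverse z) / 2) = qpoch (a * z) P k * qpoch (a / z) P k"
    using qpoch_pair_poly[of a P] by metis
  define R where "R = (\<Sum>k\<le>n. Polynomial.smult (c' k) (Q k))"
  have R: "poly R ((z + inverse z) / 2) = K * qhyp [inverse (P ^ n), a * b * c * d * P powi (int n - 1), a * z, a / z] [a * b, a * c, a * d] P P"
    if "z \<noteq> 0" for z unfolding hy R_def poly_sum using that by (simp add: Q)
  have "askey_wilson n a b c d P = R" unfolding askey_wilson_def
  proof (rule the_equality)
    fix R' assume R': "\<forall>z. z \<noteq> 0 \<longrightarrow> poly R' ((z + inverse z) / 2) =
     inverse (a ^ n) * qpoch (a * b) P n * qpoch (a * c) P n * qpoch (a * d) P n *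
     qhyp [inverse (P ^ n), a * b * c * d * P powi (int n - 1), a * z, a / z] [a * b, a * c, a * d] P P"
    have "poly R' x = poly R x" for x
    proof -
      obtain z where z: "z \<noteq> 0" "x = (z + inverse z) / 2" using joukowski_surj[of x] by blast
      show ?thesis unfolding z(2) R[OF z(1)] using R' z(1) by (simp add: K_def)
    qed
    then show "R' = R" by (metis poly_eq_poly_eq_iff ext)
  qed (use R in \<open>simp add: K_def\<close>)
  then have "poly (askey_wilson n a b c d P) ((z + inverse z) / 2) = (\<Sum>k\<le>n. c' k * (qpoch (a * z) P k * qpoch (a / z) P k))"
    using R[OF nz(5)] hy by simp
  also have "\<dots> = aw_sum P n a b c d z"
  proof -
    have "(\<Sum>k\<le>n. c' k * (qpoch (a * z) P k * qpoch (a / z) P k)) = K * (\<Sum>k\<le>n. qpoch (inverse (P ^ n)) P k * qpoch (a * b * c * d * P ^ n / P) P k * qpoch (a * z) P k * qpoch (a / z) P k /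
        (qpoch (a * b) P k * qpoch (a * c) P k * qpoch (a * d) P k * qpoch P P k) * P ^ k)"
      unfolding sum_distrib_left c'_def by (intro sum.cong) (simp_all add: ac_simps)
    also have "\<dots> = aw_sum P n a b c d z"
      unfolding K_def using P0 P1 nz den[folded P_def] by (intro askey_wilson_sum) auto
    finally show ?thesis .
  qed
  finally show ?thesis unfolding P_def .
qed

section \<open>The eigenvectors\<close>

lemma of_real_qpoch: "qpoch (of_real a) (of_real p) k = (of_real (qpoch a p k) :: 'a::{real_algebra_1,comm_ring_1})"
  by (induction k) (simp_all add: qpoch_Suc)

lemma of_real_tri: "tri (of_real p) (of_real a) k = (of_real (tri p a k) :: 'a::{real_algebra_1,comm_ring_1})"
  by (induction k) (simp_all add: tri_Suc)

lemma of_real_gauss_binom: "gauss_binom (of_real p) n k = (of_real (gauss_binom p n k) :: 'a::{real_algebra_1,comm_ring_1})"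
  by (induction p n k rule: gauss_binom.induct) simp_all

text \<open>The defining equation carries the assumptions of its context; they hold for a real base
  between 0 and 1.\<close>

lemma dual_krawtchouk_explicit:
  assumes "0 < p" "p < (1::real)"
  shows "dual_krawtchouk p \<theta> N x k = (\<Sum>m\<le>x. qpoch (inverse (p ^ k)) p m * qpoch (inverse (p ^ x)) p m * qpoch (\<theta> * p ^ x / p ^ N) p m /
     (qpoch (inverse (p ^ N)) p m * qpoch p p m) * p ^ m)"
  using assms of_real_pow_neq_1(2)[OF assms] by (intro dual_krawtchouk_def) auto

lemma dual_krawtchouk_explicit_complex:
  assumes "0 < p" "p < (1::real)"
  shows "dual_krawtchouk (complex_of_real p) \<theta> N x k = (\<Sum>m\<le>x. qpoch (inverse ((complex_of_real p) ^ k)) (complex_of_real p) m * qpoch (inverse ((complex_of_real p) ^ x)) (complex_of_real p) m * qpoch (\<theta> * (complex_of_real p) ^ x / (complex_of_real p) ^ N) (complex_of_real p) m /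
     (qpoch (inverse ((complex_of_real p) ^ N)) (complex_of_real p) m * qpoch (complex_of_real p) (complex_of_real p) m) * (complex_of_real p) ^ m)"
  using assms of_real_pow_neq_1(1)[OF assms] by (intro dual_krawtchouk_def) auto

lemma of_real_dual_krawtchouk:
  assumes "0 < p" "p < 1"
  shows "dual_krawtchouk (complex_of_real p) (of_real \<theta>) N x k = of_real (dual_krawtchouk p \<theta> N x k)"
proof -
  have e: "inverse (complex_of_real p ^ k) = of_real (inverse (p ^ k))" for k by simp
  have f: "complex_of_real \<theta> * of_real p ^ x / of_real p ^ N = of_real (\<theta> * p ^ x / p ^ N)" by simp
  have p: "p \<noteq> 0" "complex_of_real p \<noteq> 0" using assms by auto
  show ?thesis
    unfolding dual_krawtchouk_explicit[OF assms] dual_krawtchouk_explicit_complex[OF assms] e f of_real_qpoch by simp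
qed

lemma qpoch_pos:
  assumes "0 < p" "p < 1" "a < (1::real)"
  shows "0 < qpoch a p k"
  unfolding qpoch_def
proof (rule prod_pos)
  fix r assume "r \<in> {..<k}"
  have "p ^ r \<le> 1" "0 < p ^ r" using assms by (auto intro: power_le_one)
  then have "a * p ^ r < 1"
    by (cases "0 \<le> a") (use assms mult_left_le[of "p^r" a] mult_neg_pos[of a "p^r"] in \<open>auto\<close>)
  then show "0 < 1 - a * p ^ r" by simp
qed

lemma gauss_binom_pos:
  assumes "0 < p" "k \<le> n"
  shows "0 < gauss_binom (p::real) n k"
  using assms
proof (induction p n k rule: gauss_binom.induct)
  case (3 p n j)
  show ?case
  proof (cases "Suc j \<le> n")
    case True
    then have "0 < gauss_binom p n (Suc j)" "0 < p ^ (n - j) * gauss_binom p n j" using 3 by auto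
    then show ?thesis by simp
  next
    case False
    then have "gauss_binom p n (Suc j) = 0" by (simp add: gauss_binom_zero)
    then show ?thesis using 3 by simp
  qed
qed auto

context
  fixes q :: real
  assumes q: "0 < q" "q < 1"
begin

lemma pq: "0 < q\<^sup>2" "q\<^sup>2 < 1" "q\<^sup>2 \<noteq> 0" "k > 0 \<Longrightarrow> (q\<^sup>2) ^ k \<noteq> 1"
proof -
  show a: "q\<^sup>2 < 1" using power_Suc_less_one[of q 1] q by (simp add: power2_eq_square)
  show "k > 0 \<Longrightarrow> (q\<^sup>2) ^ k \<noteq> 1" using of_real_pow_neq_1(2)[of "q\<^sup>2" k] q a by simp
qed (use q in simp_all)

lemma powr_2_nat: "q powr (2 * real k) = (q\<^sup>2) ^ k" "q powr (- 2 * real k) = inverse ((q\<^sup>2) ^ k)"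
proof -
  have "(q powr 2) ^ k = q powr (2 * real k)" using q by (subst powr_power) (simp_all add: mult.commute)
  moreover have "q powr 2 = q\<^sup>2" using powr_realpow[of q 2] q by simp
  ultimately show "q powr (2 * real k) = (q\<^sup>2) ^ k" by simp
  then show "q powr (- 2 * real k) = inverse ((q\<^sup>2) ^ k)" by (simp add: powr_minus)
qed

lemma qpoch_powr_gauss_binom:
  assumes "k \<le> N"
  shows "qpoch (q powr (2 * real N)) (q powr (-2)) k = (\<Prod>r<k. 1 - (q\<^sup>2) ^ (N - r))"
  unfolding qpoch_def
proof (rule prod.cong)
  fix r assume "r \<in> {..<k}"
  then have "real (N - r) = real N - real r" using assms by auto
  then have "(q\<^sup>2) ^ (N - r) = q powr (2 * real N) * (q powr (-2)) ^ r"
    using powr_2_nat(1)[of "N - r"] q by (simp add: powr_power powr_add[symmetric] algebra_simps)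
  then show "1 - q powr (2 * real N) * (q powr (-2)) ^ r = 1 - (q\<^sup>2) ^ (N - r)" by simp
qed simp

lemma gauss_binom_ratio:
  assumes "k \<le> N"
  shows "qpoch (q powr (2 * real N)) (q powr (-2)) k / qpoch (q\<^sup>2) (q\<^sup>2) k = gauss_binom (q\<^sup>2) N k"
  unfolding qpoch_powr_gauss_binom[OF assms] gauss_binom_mult[OF assms, symmetric]
  using qpoch_pp_nonzero[OF pq(3,4), of k] by simp

text \<open>The power of q in front of the series in \<open>v_coeff\<close>. Its exponent k(k-1)/2
  is half of what \<open>tri\<close> needs in base q^2, so the product of two weights is a
  \<open>tri\<close> (\<open>wt_mult\<close>).\<close>

definition wt :: "real \<Rightarrow> nat \<Rightarrow> real" where
  "wt \<sigma> k = (q powr \<sigma>) ^ k * q powr (real k * (real k - 1) / 2)"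

lemma wt_Suc: "wt \<sigma> (Suc k) = wt \<sigma> k * (q powr \<sigma> * q ^ k)"
proof -
  have "q powr (real (Suc k) * (real (Suc k) - 1) / 2) = q powr (real k * (real k - 1) / 2 + real k)"
    by (rule arg_cong[where f="\<lambda>x. q powr x"]) (simp add: field_simps)
  also have "\<dots> = q powr (real k * (real k - 1) / 2) * q ^ k" using q by (simp add: powr_add powr_realpow)
  finally show ?thesis by (simp add: wt_def)
qed

lemma wt_mult: "wt \<sigma> k * wt \<tau> k = tri (q\<^sup>2) (- (q powr \<sigma> * q powr \<tau>)) k"
proof (induction k)
  case 0
  show ?case using q by (simp add: wt_def)
next
  case (Suc k)
  have "wt \<sigma> (Suc k) * wt \<tau> (Suc k) = (wt \<sigma> k * wt \<tau> k) * (q powr \<sigma> * q powr \<tau> * (q ^ k * q ^ k))"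
    unfolding wt_Suc by (simp add: ac_simps)
  then show ?case unfolding Suc tri_Suc by (simp add: power_mult[symmetric] power_mult_distrib power2_eq_square)
qed

definition th :: "real \<Rightarrow> real" where "th \<sigma> = - (q powr (-2 * \<sigma>))"

text \<open>Weights are counted from the top: N = 2l, k = l - n and x = l - j are natural numbers,
  and all floors and real exponents disappear.\<close>

lemma v_coeff_eq:
  assumes N: "2 * l = real N" and k: "k \<le> N" and x: "x \<le> N"
  shows "v_coeff q l (l - real x) (l - real k) \<sigma> = inverse \<i> ^ k *
    complex_of_real (C_coeff q l (l - real x) \<sigma> * wt \<sigma> k * sqrt (gauss_binom (q\<^sup>2) N k) * dual_krawtchouk (q\<^sup>2) (th \<sigma>) N x k)"
proof -
  let ?p = "q\<^sup>2"
  have 1: "\<i> powi \<lfloor>l - real k - l\<rfloor> = inverse \<i> ^ k"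
  proof -
    have "\<lfloor>l - real k - l\<rfloor> = - int k" by simp linarith
    then show ?thesis by (simp only: power_int_minus power_int_of_nat power_inverse)
  qed
  have 2: "l - (l - real k) = real k" "l - (l - real x) = real x" by auto
  have 4: "4 * l = 2 * real N" "-4 * l = - 2 * real N" using N by auto
  have 5: "q powr (\<sigma> * real k) = (q powr \<sigma>) ^ k" using q by (simp add: powr_power mult.commute)
  have 6: "- (q powr (-2 * l - 2 * (l - real x) - 2 * \<sigma>)) = th \<sigma> * ?p ^ x / ?p ^ N"
  proof -
    have "-2 * l - 2 * (l - real x) - 2 * \<sigma> = (-2 * \<sigma>) + 2 * real x - 2 * real N" using N by auto
    then show ?thesis unfolding th_def powr_2_nat(1)[symmetric] by (simp add: powr_add powr_diff powr_minus field_simps)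
  qed
  have 7: "qhyp [q powr (-2 * real k), q powr (-2 * real x), th \<sigma> * ?p ^ x / ?p ^ N] [q powr (-2 * real N), 0] ?p ?p =
    dual_krawtchouk ?p (th \<sigma>) N x k"
  proof -
    have "qhyp [q powr (-2 * real k), q powr (-2 * real x), th \<sigma> * ?p ^ x / ?p ^ N] [q powr (-2 * real N), 0] ?p ?p =
      (\<Sum>m\<le>x. (\<Prod>a\<leftarrow>[q powr (-2 * real k), q powr (-2 * real x), th \<sigma> * ?p ^ x / ?p ^ N]. qpoch a ?p m) /
         ((\<Prod>b\<leftarrow>[q powr (-2 * real N), 0]. qpoch b ?p m) * qpoch ?p ?p m) * ?p ^ m)"
      unfolding qhyp_def
    proof (rule suminf_finite)
      fix m assume "m \<notin> {..x}"
      then have "qpoch (q powr (-2 * real x)) ?p m = 0"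
        unfolding powr_2_nat by (intro qpoch_minus_zero[OF pq(3,4)]) auto
      then show "(\<Prod>a\<leftarrow>[q powr (-2 * real k), q powr (-2 * real x), th \<sigma> * ?p ^ x / ?p ^ N]. qpoch a ?p m) /
         ((\<Prod>b\<leftarrow>[q powr (-2 * real N), 0]. qpoch b ?p m) * qpoch ?p ?p m) * ?p ^ m = 0" by simp
    qed simp
    then show ?thesis unfolding dual_krawtchouk_explicit[OF pq(1,2)] powr_2_nat by (simp add: ac_simps)
  qed
  have fl: "nat \<lfloor>real k\<rfloor> = k" by simp
  have "v_coeff q l (l - real x) (l - real k) \<sigma> = inverse \<i> ^ k * complex_of_real (C_coeff q l (l - real x) \<sigma>
     * (q powr \<sigma>) ^ k * q powr (1/2 * real k * (real k - 1)) * sqrt (gauss_binom ?p N k) * dual_krawtchouk ?p (th \<sigma>) N x k)"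
    unfolding v_coeff_def 1 2 4 5 6 7 fl gauss_binom_ratio[OF k] ..
  then show ?thesis by (simp add: wt_def ac_simps)
qed

text \<open>The torus value of a generalised matrix element, up to the constants
  \<open>C_coeff\<close> and a power of lam, with z = lam^2
  (\<open>tau_gen_mat_elem\<close>).\<close>

definition krawtchouk_sum :: "complex \<Rightarrow> nat \<Rightarrow> nat \<Rightarrow> nat \<Rightarrow> real \<Rightarrow> real \<Rightarrow> complex" where
  "krawtchouk_sum z N x y \<sigma> \<tau> = (let P = complex_of_real (q\<^sup>2) in \<Sum>k\<le>N. gauss_binom P N k * tri P (- (z * complex_of_real (q powr \<sigma> * q powr \<tau>))) k *
     dual_krawtchouk P (of_real (th \<sigma>)) N x k * dual_krawtchouk P (of_real (th \<tau>)) N y k)"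

lemma tau_gen_mat_elem:
  assumes N: "2 * l = real N" and x: "x \<le> N" and y: "y \<le> N" and lam: "lam \<noteq> 0"
  shows "tau lam (elem_lift q l (\<lambda>m. v_coeff q l (l - real x) m \<sigma>) (\<lambda>n. v_coeff q l (l - real y) n \<tau>)) =
    complex_of_real (C_coeff q l (l - real x) \<sigma> * C_coeff q l (l - real y) \<tau>) * lam powi (- int N) * krawtchouk_sum (lam\<^sup>2) N x y \<sigma> \<tau>"
proof -
  let ?P = "complex_of_real (q\<^sup>2)" and ?C = "complex_of_real (C_coeff q l (l - real x) \<sigma> * C_coeff q l (l - real y) \<tau>)"
  let ?v = "\<lambda>m. v_coeff q l (l - real x) m \<sigma>" and ?w = "\<lambda>n. v_coeff q l (l - real y) n \<tau>"
  have t: "?v (l - real k) * cnj (?w (l - real k)) * lam powi \<lfloor>- 2 * (l - real k)\<rfloor> =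
     ?C * lam powi (- int N) * (gauss_binom ?P N k * tri ?P (- (lam\<^sup>2 * complex_of_real (q powr \<sigma> * q powr \<tau>))) k *
     dual_krawtchouk ?P (of_real (th \<sigma>)) N x k * dual_krawtchouk ?P (of_real (th \<tau>)) N y k)" if k: "k \<le> N" for k
  proof -
    have "- 2 * (l - real k) = of_int (2 * int k - int N)" using N by simp
    then have f: "\<lfloor>- 2 * (l - real k)\<rfloor> = 2 * int k - int N" by (simp only: floor_of_int)
    have pi: "lam powi (2 * int k - int N) = (lam\<^sup>2) ^ k * lam powi (- int N)"
      using lam by (simp only: power_int_diff power_int_minus power_int_mult power_int_numeral power_int_of_nat divide_inverse simp_thms)
    \<comment> \<open>The phases of the two vectors cancel, one of them being conjugated.\<close>
    have ii: "inverse \<i> ^ k * cnj (inverse \<i> ^ k) = 1"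
      by (simp flip: power_mult_distrib)
    have t1: "tri ?P (- (lam\<^sup>2 * complex_of_real (q powr \<sigma> * q powr \<tau>))) k = (lam\<^sup>2) ^ k * complex_of_real (wt \<sigma> k * wt \<tau> k)"
      unfolding wt_mult of_real_tri[symmetric] by (simp add: tri_scale[symmetric])
    have s: "complex_of_real (sqrt (gauss_binom (q\<^sup>2) N k)) * complex_of_real (sqrt (gauss_binom (q\<^sup>2) N k)) = gauss_binom ?P N k"
      using gauss_binom_pos[OF pq(1) k] by (simp only: of_real_gauss_binom of_real_mult[symmetric] real_sqrt_mult_self abs_of_pos)
    have "?v (l - real k) * cnj (?w (l - real k)) = (inverse \<i> ^ k * cnj (inverse \<i> ^ k)) * ?C *
      (complex_of_real (sqrt (gauss_binom (q\<^sup>2) N k)) * complex_of_real (sqrt (gauss_binom (q\<^sup>2) N k))) * complex_of_real (wt \<sigma> k * wt \<tau> k) *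
      of_real (dual_krawtchouk (q\<^sup>2) (th \<sigma>) N x k) * of_real (dual_krawtchouk (q\<^sup>2) (th \<tau>) N y k)"
      unfolding v_coeff_eq[OF N k x] v_coeff_eq[OF N k y] by (simp only: complex_cnj_mult complex_cnj_complex_of_real of_real_mult ac_simps)
    then show ?thesis unfolding f pi t1 s ii of_real_dual_krawtchouk[OF pq(1,2)] by (simp add: ac_simps)
  qed
  have "tau lam (elem_lift q l ?v ?w) = (\<Sum>k\<le>N. ?v (- l + real k) * cnj (?w (- l + real k)) * lam powi \<lfloor>- 2 * (- l + real k)\<rfloor>)"
    by (simp only: tau_elem_lift[OF q N lam] sum_weights[OF q N])
  also have "\<dots> = (\<Sum>k\<le>N. ?v (l - real k) * cnj (?w (l - real k)) * lam powi \<lfloor>- 2 * (l - real k)\<rfloor>)"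
  proof (rule sum.reindex_bij_witness[of _ "\<lambda>k. N - k" "\<lambda>k. N - k"])
    fix k assume "k \<in> {..N}"
    then have "l - real (N - k) = - l + real k" using N by auto
    then show "?v (l - real (N - k)) * cnj (?w (l - real (N - k))) * lam powi \<lfloor>- 2 * (l - real (N - k))\<rfloor> =
      ?v (- l + real k) * cnj (?w (- l + real k)) * lam powi \<lfloor>- 2 * (- l + real k)\<rfloor>" by (simp only:)
  qed auto
  also have "\<dots> = ?C * lam powi (- int N) * krawtchouk_sum (lam\<^sup>2) N x y \<sigma> \<tau>"
    unfolding krawtchouk_sum_def Let_def sum_distrib_left by (intro sum.cong refl t) auto
  finally show ?thesis .
qed

end

section \<open>Symmetries and special values of the bilinear sums\<close>

lemma gauss_binom_symmetric:
  assumes "0 < p" "p < (1::real)" "k \<le> n"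
  shows "gauss_binom p n (n - k) = gauss_binom p n k"
proof -
  have nz: "qpoch p p m \<noteq> 0" for m using qpoch_pos[OF assms(1,2,2)] by (metis less_irrefl)
  have f: "gauss_binom p n k * qpoch p p k * qpoch p p (n - k) = qpoch p p n" if "k \<le> n" for k
  proof -
    have "(\<Prod>r<k. 1 - p ^ (n - r)) = (\<Prod>r<k. 1 - p ^ (n - (k - Suc r)))"
      by (rule prod.nat_diff_reindex[symmetric])
    also have "\<dots> = qpoch (p * p ^ (n - k)) p k"
      unfolding qpoch_def
    proof (rule prod.cong)
      fix r assume "r \<in> {..<k}"
      then have "n - (k - Suc r) = Suc (n - k) + r" using that by auto
      then show "1 - p ^ (n - (k - Suc r)) = 1 - p * p ^ (n - k) * p ^ r" by (simp only: power_add power_Suc)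
    qed simp
    finally show ?thesis using gauss_binom_mult[OF that, of p] qpoch_add[of p p "n - k" k] that by (simp add: ac_simps)
  qed
  have "gauss_binom p n (n - k) * (qpoch p p k * qpoch p p (n - k)) = gauss_binom p n k * (qpoch p p k * qpoch p p (n - k))"
    using f[OF assms(3)] f[of "n - k"] assms(3) by (simp add: ac_simps)
  then show ?thesis using nz[of k] nz[of "n - k"] by simp
qed

context
  fixes q :: real
  assumes q: "0 < q" "q < 1"
begin

lemma of_real_gauss_binom_nonzero: "k \<le> N \<Longrightarrow> gauss_binom (complex_of_real (q\<^sup>2)) N k \<noteq> 0"
  using gauss_binom_pos[OF pq(1)[OF q], of k N] by (simp only: of_real_gauss_binom of_real_eq_0_iff) auto

lemma th_eq: "th q \<sigma> = - (1 / (q powr \<sigma> * q powr \<sigma>))"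
proof -
  have "q powr (-2 * \<sigma>) = q powr (- \<sigma>) * q powr (- \<sigma>)" using q by (simp add: powr_add[symmetric])
  then show ?thesis unfolding th_def[OF q] by (simp add: powr_minus divide_inverse)
qed

lemma th_minus: "th q (- \<sigma>) = inverse (th q \<sigma>)" "th q \<sigma> \<noteq> 0"
  using q by (simp_all add: th_eq powr_minus divide_inverse)

text \<open>The generating product is unchanged when b, theta, x are replaced by b theta, 1/theta, N
  - x. Comparing coefficients of powers of b gives the claim.\<close>

lemma dual_krawtchouk_reflect:
  fixes \<theta> :: complex
  assumes th: "\<theta> \<noteq> 0" and x: "x \<le> N" and k: "k \<le> N"
  defines "P \<equiv> complex_of_real (q\<^sup>2)"
  shows "dual_krawtchouk P \<theta> N x k = \<theta> ^ k * dual_krawtchouk P (inverse \<theta>) N (N - x) k"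
proof -
  have P0: "P \<noteq> 0" using q by (simp add: P_def)
  have P1: "\<And>k. 0 < k \<Longrightarrow> P ^ k \<noteq> 1" unfolding P_def using of_real_pow_neq_1(1)[OF pq(1,2)[OF q]] by blast
  have g: "(\<Sum>k\<le>N. gauss_binom P N k * tri P b k * dual_krawtchouk P \<theta> N x k) = qpoch b P (N - x) * qpoch (b * \<theta>) P x"
    if "x \<le> N" for b \<theta> x using P0 P1 that by (intro dual_krawtchouk_generating) auto
  have "(\<Sum>k\<le>N. (gauss_binom P N k * tri P 1 k * (dual_krawtchouk P \<theta> N x k - \<theta> ^ k * dual_krawtchouk P (inverse \<theta>) N (N - x) k)) * b ^ k) = 0" for b
  proof -
    have t: "tri P b k = b ^ k * tri P 1 k" "tri P (b * \<theta>) k = b ^ k * \<theta> ^ k * tri P 1 k" for k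
      using tri_scale[of P b 1 k] tri_scale[of P "b * \<theta>" 1 k] by (simp_all add: power_mult_distrib)
    have "(\<Sum>k\<le>N. (gauss_binom P N k * tri P 1 k * (dual_krawtchouk P \<theta> N x k - \<theta> ^ k * dual_krawtchouk P (inverse \<theta>) N (N - x) k)) * b ^ k) =
      (\<Sum>k\<le>N. gauss_binom P N k * tri P b k * dual_krawtchouk P \<theta> N x k) - (\<Sum>k\<le>N. gauss_binom P N k * tri P (b * \<theta>) k * dual_krawtchouk P (inverse \<theta>) N (N - x) k)"
      unfolding t sum_subtractf[symmetric] by (intro sum.cong) (auto simp: algebra_simps)
    also have "\<dots> = 0" 
    proof -
      have "b * \<theta> * inverse \<theta> = b" "N - (N - x) = x" using th x by auto
      then show ?thesis unfolding g[OF x] g[OF diff_le_self] by (simp only: mult.commute diff_self)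
    qed
    finally show ?thesis .
  qed
  then have "gauss_binom P N k * tri P 1 k * (dual_krawtchouk P \<theta> N x k - \<theta> ^ k * dual_krawtchouk P (inverse \<theta>) N (N - x) k) = 0"
    using k polyfun_eq_0[of "\<lambda>k. gauss_binom P N k * tri P 1 k * (dual_krawtchouk P \<theta> N x k - \<theta> ^ k * dual_krawtchouk P (inverse \<theta>) N (N - x) k)" N] by blast
  then show ?thesis using of_real_gauss_binom_nonzero[OF k] tri_nonzero[of 1 P k] P0 by (simp add: P_def)
qed

lemma krawtchouk_sum_commute: "krawtchouk_sum q z N x y \<sigma> \<tau> = krawtchouk_sum q z N y x \<tau> \<sigma>"
  by (simp add: krawtchouk_sum_def[OF q] ac_simps)

text \<open>The factors theta^k from the two reflections are absorbed by \<open>tri\<close>, where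
  they invert the product of q^sigma and q^tau.\<close>

lemma krawtchouk_sum_reflect:
  assumes x: "x \<le> N" and y: "y \<le> N"
  shows "krawtchouk_sum q z N (N - x) (N - y) (- \<sigma>) (- \<tau>) = krawtchouk_sum q z N x y \<sigma> \<tau>"
proof -
  let ?P = "complex_of_real (q\<^sup>2)" and ?S = "q powr \<sigma>" and ?T = "q powr \<tau>"
  have "gauss_binom ?P N k * tri ?P (- (z * complex_of_real (?S * ?T))) k *
     dual_krawtchouk ?P (of_real (th q \<sigma>)) N x k * dual_krawtchouk ?P (of_real (th q \<tau>)) N y k =
     gauss_binom ?P N k * tri ?P (- (z * complex_of_real (q powr (-\<sigma>) * q powr (-\<tau>)))) k *
     dual_krawtchouk ?P (of_real (th q (-\<sigma>))) N (N - x) k * dual_krawtchouk ?P (of_real (th q (-\<tau>))) N (N - y) k" if k: "k \<le> N" for k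
  proof -
    have t: "tri ?P (- (z * complex_of_real (?S * ?T))) k * of_real (th q \<sigma>) ^ k * of_real (th q \<tau>) ^ k =
      tri ?P (- (z * complex_of_real (q powr (-\<sigma>) * q powr (-\<tau>)))) k"
    proof -
      have "- (z * complex_of_real (q powr (-\<sigma>) * q powr (-\<tau>))) = (of_real (th q \<sigma>) * of_real (th q \<tau>)) * - (z * complex_of_real (?S * ?T))"
        using q by (simp add: th_eq powr_minus field_simps)
      then show ?thesis by (simp only: tri_scale power_mult_distrib ac_simps)
    qed
    have nz: "complex_of_real (th q \<sigma>) \<noteq> 0" "complex_of_real (th q \<tau>) \<noteq> 0" using th_minus by auto
    show ?thesis unfolding dual_krawtchouk_reflect[OF nz(1) x k] dual_krawtchouk_reflect[OF nz(2) y k] t[symmetric] th_minus(1) of_real_inverse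
      by (simp only: ac_simps)
  qed
  then show ?thesis unfolding krawtchouk_sum_def[OF q] Let_def by (intro sum.cong) (simp_all only: atMost_iff)
qed

text \<open>For y = 0 the second polynomial is 1 and the sum is the generating function
  itself.\<close>

lemma krawtchouk_sum_top:
  assumes x: "x \<le> N"
  shows "krawtchouk_sum q z N x 0 \<sigma> \<tau> = qpoch (z * complex_of_real (q powr (\<tau> - \<sigma>))) (complex_of_real (q\<^sup>2)) x *
    qpoch (- z * complex_of_real (q powr (\<tau> + \<sigma>))) (complex_of_real (q\<^sup>2)) (N - x)"
proof -
  let ?P = "complex_of_real (q\<^sup>2)" and ?S = "q powr \<sigma>" and ?T = "q powr \<tau>"
  let ?b = "- (z * complex_of_real (?S * ?T))"
  have P0: "?P \<noteq> 0" using q by simp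
  have P1: "\<And>k. 0 < k \<Longrightarrow> ?P ^ k \<noteq> 1" using of_real_pow_neq_1(1)[OF pq(1,2)[OF q]] by blast
  have "dual_krawtchouk ?P \<theta> N 0 k = 1" for \<theta> k by (simp only: dual_krawtchouk_explicit_complex[OF pq(1,2)[OF q]]) simp
  then have "krawtchouk_sum q z N x 0 \<sigma> \<tau> = (\<Sum>k\<le>N. gauss_binom ?P N k * tri ?P ?b k * dual_krawtchouk ?P (of_real (th q \<sigma>)) N x k)"
    by (simp only: krawtchouk_sum_def[OF q] Let_def mult_1_right)
  also have "\<dots> = qpoch ?b ?P (N - x) * qpoch (?b * of_real (th q \<sigma>)) ?P x"
    using P0 P1 x by (intro dual_krawtchouk_generating) auto
  also have "?b * of_real (th q \<sigma>) = z * complex_of_real (q powr (\<tau> - \<sigma>))"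
    using q by (simp add: th_eq powr_diff)
  also have "?b = - z * complex_of_real (q powr (\<tau> + \<sigma>))" by (simp add: powr_add)
  finally show ?thesis by simp
qed

lemma krawtchouk_sum_askey_wilson:
  assumes xy: "y \<le> x" "x + y \<le> N" and z: "z \<noteq> 0"
  shows "krawtchouk_sum q z N x y \<sigma> \<tau> = krawtchouk_sum q z (N - 2 * y) (x - y) 0 \<sigma> \<tau> * ((z / of_real q) ^ y / of_real (\<Prod>r<y. 1 - (q\<^sup>2) ^ (N - r))) *
    poly (askey_wilson2 y (real (x - y)) (real (N - x - y)) (q powr \<tau>) (q powr \<sigma>) (q\<^sup>2)) ((z / of_real q + inverse (z / of_real q)) / 2)"
proof -
  let ?P = "complex_of_real (q\<^sup>2)" and ?S = "q powr \<sigma>" and ?T = "q powr \<tau>"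
  let ?b = "- (z * complex_of_real (?S * ?T))" and ?w = "z / complex_of_real q"
  let ?th = "complex_of_real (th q \<sigma>)" and ?th' = "complex_of_real (th q \<tau>)"
  have P0: "?P \<noteq> 0" using q by simp
  have P1: "\<And>k. 0 < k \<Longrightarrow> ?P ^ k \<noteq> 1" using of_real_pow_neq_1(1)[OF pq(1,2)[OF q]] by blast
  have ST: "?S > 0" "?T > 0" using q by auto
  have ths: "th q \<sigma> = - (1 / (?S * ?S))" "th q \<tau> = - (1 / (?T * ?T))"
    by (rule th_eq)+
  \<comment> \<open>The parameters of the polynomial in \<open>askey_wilson2\<close> for base q^2,
    with exponents x - y and N - x - y; the variable is z / q.\<close>
  define A B C D where "A = q * ?S / ?T" and "B = q * (q\<^sup>2) ^ (x - y) * ?T / ?S" and "C = - q / (?T * ?S)"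
    and "D = - ?T * ?S * (q * (q\<^sup>2) ^ (N - x - y))"
  have nz: "complex_of_real A \<noteq> 0" "complex_of_real B \<noteq> 0" "complex_of_real C \<noteq> 0" "complex_of_real D \<noteq> 0"
    using q ST by (simp_all add: A_def B_def C_def D_def)
  have 1: "?P * ?w / (?b * ?th) = complex_of_real A" "?b * ?th * ?P ^ (x - y) / ?w = complex_of_real B"
    "?P * ?w / ?b = complex_of_real C" "?b * ?P ^ (N - x - y) / ?w = complex_of_real D"
    "?w * ?w * ?P = ?th' * (?b * ?th) * ?b"
    using q ST z unfolding ths A_def B_def C_def D_def by (simp_all add: field_simps power2_eq_square)
  have "krawtchouk_sum q z N x y \<sigma> \<tau> = qpoch (?b * ?th) ?P (x - y) * qpoch ?b ?P (N - x - y) * (?w ^ y / (\<Prod>r<y. 1 - ?P ^ (N - r))) *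
    aw_sum ?P y (?P * ?w / (?b * ?th)) (?b * ?th * ?P ^ (x - y) / ?w) (?P * ?w / ?b) (?b * ?P ^ (N - x - y) / ?w) ?w"
    unfolding krawtchouk_sum_def[OF q] Let_def
    by (rule dual_krawtchouk_bilinear) (use P0 P1 xy z q ST 1(5) th_minus(2) in auto)
  also have "(?b * ?th) = z * complex_of_real (q powr (\<tau> - \<sigma>))"
    using ST unfolding ths by (simp add: powr_diff field_simps)
  also have "qpoch (z * complex_of_real (q powr (\<tau> - \<sigma>))) ?P (x - y) * qpoch ?b ?P (N - x - y) = krawtchouk_sum q z (N - 2 * y) (x - y) 0 \<sigma> \<tau>"
  proof -
    have "x - y \<le> N - 2 * y" "N - 2 * y - (x - y) = N - x - y" using xy by auto
    then show ?thesis by (simp add: krawtchouk_sum_top powr_add mult.commute mult.left_commute)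
  qed
  also have "(\<Prod>r<y. 1 - ?P ^ (N - r)) = of_real (\<Prod>r<y. 1 - (q\<^sup>2) ^ (N - r))" by simp
  finally have 2: "krawtchouk_sum q z N x y \<sigma> \<tau> = krawtchouk_sum q z (N - 2 * y) (x - y) 0 \<sigma> \<tau> * (?w ^ y / of_real (\<Prod>r<y. 1 - (q\<^sup>2) ^ (N - r))) *
    aw_sum ?P y (complex_of_real A) (complex_of_real B) (complex_of_real C) (complex_of_real D) ?w"
    using 1(1-4) ST unfolding ths by (simp add: powr_diff field_simps)
  \<comment> \<open>All three products lie below 1, so the denominators required by
    \<open>askey_wilson_value\<close> are nonzero.\<close>
  have lt: "A * B < 1" "A * C < 1" "A * D < 1"
  proof -
    have "A * B = (q\<^sup>2) ^ Suc (x - y)" using ST by (simp add: A_def B_def power2_eq_square)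
    then show "A * B < 1" using pq(1,2)[OF q] by (simp only: power_Suc_less_one)
    have "A * C \<le> 0" "A * D \<le> 0" using q ST by (simp_all add: A_def C_def D_def mult_le_0_iff divide_le_0_iff zero_le_mult_iff)
    then show "A * C < 1" "A * D < 1" by auto
  qed
  have den: "qpoch (complex_of_real A * complex_of_real X) ?P y \<noteq> 0" if "A * X < 1" for X
    using qpoch_pos[OF pq(1,2)[OF q] that, of y] unfolding of_real_mult[symmetric] of_real_qpoch by auto
  have pr: "(q\<^sup>2) powr (1/2) = q" "(q\<^sup>2) powr (1/2 + real k) = q * (q\<^sup>2) ^ k" for k
    using q by (simp_all add: powr_half_sqrt powr_add powr_realpow)
  have "askey_wilson2 y (real (x - y)) (real (N - x - y)) ?T ?S (q\<^sup>2) =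
    askey_wilson y (complex_of_real A) (complex_of_real B) (complex_of_real C) (complex_of_real D) ?P"
    unfolding askey_wilson2_def pr A_def B_def C_def D_def by (simp add: ac_simps)
  moreover have "poly (askey_wilson y (complex_of_real A) (complex_of_real B) (complex_of_real C) (complex_of_real D) ?P) ((?w + inverse ?w) / 2) =
    aw_sum ?P y (complex_of_real A) (complex_of_real B) (complex_of_real C) (complex_of_real D) ?w"
    using z q by (intro askey_wilson_value pq(1,2)[OF q] nz den lt) auto
  ultimately show ?thesis using 2 by simp
qed

lemma C_coeff_eq:
  assumes N: "2 * l = real N" and x: "x \<le> N"
  shows "C_coeff q l (l - real x) \<sigma> = q powr (real N - real x) * sqrt (gauss_binom (q\<^sup>2) N x) *
     sqrt ((1 + q powr (4 * real x - 2 * real N - 2 * \<sigma>)) / (1 + q powr (-2 * \<sigma>))) *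
     inverse (sqrt (qpoch (- (q powr (2 - 2 * \<sigma>))) (q\<^sup>2) x * qpoch (- (q powr (2 + 2 * \<sigma>))) (q\<^sup>2) (N - x)))"
proof -
  have 1: "nat \<lfloor>2 * l\<rfloor> = N" "nat \<lfloor>l - (l - real x)\<rfloor> = x" using N by simp_all
  have e: "l + (l - real x) = real (N - x)" using N x by auto
  have 20: "nat \<lfloor>l + (l - real x)\<rfloor> = N - x" unfolding e by (simp only: floor_of_nat nat_int)
  have 21: "l + (l - real x) = real N - real x" using N by simp
  have 3: "-4 * (l - real x) - 2 * \<sigma> = 4 * real x - 2 * real N - 2 * \<sigma>" using N by simp
  have 4: "qbinom N x (q\<^sup>2) = gauss_binom (q\<^sup>2) N x"
  proof -
    have "(q\<^sup>2) ^ N = q powr (2 * real N)" "inverse (q\<^sup>2) = q powr (-2)"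
      using powr_2_nat(1)[OF q, of N] powr_2_nat(2)[OF q, of 1] by simp_all
    then show ?thesis unfolding qbinom_def using gauss_binom_ratio[OF q x] by simp
  qed
  show ?thesis unfolding C_coeff_def 1 20 3 4 unfolding 21 ..
qed

lemma C_coeff_pos:
  assumes N: "2 * l = real N" and x: "x \<le> N"
  shows "0 < C_coeff q l (l - real x) \<sigma>"
proof -
  have a: "0 < 1 + q powr a" for a using q by (simp add: add_pos_pos)
  have b: "- (q powr a) < 1" for a using powr_gt_zero[of q a] q by linarith
  show ?thesis unfolding C_coeff_eq[OF assms]
    using q gauss_binom_pos[OF pq(1)[OF q] x] a qpoch_pos[OF pq(1,2)[OF q] b] by (intro mult_pos_pos) auto
qed

text \<open>The two shifted factorials change places, and the power of q extracted from the square
  root compensates the change of q^(l+j) into q^(l-j).\<close>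

lemma C_coeff_reflect:
  assumes N: "2 * l = real N" and x: "x \<le> N"
  shows "C_coeff q l (l - real (N - x)) (- \<sigma>) = C_coeff q l (l - real x) \<sigma>"
proof -
  let ?e = "real N - 2 * real x"
  have r: "real (N - x) = real N - real x" "N - (N - x) = x" using x by auto
  have a: "0 < 1 + q powr a" for a using q by (simp add: add_pos_pos)
  have "1 + q powr (4 * (real N - real x) - 2 * real N - 2 * - \<sigma>) = q powr (2 * ?e) * q powr (2 * \<sigma>) * (1 + q powr (4 * real x - 2 * real N - 2 * \<sigma>))"
    using q by (simp add: distrib_left powr_add[symmetric] algebra_simps)
  moreover have "1 + q powr (-2 * - \<sigma>) = q powr (2 * \<sigma>) * (1 + q powr (-2 * \<sigma>))"
    using q by (simp add: distrib_left powr_add[symmetric])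
  moreover have "q powr (2 * ?e) = q powr ?e * q powr ?e" by (simp add: powr_add[symmetric])
  moreover have "a * b * c / (b * d) = a * (c / d)" if "b > 0" for a b c d :: real using that by simp
  moreover have "q powr (2 * \<sigma>) > 0" using q by simp
  ultimately have "(1 + q powr (4 * (real N - real x) - 2 * real N - 2 * - \<sigma>)) / (1 + q powr (-2 * - \<sigma>)) =
    q powr ?e * q powr ?e * ((1 + q powr (4 * real x - 2 * real N - 2 * \<sigma>)) / (1 + q powr (-2 * \<sigma>)))"
    by presburger
  then have "sqrt ((1 + q powr (4 * (real N - real x) - 2 * real N - 2 * - \<sigma>)) / (1 + q powr (-2 * - \<sigma>))) =
    q powr ?e * sqrt ((1 + q powr (4 * real x - 2 * real N - 2 * \<sigma>)) / (1 + q powr (-2 * \<sigma>)))"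
    by (simp only: real_sqrt_mult real_sqrt_mult_self) simp
  moreover have "q powr (real N - (real N - real x)) * q powr ?e = q powr (real N - real x)" by (simp add: powr_add[symmetric])
  ultimately show ?thesis
    unfolding C_coeff_eq[OF N x] C_coeff_eq[OF N diff_le_self] unfolding r gauss_binom_symmetric[OF pq(1,2)[OF q] x]
    by (simp add: ac_simps)
qed

end

section \<open>The vectors v are eigenvectors\<close>

lemma coeff_mult_quadratic:
  "Polynomial.coeff (A * [:1, a, b:]) (Suc k) =
     Polynomial.coeff A (Suc k) + a * Polynomial.coeff A k + b * (case k of 0 \<Rightarrow> 0 | Suc j \<Rightarrow> Polynomial.coeff A j)"
  for A :: "'a::comm_ring_1 poly"
proof -
  have "A * [:1, a, b:] = A + Polynomial.smult a (pCons 0 A) + Polynomial.smult b (pCons 0 (pCons 0 A))" by simp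
  then show ?thesis by (simp add: coeff_pCons split: nat.split)
qed

context
  fixes q :: real
  assumes q: "0 < q" "q < 1"
begin

text \<open>Coefficients of the generating product (-S u; p)_(N-x) (u/S; p)_x with S = q^sigma; up
  to nonzero factors these are the components of the vector.\<close>

definition v_genfun :: "nat \<Rightarrow> nat \<Rightarrow> real \<Rightarrow> nat \<Rightarrow> real" where
  "v_genfun N x \<sigma> k = gauss_binom (q\<^sup>2) N k * tri (q\<^sup>2) (- (q powr \<sigma>)) k * dual_krawtchouk (q\<^sup>2) (th q \<sigma>) N x k"

text \<open>The generating product satisfies a first-order equation under u -> pu with quadratic
  coefficients; its coefficient at u^(k+1) is a three-term recurrence.\<close>

lemma v_genfun_recurrence:
  fixes \<sigma> :: real
  assumes x: "x \<le> N"
  defines "S \<equiv> q powr \<sigma>" and "p \<equiv> q\<^sup>2"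
  shows "(p ^ Suc k - 1) * v_genfun N x \<sigma> (Suc k) + ((S - 1 / S) * p ^ k - S * p ^ (N - x) + p ^ x / S) * v_genfun N x \<sigma> k
    + (case k of 0 \<Rightarrow> 0 | Suc j \<Rightarrow> (p ^ N - p ^ j) * v_genfun N x \<sigma> j) = 0"
proof -
  have S: "S \<noteq> 0" using q by (simp add: S_def)
  define G where "G = (\<Sum>k\<le>N. monom (v_genfun N x \<sigma> k) k)"
  have cG: "Polynomial.coeff G k = v_genfun N x \<sigma> k" for k
    by (auto simp: G_def coeff_sum v_genfun_def gauss_binom_zero)
  have pG: "poly G u = qpoch (- (S * u)) p (N - x) * qpoch (u / S) p x" for u
  proof -
    have "poly G u = (\<Sum>k\<le>N. gauss_binom p N k * tri p (- (S * u)) k * dual_krawtchouk p (th q \<sigma>) N x k)"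
      unfolding G_def poly_sum poly_monom v_genfun_def S_def[symmetric] p_def[symmetric]
      using tri_scale[of p u "- S"] by (intro sum.cong) (simp_all add: mult.commute)
    also have "\<dots> = qpoch (- (S * u)) p (N - x) * qpoch (- (S * u) * th q \<sigma>) p x"
      using x pq[OF q] unfolding p_def by (intro dual_krawtchouk_generating) auto
    also have "- (S * u) * th q \<sigma> = u / S" using S by (simp add: th_eq[OF q] S_def)
    finally show ?thesis .
  qed
  have sh: "qpoch (a * p) p n * (1 - a) = qpoch a p n * (1 - a * p ^ n)" for a n
    using qpoch_Suc_shift[of a p n] qpoch_Suc[of a p n] by (simp add: mult.commute)
  \<comment> \<open>Each factor of the product changes only at its two ends under u -> pu, which is
    \<open>sh\<close>.\<close>
  have "poly (pcompose G [:0, p:] * [:1, S - 1 / S, - 1:]) u = poly (G * [:1, S * p ^ (N - x) - p ^ x / S, - (p ^ N):]) u" for u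
  proof -
    have "poly (pcompose G [:0, p:] * [:1, S - 1 / S, - 1:]) u =
      (qpoch (- (S * u) * p) p (N - x) * (1 - - (S * u))) * (qpoch (u / S * p) p x * (1 - u / S))"
    proof -
      have "1 + u * (S - 1 / S + u * - 1) = (1 - - (S * u)) * (1 - u / S)" using S by (simp add: field_simps)
      moreover have "poly (pcompose G [:0, p:] * [:1, S - 1 / S, - 1:]) u = poly G (u * p) * (1 + u * (S - 1 / S + u * - 1))"
        by (simp add: poly_pcompose algebra_simps)
      ultimately show ?thesis by (simp only: pG) (simp add: ac_simps)
    qed
    also have "\<dots> = (qpoch (- (S * u)) p (N - x) * (1 - - (S * u) * p ^ (N - x))) * (qpoch (u / S) p x * (1 - u / S * p ^ x))"
      unfolding sh ..
    also have "\<dots> = poly (G * [:1, S * p ^ (N - x) - p ^ x / S, - (p ^ N):]) u"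
    proof -
      have "p ^ N = p ^ (N - x) * p ^ x" using x by (simp add: power_add[symmetric])
      then have "1 + u * (S * p ^ (N - x) - p ^ x / S + u * - (p ^ N)) = (1 - - (S * u) * p ^ (N - x)) * (1 - u / S * p ^ x)"
        using S by (simp add: field_simps)
      moreover have "poly (G * [:1, S * p ^ (N - x) - p ^ x / S, - (p ^ N):]) u = poly G u * (1 + u * (S * p ^ (N - x) - p ^ x / S + u * - (p ^ N)))"
        by (simp add: algebra_simps)
      ultimately show ?thesis by (simp only: pG) (simp add: ac_simps)
    qed
    finally show ?thesis .
  qed
  then have "pcompose G [:0, p:] * [:1, S - 1 / S, - 1:] = G * [:1, S * p ^ (N - x) - p ^ x / S, - (p ^ N):]"
    by (metis poly_eq_poly_eq_iff ext)
  from arg_cong[OF this, of "\<lambda>A. Polynomial.coeff A (Suc k)"]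
  have "p ^ Suc k * v_genfun N x \<sigma> (Suc k) + (S - 1 / S) * (p ^ k * v_genfun N x \<sigma> k) - (case k of 0 \<Rightarrow> 0 | Suc j \<Rightarrow> p ^ j * v_genfun N x \<sigma> j) =
     v_genfun N x \<sigma> (Suc k) + (S * p ^ (N - x) - p ^ x / S) * v_genfun N x \<sigma> k - p ^ N * (case k of 0 \<Rightarrow> 0 | Suc j \<Rightarrow> v_genfun N x \<sigma> j)"
    unfolding coeff_mult_quadratic coeff_pcompose_linear cG by (simp split: nat.split)
  then show ?thesis by (cases k) (simp_all add: algebra_simps)
qed

definition h_const :: real where "h_const = inverse (inverse q - q)"

text \<open>The radicand contains the numerator and the denominator of the ratio of neighbouring
  Gaussian binomials, so multiplication by the root of one binomial yields the root of the next
  without remaining radicals.\<close>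

lemma b_entry_eq:
  assumes N: "2 * l = real N" and k: "k < N"
  shows "b_entry q l (l - real k) * of_real (sqrt (gauss_binom (q\<^sup>2) N k)) =
      of_real (q powr (-(real N + 1) / 2) * h_const * (1 - (q\<^sup>2) ^ Suc k) * sqrt (gauss_binom (q\<^sup>2) N (Suc k)))"
    and "b_entry q l (l - real k) * of_real (sqrt (gauss_binom (q\<^sup>2) N (Suc k))) =
      of_real (q powr (-(real N + 1) / 2) * h_const * (1 - (q\<^sup>2) ^ (N - k)) * sqrt (gauss_binom (q\<^sup>2) N k))"
proof -
  let ?p = "q\<^sup>2"
  have le: "?p ^ n \<le> 1" for n using pq(1,2)[OF q] by (intro power_le_one less_imp_le)
  have f: "q powr (- real m) - q powr (real m) = q powr (- real m) * (1 - ?p ^ m)" for m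
  proof -
    have "q powr (real m) = q powr (- real m) * q powr (2 * real m)" by (simp add: powr_add[symmetric])
    then show ?thesis by (simp only: powr_2_nat(1)[OF q] right_diff_distrib mult_1_right)
  qed
  have 1: "- l + (l - real k) - 1 = - real (Suc k)" "l - (l - real k) + 1 = real (Suc k)"
    "- l - (l - real k) = - real (N - k)" "l + (l - real k) = real (N - k)" using N k by (auto simp: of_nat_diff)
  have e: "q powr (- real (Suc k)) * q powr (- real (N - k)) = (q powr (-(real N + 1) / 2))\<^sup>2"
  proof -
    have "- real (Suc k) + - real (N - k) = -(real N + 1) / 2 + -(real N + 1) / 2" using k by (simp add: of_nat_diff field_simps)
    then show ?thesis by (simp only: power2_eq_square powr_add[symmetric])
  qed
  have "(q powr (-l+(l - real k)-1) - q powr (l-(l - real k)+1)) * (q powr (-l-(l - real k)) - q powr (l+(l - real k)))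
    = (q powr (-(real N + 1) / 2))\<^sup>2 * ((1 - ?p ^ Suc k) * (1 - ?p ^ (N - k)))"
    unfolding 1 f e[symmetric] by (simp only: ac_simps)
  note e2 = this
  have b: "b_entry q l (l - real k) = of_real (q powr (-(real N + 1) / 2) * h_const * sqrt ((1 - ?p ^ Suc k) * (1 - ?p ^ (N - k))))"
  proof -
    have "0 < q powr (-(real N + 1) / 2)" using q by simp
    then have "sqrt ((q powr (-(real N + 1) / 2))\<^sup>2 * X) = q powr (-(real N + 1) / 2) * sqrt X" for X
      by (simp only: real_sqrt_mult real_sqrt_abs abs_of_pos)
    note rt = this
    show ?thesis unfolding b_entry_def e2 rt h_const_def by (simp only: divide_inverse ac_simps)
  qed
  have s: "gauss_binom ?p N k * (1 - ?p ^ (N - k)) = gauss_binom ?p N (Suc k) * (1 - ?p ^ Suc k)" by (rule gauss_binom_step)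
  have s1: "sqrt ((1 - ?p ^ Suc k) * (1 - ?p ^ (N - k))) * sqrt (gauss_binom ?p N k) = (1 - ?p ^ Suc k) * sqrt (gauss_binom ?p N (Suc k))"
  proof -
    have "sqrt ((1 - ?p ^ Suc k) * (1 - ?p ^ (N - k))) * sqrt (gauss_binom ?p N k) = sqrt ((1 - ?p ^ Suc k) * (gauss_binom ?p N k * (1 - ?p ^ (N - k))))"
      by (simp only: real_sqrt_mult ac_simps)
    also have "\<dots> = sqrt ((1 - ?p ^ Suc k)\<^sup>2 * gauss_binom ?p N (Suc k))" unfolding s by (simp only: power2_eq_square ac_simps)
    also have "\<dots> = (1 - ?p ^ (Suc k)) * sqrt (gauss_binom ?p N (Suc k))" using le[of "Suc k"] by (simp only: real_sqrt_mult real_sqrt_abs abs_of_nonneg diff_ge_0_iff_ge)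
    finally show ?thesis .
  qed
  have s2: "sqrt ((1 - ?p ^ Suc k) * (1 - ?p ^ (N - k))) * sqrt (gauss_binom ?p N (Suc k)) = (1 - ?p ^ (N - k)) * sqrt (gauss_binom ?p N k)"
  proof -
    have "sqrt ((1 - ?p ^ Suc k) * (1 - ?p ^ (N - k))) * sqrt (gauss_binom ?p N (Suc k)) = sqrt ((1 - ?p ^ (N - k)) * (gauss_binom ?p N (Suc k) * (1 - ?p ^ Suc k)))"
      by (simp only: real_sqrt_mult ac_simps)
    also have "\<dots> = sqrt ((1 - ?p ^ (N - k))\<^sup>2 * gauss_binom ?p N k)" unfolding s[symmetric] by (simp only: power2_eq_square ac_simps)
    also have "\<dots> = (1 - ?p ^ (N - k)) * sqrt (gauss_binom ?p N (k))" using le[of "N - k"] by (simp only: real_sqrt_mult real_sqrt_abs abs_of_nonneg diff_ge_0_iff_ge)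
    finally show ?thesis .
  qed
  show "b_entry q l (l - real k) * of_real (sqrt (gauss_binom ?p N k)) =
      of_real (q powr (-(real N + 1) / 2) * h_const * (1 - ?p ^ Suc k) * sqrt (gauss_binom ?p N (Suc k)))"
    unfolding b of_real_mult[symmetric] mult.assoc s1 ..
  show "b_entry q l (l - real k) * of_real (sqrt (gauss_binom ?p N (Suc k))) =
      of_real (q powr (-(real N + 1) / 2) * h_const * (1 - ?p ^ (N - k)) * sqrt (gauss_binom ?p N k))"
    unfolding b of_real_mult[symmetric] mult.assoc s2 ..
qed

definition x_shift :: "real \<Rightarrow> real" where "x_shift \<sigma> = (q powr (-\<sigma>) - q powr \<sigma>) / (inverse q - q)"

text \<open>Depends on sigma and j but not on l, which is what allows elements of different spin to
  be compared.\<close>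

definition x_eigenvalue :: "real \<Rightarrow> real \<Rightarrow> real" where
  "x_eigenvalue \<sigma> j = (q powr (\<sigma> + 2 * j) - q powr (- \<sigma> - 2 * j) - q powr \<sigma> + q powr (- \<sigma>)) / (inverse q - q)"

lemma eigenvec_v_coeff:
  assumes N: "2 * l = real N" and x: "x \<le> N"
  shows "eigenvec q l (x_shift \<sigma>) (x_eigenvalue \<sigma> (l - real x)) (\<lambda>n. v_coeff q l (l - real x) n \<sigma>)"
  unfolding eigenvec_def
proof
  fix n assume n: "n \<in> weights l"
  let ?p = "q\<^sup>2" and ?S = "q powr \<sigma>" and ?g = "v_genfun N x \<sigma>" and ?v = "\<lambda>n. v_coeff q l (l - real x) n \<sigma>"
  from n N obtain k' where k': "k' \<le> N" "n = - l + real k'" by (auto simp: weights_def)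
  define k where "k = N - k'"
  have k: "k \<le> N" and nk: "n = l - real k" using k' N by (auto simp: k_def)
  define r where "r k = sqrt (gauss_binom ?p N k)" for k
  define w where "w k = wt q \<sigma> k * r k * dual_krawtchouk ?p (th q \<sigma>) N x k" for k
  define C where "C = C_coeff q l (l - real x) \<sigma>"
  have v: "?v (l - real k) = inverse \<i> ^ k * of_real (C * w k)" if "k \<le> N" for k
    unfolding v_coeff_eq[OF q N that x] C_def w_def r_def by (simp add: ac_simps)
  have gw: "?g k = wt q 0 k * r k * w k" if "k \<le> N" for k
  proof -
    have "wt q 0 k * wt q \<sigma> k = tri ?p (- ?S) k" using wt_mult[OF q, of 0 k \<sigma>] q by simp
    moreover have "r k * r k = gauss_binom ?p N k" using gauss_binom_pos[OF pq(1)[OF q] that] by (simp add: r_def)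
    ultimately show ?thesis unfolding v_genfun_def w_def by (metis mult.assoc mult.commute)
  qed
  have wt0: "wt q 0 (Suc k) = wt q 0 k * q ^ k" for k using q by (simp add: wt_Suc[OF q])
  \<comment> \<open>The equation is multiplied by this nonzero factor. It turns components of the
    vector into \<open>v_genfun\<close>, and the neighbours n + 1 and n - 1 become k - 1 and k +
    1.\<close>
  have nz: "wt q 0 k * r k \<noteq> 0"
    using gauss_binom_pos[OF pq(1)[OF q] k] q by (simp add: r_def wt_def[OF q])
  define K where "K = inverse \<i> ^ k * of_real (C * h_const * q powr (- real N))"
  have T1: "xB q * b_entry q l (n + 1) * complex_of_real (q powr (-n-1)) * ?v (n + 1) * of_real (wt q 0 k * r k) =
    K * of_real (case k of 0 \<Rightarrow> 0 | Suc j \<Rightarrow> (?p ^ N - ?p ^ j) * ?g j)"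
  proof (cases k)
    case 0
    then have "b_entry q l (n + 1) = 0" by (simp add: nk b_entry_def)
    then show ?thesis using 0 by simp
  next
    case (Suc j)
    have j: "j < N" "j \<le> N" using k Suc by auto
    have n1: "n + 1 = l - real j" by (simp add: nk Suc)
    have pw: "q powr (1/2) * q powr (-n-1) * q powr (-(real N + 1) / 2) * q ^ j = ?p ^ j * q powr (- real N)"
    proof -
      have "q ^ j = q powr real j" "?p ^ j = q powr (2 * real j)" using q by (simp_all only: powr_realpow powr_2_nat(1)[OF q])
      moreover have "1/2 + (-n-1) + (-(real N + 1) / 2) + real j = 2 * real j + - real N"
        using N by (simp add: nk Suc field_simps)
      ultimately show ?thesis by (simp only: powr_add[symmetric])
    qed
    have "xB q * b_entry q l (n + 1) * complex_of_real (q powr (-n-1)) * ?v (n + 1) * of_real (wt q 0 k * r k) =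
      \<i> * inverse \<i> ^ j * of_real C * of_real (q powr (1/2)) * of_real (q powr (-n-1)) * of_real (w j) * of_real (wt q 0 j * q ^ j) * (b_entry q l (l - real j) * of_real (r (Suc j)))"
      unfolding n1 v[OF j(2)] Suc wt0 xB_def of_real_mult by (simp only: ac_simps)
    also have "b_entry q l (l - real j) * of_real (r (Suc j)) = of_real (q powr (-(real N + 1) / 2) * h_const * (1 - ?p ^ (N - j)) * r j)"
      unfolding r_def by (rule b_entry_eq(2)[OF N j(1)])
    also have "\<i> * inverse \<i> ^ j * of_real C * of_real (q powr (1/2)) * of_real (q powr (-n-1)) * of_real (w j) * of_real (wt q 0 j * q ^ j) * \<dots> =
      \<i> * inverse \<i> ^ j * of_real (C * h_const * (q powr (1/2) * q powr (-n-1) * q powr (-(real N + 1) / 2) * q ^ j) * (1 - ?p ^ (N - j)) * (wt q 0 j * r j * w j))"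
      by (simp only: of_real_mult ac_simps)
    also have "\<dots> = \<i> * inverse \<i> ^ j * of_real (C * h_const * q powr (- real N) * ((?p ^ j - ?p ^ N) * ?g j))"
    proof -
      have "?p ^ j * (1 - ?p ^ (N - j)) = ?p ^ j - ?p ^ N" using j by (simp add: right_diff_distrib power_add[symmetric])
      then have "C * h_const * (?p ^ j * q powr (- real N)) * (1 - ?p ^ (N - j)) * (wt q 0 j * r j * w j) = C * h_const * q powr (- real N) * ((?p ^ j - ?p ^ N) * ?g j)"
      proof -
        assume e: "?p ^ j * (1 - ?p ^ (N - j)) = ?p ^ j - ?p ^ N"
        show ?thesis unfolding gw[OF j(2)] e[symmetric] by (simp only: ac_simps)
      qed
      then show ?thesis unfolding pw by (simp only:)
    qed
    also have "\<dots> = K * of_real ((?p ^ N - ?p ^ j) * ?g j)"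
      unfolding K_def Suc by (simp add: algebra_simps)
    finally show ?thesis by (simp only: Suc nat.case)
  qed
  have T2: "xC q * b_entry q l n * complex_of_real (q powr (1-n)) * ?v (n - 1) * of_real (wt q 0 k * r k) =
    K * of_real ((?p ^ Suc k - 1) * ?g (Suc k))"
  proof (cases "k = N")
    case True
    then have "n = - l" using N nk by simp
    then have "b_entry q l n = 0" by (simp add: b_entry_def)
    then show ?thesis using True by (simp add: v_genfun_def gauss_binom_zero)
  next
    case False
    then have kN: "k < N" "Suc k \<le> N" using k by auto
    have n1: "n - 1 = l - real (Suc k)" by (simp add: nk)
    have pw: "q powr (1/2) * q powr (1-n) * q powr (-(real N + 1) / 2) = q * q ^ k * q powr (- real N)"
    proof -
      have "q * q ^ k = q powr real (Suc k)" using powr_realpow[of q "Suc k"] q by simp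
      moreover have "1/2 + (1-n) + (-(real N + 1) / 2) = real (Suc k) + - real N"
        using N by (simp add: nk field_simps)
      ultimately show ?thesis by (simp only: powr_add[symmetric])
    qed
    have xc: "xC q * inverse \<i> ^ Suc k = - (inverse \<i> ^ k) * of_real (q powr (1/2)) / of_real q"
    proof -
      have "\<i> * a * (\<i> * b) = - (b * a)" for a b
      proof -
        have "\<i> * a * (\<i> * b) = (\<i> * \<i>) * (b * a)" by (simp only: ac_simps)
        then show ?thesis by simp
      qed
      then show ?thesis by (simp add: xC_def xB_def)
    qed
    have "xC q * b_entry q l n * complex_of_real (q powr (1-n)) * ?v (n - 1) * of_real (wt q 0 k * r k) =
      (xC q * inverse \<i> ^ Suc k) * of_real C * of_real (q powr (1-n)) * of_real (w (Suc k)) * of_real (wt q 0 k) * (b_entry q l (l - real k) * of_real (r k))"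
      unfolding n1 v[OF kN(2)] of_real_mult unfolding nk by (simp only: ac_simps)
    also have "b_entry q l (l - real k) * of_real (r k) = of_real (q powr (-(real N + 1) / 2) * h_const * (1 - ?p ^ Suc k) * r (Suc k))"
      unfolding r_def by (rule b_entry_eq(1)[OF N kN(1)])
    also have "(xC q * inverse \<i> ^ Suc k) * of_real C * of_real (q powr (1-n)) * of_real (w (Suc k)) * of_real (wt q 0 k) * \<dots> =
      - (inverse \<i> ^ k) * of_real (C * h_const * (q powr (1/2) * q powr (1-n) * q powr (-(real N + 1) / 2) / q) * (1 - ?p ^ Suc k) * (wt q 0 k * r (Suc k) * w (Suc k)))"
      unfolding xc by (simp only: of_real_mult of_real_divide of_real_inverse divide_inverse ac_simps)
    also have "\<dots> = - (inverse \<i> ^ k) * of_real (C * h_const * q powr (- real N) * ((1 - ?p ^ Suc k) * ?g (Suc k)))"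
    proof -
      have "q * q ^ k * q powr (- real N) / q = q ^ k * q powr (- real N)" using q by simp
      then have "C * h_const * (q * q ^ k * q powr (- real N) / q) * (1 - ?p ^ Suc k) * (wt q 0 k * r (Suc k) * w (Suc k)) =
        C * h_const * q powr (- real N) * ((1 - ?p ^ Suc k) * ?g (Suc k))"
        unfolding gw[OF kN(2)] wt0 by (simp only: ac_simps)
      then show ?thesis unfolding pw by (simp only:)
    qed
    also have "\<dots> = K * of_real ((?p ^ Suc k - 1) * ?g (Suc k))"
      unfolding K_def by (simp add: algebra_simps)
    finally show ?thesis .
  qed
  have T3: "(complex_of_real (x_shift \<sigma>) * (complex_of_real (q powr (-n)) * complex_of_real (q powr (-n)) - 1) * ?v n
     + complex_of_real (x_eigenvalue \<sigma> (l - real x)) * ?v n) * of_real (wt q 0 k * r k) =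
     - K * of_real (((?S - 1 / ?S) * ?p ^ k - ?S * ?p ^ (N - x) + ?p ^ x / ?S) * ?g k)"
  proof -
    let ?Q = "q powr (- real N)"
    have Q: "?Q > 0" "?S > 0" using q by auto
    have a: "q powr (-n) * q powr (-n) = ?p ^ k * ?Q"
      using N unfolding powr_2_nat(1)[OF q, symmetric] by (simp add: powr_add[symmetric] nk)
    have b: "q powr (- \<sigma> - 2 * (l - real x)) = ?p ^ x * ?Q / ?S"
    proof -
      have "- \<sigma> - 2 * (l - real x) = 2 * real x + (- real N) - \<sigma>" using N by simp
      then show ?thesis unfolding powr_2_nat(1)[OF q, symmetric] by (simp only: powr_add powr_diff)
    qed
    have c: "?S * ?p ^ (N - x) * ?Q = q powr (\<sigma> + 2 * (l - real x))"
    proof -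
      have "\<sigma> + 2 * (l - real x) = \<sigma> + 2 * real (N - x) + - real N" using N x by (simp add: of_nat_diff)
      then show ?thesis unfolding powr_2_nat(1)[OF q, symmetric] by (simp only: powr_add)
    qed
    have "x_shift \<sigma> * (q powr (-n) * q powr (-n) - 1) + x_eigenvalue \<sigma> (l - real x) =
      - (h_const * ?Q) * ((?S - 1 / ?S) * ?p ^ k - ?S * ?p ^ (N - x) + ?p ^ x / ?S)"
    proof -
      have "x_shift \<sigma> * (?p ^ k * ?Q - 1) + x_eigenvalue \<sigma> (l - real x) = h_const * ((1 / ?S - ?S) * (?p ^ k * ?Q - 1) + (?S * ?p ^ (N - x) * ?Q - ?p ^ x * ?Q / ?S - ?S + 1 / ?S))"
        unfolding x_shift_def x_eigenvalue_def h_const_def b c[symmetric] powr_minus[of q \<sigma>]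
        by (simp add: divide_inverse algebra_simps)
      then show ?thesis unfolding a by (simp add: algebra_simps divide_inverse)
    qed
    from arg_cong[OF this, of "\<lambda>X. inverse \<i> ^ k * of_real (C * X * (wt q 0 k * r k * w k))"]
    have "inverse \<i> ^ k * of_real (C * (x_shift \<sigma> * (q powr (-n) * q powr (-n) - 1) + x_eigenvalue \<sigma> (l - real x)) * (wt q 0 k * r k * w k)) =
      - K * of_real (((?S - 1 / ?S) * ?p ^ k - ?S * ?p ^ (N - x) + ?p ^ x / ?S) * ?g k)"
      unfolding K_def gw[OF k] by (simp add: ac_simps)
    then show ?thesis unfolding nk v[OF k] by (simp add: algebra_simps)
  qed
  have X: "a1 + a2 - a3 = a4" if "(a1 + a2 - (a3 + a4)) * z = 0" "z \<noteq> 0" for a1 a2 a3 a4 z :: complex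
    using that by (simp add: diff_eq_eq diff_add_eq)
  have "(xB q * b_entry q l (n + 1) * complex_of_real (q powr (-n-1)) * ?v (n + 1)
     + xC q * b_entry q l n * complex_of_real (q powr (1-n)) * ?v (n - 1)
     - (complex_of_real (x_shift \<sigma>) * (complex_of_real (q powr (-n)) * complex_of_real (q powr (-n)) - 1) * ?v n
     + complex_of_real (x_eigenvalue \<sigma> (l - real x)) * ?v n)) * of_real (wt q 0 k * r k) =
     K * of_real ((?p ^ Suc k - 1) * ?g (Suc k) + ((?S - 1 / ?S) * ?p ^ k - ?S * ?p ^ (N - x) + ?p ^ x / ?S) * ?g k
    + (case k of 0 \<Rightarrow> 0 | Suc j \<Rightarrow> (?p ^ N - ?p ^ j) * ?g j))"
    unfolding left_diff_distrib[of _ _ "of_real (wt q 0 k * r k)"] distrib_right[of _ _ "of_real (wt q 0 k * r k)"] T1 T2 T3[unfolded distrib_right[of _ _ "of_real (wt q 0 k * r k)"]]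
    by (simp only: of_real_add distrib_left) simp
  also have "\<dots> = 0" unfolding v_genfun_recurrence[OF x] by simp
  finally show "xB q * b_entry q l (n + 1) * complex_of_real (q powr (-n-1)) * ?v (n + 1)
     + xC q * b_entry q l n * complex_of_real (q powr (1-n)) * ?v (n - 1)
     - complex_of_real (x_shift \<sigma>) * (complex_of_real (q powr (-n)) * complex_of_real (q powr (-n)) - 1) * ?v n =
     complex_of_real (x_eigenvalue \<sigma> (l - real x)) * ?v n"
    by (rule X) (use nz in simp)
qed

end

section \<open>Torus values and the four cases\<close>

definition is_weight :: "real \<Rightarrow> real \<Rightarrow> bool" where
  "is_weight l i \<longleftrightarrow> (\<exists>N y. 2 * l = real N \<and> y \<le> N \<and> i = l - real y)"

text \<open>Both weights share the same N, since 2l determines it.\<close>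

lemma admE:
  assumes "is_weight l i" "is_weight l j"
  obtains N x y where "2 * l = real N" "y \<le> N" "i = l - real y" "x \<le> N" "j = l - real x"
  using assms unfolding is_weight_def by (metis of_nat_eq_iff)

lemma is_weight_top: "is_weight l i \<Longrightarrow> is_weight l l"
  unfolding is_weight_def by (metis diff_zero le0 of_nat_0)

lemma is_weight_minus: "is_weight l i \<Longrightarrow> is_weight l (- i)"
  unfolding is_weight_def
proof (elim exE conjE)
  fix N y assume "2 * l = real N" "y \<le> N" "i = l - real y"
  then show "\<exists>N y. 2 * l = real N \<and> y \<le> N \<and> - i = l - real y"
    by (intro exI[of _ N] exI[of _ "N - y"]) (auto simp: of_nat_diff)
qed

lemma is_weight_mono: "is_weight m i \<Longrightarrow> l - m \<in> \<nat> \<Longrightarrow> is_weight l i"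
  unfolding is_weight_def Nats_def
proof (elim exE conjE imageE)
  fix N y k assume "2 * m = real N" "y \<le> N" "i = m - real y" "l - m = of_nat k"
  then show "\<exists>N y. 2 * l = real N \<and> y \<le> N \<and> i = l - real y"
    by (intro exI[of _ "N + 2 * k"] exI[of _ "y + k"]) auto
qed

lemma is_weight_intro:
  assumes "2 * i \<in> \<int>" "i - j \<in> \<int>" "\<bar>j\<bar> \<le> i"
  shows "is_weight i j"
proof -
  obtain a b where ab: "2 * i = of_int a" "i - j = of_int b" using assms(1,2) by (auto elim!: Ints_cases)
  have "0 \<le> real_of_int b" "real_of_int b \<le> real_of_int a" using ab assms(3) by linarith+
  then have "0 \<le> b" "b \<le> a" by simp_all
  then show ?thesis unfolding is_weight_def using ab by (intro exI[of _ "nat a"] exI[of _ "nat b"]) auto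
qed

context
  fixes q :: real
  assumes q: "0 < q" "q < 1"
begin

definition torus_value :: "complex \<Rightarrow> real \<Rightarrow> real \<Rightarrow> real \<Rightarrow> real \<Rightarrow> real \<Rightarrow> complex" where
  "torus_value lam l i j \<tau> \<sigma> = tau lam (elem_lift q l (\<lambda>m. v_coeff q l j m \<sigma>) (\<lambda>n. v_coeff q l i n \<tau>))"

lemma torus_value_eq:
  assumes "2 * l = real N" "x \<le> N" "y \<le> N" "lam \<noteq> 0"
  shows "torus_value lam l (l - real y) (l - real x) \<tau> \<sigma> =
    complex_of_real (C_coeff q l (l - real x) \<sigma> * C_coeff q l (l - real y) \<tau>) * lam powi (- int N) * krawtchouk_sum q (lam\<^sup>2) N x y \<sigma> \<tau>"
  unfolding torus_value_def by (rule tau_gen_mat_elem[OF q assms])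

lemma torus_value_commute:
  assumes "is_weight l i" "is_weight l j" "lam \<noteq> 0"
  shows "torus_value lam l i j \<tau> \<sigma> = torus_value lam l j i \<sigma> \<tau>"
  using assms(1,2)
proof (rule admE)
  fix N x y assume a: "2 * l = real N" "y \<le> N" "i = l - real y" "x \<le> N" "j = l - real x"
  show ?thesis unfolding a(3,5) torus_value_eq[OF a(1,4,2) assms(3)] torus_value_eq[OF a(1,2,4) assms(3)]
    using krawtchouk_sum_commute[OF q, of "lam\<^sup>2" N x y \<sigma> \<tau>] by simp
qed

lemma torus_value_minus:
  assumes "is_weight l i" "is_weight l j" "lam \<noteq> 0"
  shows "torus_value lam l (- i) (- j) (- \<tau>) (- \<sigma>) = torus_value lam l i j \<tau> \<sigma>"
  using assms(1,2)
proof (rule admE)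
  fix N x y assume a: "2 * l = real N" "y \<le> N" "i = l - real y" "x \<le> N" "j = l - real x"
  have m: "- (l - real z) = l - real (N - z)" if "z \<le> N" for z using a(1) that by (simp add: of_nat_diff)
  show ?thesis unfolding a(3,5) m[OF a(2)] m[OF a(4)] torus_value_eq[OF a(1) diff_le_self diff_le_self assms(3)] torus_value_eq[OF a(1,4,2) assms(3)]
      C_coeff_reflect[OF q a(1,2)] C_coeff_reflect[OF q a(1,4)] krawtchouk_sum_reflect[OF q a(4,2)] ..
qed

lemma torus_value_top:
  assumes "is_weight l j" "lam \<noteq> 0"
  shows "torus_value lam l l j \<tau> \<sigma> = complex_of_real (C_coeff q l j \<sigma> * C_coeff q l l \<tau>) * lam powi \<lfloor>- 2 * l\<rfloor>
      * qpoch (lam\<^sup>2 * complex_of_real (q powr (\<tau> - \<sigma>))) (complex_of_real (q\<^sup>2)) (nat \<lfloor>l - j\<rfloor>)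
      * qpoch (- (lam\<^sup>2) * complex_of_real (q powr (\<tau> + \<sigma>))) (complex_of_real (q\<^sup>2)) (nat \<lfloor>l + j\<rfloor>)"
proof -
  obtain N x where a: "2 * l = real N" "x \<le> N" "j = l - real x" using assms(1) by (auto simp: is_weight_def)
  have "- 2 * l = of_int (- int N)" using a by simp
  then have 1: "\<lfloor>- 2 * l\<rfloor> = - int N" by (simp only: floor_of_int)
  have "l - j = real x" "l + j = real (N - x)" using a by (auto simp: of_nat_diff)
  then have 2: "nat \<lfloor>l - j\<rfloor> = x" "nat \<lfloor>l + j\<rfloor> = N - x" by (simp_all only: floor_of_nat nat_int)
  show ?thesis using torus_value_eq[OF a(1,2) le0 assms(2), of \<tau> \<sigma>] unfolding 1 2 krawtchouk_sum_top[OF q a(2)] a(3)[symmetric]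
    by (simp add: mult.assoc)
qed

text \<open>The bilinear formula for N = 2l leaves as prefactor the bilinear sum for spin i, so the
  quotient of the two torus values is a constant times the polynomial.\<close>

lemma torus_value_askey_wilson:
  assumes "is_weight i j" "l - i \<in> \<nat>" "lam \<noteq> 0"
  shows "torus_value lam l i j \<tau> \<sigma> = complex_of_real (d_coeff q l i j \<tau> \<sigma>) * torus_value lam i i j \<tau> \<sigma> *
    poly (askey_wilson2 (nat \<lfloor>l - i\<rfloor>) (i - j) (i + j) (q powr \<tau>) (q powr \<sigma>) (q\<^sup>2)) ((lam\<^sup>2 / q + inverse (lam\<^sup>2 / q)) / 2)"
proof -
  obtain M e where a: "2 * i = real M" "e \<le> M" "j = i - real e" using assms(1) by (auto simp: is_weight_def)
  obtain y where y: "l - i = real y" using assms(2) by (auto elim: Nats_cases)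
  define N x where "N = M + 2 * y" and "x = y + e"
  have N: "2 * l = real N" "y \<le> x" "x + y \<le> N" "x \<le> N" "y \<le> N" "i = l - real y" "j = l - real x"
    "N - 2 * y = M" "x - y = e" "N - x - y = M - e" "i - j = real e" "i + j = real (M - e)"
    using a y by (auto simp: N_def x_def of_nat_diff)
  have y': "nat \<lfloor>l - i\<rfloor> = y" by (simp only: y floor_of_nat nat_int)
  let ?poly = "poly (askey_wilson2 y (real e) (real (M - e)) (q powr \<tau>) (q powr \<sigma>) (q\<^sup>2)) ((lam\<^sup>2 / q + inverse (lam\<^sup>2 / q)) / 2)"
  let ?D = "\<Prod>r<y. 1 - (q\<^sup>2) ^ (N - r)"
  let ?Cl = "C_coeff q l j \<sigma> * C_coeff q l i \<tau>" and ?Ci = "C_coeff q i j \<sigma> * C_coeff q i i \<tau>"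
  have l: "torus_value lam l i j \<tau> \<sigma> = complex_of_real ?Cl * lam powi (- int N) *
     (krawtchouk_sum q (lam\<^sup>2) M e 0 \<sigma> \<tau> * ((lam\<^sup>2 / of_real q) ^ y / of_real ?D) * ?poly)"
    using torus_value_eq[OF N(1,4,5) assms(3), of \<tau> \<sigma>] krawtchouk_sum_askey_wilson[OF q N(2,3), of "lam\<^sup>2" \<sigma> \<tau>] assms(3)
    unfolding N(6,7)[symmetric] N(8-10) by simp
  have i: "torus_value lam i i j \<tau> \<sigma> = complex_of_real ?Ci * lam powi (- int M) * krawtchouk_sum q (lam\<^sup>2) M e 0 \<sigma> \<tau>"
    using torus_value_eq[OF a(1,2) le0 assms(3), of \<tau> \<sigma>] unfolding a(3)[symmetric] by simp
  have Ci: "?Ci \<noteq> 0"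
    using C_coeff_pos[OF q a(1,2), of \<sigma>] C_coeff_pos[OF q a(1) le0, of \<tau>] unfolding a(3)[symmetric] by simp
  have d: "d_coeff q l i j \<tau> \<sigma> = ?Cl / ?Ci * (inverse (q ^ y) / ?D)"
  proof -
    have "i - l = - real y" using y by simp
    then have "q powr (i - l) = inverse (q ^ y)" using q by (simp add: powr_minus powr_realpow)
    moreover have "4 * l = 2 * real N" using N(1) by simp
    ultimately show ?thesis unfolding d_coeff_def y' by (simp only: qpoch_powr_gauss_binom[OF q N(5)])
  qed
  \<comment> \<open>With y = l - i the power of z / q in the bilinear formula accounts exactly for
    the change of spin and leaves q^(-y), the power of q in \<open>d_coeff\<close>.\<close>
  have p: "lam powi (- int N) * (lam\<^sup>2 / of_real q) ^ y = lam powi (- int M) * of_real (inverse (q ^ y))"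
  proof -
    have "lam powi (- int N) * (lam\<^sup>2) ^ y = lam powi (- int N) * lam powi (int (2 * y))"
      by (simp only: power_int_of_nat power_mult)
    also have "\<dots> = lam powi (- int M)" using assms(3) by (simp add: N_def flip: power_int_add)
    finally show ?thesis by (simp add: power_mult_distrib power_inverse divide_inverse mult.assoc[symmetric])
  qed
  have "torus_value lam l i j \<tau> \<sigma> = complex_of_real (?Cl / ?D) * (lam powi (- int N) * (lam\<^sup>2 / of_real q) ^ y) * krawtchouk_sum q (lam\<^sup>2) M e 0 \<sigma> \<tau> * ?poly"
    unfolding l by simp
  also have "\<dots> = complex_of_real (?Cl / ?Ci * (inverse (q ^ y) / ?D)) * (complex_of_real ?Ci * lam powi (- int M) * krawtchouk_sum q (lam\<^sup>2) M e 0 \<sigma> \<tau>) * ?poly"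
  proof -
    have "complex_of_real (?Cl / ?Ci * (inverse (q ^ y) / ?D)) * complex_of_real ?Ci = complex_of_real (?Cl / ?D) * complex_of_real (inverse (q ^ y))"
      unfolding of_real_mult[symmetric] using Ci by simp
    moreover have "a * (b * c * e) * f = (a * b) * c * e * f" for a b c e f :: complex by (simp only: mult.assoc)
    ultimately show ?thesis unfolding p by (simp only:) (simp only: ac_simps)
  qed
  finally show ?thesis unfolding d i y' N(11,12) .
qed

lemma tau_hom_gen_mat_elem:
  assumes "is_weight l i" "lam \<noteq> 0"
  shows "tau_hom q lam (gen_mat_elem q l i j \<tau> \<sigma>) = torus_value lam l i j \<tau> \<sigma>"
proof -
  obtain N where N: "2 * l = real N" using assms(1) by (auto simp: is_weight_def)
  show ?thesis unfolding gen_mat_elem_eq[OF q N] tau_hom_cls[OF q(1) assms(2)] torus_value_def ..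
qed

text \<open>The difference of the two sides satisfies both eigen-equations, with eigenvalues
  depending on i and j only, and its torus values are 0 by hypothesis; \<open>spherical_zero\<close>
  puts it into the relation ideal.\<close>

lemma gen_mat_elem_poly:
  assumes "is_weight l i" "is_weight l j" "is_weight m i" "is_weight m j"
    and torus_value: "\<And>lam. lam \<noteq> 0 \<Longrightarrow> torus_value lam l i j \<tau> \<sigma> = c * torus_value lam m i j \<tau> \<sigma> * poly P ((lam\<^sup>2 / q + inverse (lam\<^sup>2 / q)) / 2)"
  shows "gen_mat_elem q l i j \<tau> \<sigma> = c \<odot>\<^bsub>Aq q\<^esub> (gen_mat_elem q m i j \<tau> \<sigma> \<otimes>\<^bsub>Aq q\<^esub> poly_at_D_rho q \<tau> \<sigma> P)"
proof -
  obtain N M where N: "2 * l = real N" "2 * m = real M" using assms(1,3) by (auto simp: is_weight_def)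
  define G where "G l = elem_lift q l (\<lambda>m. v_coeff q l j m \<sigma>) (\<lambda>n. v_coeff q l i n \<tau>)" for l
  have right_eigen: "right_eigen q (complex_of_real (x_shift q \<sigma>)) (complex_of_real (x_eigenvalue q \<sigma> j)) (G l)" if "is_weight l j" for l
  proof -
    obtain N x where a: "2 * l = real N" "x \<le> N" "j = l - real x" using \<open>is_weight l j\<close> by (auto simp: is_weight_def)
    show ?thesis unfolding G_def a(3) by (rule right_eigen_elem_lift[OF q a(1) eigenvec_v_coeff[OF q a(1,2)]])
  qed
  have left_eigen: "left_eigen q (complex_of_real (x_shift q \<tau>)) (complex_of_real (x_eigenvalue q \<tau> i)) (G l)" if "is_weight l i" for l
  proof -
    obtain N x where a: "2 * l = real N" "x \<le> N" "i = l - real x" using \<open>is_weight l i\<close> by (auto simp: is_weight_def)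
    show ?thesis unfolding G_def a(3) by (rule left_eigen_elem_lift[OF q a(1) eigenvec_v_coeff[OF q a(1,2)]])
  qed
  have e: "right_eigen q (complex_of_real (x_shift q \<sigma>)) 0 (eta q \<tau> \<sigma>)" "left_eigen q (complex_of_real (x_shift q \<tau>)) 0 (eta q \<tau> \<sigma>)"
    unfolding x_shift_def[OF q] by (rule eta_equations[OF q])+
  have "G l - const c * (G m * poly_lift P (eta q \<tau> \<sigma>)) \<in> ideal_span (Aq_rels q)"
  proof (rule spherical_zero[OF q])
    show "right_eigen q (complex_of_real (x_shift q \<sigma>)) (complex_of_real (x_eigenvalue q \<sigma> j)) (G l - const c * (G m * poly_lift P (eta q \<tau> \<sigma>)))"
      by (intro right_eigen_diff right_eigen_const right_eigen_poly_lift[OF q] right_eigen e assms)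
    show "left_eigen q (complex_of_real (x_shift q \<tau>)) (complex_of_real (x_eigenvalue q \<tau> i)) (G l - const c * (G m * poly_lift P (eta q \<tau> \<sigma>)))"
      by (intro left_eigen_diff left_eigen_const left_eigen_poly_lift[OF q] left_eigen e assms)
    show "tau lam (G l - const c * (G m * poly_lift P (eta q \<tau> \<sigma>))) = 0" if "lam \<noteq> 0" for lam
      using torus_value[OF that] unfolding tau_diff tau_const by (simp add: tau_mult tau_poly_lift tau_eta[OF q that] torus_value_def G_def)
  qed
  then show ?thesis
    unfolding poly_at_D_rho_eq[OF q] gen_mat_elem_eq[OF q N(1)] gen_mat_elem_eq[OF q N(2)] Aq_def quot_simps cls_eq G_def .
qed

end

theorem corollary7p7:
  fixes q \<sigma> \<tau> i j m l :: real and lam :: complex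
  assumes "0 < q" and "q < 1"
    and "2 * i \<in> \<int>" and "2 * j \<in> \<int>" and "i - j \<in> \<int>"
    and "m = max \<bar>i\<bar> \<bar>j\<bar>" and "l - m \<in> \<nat>" and "lam \<noteq> 0"
  shows
    "(m = i \<longrightarrow>
        gen_mat_elem q l i j \<tau> \<sigma> =
          complex_of_real (d_coeff q l i j \<tau> \<sigma>) \<odot>\<^bsub>Aq q\<^esub>
            (gen_mat_elem q i i j \<tau> \<sigma> \<otimes>\<^bsub>Aq q\<^esub>
             poly_at_D_rho q \<tau> \<sigma>
               (askey_wilson2 (nat \<lfloor>l - i\<rfloor>) (i - j) (i + j) (q powr \<tau>) (q powr \<sigma>) (q\<^sup>2))) \<and>
        tau_hom q lam (gen_mat_elem q i i j \<tau> \<sigma>) =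
          complex_of_real (C_coeff q i j \<sigma> * C_coeff q i i \<tau>) * lam powi \<lfloor>- 2 * i\<rfloor>
          * qpoch (lam\<^sup>2 * complex_of_real (q powr (\<tau> - \<sigma>))) (complex_of_real (q\<^sup>2)) (nat \<lfloor>i - j\<rfloor>)
          * qpoch (- (lam\<^sup>2) * complex_of_real (q powr (\<tau> + \<sigma>))) (complex_of_real (q\<^sup>2)) (nat \<lfloor>i + j\<rfloor>)) \<and>
     (m = j \<longrightarrow>
        gen_mat_elem q l i j \<tau> \<sigma> =
          complex_of_real (d_coeff q l j i \<sigma> \<tau>) \<odot>\<^bsub>Aq q\<^esub>
            (gen_mat_elem q j i j \<tau> \<sigma> \<otimes>\<^bsub>Aq q\<^esub>
             poly_at_D_rho q \<tau> \<sigma>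
               (askey_wilson2 (nat \<lfloor>l - j\<rfloor>) (j - i) (i + j) (q powr \<sigma>) (q powr \<tau>) (q\<^sup>2))) \<and>
        tau_hom q lam (gen_mat_elem q j i j \<tau> \<sigma>) =
          complex_of_real (C_coeff q j i \<tau> * C_coeff q j j \<sigma>) * lam powi \<lfloor>- 2 * j\<rfloor>
          * qpoch (lam\<^sup>2 * complex_of_real (q powr (\<sigma> - \<tau>))) (complex_of_real (q\<^sup>2)) (nat \<lfloor>j - i\<rfloor>)
          * qpoch (- (lam\<^sup>2) * complex_of_real (q powr (\<tau> + \<sigma>))) (complex_of_real (q\<^sup>2)) (nat \<lfloor>i + j\<rfloor>)) \<and>
     (m = - i \<longrightarrow>
        gen_mat_elem q l i j \<tau> \<sigma> =
          complex_of_real (d_coeff q l (- i) (- j) (- \<tau>) (- \<sigma>)) \<odot>\<^bsub>Aq q\<^esub>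
            (gen_mat_elem q (- i) i j \<tau> \<sigma> \<otimes>\<^bsub>Aq q\<^esub>
             poly_at_D_rho q \<tau> \<sigma>
               (askey_wilson2 (nat \<lfloor>l + i\<rfloor>) (j - i) (- i - j) (q powr (- \<tau>)) (q powr (- \<sigma>)) (q\<^sup>2))) \<and>
        tau_hom q lam (gen_mat_elem q (- i) i j \<tau> \<sigma>) =
          complex_of_real (C_coeff q (- i) (- j) (- \<sigma>) * C_coeff q (- i) (- i) (- \<tau>)) * lam powi \<lfloor>2 * i\<rfloor>
          * qpoch (lam\<^sup>2 * complex_of_real (q powr (- \<tau> + \<sigma>))) (complex_of_real (q\<^sup>2)) (nat \<lfloor>j - i\<rfloor>)
          * qpoch (- (lam\<^sup>2) * complex_of_real (q powr (- \<tau> - \<sigma>))) (complex_of_real (q\<^sup>2)) (nat \<lfloor>- i - j\<rfloor>)) \<and>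
     (m = - j \<longrightarrow>
        gen_mat_elem q l i j \<tau> \<sigma> =
          complex_of_real (d_coeff q l (- j) (- i) (- \<sigma>) (- \<tau>)) \<odot>\<^bsub>Aq q\<^esub>
            (gen_mat_elem q (- j) i j \<tau> \<sigma> \<otimes>\<^bsub>Aq q\<^esub>
             poly_at_D_rho q \<tau> \<sigma>
               (askey_wilson2 (nat \<lfloor>l + j\<rfloor>) (i - j) (- i - j) (q powr (- \<sigma>)) (q powr (- \<tau>)) (q\<^sup>2))) \<and>
        tau_hom q lam (gen_mat_elem q (- j) i j \<tau> \<sigma>) =
          complex_of_real (C_coeff q (- j) (- i) (- \<tau>) * C_coeff q (- j) (- j) (- \<sigma>)) * lam powi \<lfloor>2 * j\<rfloor>
          * qpoch (lam\<^sup>2 * complex_of_real (q powr (- \<sigma> + \<tau>))) (complex_of_real (q\<^sup>2)) (nat \<lfloor>i - j\<rfloor>)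
          * qpoch (- (lam\<^sup>2) * complex_of_real (q powr (- \<tau> - \<sigma>))) (complex_of_real (q\<^sup>2)) (nat \<lfloor>- i - j\<rfloor>))"
proof -
  note q = assms(1,2) and lam = assms(8)
  have ij: "2 * - i \<in> \<int>" "2 * - j \<in> \<int>" "j - i \<in> \<int>" "- i - - j \<in> \<int>" "- j - - i \<in> \<int>"
    using assms(3-5) Ints_minus[OF assms(3)] Ints_minus[OF assms(4)] Ints_minus[OF assms(5)] by simp_all
  \<comment> \<open>The common form of the four cases: k is the extreme index, b the other one, t
    and s the parameters in the matching order. The actual element stays at i, j, tau, sigma; only
    its torus value is rewritten by a symmetry.\<close>
  have A: "gen_mat_elem q l i j \<tau> \<sigma> = complex_of_real d \<odot>\<^bsub>Aq q\<^esub>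
       (gen_mat_elem q k i j \<tau> \<sigma> \<otimes>\<^bsub>Aq q\<^esub> poly_at_D_rho q \<tau> \<sigma> (askey_wilson2 (nat \<lfloor>l - k\<rfloor>) (k - b) (k + b) (q powr t) (q powr s) (q\<^sup>2)))"
    "tau_hom q lam (gen_mat_elem q k i j \<tau> \<sigma>) = complex_of_real (C_coeff q k b s * C_coeff q k k t) * lam powi \<lfloor>- 2 * k\<rfloor>
      * qpoch (lam\<^sup>2 * complex_of_real (q powr (t - s))) (complex_of_real (q\<^sup>2)) (nat \<lfloor>k - b\<rfloor>)
      * qpoch (- (lam\<^sup>2) * complex_of_real (q powr (t + s))) (complex_of_real (q\<^sup>2)) (nat \<lfloor>k + b\<rfloor>)"
    if k: "l - k \<in> \<nat>" and kb: "is_weight k b" and ki: "is_weight k i" "is_weight k j"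
      and d: "d = d_coeff q l k b t s"
      and torus_value: "\<And>l lam. is_weight l i \<Longrightarrow> is_weight l j \<Longrightarrow> lam \<noteq> 0 \<Longrightarrow> torus_value q lam l i j \<tau> \<sigma> = torus_value q lam l k b t s"
    for d k b t s
  proof -
    have li: "is_weight l i" "is_weight l j" using is_weight_mono[OF _ k] ki by auto
    show "gen_mat_elem q l i j \<tau> \<sigma> = complex_of_real d \<odot>\<^bsub>Aq q\<^esub>
       (gen_mat_elem q k i j \<tau> \<sigma> \<otimes>\<^bsub>Aq q\<^esub> poly_at_D_rho q \<tau> \<sigma> (askey_wilson2 (nat \<lfloor>l - k\<rfloor>) (k - b) (k + b) (q powr t) (q powr s) (q\<^sup>2)))"
    proof (rule gen_mat_elem_poly[OF q li ki])
      fix lam :: complex assume "lam \<noteq> 0"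
      then show "torus_value q lam l i j \<tau> \<sigma> = complex_of_real d * torus_value q lam k i j \<tau> \<sigma> *
        poly (askey_wilson2 (nat \<lfloor>l - k\<rfloor>) (k - b) (k + b) (q powr t) (q powr s) (q\<^sup>2)) ((lam\<^sup>2 / q + inverse (lam\<^sup>2 / q)) / 2)"
        unfolding torus_value[OF li \<open>lam \<noteq> 0\<close>] torus_value[OF ki \<open>lam \<noteq> 0\<close>] d by (rule torus_value_askey_wilson[OF q kb k])
    qed
    show "tau_hom q lam (gen_mat_elem q k i j \<tau> \<sigma>) = complex_of_real (C_coeff q k b s * C_coeff q k k t) * lam powi \<lfloor>- 2 * k\<rfloor>
      * qpoch (lam\<^sup>2 * complex_of_real (q powr (t - s))) (complex_of_real (q\<^sup>2)) (nat \<lfloor>k - b\<rfloor>)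
      * qpoch (- (lam\<^sup>2) * complex_of_real (q powr (t + s))) (complex_of_real (q\<^sup>2)) (nat \<lfloor>k + b\<rfloor>)"
      unfolding tau_hom_gen_mat_elem[OF q ki(1) lam] torus_value[OF ki lam] by (rule torus_value_top[OF q kb lam])
  qed
  show ?thesis
  proof (intro conjI impI, goal_cases)
    case 1
    then have a: "is_weight i j" "l - i \<in> \<nat>" using assms(3-7) is_weight_intro by auto
    show ?case using A(1)[OF a(2,1) is_weight_top[OF a(1)] a(1) refl] by blast
  next
    case 2
    then have a: "is_weight i j" "l - i \<in> \<nat>" using assms(3-7) is_weight_intro by auto
    show ?case using A(2)[OF a(2,1) is_weight_top[OF a(1)] a(1) refl] by blast
  next
    case 3
    then have a: "is_weight j i" "l - j \<in> \<nat>" using assms(3-7) ij is_weight_intro by auto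
    show ?case using A(1)[OF a(2,1) a(1) is_weight_top[OF a(1)] refl torus_value_commute[OF q]] by (simp add: add.commute)
  next
    case 4
    then have a: "is_weight j i" "l - j \<in> \<nat>" using assms(3-7) ij is_weight_intro by auto
    show ?case using A(2)[OF a(2,1) a(1) is_weight_top[OF a(1)] refl torus_value_commute[OF q]] by (simp add: add.commute)
  next
    case 5
    then have a: "is_weight (- i) (- j)" "l - - i \<in> \<nat>" using assms(3-7) ij by (auto intro!: is_weight_intro)
    show ?case using A(1)[OF a(2,1) _ _ refl torus_value_minus[OF q, symmetric]] is_weight_minus[OF a(1)] is_weight_minus[OF is_weight_top[OF a(1)]] by simp
  next
    case 6
    then have a: "is_weight (- i) (- j)" "l - - i \<in> \<nat>" using assms(3-7) ij by (auto intro!: is_weight_intro)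
    show ?case using A(2)[OF a(2,1) _ _ refl torus_value_minus[OF q, symmetric]] is_weight_minus[OF a(1)] is_weight_minus[OF is_weight_top[OF a(1)]] by simp
  next
    case 7
    then have a: "is_weight (- j) (- i)" "l - - j \<in> \<nat>" using assms(3-7) ij by (auto intro!: is_weight_intro)
    \<comment> \<open>The last case needs the change of signs followed by the exchange of the
      indices.\<close>
    have "torus_value q lam l i j \<tau> \<sigma> = torus_value q lam l (- j) (- i) (- \<sigma>) (- \<tau>)" if "is_weight l i" "is_weight l j" "lam \<noteq> 0" for l lam
      using torus_value_minus[OF q that, of \<tau> \<sigma>] torus_value_commute[OF q is_weight_minus[OF that(1)] is_weight_minus[OF that(2)] that(3)] by metis
    note b = A(1)[OF a(2,1) _ _ refl this]
    show ?case using b is_weight_minus[OF a(1)] is_weight_minus[OF is_weight_top[OF a(1)]] by (simp add: add.commute)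
  next
    case 8
    then have a: "is_weight (- j) (- i)" "l - - j \<in> \<nat>" using assms(3-7) ij by (auto intro!: is_weight_intro)
    have "torus_value q lam l i j \<tau> \<sigma> = torus_value q lam l (- j) (- i) (- \<sigma>) (- \<tau>)" if "is_weight l i" "is_weight l j" "lam \<noteq> 0" for l lam
      using torus_value_minus[OF q that, of \<tau> \<sigma>] torus_value_commute[OF q is_weight_minus[OF that(1)] is_weight_minus[OF that(2)] that(3)] by metis
    note b = A(2)[OF a(2,1) _ _ refl this]
    have e: "- \<tau> - \<sigma> = - \<sigma> - \<tau>" by simp
    show ?case unfolding e using b is_weight_minus[OF a(1)] is_weight_minus[OF is_weight_top[OF a(1)]] by (simp add: add.commute)
  qed
qed

end
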